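(* Let $\omega\in PC(\mathbb{T})$ and let $\Omega$ be the set of its jump discontinuities. Let $\tau:[0,\infty)^2\to\mathbb{C}$ be a bounded function satisfying the following three conditions, where $\tau_N(j,k)=\tau(j/N,k/N)$ for $j,k\in\mathbb{Z}_+$, $N\ge 1$: (A$_H$) $\displaystyle\sup_{N\ge1}\Big(\sup_{\|\Gamma(\widehat\phi)\|=1}\|\tau_N\star\Gamma(\widehat\phi)\|\Big)<\infty$, the inner supremum being over all bounded Hankel matrices $\Gamma(\widehat\phi)$ of norm $1$; (B) $\tau(0,0)=1$ and for some $\varepsilon>0$ and some $\beta>1/2$ there exists $C_\beta>0$ such that $|\tau(x,y)-1|\le C_\beta|\log(x+y)|^{-\beta}$ for all $0\le x,y\le\varepsilon$; (C) for some $\alpha>1/2$ there exists $C_\alpha$ such that $|\tau(x,y)|\le C_\alpha(\log(x+y+2))^{-\alpha}$ for all $x,y\ge 0$. Then for every $t>0$ $$\lim_{N\to\infty}\frac{\mathsf{n}(t;\tau_N\star\Gamma(\widehat\omega))}{\log N}=\sum_{z\in\Omega}\mathsf{c}\left(t|\varkappa_z(\omega)|^{-1}\right).$$ Furthermore, if $\omega(v)=\overline{\omega(\overline v)}$ for $v\in\mathbb{T}$ and $\tau(x,y)=\overline{\tau(y,x)}$ for all $x,y\ge0$, then, with $\Omega^+=\{z\in\Omega:\operatorname{Im}z>0\}$, for every $t>0$ and each sign $\pm$ $$\lim_{N\to\infty}\frac{\mathsf{n}_\pm(t;\tau_N\star\Gamma(\widehat\omega))}{\log N}=\sum_{z\in\Omega^+}\mathsf{c}\left(t|\varkappa_z(\omega)|^{-1}\right)+\mathsf{c}\left(t|\varkappa_1(\omega)|^{-1}\right)\mathbf{1}_\pm(-i\varkappa_1(\omega))+\mathsf{c}\left(t|\varkappa_{-1}(\omega)|^{-1}\right)\mathbf{1}_\pm(-i\varkappa_{-1}(\omega)),$$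 where $\mathbf{1}_+$ and $\mathbf{1}_-$ are the characteristic functions of $(0,\infty)$ and $(-\infty,0)$ respectively (a term with $\varkappa_{\pm1}(\omega)=0$ is read as $0$).
   Context: $\mathbb{Z}_+=\{0,1,2,\dots\}$, $\mathbb{T}$ is the unit circle in $\mathbb{C}$. $PC(\mathbb{T})$ is the class of functions $\omega:\mathbb{T}\to\mathbb{C}$ for which the limits $\omega(z\pm)=\lim_{\epsilon\to0+}\omega(ze^{\pm i\epsilon})$ exist and are finite for all $z\in\mathbb{T}$. Put $\varkappa_z(\omega)=\frac{\omega(z+)-\omega(z-)}{2}$; the jump discontinuities of $\omega$ are the points $z$ with $\varkappa_z(\omega)\ne0$ (an at most countable set; for each $s>0$ only finitely many $z$ have $|\varkappa_z(\omega)|>s$). If $\omega(v)=\overline{\omega(\overline v)}$, then $\varkappa_{\overline z}(\omega)=-\overline{\varkappa_z(\omega)}$, so $\varkappa_{\pm1}(\omega)$ are purely imaginary. For an essentially bounded $\phi$ on $\mathbb{T}$, $\widehat\phi(j)=\int_0^{2\pi}\phi(e^{i\theta})e^{-ij\theta}\frac{d\theta}{2\pi}$, and the Hankel matrix $\Gamma(\widehat\phi)$ is the bounded operator on $\ell^2(\mathbb{Z}_+)$ with matrix entries $\widehat\phi(j+k)$, $j,k\ge0$. Schur–Hadamard multiplication: for a bounded double sequence $\sigma=(\sigma(j,k))_{j,k\ge0}$ and a bounded operator $A$ on $\ell^2(\mathbb{Z}_+)$, $\sigma\star A$ is the operator with entries $((\sigma\star A)e_j,e_k)=\sigma(j,k)(Ae_j,e_k)$,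 where $(e_j)$ is the standard basis. For a compact operator $K$ and $t>0$, $\mathsf{n}(t;K)$ is the number of singular values of $K$ greater than $t$; for compact self-adjoint $K$, $\mathsf{n}_\pm(t;K)$ is the number of eigenvalues of $\pm K$ greater than $t$ (all counted with multiplicity). $\mathsf{c}(t)=\frac{1}{\pi^2}\log\left(\frac{1+\sqrt{1-t^2}}{t}\right)$ for $t\in(0,1]$ and $\mathsf{c}(t)=0$ for $t\notin(0,1)$. *)

theory Defs
  imports "HOL-Analysis.Analysis"
begin

section \<open>The complex Hilbert space of square-summable sequences\<close>

typedef ell2 = "{x :: nat \<Rightarrow> complex. summable (\<lambda>n. (norm (x n))\<^sup>2)}"
  morphisms coord Abs_ell2
  by (rule exI[of _ "\<lambda>_. 0"]) simp

setup_lifting type_definition_ell2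

lemma square_summable_add:
  fixes x y :: "nat \<Rightarrow> complex"
  assumes "summable (\<lambda>n. (norm (x n))\<^sup>2)" "summable (\<lambda>n. (norm (y n))\<^sup>2)"
  shows "summable (\<lambda>n. (norm (x n + y n))\<^sup>2)"
proof (rule summable_comparison_test')
  show "summable (\<lambda>n. 2 * (norm (x n))\<^sup>2 + 2 * (norm (y n))\<^sup>2)"
    using assms by (intro summable_add summable_mult)
  fix n :: nat
  have "(norm (x n + y n))\<^sup>2 \<le> (norm (x n) + norm (y n))\<^sup>2"
    by (intro power_mono norm_triangle_ineq) simp
  also have "\<dots> \<le> 2 * (norm (x n))\<^sup>2 + 2 * (norm (y n))\<^sup>2"
    using sum_squares_ge_zero[of "norm (x n) - norm (y n)" 0]
    by (simp add: power2_eq_square algebra_simps)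
  finally show "norm ((norm (x n + y n))\<^sup>2) \<le> 2 * (norm (x n))\<^sup>2 + 2 * (norm (y n))\<^sup>2"
    by simp
qed

lemma square_summable_scale:
  fixes x :: "nat \<Rightarrow> complex"
  assumes "summable (\<lambda>n. (norm (x n))\<^sup>2)"
  shows "summable (\<lambda>n. (norm (c * x n))\<^sup>2)"
  using summable_mult[OF assms, of "(norm c)\<^sup>2"] by (simp add: norm_mult power_mult_distrib)

lift_definition scaleC :: "complex \<Rightarrow> ell2 \<Rightarrow> ell2" (infixr \<open>*\<^sub>C\<close> 75)
  is "\<lambda>c x n. c * x n"
  by (rule square_summable_scale)

lift_definition std_basis :: "nat \<Rightarrow> ell2" is "\<lambda>j n. if n = j then 1 else 0"
proof -
  fix j :: nat
  show "summable (\<lambda>n. (norm (if n = j then 1 else 0 :: complex))\<^sup>2)"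
    by (rule summable_finite[of "{j}"]) auto
qed

text \<open>The inner product is linear in its first argument.\<close>

definition cinner :: "ell2 \<Rightarrow> ell2 \<Rightarrow> complex" where
  "cinner x y = (\<Sum>n. coord x n * cnj (coord y n))"

lemma summable_cinner: "summable (\<lambda>n. coord x n * cnj (coord y n))"
proof (rule summable_comparison_test')
  show "summable (\<lambda>n. (norm (coord x n))\<^sup>2 + (norm (coord y n))\<^sup>2)"
    using coord[of x] coord[of y] by (intro summable_add) auto
  fix n :: nat
  have "0 \<le> (norm (coord x n) - norm (coord y n))\<^sup>2" by simp
  then have "2 * (norm (coord x n) * norm (coord y n)) \<le> (norm (coord x n))\<^sup>2 + (norm (coord y n))\<^sup>2"
    by (simp add: power2_eq_square algebra_simps)
  moreover have "0 \<le> norm (coord x n) * norm (coord y n)" by simp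
  ultimately show "norm (coord x n * cnj (coord y n)) \<le> (norm (coord x n))\<^sup>2 + (norm (coord y n))\<^sup>2"
    unfolding norm_mult complex_mod_cnj by linarith
qed

instantiation ell2 :: real_inner
begin

lift_definition zero_ell2 :: ell2 is "\<lambda>_. 0" by simp
lift_definition plus_ell2 :: "ell2 \<Rightarrow> ell2 \<Rightarrow> ell2" is "\<lambda>x y n. x n + y n"
  by (rule square_summable_add)
lift_definition uminus_ell2 :: "ell2 \<Rightarrow> ell2" is "\<lambda>x n. - x n" by simp
lift_definition minus_ell2 :: "ell2 \<Rightarrow> ell2 \<Rightarrow> ell2" is "\<lambda>x y n. x n - y n"
proof -
  fix x y :: "nat \<Rightarrow> complex"
  assume "summable (\<lambda>n. (norm (x n))\<^sup>2)" "summable (\<lambda>n. (norm (y n))\<^sup>2)"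
  then show "summable (\<lambda>n. (norm (x n - y n))\<^sup>2)"
    using square_summable_add[of x "\<lambda>n. - y n"] by simp
qed

definition scaleR_ell2 :: "real \<Rightarrow> ell2 \<Rightarrow> ell2" where
  "scaleR_ell2 r x = complex_of_real r *\<^sub>C x"
definition inner_ell2 :: "ell2 \<Rightarrow> ell2 \<Rightarrow> real" where
  "inner_ell2 x y = Re (cinner x y)"
definition norm_ell2 :: "ell2 \<Rightarrow> real" where
  "norm_ell2 x = sqrt (Re (cinner x x))"
definition sgn_ell2 :: "ell2 \<Rightarrow> ell2" where
  "sgn_ell2 x = inverse (norm x) *\<^sub>R x"
definition dist_ell2 :: "ell2 \<Rightarrow> ell2 \<Rightarrow> real" where
  "dist_ell2 x y = norm (x - y)"
definition uniformity_ell2 :: "(ell2 \<times> ell2) filter" where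
  "uniformity_ell2 = (INF e\<in>{0 <..}. principal {(x, y). dist x y < e})"
definition open_ell2 :: "ell2 set \<Rightarrow> bool" where
  "open_ell2 U \<longleftrightarrow> (\<forall>x\<in>U. eventually (\<lambda>(x', y). x' = x \<longrightarrow> y \<in> U) uniformity)"

instance
proof
  fix x y z :: ell2 and r s :: real and U :: "ell2 set"
  show "x + y + z = x + (y + z)" by transfer (simp add: algebra_simps)
  show "x + y = y + x" by transfer (simp add: algebra_simps)
  show "0 + x = x" by transfer simp
  show "- x + x = 0" by transfer simp
  show "x - y = x + - y" by transfer simp
  show "r *\<^sub>R (x + y) = r *\<^sub>R x + r *\<^sub>R y"
    unfolding scaleR_ell2_def by transfer (simp add: algebra_simps)
  show "(r + s) *\<^sub>R x = r *\<^sub>R x + s *\<^sub>R x"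
    unfolding scaleR_ell2_def by transfer (simp add: algebra_simps)
  show "r *\<^sub>R s *\<^sub>R x = (r * s) *\<^sub>R x"
    unfolding scaleR_ell2_def by transfer (simp add: algebra_simps)
  show "1 *\<^sub>R x = x"
    unfolding scaleR_ell2_def by transfer simp
  show "dist x y = norm (x - y)" by (rule dist_ell2_def)
  show "sgn x = inverse (norm x) *\<^sub>R x" by (rule sgn_ell2_def)
  show "uniformity = (INF e\<in>{0 <..}. principal {(x :: ell2, y). dist x y < e})"
    by (rule uniformity_ell2_def)
  show "open U \<longleftrightarrow> (\<forall>x\<in>U. \<forall>\<^sub>F (x', y) in uniformity. x' = x \<longrightarrow> y \<in> U)"
    by (rule open_ell2_def)
  have cc: "cinner x x = complex_of_real (\<Sum>n. (norm (coord x n))\<^sup>2)" for x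
    using coord[of x] unfolding cinner_def complex_norm_square[symmetric]
    by (intro suminf_of_real[symmetric]) simp
  have "cinner y x = cnj (cinner x y)"
    unfolding cinner_def
    using sums_unique[OF sums_cnj[THEN iffD2, OF summable_sums[OF summable_cinner[of x y]]]]
    by (simp add: mult.commute)
  then show "x \<bullet> y = y \<bullet> x" by (simp add: inner_ell2_def)
  have "cinner (x + y) z = cinner x z + cinner y z"
    unfolding cinner_def
    by (subst suminf_add[OF summable_cinner summable_cinner])
       (simp add: plus_ell2.rep_eq algebra_simps)
  then show "(x + y) \<bullet> z = x \<bullet> z + y \<bullet> z" by (simp add: inner_ell2_def)
  have "cinner (r *\<^sub>R x) y = complex_of_real r * cinner x y"
    unfolding cinner_def
    by (subst suminf_mult[OF summable_cinner, symmetric])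
       (simp add: scaleR_ell2_def scaleC.rep_eq mult.assoc)
  then show "r *\<^sub>R x \<bullet> y = r * (x \<bullet> y)" by (simp add: inner_ell2_def)
  show "0 \<le> x \<bullet> x"
    using coord[of x] by (simp add: inner_ell2_def cc suminf_nonneg)
  have "(x \<bullet> x = 0) = (\<forall>n. coord x n = 0)"
    using coord[of x] by (simp add: inner_ell2_def cc suminf_eq_zero_iff)
  also have "\<dots> = (x = 0)" by transfer auto
  finally show "(x \<bullet> x = 0) = (x = 0)" .
  show "norm x = sqrt (x \<bullet> x)" by (simp add: norm_ell2_def inner_ell2_def)
qed

end

global_interpretation cell2: vector_space "scaleC :: complex \<Rightarrow> ell2 \<Rightarrow> ell2"
  by standard (transfer; simp add: algebra_simps)+


section \<open>Operators and infinite matrices\<close>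

definition bounded_clinear :: "(ell2 \<Rightarrow> ell2) \<Rightarrow> bool" where
  "bounded_clinear A \<longleftrightarrow> bounded_linear A \<and> (\<forall>c x. A (c *\<^sub>C x) = c *\<^sub>C A x)"

definition compact_operator :: "(ell2 \<Rightarrow> ell2) \<Rightarrow> bool" where
  "compact_operator A \<longleftrightarrow> bounded_clinear A \<and> compact (closure (A ` cball 0 1))"

definition self_adjoint :: "(ell2 \<Rightarrow> ell2) \<Rightarrow> bool" where
  "self_adjoint A \<longleftrightarrow> (\<forall>x y. cinner (A x) y = cinner x (A y))"

definition cadjoint :: "(ell2 \<Rightarrow> ell2) \<Rightarrow> ell2 \<Rightarrow> ell2" where
  "cadjoint A = (THE B. \<forall>x y. cinner (A x) y = cinner x (B y))"

definition entry :: "(ell2 \<Rightarrow> ell2) \<Rightarrow> nat \<Rightarrow> nat \<Rightarrow> complex" where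
  "entry A j k = cinner (A (std_basis j)) (std_basis k)"

definition bounded_matrix :: "(nat \<Rightarrow> nat \<Rightarrow> complex) \<Rightarrow> bool" where
  "bounded_matrix a \<longleftrightarrow> (\<exists>A. bounded_clinear A \<and> entry A = a)"

text \<open>A bounded operator is determined by its entries; the value is unspecified when no bounded
  operator has the entries \<open>a\<close>.\<close>

definition matrix_operator :: "(nat \<Rightarrow> nat \<Rightarrow> complex) \<Rightarrow> ell2 \<Rightarrow> ell2" where
  "matrix_operator a = (THE A. bounded_clinear A \<and> entry A = a)"

definition matrix_norm :: "(nat \<Rightarrow> nat \<Rightarrow> complex) \<Rightarrow> ennreal" where
  "matrix_norm a = (if bounded_matrix a then ennreal (onorm (matrix_operator a)) else \<infinity>)"

definition schur_matrix :: "(nat \<Rightarrow> nat \<Rightarrow> complex) \<Rightarrow> (ell2 \<Rightarrow> ell2) \<Rightarrow> nat \<Rightarrow> nat \<Rightarrow> complex" where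
  "schur_matrix \<sigma> A = (\<lambda>j k. \<sigma> j k * entry A j k)"

definition schur :: "(nat \<Rightarrow> nat \<Rightarrow> complex) \<Rightarrow> (ell2 \<Rightarrow> ell2) \<Rightarrow> ell2 \<Rightarrow> ell2" (infixr \<open>\<star>\<close> 70) where
  "\<sigma> \<star> A = matrix_operator (schur_matrix \<sigma> A)"


section \<open>Counting functions\<close>

definition eigenspace :: "(ell2 \<Rightarrow> ell2) \<Rightarrow> complex \<Rightarrow> ell2 set" where
  "eigenspace A \<mu> = {x. A x = \<mu> *\<^sub>C x}"

text \<open>For a compact operator and \<open>t > 0\<close> the sums below are finite and the eigenspaces involved are
  finite-dimensional. The singular values of \<open>K\<close> are the nonnegative square roots of the
  eigenvalues of \<open>K\<^sup>*K\<close>. The functions \<open>n_plus\<close> and \<open>n_minus\<close> are meant for self-adjoint \<open>K\<close>.\<close>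

definition n_sing :: "real \<Rightarrow> (ell2 \<Rightarrow> ell2) \<Rightarrow> nat" where
  "n_sing t K =
    (\<Sum>s | s > t \<and> s \<ge> 0 \<and> eigenspace (cadjoint K \<circ> K) (complex_of_real (s\<^sup>2)) \<noteq> {0}.
       cell2.dim (eigenspace (cadjoint K \<circ> K) (complex_of_real (s\<^sup>2))))"

definition n_plus :: "real \<Rightarrow> (ell2 \<Rightarrow> ell2) \<Rightarrow> nat" where
  "n_plus t K =
    (\<Sum>\<mu> | \<mu> > t \<and> eigenspace K (complex_of_real \<mu>) \<noteq> {0}.
       cell2.dim (eigenspace K (complex_of_real \<mu>)))"

definition n_minus :: "real \<Rightarrow> (ell2 \<Rightarrow> ell2) \<Rightarrow> nat" where
  "n_minus t K = n_plus t (\<lambda>x. - K x)"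


section \<open>Functions on the unit circle and Hankel operators\<close>

text \<open>A function on the unit circle is a map \<open>complex \<Rightarrow> complex\<close> of which only the values on
  \<open>sphere 0 1\<close> are ever used.\<close>

definition ess_bounded :: "(complex \<Rightarrow> complex) \<Rightarrow> bool" where
  "ess_bounded \<phi> \<longleftrightarrow>
    (\<lambda>\<theta>. \<phi> (cis \<theta>)) \<in> borel_measurable (lebesgue_on {0..2 * pi}) \<and>
    (\<exists>M. AE \<theta> in lebesgue_on {0..2 * pi}. norm (\<phi> (cis \<theta>)) \<le> M)"

definition fourier_coeff :: "(complex \<Rightarrow> complex) \<Rightarrow> int \<Rightarrow> complex" where
  "fourier_coeff \<phi> j =
    (LINT \<theta>|lebesgue_on {0..2 * pi}. \<phi> (cis \<theta>) * cis (- (of_int j * \<theta>))) / (2 * pi)"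

definition hankel :: "(int \<Rightarrow> complex) \<Rightarrow> ell2 \<Rightarrow> ell2" where
  "hankel a = matrix_operator (\<lambda>j k. a (int j + int k))"

definition PC :: "(complex \<Rightarrow> complex) set" where
  "PC = {\<omega>. \<forall>z\<in>sphere 0 1.
    (\<exists>l. ((\<lambda>\<epsilon>. \<omega> (z * cis \<epsilon>)) \<longlongrightarrow> l) (at_right 0)) \<and>
    (\<exists>l. ((\<lambda>\<epsilon>. \<omega> (z * cis (- \<epsilon>))) \<longlongrightarrow> l) (at_right 0))}"

definition lim_plus :: "(complex \<Rightarrow> complex) \<Rightarrow> complex \<Rightarrow> complex" where
  "lim_plus \<omega> z = Lim (at_right 0) (\<lambda>\<epsilon>. \<omega> (z * cis \<epsilon>))"

definition lim_minus :: "(complex \<Rightarrow> complex) \<Rightarrow> complex \<Rightarrow> complex" where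
  "lim_minus \<omega> z = Lim (at_right 0) (\<lambda>\<epsilon>. \<omega> (z * cis (- \<epsilon>)))"

definition jump :: "(complex \<Rightarrow> complex) \<Rightarrow> complex \<Rightarrow> complex" where
  "jump \<omega> z = (lim_plus \<omega> z - lim_minus \<omega> z) / 2"

definition jumps :: "(complex \<Rightarrow> complex) \<Rightarrow> complex set" where
  "jumps \<omega> = {z \<in> sphere 0 1. jump \<omega> z \<noteq> 0}"

definition cfun :: "real \<Rightarrow> real" where
  "cfun t = (if 0 < t \<and> t \<le> 1 then ln ((1 + sqrt (1 - t\<^sup>2)) / t) / pi\<^sup>2 else 0)"


section \<open>Conditions on the multiplier\<close>

definition dilate :: "(real \<Rightarrow> real \<Rightarrow> complex) \<Rightarrow> nat \<Rightarrow> nat \<Rightarrow> nat \<Rightarrow> complex" where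
  "dilate \<tau> N = (\<lambda>j k. \<tau> (real j / real N) (real k / real N))"

definition cond_AH :: "(real \<Rightarrow> real \<Rightarrow> complex) \<Rightarrow> bool" where
  "cond_AH \<tau> \<longleftrightarrow>
    (SUP N\<in>{1::nat..}.
      SUP \<phi>\<in>{\<phi>. ess_bounded \<phi> \<and> onorm (hankel (fourier_coeff \<phi>)) = 1}.
        matrix_norm (schur_matrix (dilate \<tau> N) (hankel (fourier_coeff \<phi>)))) < \<infinity>"

text \<open>At \<open>x = y = 0\<close> the right-hand side below is \<open>0\<close> (as \<open>ln 0 = 0\<close> and \<open>0 powr a = 0\<close>), which
  agrees with the convention \<open>|log 0|\<^sup>-\<^sup>\<beta> = 0\<close>. At \<open>x + y = 1\<close> it is \<open>0\<close> rather than infinite, which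
  is immaterial because \<open>\<epsilon>\<close> may always be taken smaller than \<open>1/2\<close>.\<close>

definition cond_B :: "(real \<Rightarrow> real \<Rightarrow> complex) \<Rightarrow> bool" where
  "cond_B \<tau> \<longleftrightarrow> \<tau> 0 0 = 1 \<and>
    (\<exists>\<epsilon>>0. \<exists>\<beta>>1/2. \<exists>C>0. \<forall>x\<in>{0..\<epsilon>}. \<forall>y\<in>{0..\<epsilon>}.
       norm (\<tau> x y - 1) \<le> C * \<bar>ln (x + y)\<bar> powr (- \<beta>))"

definition cond_C :: "(real \<Rightarrow> real \<Rightarrow> complex) \<Rightarrow> bool" where
  "cond_C \<tau> \<longleftrightarrow>
    (\<exists>\<alpha>>1/2. \<exists>C. \<forall>x\<ge>0. \<forall>y\<ge>0. norm (\<tau> x y) \<le> C * ln (x + y + 2) powr (- \<alpha>))"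

end

theory Submission
  imports Defs "HOL-Real_Asymp.Real_Asymp"
begin

text \<open>By the minimax principle, \<open>n(t; K)\<close> is stable, up to an error \<open>S / d\<^sup>2\<close> and a shift of \<open>t\<close> by
 \<open>d + \<rho>\<close>, under perturbations that are the sum of a Hilbert--Schmidt operator of squared norm \<open>S\<close> and an
 operator of norm \<open>\<rho>\<close>. A piecewise continuous symbol is, up to a uniformly small one, a step function
 with Fourier coefficients \<open>\<Sum>z. a z * cnj z ^ j / (\<pi> j)\<close>; the small part is controlled by (A), and by (B)
 and (C) multiplying the rest by \<open>\<tau>\<^sub>N\<close> amounts to truncating it to \<open>1 \<le> j, k \<le> N\<close>, with a squared
 Hilbert--Schmidt error \<open>o(log N)\<close>. For the truncated matrix the vectors \<open>z ^ j * j powr (- 1/2 + i\<xi>)\<close> with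
 \<open>\<xi>\<close> in \<open>2\<pi>\<int> / log N\<close> are nearly orthonormal and nearly singular vectors, with singular values
 \<open>norm (a z) / cosh (\<pi> \<xi>)\<close>; counting them gives the lower bound. The upper bound needs no further
 spectral analysis: the lower bounds at all levels together already exhaust the Hilbert--Schmidt norm of the
 truncated matrix. The signed counting functions follow because their lower bounds add up to the bound
 for singular values.\<close>

section \<open>The Hilbert space of square-summable sequences\<close>

text \<open>Exhaustion is sharp because of one identity. The frequencies with
  \<open>lam / cosh (pi * \<xi>) \<ge> t\<close> fill an interval of length
  \<open>2 * arcosh (lam / t) / pi\<close>; the spacing \<open>2 * pi / ln N\<close> turns this into
  \<open>ln N * cfun (t / lam)\<close> modes. On the other side the integral of
  \<open>2 * s * cfun s\<close> over (0, 1) is \<open>1 / pi^2\<close>, exactly the coefficient of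
  \<open>ln N\<close> that a jump with \<open>norm (a z) = 1\<close> contributes to the squared
  Hilbert--Schmidt norm. The factor 1/cosh is the Mellin transform of 1/(1 + x) on the line Re s =
  1/2, divided by the \<open>pi\<close> of \<open>1 / (pi * j)\<close>. The obstacle is that about
  \<open>ln N\<close> modes have pairwise errors of order \<open>1 / ln N\<close>: the Gram error
  need not be small in operator norm, only its Hilbert--Schmidt norm stays bounded. So the modes are
  not orthonormalized; boundedly many linear constraints on the coefficients remove the bad
  directions. A Hankel matrix moves a mode at \<open>z\<close> to \<open>cnj z\<close>. In the
  symmetric case a nonreal pair of jumps therefore yields eigenvalues of both signs, while 1 and -1
  yield only the sign of \<open>- \<i> * jump \<omega> z\<close>.\<close>

declare zero_ell2.rep_eq [simp] plus_ell2.rep_eq [simp] uminus_ell2.rep_eq [simp]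
 minus_ell2.rep_eq [simp] scaleC.rep_eq [simp] std_basis.rep_eq [simp]

lemma ell2_eqI: "(\<And>n. coord x n = coord y n) \<Longrightarrow> x = y"
 by (simp add: coord_inject[symmetric] fun_eq_iff)

lemma coord_scaleR [simp]: "coord (r *\<^sub>R x) n = complex_of_real r * coord x n"
 by (simp add: scaleR_ell2_def)

lemma scaleC_of_real: "complex_of_real r *\<^sub>C x = r *\<^sub>R x"
 by (simp add: scaleR_ell2_def)

lemma coord_sum [simp]: "coord (sum f A) n = (\<Sum>i\<in>A. coord (f i) n)"
 by (induction A rule: infinite_finite_induct) auto

lemma summable_coord: "summable (\<lambda>n. (norm (coord x n))^2)"
 using coord[of x] by simp

lemma coord_Abs: "summable (\<lambda>n. (norm (f n))^2) \<Longrightarrow> coord (Abs_ell2 f) = f"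
 by (simp add: Abs_ell2_inverse)

lemma cinner_add_left: "cinner (x + y) z = cinner x z + cinner y z"
 unfolding cinner_def
 by (subst suminf_add[OF summable_cinner summable_cinner]) (simp add: algebra_simps)

lemma cinner_scaleC_left [simp]: "cinner (c *\<^sub>C x) y = c * cinner x y"
 unfolding cinner_def
 by (subst suminf_mult[OF summable_cinner, symmetric]) (simp add: mult.assoc)

lemma cinner_commute: "cinner y x = cnj (cinner x y)"
 unfolding cinner_def
 using sums_unique[OF sums_cnj[THEN iffD2, OF summable_sums[OF summable_cinner[of x y]]]]
 by (simp add: mult.commute)

lemma cinner_add_right: "cinner x (y + z) = cinner x y + cinner x z"
 by (subst (1 2 3) cinner_commute) (simp add: cinner_add_left)

lemma cinner_scaleC_right [simp]: "cinner x (c *\<^sub>C y) = cnj c * cinner x y"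
 by (subst (1 2) cinner_commute) simp

lemma cinner_scaleR_left [simp]: "cinner (r *\<^sub>R x) y = complex_of_real r * cinner x y"
 by (simp add: scaleR_ell2_def)

lemma cinner_scaleR_right [simp]: "cinner x (r *\<^sub>R y) = complex_of_real r * cinner x y"
 by (simp add: scaleR_ell2_def)

lemma cinner_zero_left [simp]: "cinner 0 x = 0"
 using cinner_scaleC_left[of 0 0 x] by (simp add: cinner_def)

lemma cinner_zero_right [simp]: "cinner x 0 = 0"
 by (simp add: cinner_def)

lemma cinner_minus_left [simp]: "cinner (- x) y = - cinner x y"
 using cinner_add_left[of x "- x" y] by (simp add: add_eq_0_iff)

lemma cinner_minus_right [simp]: "cinner x (- y) = - cinner x y"
 using cinner_add_right[of x y "- y"] by (simp add: add_eq_0_iff)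

lemma cinner_diff_left: "cinner (x - y) z = cinner x z - cinner y z"
 using cinner_add_left[of x "- y" z] by simp

lemma cinner_diff_right: "cinner x (y - z) = cinner x y - cinner x z"
 using cinner_add_right[of x y "- z"] by simp

lemma cinner_sum_left: "cinner (sum f A) y = (\<Sum>i\<in>A. cinner (f i) y)"
 by (induction A rule: infinite_finite_induct) (auto simp: cinner_add_left)

lemma cinner_sum_right: "cinner y (sum f A) = (\<Sum>i\<in>A. cinner y (f i))"
 by (induction A rule: infinite_finite_induct) (auto simp: cinner_add_right)

lemma cinner_self_sum: "cinner x x = complex_of_real (\<Sum>n. (norm (coord x n))^2)"
 using coord[of x] unfolding cinner_def complex_norm_square[symmetric]
 by (intro suminf_of_real[symmetric]) simp

lemma norm_ell2_sq: "(norm x)^2 = (\<Sum>n. (norm (coord x n))^2)"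
proof -
 have "0 \<le> (\<Sum>n. (norm (coord x n))^2)"
  by (rule suminf_nonneg[OF summable_coord]) simp
 then show ?thesis by (simp add: norm_ell2_def cinner_self_sum)
qed

lemma cinner_self: "cinner x x = complex_of_real ((norm x)^2)"
 by (simp add: cinner_self_sum norm_ell2_sq)

lemma norm_scaleC [simp]: "norm (c *\<^sub>C x) = norm c * norm x"
proof -
 have "complex_of_real ((norm (c *\<^sub>C x))^2) = complex_of_real ((norm c * norm x)^2)"
  by (simp only: cinner_self[symmetric] cinner_scaleC_left cinner_scaleC_right)
   (simp add: cinner_self power_mult_distrib mult.assoc[symmetric] complex_norm_square[of c, simplified] mult.commute)
 then have "(norm (c *\<^sub>C x))^2 = (norm c * norm x)^2"
  by (simp only: of_real_eq_iff)
 then show ?thesis by (simp add: power2_eq_iff_nonneg)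
qed

lemma cinner_Cauchy_Schwarz: "norm (cinner x y) \<le> norm x * norm y"
proof (cases "cinner x y = 0")
 case False
 \<comment> \<open>Multiplying by this phase makes the inner product real and nonnegative, which
   reduces the complex inequality to the real one.\<close>
 define c where "c = cnj (cinner x y) / of_real (norm (cinner x y))"
 have c: "norm c = 1" using False by (simp add: c_def norm_divide)
 have "c * cinner x y = of_real (norm (cinner x y))"
  using False complex_norm_square[of "cinner x y"]
  by (simp add: c_def field_simps power2_eq_square)
 then have "norm (cinner x y) = Re (cinner (c *\<^sub>C x) y)" by simp
 also have "\<dots> = inner (c *\<^sub>C x) y" by (simp add: inner_ell2_def)
 also have "\<dots> \<le> norm (c *\<^sub>C x) * norm y" by (rule norm_cauchy_schwarz)
 finally show ?thesis by (simp add: c)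
qed simp

lemma bounded_linear_cinner_left: "bounded_linear (\<lambda>x. cinner x y)"
 by (rule bounded_linear_intro[where K="norm y"])
  (auto simp: cinner_add_left scaleR_conv_of_real cinner_Cauchy_Schwarz)

lemma cinner_std_basis [simp]: "cinner x (std_basis k) = coord x k"
proof -
 have "(\<lambda>n. coord x n * cnj (coord (std_basis k) n)) sums (\<Sum>n\<in>{k}. coord x n * cnj (coord (std_basis k) n))"
  by (rule sums_finite) auto
 then show ?thesis unfolding cinner_def by (simp add: sums_unique[symmetric])
qed

lemma cinner_std_basis_left [simp]: "cinner (std_basis k) x = cnj (coord x k)"
 by (subst cinner_commute) simp

lemma norm_std_basis [simp]: "norm (std_basis k) = 1"
proof -
 have "complex_of_real ((norm (std_basis k))^2) = complex_of_real 1"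
  by (subst cinner_self[symmetric]) simp
 then have "(norm (std_basis k))^2 = 1^2" by (simp only: of_real_eq_iff one_power2)
 then show ?thesis by (rule power2_eq_imp_eq) auto
qed

lemma sum_coord_le: "(\<Sum>k<n. (norm (coord x k))^2) \<le> (norm x)^2"
 unfolding norm_ell2_sq by (rule sum_le_suminf[OF summable_coord]) auto

lemma bounded_partial_summable:
 fixes f :: "nat \<Rightarrow> complex"
 assumes "\<And>n. (\<Sum>k<n. (norm (f k))^2) \<le> S"
 shows "summable (\<lambda>n. (norm (f n))^2)" and "(\<Sum>n. (norm (f n))^2) \<le> S"
proof -
 show "summable (\<lambda>n. (norm (f n))^2)"
  by (rule summableI_nonneg_bounded[where x=S]) (use assms in auto)
 then show "(\<Sum>n. (norm (f n))^2) \<le> S"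
  by (rule suminf_le_const) (use assms in auto)
qed

lemma norm_ell2_le: "(\<And>n. (\<Sum>k<n. (norm (coord x k))^2) \<le> S) \<Longrightarrow> (norm x)^2 \<le> S"
 unfolding norm_ell2_sq by (rule bounded_partial_summable)

text \<open>The coordinatewise limit is a norm limit because the Cauchy estimate survives on every
  initial segment, with a bound independent of its length. Completeness is what later turns total
  boundedness into compactness.\<close>

instance ell2 :: complete_space
proof
 fix X :: "nat \<Rightarrow> ell2"
 assume X: "Cauchy X"
 have "Cauchy (\<lambda>m. coord (X m) k)" for k
  using bounded_linear.Cauchy[OF bounded_linear_cinner_left[of "std_basis k"] X] by simp
 then have "\<exists>l. (\<lambda>m. coord (X m) k) \<longlonglongrightarrow> l" for k
  by (simp add: Cauchy_convergent_iff convergent_def)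
 then obtain l where l: "\<And>k. (\<lambda>m. coord (X m) k) \<longlonglongrightarrow> l k" by metis
 have key: "\<exists>M. \<forall>m\<ge>M. \<forall>n. (\<Sum>k<n. (norm (coord (X m) k - l k))^2) \<le> e^2" if "e > 0" for e
 proof -
  obtain M where M: "\<And>m p. m \<ge> M \<Longrightarrow> p \<ge> M \<Longrightarrow> norm (X m - X p) < e"
   using X \<open>e > 0\<close> unfolding Cauchy_iff by blast
  have "(\<Sum>k<n. (norm (coord (X m) k - l k))^2) \<le> e^2" if "m \<ge> M" for m n
  proof (rule tendsto_upperbound[where F=sequentially])
   show "(\<lambda>p. \<Sum>k<n. (norm (coord (X m) k - coord (X p) k))^2) \<longlonglongrightarrow> (\<Sum>k<n. (norm (coord (X m) k - l k))^2)"
    by (intro tendsto_intros l)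
   show "\<forall>\<^sub>F p in sequentially. (\<Sum>k<n. (norm (coord (X m) k - coord (X p) k))^2) \<le> e^2"
    unfolding eventually_sequentially
   proof (intro exI allI impI)
    fix p assume "M \<le> p"
    have "(\<Sum>k<n. (norm (coord (X m) k - coord (X p) k))^2) \<le> (norm (X m - X p))^2"
     using sum_coord_le[where x="X m - X p"] by simp
    also have "\<dots> \<le> e^2" using M[OF \<open>m \<ge> M\<close> \<open>M \<le> p\<close>] by (intro power_mono) auto
    finally show "(\<Sum>k<n. (norm (coord (X m) k - coord (X p) k))^2) \<le> e^2" .
   qed
  qed simp
  then show ?thesis by blast
 qed
 obtain M where M: "\<And>n. (\<Sum>k<n. (norm (coord (X M) k - l k))^2) \<le> 1" using key[of 1] by fastforce
 have "summable (\<lambda>k. (norm (coord (X M) k - l k))^2)" by (rule bounded_partial_summable[OF M])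
 then have "summable (\<lambda>k. (norm (- (coord (X M) k - l k)))^2)" by (simp only: norm_minus_cancel)
 from square_summable_add[OF summable_coord[of "X M"] this]
 have sl: "summable (\<lambda>k. (norm (l k))^2)" by simp
 define x where "x = Abs_ell2 l"
 have cx: "coord x = l" unfolding x_def by (rule coord_Abs[OF sl])
 have "X \<longlonglongrightarrow> x"
 proof (rule LIMSEQ_I)
  fix e :: real assume "e > 0"
  then obtain M where M: "\<And>m n. m \<ge> M \<Longrightarrow> (\<Sum>k<n. (norm (coord (X m) k - l k))^2) \<le> (e/2)^2"
   using key[of "e/2"] by fastforce
  have "norm (X m - x) < e" if "m \<ge> M" for m
  proof -
   have "(norm (X m - x))^2 \<le> (e/2)^2" by (rule norm_ell2_le) (use M[OF that] cx in simp)
   then have "norm (X m - x) \<le> e/2" using \<open>e > 0\<close> by (simp add: power2_le_iff_abs_le)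
   then show ?thesis using \<open>e > 0\<close> by simp
  qed
  then show "\<exists>no. \<forall>n\<ge>no. norm (X n - x) < e" by blast
 qed
 then show "convergent X" by (auto simp: convergent_def)
qed

instance ell2 :: banach ..

lemma std_basis_expansion: "(\<lambda>n. \<Sum>k<n. coord x k *\<^sub>C std_basis k) \<longlonglongrightarrow> x"
proof (rule LIMSEQ_I)
 fix e :: real assume "e > 0"
 define D where "D n = x - (\<Sum>k<n. coord x k *\<^sub>C std_basis k)" for n
 have cD: "coord (D n) j = (if j < n then 0 else coord x j)" for n j
  by (simp add: D_def if_distrib cong: if_cong)
 have "\<exists>N. \<forall>n\<ge>N. norm (\<Sum>i. (norm (coord x (i + n)))^2) < e^2"
  using suminf_exist_split[OF _ summable_coord, of "e^2" x] \<open>e > 0\<close> by simp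
 then obtain N where N: "\<And>n. n \<ge> N \<Longrightarrow> norm (\<Sum>i. (norm (coord x (i + n)))^2) < e^2" by blast
 have "norm (D n) < e" if "n \<ge> N" for n
 proof -
  have "(norm (D n))^2 = (\<Sum>i. (norm (coord (D n) (i + n)))^2) + (\<Sum>i<n. (norm (coord (D n) i))^2)"
   unfolding norm_ell2_sq by (rule suminf_split_initial_segment[OF summable_coord])
  also have "\<dots> = (\<Sum>i. (norm (coord x (i + n)))^2)" by (simp add: cD)
  also have "\<dots> < e^2" using N[OF that] by simp
  finally show ?thesis using \<open>e > 0\<close> by (simp add: power2_less_imp_less)
 qed
 then show "\<exists>no. \<forall>n\<ge>no. norm ((\<Sum>k<n. coord x k *\<^sub>C std_basis k) - x) < e"
  unfolding D_def by (metis norm_minus_commute)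
qed

section \<open>Bounded operators, Riesz representation and adjoints\<close>

lemma bounded_clinearD:
 assumes "bounded_clinear A"
 shows "bounded_linear A" "A (c *\<^sub>C x) = c *\<^sub>C A x" "A (x + y) = A x + A y" "A 0 = 0"
  "A (x - y) = A x - A y" "A (sum f I) = (\<Sum>i\<in>I. A (f i))" "norm (A x) \<le> onorm A * norm x"
  "A (r *\<^sub>R x) = r *\<^sub>R A x" "A (- x) = - A x"
proof -
 show bl: "bounded_linear A" using assms by (simp add: bounded_clinear_def)
 then interpret bounded_linear A .
 show "A (c *\<^sub>C x) = c *\<^sub>C A x" using assms by (simp add: bounded_clinear_def)
 show "A (x + y) = A x + A y" "A 0 = 0" "A (x - y) = A x - A y" "A (sum f I) = (\<Sum>i\<in>I. A (f i))"
  "A (r *\<^sub>R x) = r *\<^sub>R A x" "A (- x) = - A x"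
  by (simp_all add: add zero diff sum scaleR neg)
 show "norm (A x) \<le> onorm A * norm x" by (rule onorm[OF bl])
qed

lemma riesz_representation:
 fixes f :: "ell2 \<Rightarrow> complex"
 assumes f: "bounded_linear f" and fc: "\<And>c x. f (c *\<^sub>C x) = c * f x"
 shows "\<exists>b. \<forall>x. f x = cinner x b"
proof -
 interpret bounded_linear f by fact
 define b where "b k = cnj (f (std_basis k))" for k
 have fin: "f (\<Sum>k<n. a k *\<^sub>C std_basis k) = (\<Sum>k<n. a k * cnj (b k))" for a n
  by (simp add: sum fc b_def)
 have bd: "(\<Sum>k<n. (norm (b k))^2) \<le> (onorm f)^2" for n
 proof -
  define S where "S = (\<Sum>k<n. (norm (b k))^2)"
  have S0: "S \<ge> 0" by (simp add: S_def sum_nonneg)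
  \<comment> \<open>Evaluating the functional at the truncation of \<open>b\<close> itself gives
    \<open>f y = (norm y)^2\<close>, hence \<open>norm y \<le> onorm f\<close>. This is the square
    summability of \<open>b\<close>.\<close>
  define y where "y = (\<Sum>k<n. b k *\<^sub>C std_basis k)"
  have "cinner y y = (\<Sum>k<n. b k * cnj (b k))"
   by (simp add: y_def cinner_sum_left cinner_sum_right if_distrib mult.commute cong: if_cong)
  then have "complex_of_real ((norm y)^2) = complex_of_real S"
   by (simp add: cinner_self[symmetric] S_def complex_norm_square del: of_real_power)
  then have ny: "(norm y)^2 = S" by (simp only: of_real_eq_iff)
  have "f y = complex_of_real S" by (simp add: y_def fin S_def complex_norm_square del: of_real_power)
  then have "S \<le> onorm f * norm y" using onorm[OF f, of y] S0 by simp
  then have "S^2 \<le> (onorm f)^2 * S" using S0 ny by (metis power_mono power_mult_distrib)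
  then have "S \<le> (onorm f)^2"
   using S0 by (cases "S = 0") (auto simp: power2_eq_square)
  then show ?thesis by (simp add: S_def)
 qed
 have sb: "summable (\<lambda>k. (norm (b k))^2)" by (rule bounded_partial_summable[OF bd])
 define B where "B = Abs_ell2 b"
 have cB: "coord B = b" unfolding B_def by (rule coord_Abs[OF sb])
 have "f x = cinner x B" for x
 proof (rule LIMSEQ_unique)
  show "(\<lambda>n. f (\<Sum>k<n. coord x k *\<^sub>C std_basis k)) \<longlonglongrightarrow> f x"
   by (rule tendsto[OF std_basis_expansion])
  show "(\<lambda>n. f (\<Sum>k<n. coord x k *\<^sub>C std_basis k)) \<longlonglongrightarrow> cinner x B"
   unfolding fin cinner_def cB[symmetric] by (rule summable_LIMSEQ[OF summable_cinner])
 qed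
 then show ?thesis by blast
qed

lemma cinner_left_eqI: "(\<And>z. cinner z x = cinner z y) \<Longrightarrow> x = y"
 using cinner_self[of "x - y"] by (auto simp: cinner_diff_right)

lemma cadjoint_exists:
 assumes A: "bounded_clinear A"
 shows "\<exists>B. bounded_clinear B \<and> (\<forall>x y. cinner (A x) y = cinner x (B y))"
proof -
 have "\<exists>b. \<forall>x. cinner (A x) y = cinner x b" for y
  by (rule riesz_representation[where f="\<lambda>x. cinner (A x) y"])
   (auto intro: bounded_linear_compose[OF bounded_linear_cinner_left bounded_clinearD(1)[OF A]]
    simp: bounded_clinearD[OF A])
 then obtain B where B: "\<And>x y. cinner (A x) y = cinner x (B y)" by metis
 have Bc: "B (c *\<^sub>C y) = c *\<^sub>C B y" for c y
  by (rule cinner_left_eqI) (simp add: B[symmetric])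
 have "bounded_linear B"
 proof (rule bounded_linear_intro[where K="onorm A"])
  show "B (x + y) = B x + B y" for x y
   by (rule cinner_left_eqI) (simp add: B[symmetric] cinner_add_right)
  show "B (r *\<^sub>R x) = r *\<^sub>R B x" for r x
   by (simp add: scaleR_ell2_def Bc)
  fix y
  \<comment> \<open>Testing the adjoint relation at \<open>B y\<close> bounds \<open>B\<close> by
    the norm of \<open>A\<close>.\<close>
  have "(norm (B y))^2 = Re (cinner (A (B y)) y)" by (simp add: B cinner_self)
  also have "\<dots> \<le> norm (A (B y)) * norm y"
   by (rule order_trans[OF complex_Re_le_cmod cinner_Cauchy_Schwarz])
  also have "\<dots> \<le> onorm A * norm (B y) * norm y"
   by (intro mult_right_mono bounded_clinearD(7)[OF A]) auto
  finally show "norm (B y) \<le> norm y * onorm A"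
   by (cases "B y = 0")
    (auto simp: power2_eq_square algebra_simps onorm_pos_le[OF bounded_clinearD(1)[OF A]])
 qed
 then show ?thesis using B Bc by (auto simp: bounded_clinear_def)
qed

lemma cadjoint:
 assumes A: "bounded_clinear A"
 shows "bounded_clinear (cadjoint A)" "cinner (A x) y = cinner x (cadjoint A y)"
proof -
 obtain B where B: "bounded_clinear B" "\<And>x y. cinner (A x) y = cinner x (B y)"
  using cadjoint_exists[OF A] by blast
 have "cadjoint A = B"
  unfolding cadjoint_def
 proof (rule the_equality)
  fix C assume C: "\<forall>x y. cinner (A x) y = cinner x (C y)"
  have "C y = B y" for y by (rule cinner_left_eqI) (use C B(2) in metis)
  then show "C = B" by blast
 qed (use B in blast)
 then show "bounded_clinear (cadjoint A)" "cinner (A x) y = cinner x (cadjoint A y)"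
  using B by auto
qed

lemma bounded_clinear_add: "bounded_clinear A \<Longrightarrow> bounded_clinear B \<Longrightarrow> bounded_clinear (\<lambda>x. A x + B x)"
 by (auto simp: bounded_clinear_def bounded_linear_add cell2.scale_right_distrib)

lemma bounded_clinear_minus: "bounded_clinear A \<Longrightarrow> bounded_clinear (\<lambda>x. - A x)"
 by (auto simp: bounded_clinear_def bounded_linear_minus)

lemma bounded_clinear_compose:
 "bounded_clinear A \<Longrightarrow> bounded_clinear B \<Longrightarrow> bounded_clinear (A \<circ> B)"
 by (auto simp: bounded_clinear_def o_def intro: bounded_linear_compose)

section \<open>Finite orthonormal systems\<close>

definition orthonormal :: "ell2 set \<Rightarrow> bool" where
 "orthonormal S \<longleftrightarrow> finite S \<and> (\<forall>x\<in>S. \<forall>y\<in>S. cinner x y = (if x = y then 1 else 0))"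

lemma orthonormal_cinner_sum:
 assumes "orthonormal S" "y \<in> S"
 shows "cinner (\<Sum>x\<in>S. c x *\<^sub>C x) y = c y"
proof -
 have "cinner (\<Sum>x\<in>S. c x *\<^sub>C x) y = (\<Sum>x\<in>S. if x = y then c x else 0)"
  unfolding cinner_sum_left using assms by (intro sum.cong) (auto simp: orthonormal_def)
 then show ?thesis using assms by (simp add: orthonormal_def)
qed

lemma orthonormal_cinner_sum2:
 assumes "orthonormal S"
 shows "cinner (\<Sum>x\<in>S. c x *\<^sub>C x) (\<Sum>x\<in>S. d x *\<^sub>C x) = (\<Sum>x\<in>S. c x * cnj (d x))"
 by (subst cinner_sum_right) (simp add: orthonormal_cinner_sum[OF assms] mult.commute)

lemma orthonormal_norm_sum:
 assumes "orthonormal S"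
 shows "(norm (\<Sum>x\<in>S. c x *\<^sub>C x))^2 = (\<Sum>x\<in>S. (norm (c x))^2)"
proof -
 have "complex_of_real ((norm (\<Sum>x\<in>S. c x *\<^sub>C x))^2) = complex_of_real (\<Sum>x\<in>S. (norm (c x))^2)"
  unfolding cinner_self[symmetric] orthonormal_cinner_sum2[OF assms]
  by (simp only: complex_norm_square[symmetric] of_real_sum)
 then show ?thesis by (simp only: of_real_eq_iff)
qed

lemma orthonormal_norm: "orthonormal S \<Longrightarrow> x \<in> S \<Longrightarrow> norm x = 1"
proof -
 assume "orthonormal S" "x \<in> S"
 then have "complex_of_real ((norm x)^2) = complex_of_real 1"
  by (subst cinner_self[symmetric]) (auto simp: orthonormal_def)
 then have "(norm x)^2 = 1^2" by (simp only: of_real_eq_iff one_power2)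
 then show "norm x = 1" by (rule power2_eq_imp_eq) auto
qed

lemma orthonormal_residual:
 assumes "orthonormal S" "y \<in> S"
 shows "cinner (x - (\<Sum>s\<in>S. cinner x s *\<^sub>C s)) y = 0"
 by (simp add: cinner_diff_left orthonormal_cinner_sum[OF assms])

lemma bessel_inequality:
 assumes "orthonormal S"
 shows "(\<Sum>s\<in>S. (norm (cinner x s))^2) \<le> (norm x)^2"
proof -
 define p where "p = (\<Sum>s\<in>S. cinner x s *\<^sub>C s)"
 have "cinner (x - p) p = 0"
  by (subst (2) p_def, subst cinner_sum_right) (simp add: p_def orthonormal_residual[OF assms])
 then have "cinner x x = cinner (x - p) (x - p) + cinner p p"
  using cinner_commute[of p "x - p"] by (simp add: cinner_diff_left cinner_diff_right)
 then have "complex_of_real ((norm x)^2) = complex_of_real ((norm (x - p))^2 + (norm p)^2)"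
  by (simp add: cinner_self)
 then have "(norm x)^2 = (norm (x - p))^2 + (norm p)^2" by (simp only: of_real_eq_iff)
 moreover have "(norm p)^2 = (\<Sum>s\<in>S. (norm (cinner x s))^2)"
  unfolding p_def by (rule orthonormal_norm_sum[OF assms])
 ultimately show ?thesis by simp
qed

lemma orthonormal_empty [simp]: "orthonormal {}"
 by (simp add: orthonormal_def)

lemma orthonormal_insert:
 assumes S: "orthonormal S" and x: "norm x = 1" "\<And>s. s \<in> S \<Longrightarrow> cinner x s = 0"
 shows "orthonormal (insert x S)" "x \<notin> S"
proof -
 have xx: "cinner x x = 1" using x by (simp add: cinner_self)
 then show "x \<notin> S" using x(2) by force
 have "cinner s x = 0" if "s \<in> S" for s using x(2)[OF that] cinner_commute[of s x] by simp
 then show "orthonormal (insert x S)"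
  using S x(2) xx \<open>x \<notin> S\<close> by (auto simp: orthonormal_def)
qed

lemma orthonormal_independent:
 assumes S: "orthonormal S"
 shows "cell2.independent S"
proof -
 have fin: "finite S" using S by (simp add: orthonormal_def)
 show ?thesis
  unfolding cell2.independent_explicit_finite_subsets
 proof (intro allI impI ballI)
  fix A u v
  assume A: "A \<subseteq> S" "finite A" "(\<Sum>v\<in>A. u v *\<^sub>C v) = 0" "v \<in> A"
  have "orthonormal A" using S A(1,2) unfolding orthonormal_def by blast
  then show "u v = 0" using orthonormal_cinner_sum[of A v u] A by simp
 qed
qed

section \<open>Counting functions by the variational principle\<close>

text \<open>Gaussian elimination: a multiple of equation \<open>j\<close> clears the unknown
  \<open>i0\<close> from the other equations, the induction hypothesis solves these without
  \<open>i0\<close>, and equation \<open>j\<close> then determines the value at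
  \<open>i0\<close>.\<close>

lemma homogeneous_system_solvable:
 fixes M :: "'j \<Rightarrow> 'i \<Rightarrow> 'a::field"
 assumes "finite J" "finite I" "card J < card I"
 shows "\<exists>c. (\<exists>i\<in>I. c i \<noteq> 0) \<and> (\<forall>j\<in>J. (\<Sum>i\<in>I. M j i * c i) = 0)"
 using assms
proof (induction J arbitrary: I M rule: finite_induct)
 case empty
 then obtain i where "i \<in> I" by fastforce
 then show ?case by (intro exI[of _ "\<lambda>_. 1"]) auto
next
 case (insert j J)
 show ?case
 proof (cases "\<forall>i\<in>I. M j i = 0")
  case True
  have "card J < card I" using insert by simp
  from insert.IH[OF insert.prems(1) this, of M] True show ?thesis by auto
 next
  case False
  then obtain i0 where i0: "i0 \<in> I" "M j i0 \<noteq> 0" by blast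
  define I' where "I' = I - {i0}"
  have I': "finite I'" "card J < card I'" using insert i0 by (auto simp: I'_def)
  obtain c where c: "\<exists>i\<in>I'. c i \<noteq> 0"
   "\<forall>l\<in>J. (\<Sum>i\<in>I'. (M l i - M l i0 * M j i / M j i0) * c i) = 0"
   using insert.IH[OF I', of "\<lambda>l i. M l i - M l i0 * M j i / M j i0"] by auto
  define s where "s = (\<Sum>i\<in>I'. M j i * c i)"
  define c' where "c' = c(i0 := - s / M j i0)"
  have eq: "(\<Sum>i\<in>I. M l i * c' i) = (\<Sum>i\<in>I'. M l i * c i) - M l i0 * s / M j i0" for l
  proof -
   have "(\<Sum>i\<in>I. M l i * c' i) = M l i0 * c' i0 + (\<Sum>i\<in>I'. M l i * c' i)"
    unfolding I'_def using insert.prems(1) i0(1) by (rule sum.remove)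
   also have "(\<Sum>i\<in>I'. M l i * c' i) = (\<Sum>i\<in>I'. M l i * c i)"
    by (intro sum.cong) (auto simp: c'_def I'_def)
   finally show ?thesis by (simp add: c'_def)
  qed
  have "(\<Sum>i\<in>I. M l i * c' i) = 0" if "l \<in> J" for l
  proof -
   have "(\<Sum>i\<in>I'. (M l i - M l i0 * M j i / M j i0) * c i)
     = (\<Sum>i\<in>I'. M l i * c i - M l i0 / M j i0 * (M j i * c i))"
    by (intro sum.cong) (auto simp: algebra_simps)
   also have "\<dots> = (\<Sum>i\<in>I'. M l i * c i) - M l i0 / M j i0 * s"
    by (simp add: sum_subtractf s_def sum_distrib_left)
   finally show ?thesis using c(2) that by (simp add: eq)
  qed
  moreover have "(\<Sum>i\<in>I. M j i * c' i) = 0" using i0 by (simp add: eq s_def)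
  moreover have "\<exists>i\<in>I. c' i \<noteq> 0" using c(1) by (auto simp: c'_def I'_def)
  ultimately show ?thesis by auto
 qed
qed

text \<open>\<open>robust n Q\<close> says that \<open>Q\<close> cannot be avoided by fewer than \<open>n\<close> linear constraints. By the
 min-max principle the counting functions are the largest such \<open>n\<close> for suitable \<open>Q\<close>.\<close>

definition robust :: "nat \<Rightarrow> (ell2 \<Rightarrow> bool) \<Rightarrow> bool" where
 "robust n Q \<longleftrightarrow> (\<forall>X. finite X \<and> card X < n \<longrightarrow> (\<exists>x. x \<noteq> 0 \<and> (\<forall>y\<in>X. cinner x y = 0) \<and> Q x))"

text \<open>Fewer than \<open>card S\<close> constraints on the coefficients form an underdetermined
  homogeneous system, so a nonzero vector of the span always escapes them.\<close>

lemma robust_orthonormal_span: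
 assumes S: "orthonormal S" and Q: "\<And>c. (\<Sum>x\<in>S. c x *\<^sub>C x) \<noteq> 0 \<Longrightarrow> Q (\<Sum>x\<in>S. c x *\<^sub>C x)"
 shows "robust (card S) Q"
 unfolding robust_def
proof (intro allI impI)
 fix X :: "ell2 set" assume X: "finite X \<and> card X < card S"
 have fin: "finite S" using S by (simp add: orthonormal_def)
 obtain c where c: "\<exists>i\<in>S. c i \<noteq> 0" "\<forall>y\<in>X. (\<Sum>x\<in>S. cinner x y * c x) = 0"
  using homogeneous_system_solvable[of X S "\<lambda>y x. cinner x y"] X fin by blast
 define x where "x = (\<Sum>x\<in>S. c x *\<^sub>C x)"
 obtain i where i: "i \<in> S" "c i \<noteq> 0" using c(1) by blast
 have "cinner x i = c i" unfolding x_def by (rule orthonormal_cinner_sum[OF S i(1)])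
 then have "x \<noteq> 0" using i(2) by auto
 moreover have "cinner x y = 0" if "y \<in> X" for y
  using c(2) that by (simp add: x_def cinner_sum_left mult.commute)
 moreover have "Q x" unfolding x_def by (rule Q) (use \<open>x \<noteq> 0\<close> x_def in blast)
 ultimately show "\<exists>x. x \<noteq> 0 \<and> (\<forall>y\<in>X. cinner x y = 0) \<and> Q x" by blast
qed

lemma compact_operatorD:
 assumes "compact_operator A"
 shows "bounded_clinear A"
  "e > 0 \<Longrightarrow> \<exists>F. finite F \<and> A ` cball 0 1 \<subseteq> (\<Union>y\<in>F. ball y e)"
  "(\<And>n. norm (X n) \<le> 1) \<Longrightarrow> \<exists>l r. strict_mono (r :: nat \<Rightarrow> nat) \<and> (\<lambda>n. A (X (r n))) \<longlonglongrightarrow> l"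
proof -
 show "bounded_clinear A" using assms by (simp add: compact_operator_def)
 have cpt: "compact (closure (A ` cball 0 1))" using assms by (simp add: compact_operator_def)
 show "\<exists>F. finite F \<and> A ` cball 0 1 \<subseteq> (\<Union>y\<in>F. ball y e)" if "e > 0"
  using cpt that closure_subset unfolding compact_eq_totally_bounded by (meson order_trans)
 show "\<exists>l r. strict_mono (r :: nat \<Rightarrow> nat) \<and> (\<lambda>n. A (X (r n))) \<longlonglongrightarrow> l" if "\<And>n. norm (X n) \<le> 1"
 proof -
  have "\<forall>n. A (X n) \<in> closure (A ` cball 0 1)"
   using that closure_subset by (fastforce simp: image_iff)
  then obtain l r where "strict_mono (r :: nat \<Rightarrow> nat)" "((\<lambda>n. A (X n)) \<circ> r) \<longlonglongrightarrow> l"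
   using cpt unfolding compact_def by meson
  then show ?thesis unfolding o_def by blast
 qed
qed

section \<open>The positive spectrum of a compact self-adjoint operator and the min-max
  principle\<close>

locale compact_self_adjoint =
 fixes A :: "ell2 \<Rightarrow> ell2"
 assumes cpt: "compact_operator A" and sa: "self_adjoint A"
begin

lemma bc: "bounded_clinear A" using cpt by (simp add: compact_operator_def)

lemma sym: "cinner (A x) y = cinner x (A y)" using sa by (simp add: self_adjoint_def)

definition eigensystem :: "real \<Rightarrow> ell2 set \<Rightarrow> bool" where
 "eigensystem t S \<longleftrightarrow> orthonormal S \<and> (\<forall>x\<in>S. \<exists>\<mu>>t. A x = complex_of_real \<mu> *\<^sub>C x)"

text \<open>Images of two different members are more than \<open>t\<close> apart, since
  \<open>A x - A y\<close> has component \<mu> > t along \<open>x\<close>. A finite net of radius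
  \<open>t/2\<close> for the image of the unit ball therefore separates all members.\<close>

lemma eigensystem_card_bounded:
 assumes "t > 0"
 shows "\<exists>M. \<forall>S. eigensystem t S \<longrightarrow> card S \<le> M"
proof -
 obtain F where F: "finite F" "A ` cball 0 1 \<subseteq> (\<Union>y\<in>F. ball y (t/2))"
  using compact_operatorD(2)[OF cpt, of "t/2"] assms by auto
 have "card S \<le> card F" if S: "eigensystem t S" for S
 proof -
  have on: "orthonormal S" using S by (simp add: eigensystem_def)
  have "\<exists>y\<in>F. dist y (A x) < t/2" if "x \<in> S" for x
  proof -
   have "A x \<in> A ` cball 0 1" using orthonormal_norm[OF on that] by auto
   then have "A x \<in> (\<Union>y\<in>F. ball y (t/2))" using F(2) by blast
   then show ?thesis by auto
  qed
  then obtain g where g: "\<And>x. x \<in> S \<Longrightarrow> g x \<in> F \<and> dist (g x) (A x) < t/2" by metis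
  have "inj_on g S"
  proof (rule inj_onI, rule ccontr)
   fix x y assume xy: "x \<in> S" "y \<in> S" "g x = g y" "x \<noteq> y"
   obtain \<mu> where \<mu>: "\<mu> > t" "A x = complex_of_real \<mu> *\<^sub>C x" using S xy unfolding eigensystem_def by blast
   have "dist (A x) (A y) < t"
    using dist_triangle_half_r[of "g x" "A x" t "A y"] g[OF xy(1)] g[OF xy(2)] xy(3) by auto
   then have "norm (A x - A y) < t" by (simp add: dist_norm)
   obtain \<nu> where \<nu>: "A y = complex_of_real \<nu> *\<^sub>C y" using S xy unfolding eigensystem_def by blast
   have "cinner (A x - A y) x = \<mu>"
    using on xy \<mu> \<nu> by (simp add: cinner_diff_left orthonormal_def)
   then have "\<mu> \<le> norm (A x - A y)"
    using cinner_Cauchy_Schwarz[of "A x - A y" x] orthonormal_norm[OF on xy(1)] by simp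
   then show False using \<open>norm (A x - A y) < t\<close> \<mu> by simp
  qed
  then show ?thesis using card_inj_on_le[of g S F] g F(1) by auto
 qed
 then show ?thesis by blast
qed

text \<open>The supremum \<open>m\<close> of the quadratic form over the unit sphere of the
  orthogonal complement of \<open>S\<close> is attained. A maximizing sequence consists of
  approximate eigenvectors, and compactness of \<open>A\<close> extracts a limit.\<close>

lemma eigenvector_exists:
 assumes S: "eigensystem t S" and t: "t > 0"
  and x0: "\<And>s. s \<in> S \<Longrightarrow> cinner x0 s = 0" "Re (cinner (A x0) x0) > t * (norm x0)^2"
 shows "\<exists>x \<mu>. norm x = 1 \<and> (\<forall>s\<in>S. cinner x s = 0) \<and> \<mu> > t \<and> A x = complex_of_real \<mu> *\<^sub>C x"
proof -
 define E where "E = {x. \<forall>s\<in>S. cinner x s = 0}"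
 have E_lin: "x - y \<in> E" "r *\<^sub>R x \<in> E" if "x \<in> E" "y \<in> E" for x y r
  using that by (auto simp: E_def cinner_diff_left)
 have E_A: "A x \<in> E" if "x \<in> E" for x
 proof -
  have "cinner (A x) s = 0" if s: "s \<in> S" for s
  proof -
   obtain \<mu> where "A s = complex_of_real \<mu> *\<^sub>C s" using S s unfolding eigensystem_def by blast
   then show ?thesis using \<open>x \<in> E\<close> s by (simp add: sym E_def)
  qed
  then show ?thesis by (simp add: E_def)
 qed
 have upper: "Re (cinner (A x) x) \<le> onorm A * (norm x)^2" for x
 proof -
  have "Re (cinner (A x) x) \<le> norm (A x) * norm x"
   by (rule order_trans[OF complex_Re_le_cmod cinner_Cauchy_Schwarz])
  also have "\<dots> \<le> onorm A * norm x * norm x"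
   by (intro mult_right_mono bounded_clinearD(7)[OF bc]) auto
  finally show ?thesis by (simp add: power2_eq_square mult.assoc)
 qed
 define V where "V = {Re (cinner (A x) x) | x. x \<in> E \<and> norm x = 1}"
 define m where "m = Sup V"
 have "x0 \<noteq> 0" using x0(2) by auto
 define x1 where "x1 = (1 / norm x0) *\<^sub>R x0"
 have x1: "norm x1 = 1" "x1 \<in> E" using \<open>x0 \<noteq> 0\<close> x0(1) by (auto simp: x1_def E_def)
 have ax1: "A x1 = (1 / norm x0) *\<^sub>R A x0"
  unfolding x1_def by (rule bounded_clinearD(8)[OF bc])
 have rx1: "Re (cinner (A x1) x1) = Re (cinner (A x0) x0) / (norm x0)^2"
  unfolding ax1 by (simp add: x1_def power2_eq_square)
 have x1t: "Re (cinner (A x1) x1) > t"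
  using x0(2) \<open>x0 \<noteq> 0\<close> unfolding rx1 by (simp add: field_simps)
 have bdd: "bdd_above V"
 proof (rule bdd_aboveI[where M="onorm A"])
  fix v assume "v \<in> V"
  then obtain x where "v = Re (cinner (A x) x)" "norm x = 1" by (auto simp: V_def)
  then show "v \<le> onorm A" using upper[of x] by simp
 qed
 have V_ne: "V \<noteq> {}" using x1 by (auto simp: V_def)
 have "Re (cinner (A x1) x1) \<le> m"
  unfolding m_def by (rule cSup_upper[OF _ bdd]) (use x1 in \<open>auto simp: V_def\<close>)
 then have mt: "m > t" using x1t by simp
 \<comment> \<open>The form of \<open>m - A\<close>, positive semidefinite on the complement
   \<open>E\<close> by the choice of \<open>m\<close>. It is small along a maximizing
   sequence.\<close>
 define q where "q x = m * (norm x)^2 - Re (cinner (A x) x)" for x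
 have q_nonneg: "q x \<ge> 0" if "x \<in> E" for x
 proof (cases "x = 0")
  case False
  define y where "y = (1 / norm x) *\<^sub>R x"
  have y: "norm y = 1" "y \<in> E" using False that by (auto simp: y_def E_def)
  have ay: "A y = (1 / norm x) *\<^sub>R A x"
   unfolding y_def by (rule bounded_clinearD(8)[OF bc])
  have ry: "Re (cinner (A y) y) = Re (cinner (A x) x) / (norm x)^2"
   unfolding ay by (simp add: y_def power2_eq_square)
  have "Re (cinner (A y) y) \<le> m"
   unfolding m_def by (rule cSup_upper[OF _ bdd]) (use y in \<open>auto simp: V_def\<close>)
  then show ?thesis using False unfolding ry by (simp add: q_def field_simps)
 qed (simp add: q_def bounded_clinearD(4)[OF bc])
 define K where "K = m + onorm A"
 have K: "K > 0" using mt t onorm_pos_le[OF bounded_clinearD(1)[OF bc]] by (simp add: K_def)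
 have q_upper: "q y \<le> K * (norm y)^2" for y
 proof -
  have "- Re (cinner (A y) y) \<le> norm (A y) * norm y"
   using abs_Re_le_cmod[of "cinner (A y) y"] cinner_Cauchy_Schwarz[of "A y" y] by linarith
  also have "\<dots> \<le> onorm A * norm y * norm y"
   by (intro mult_right_mono bounded_clinearD(7)[OF bc]) auto
  finally show ?thesis by (simp add: q_def K_def power2_eq_square algebra_simps)
 qed
 have residual: "(norm (m *\<^sub>R x - A x))^2 \<le> K * q x" if "x \<in> E" for x
 proof -
  define y where "y = m *\<^sub>R x - A x"
  have yE: "y \<in> E" unfolding y_def using that E_lin E_A by blast
  \<comment> \<open>This step length minimizes the upper bound
    \<open>q x - 2 * s * (norm y)^2 + s^2 * K * (norm y)^2\<close>. Nonnegativity of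
    \<open>q\<close> at \<open>x - s *\<^sub>R y\<close> then acts as the Cauchy--Schwarz inequality
    of the semidefinite form.\<close>
  define s where "s = 1 / K"
  have "x - s *\<^sub>R y \<in> E" using that yE E_lin by blast
  then have "0 \<le> q (x - s *\<^sub>R y)" by (rule q_nonneg)
  also have "q (x - s *\<^sub>R y) = q x - 2 * s * (norm y)^2 + s^2 * q y"
  proof -
   have n: "(norm (x - s *\<^sub>R y))^2 = (norm x)^2 - 2 * s * Re (cinner x y) + s^2 * (norm y)^2"
    using dot_norm_neg[of x "s *\<^sub>R y"] by (simp add: inner_ell2_def power_mult_distrib)
   have "cinner (A y) x = cnj (cinner (A x) y)"
    using cinner_commute[of y "A x"] sym by simp
   then have "Re (cinner (A y) x) = Re (cinner (A x) y)" by simp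
   then have a: "Re (cinner (A (x - s *\<^sub>R y)) (x - s *\<^sub>R y))
     = Re (cinner (A x) x) - 2 * s * Re (cinner (A x) y) + s^2 * Re (cinner (A y) y)"
    by (simp add: bounded_clinearD[OF bc] cinner_diff_left cinner_diff_right power2_eq_square algebra_simps)
   have "(norm y)^2 = Re (cinner y y)" by (simp add: cinner_self)
   also have "\<dots> = m * Re (cinner x y) - Re (cinner (A x) y)"
    by (subst (1) y_def) (simp add: cinner_diff_left)
   finally have r: "Re (cinner (A x) y) = m * Re (cinner x y) - (norm y)^2" by simp
   show ?thesis unfolding q_def n a r by (simp add: algebra_simps)
  qed
  also have "\<dots> \<le> q x - 2 * s * (norm y)^2 + s^2 * (K * (norm y)^2)"
   using q_upper[of y] by (intro add_left_mono mult_left_mono) auto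
  also have "\<dots> = q x - (norm y)^2 / K" using K by (simp add: s_def power2_eq_square field_simps)
  finally show ?thesis using K by (simp add: y_def field_simps)
 qed
 have "\<exists>x. x \<in> E \<and> norm x = 1 \<and> q x < 1 / real (Suc n)" for n
 proof -
  have "m - 1 / real (Suc n) < Sup V" by (simp add: m_def)
  then obtain v where "v \<in> V" "m - 1 / real (Suc n) < v" using less_cSup_iff[OF V_ne bdd] by blast
  then show ?thesis by (auto simp: V_def q_def)
 qed
 then obtain X where X: "\<And>n. X n \<in> E" "\<And>n. norm (X n) = 1" "\<And>n. q (X n) < 1 / real (Suc n)" by metis
 obtain l r where r: "strict_mono (r :: nat \<Rightarrow> nat)" and l: "(\<lambda>n. A (X (r n))) \<longlonglongrightarrow> l"
  using compact_operatorD(3)[OF cpt, of X] X(2) by auto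
 have "(\<lambda>n. m *\<^sub>R X n - A (X n)) \<longlonglongrightarrow> 0"
 proof (rule Lim_null_comparison[where g="\<lambda>n. sqrt (K * (1 / real (Suc n)))"])
  have "norm (m *\<^sub>R X n - A (X n)) \<le> sqrt (K * (1 / real (Suc n)))" for n
  proof (rule real_le_rsqrt)
   have "K * q (X n) \<le> K * (1 / real (Suc n))" using X(3)[of n] K by (intro mult_left_mono) auto
   then show "(norm (m *\<^sub>R X n - A (X n)))^2 \<le> K * (1 / real (Suc n))"
    using residual[OF X(1)[of n]] by linarith
  qed
  then show "\<forall>\<^sub>F n in sequentially. norm (m *\<^sub>R X n - A (X n)) \<le> sqrt (K * (1 / real (Suc n)))"
   by (rule always_eventually[OF allI])
  have "(\<lambda>n. sqrt (K * (1 / real (Suc n)))) \<longlonglongrightarrow> sqrt (K * 0)"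
   by (intro tendsto_intros filterlim_compose[OF LIMSEQ_inverse_real_of_nat, unfolded inverse_eq_divide] LIMSEQ_inverse_real_of_nat[unfolded inverse_eq_divide])
  then show "(\<lambda>n. sqrt (K * (1 / real (Suc n)))) \<longlonglongrightarrow> 0" by simp
 qed
 \<comment> \<open>Compactness only makes \<open>A (X (r n))\<close> converge; the vanishing
   residual transfers the convergence to the vectors themselves, because \<open>m\<close> is not
   0.\<close>
 from LIMSEQ_subseq_LIMSEQ[OF this r]
 have "(\<lambda>n. m *\<^sub>R X (r n) - A (X (r n))) \<longlonglongrightarrow> 0" by (simp add: o_def)
 from tendsto_add[OF this l] have mX: "(\<lambda>n. m *\<^sub>R X (r n)) \<longlonglongrightarrow> l" by simp
 have "(\<lambda>n. A (m *\<^sub>R X (r n))) \<longlonglongrightarrow> A l"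
  by (rule bounded_linear.tendsto[OF bounded_clinearD(1)[OF bc] mX])
 moreover have "(\<lambda>n. A (m *\<^sub>R X (r n))) \<longlonglongrightarrow> m *\<^sub>R l"
  unfolding bounded_clinearD(8)[OF bc] by (intro tendsto_intros l)
 ultimately have Al: "A l = m *\<^sub>R l" by (rule LIMSEQ_unique)
 have "norm l = m"
 proof (rule LIMSEQ_unique)
  show "(\<lambda>n. norm (m *\<^sub>R X (r n))) \<longlonglongrightarrow> norm l" by (intro tendsto_intros mX)
  show "(\<lambda>n. norm (m *\<^sub>R X (r n))) \<longlonglongrightarrow> m" using mt t X(2) by simp
 qed
 have "cinner l s = 0" if "s \<in> S" for s
 proof (rule LIMSEQ_unique)
  show "(\<lambda>n. cinner (m *\<^sub>R X (r n)) s) \<longlonglongrightarrow> cinner l s"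
   by (rule bounded_linear.tendsto[OF bounded_linear_cinner_left mX])
  show "(\<lambda>n. cinner (m *\<^sub>R X (r n)) s) \<longlonglongrightarrow> 0" using X(1) that by (simp add: E_def)
 qed
 moreover have "A ((1/m) *\<^sub>R l) = complex_of_real m *\<^sub>C ((1/m) *\<^sub>R l)"
  by (simp add: bounded_clinearD(8)[OF bc] Al scaleC_of_real)
 ultimately show ?thesis
  using \<open>norm l = m\<close> mt t by (intro exI[of _ "(1/m) *\<^sub>R l"] exI[of _ m]) auto
qed

text \<open>An eigensystem of maximal size cannot be extended, and by
  \<open>eigenvector_exists\<close> this is precisely the form bound on its complement. Only the
  spectrum above \<open>t\<close> is ever constructed.\<close>

lemma spectral_decomposition:
 assumes t: "t > 0"
 obtains S where "eigensystem t S"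
  "\<And>x. (\<And>s. s \<in> S \<Longrightarrow> cinner x s = 0) \<Longrightarrow> Re (cinner (A x) x) \<le> t * (norm x)^2"
proof -
 obtain M where M: "\<And>S. eigensystem t S \<Longrightarrow> card S \<le> M" using eigensystem_card_bounded[OF t] by blast
 have "eigensystem t {}" by (simp add: eigensystem_def)
 then have "\<exists>n. \<exists>S. eigensystem t S \<and> card S = n" by blast
 define n where "n = (GREATEST n. \<exists>S. eigensystem t S \<and> card S = n)"
 have "\<exists>S. eigensystem t S \<and> card S = n"
  unfolding n_def by (rule GreatestI_ex_nat[where b=M]) (use M \<open>eigensystem t {}\<close> in blast)+
 then obtain S where S: "eigensystem t S" "card S = n" by blast
 have max: "card S' \<le> n" if "eigensystem t S'" for S'
  unfolding n_def by (rule Greatest_le_nat[where b=M]) (use M that in blast)+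
 show ?thesis
 proof (rule that[OF S(1)], rule ccontr)
  fix x assume x: "\<And>s. s \<in> S \<Longrightarrow> cinner x s = 0" "\<not> Re (cinner (A x) x) \<le> t * (norm x)^2"
  obtain y \<mu> where y: "norm y = 1" "\<forall>s\<in>S. cinner y s = 0" "\<mu> > t" "A y = complex_of_real \<mu> *\<^sub>C y"
   using eigenvector_exists[OF S(1) t x(1)] x(2) by (auto simp: not_le)
  have on: "orthonormal S" using S by (simp add: eigensystem_def)
  have "eigensystem t (insert y S)"
   using orthonormal_insert(1)[OF on y(1)] y S(1) by (auto simp: eigensystem_def)
  from max[OF this] show False
   using orthonormal_insert(2)[OF on y(1)] y(2) on S(2) by (auto simp: orthonormal_def)
 qed
qed

text \<open>The definition counts dimensions of eigenspaces; grouping a maximal eigensystem by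
  eigenvalue gives a basis of each of them.\<close>

lemma n_plus_eq_card:
 assumes t: "t > 0" and S: "eigensystem t S"
  and max: "\<And>x. (\<And>s. s \<in> S \<Longrightarrow> cinner x s = 0) \<Longrightarrow> Re (cinner (A x) x) \<le> t * (norm x)^2"
 shows "n_plus t A = card S"
proof -
 have on: "orthonormal S" and fin: "finite S" using S by (auto simp: eigensystem_def orthonormal_def)
 obtain ev where ev: "\<And>x. x \<in> S \<Longrightarrow> ev x > t \<and> A x = complex_of_real (ev x) *\<^sub>C x"
  using S unfolding eigensystem_def by metis
 define B where "B \<mu> = {x\<in>S. ev x = \<mu>}" for \<mu>
 have in_span: "u \<in> cell2.span (B \<mu>)" if \<mu>: "\<mu> > t" and u: "A u = complex_of_real \<mu> *\<^sub>C u" for u \<mu>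
 proof -
  have orth: "cinner u s = 0" if "s \<in> S" "ev s \<noteq> \<mu>" for s
  proof -
   have "complex_of_real \<mu> * cinner u s = complex_of_real (ev s) * cinner u s"
    using sym[of u s] ev[OF that(1)] u by simp
   then show ?thesis using that(2) by simp
  qed
  \<comment> \<open>The residual is again an eigenvector for \<mu> > t and is orthogonal to all of
    \<open>S\<close>, so the form bound forces it to vanish.\<close>
  define w where "w = u - (\<Sum>s\<in>S. cinner u s *\<^sub>C s)"
  have Aw: "A w = complex_of_real \<mu> *\<^sub>C w"
  proof -
   have "A (\<Sum>s\<in>S. cinner u s *\<^sub>C s) = (\<Sum>s\<in>S. cinner u s *\<^sub>C A s)"
    by (simp add: bounded_clinearD[OF bc])
   also have "\<dots> = (\<Sum>s\<in>S. complex_of_real \<mu> *\<^sub>C (cinner u s *\<^sub>C s))"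
   proof (rule sum.cong[OF refl])
    fix s assume "s \<in> S"
    then show "cinner u s *\<^sub>C A s = complex_of_real \<mu> *\<^sub>C (cinner u s *\<^sub>C s)"
     using orth[of s] ev[of s] by (cases "ev s = \<mu>") (auto simp: mult.commute)
   qed
   also have "\<dots> = complex_of_real \<mu> *\<^sub>C (\<Sum>s\<in>S. cinner u s *\<^sub>C s)"
    by (simp add: cell2.scale_sum_right)
   finally show ?thesis
    by (simp add: w_def bounded_clinearD(5)[OF bc] u cell2.scale_right_diff_distrib)
  qed
  have "Re (cinner (A w) w) \<le> t * (norm w)^2"
   by (rule max) (simp add: w_def orthonormal_residual[OF on])
  then have "\<mu> * (norm w)^2 \<le> t * (norm w)^2" by (simp add: Aw cinner_self)
  then have "w = 0" using \<mu> by (simp add: mult_le_cancel_right)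
  then have "u = (\<Sum>s\<in>S. cinner u s *\<^sub>C s)" by (simp add: w_def)
  also have "\<dots> = (\<Sum>s\<in>B \<mu>. cinner u s *\<^sub>C s)"
   by (rule sum.mono_neutral_right) (auto simp: B_def fin orth)
  finally show ?thesis
   by (metis (mono_tags, lifting) cell2.span_base cell2.span_scale cell2.span_sum)
 qed
 have dim: "cell2.dim (eigenspace A (complex_of_real \<mu>)) = card (B \<mu>)" if "\<mu> > t" for \<mu>
 proof (rule cell2.dim_eq_card)
  have "orthonormal (B \<mu>)" using on by (auto simp: orthonormal_def B_def)
  then show "cell2.independent (B \<mu>)" by (rule orthonormal_independent)
  show "cell2.span (B \<mu>) = cell2.span (eigenspace A (complex_of_real \<mu>))"
  proof
   show "cell2.span (B \<mu>) \<subseteq> cell2.span (eigenspace A (complex_of_real \<mu>))"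
    using ev by (intro cell2.span_mono) (auto simp: B_def eigenspace_def)
   show "cell2.span (eigenspace A (complex_of_real \<mu>)) \<subseteq> cell2.span (B \<mu>)"
    by (rule cell2.span_minimal) (auto simp: eigenspace_def in_span[OF that])
  qed
 qed
 have set: "{\<mu>. \<mu> > t \<and> eigenspace A (complex_of_real \<mu>) \<noteq> {0}} = ev ` S"
 proof
  show "{\<mu>. \<mu> > t \<and> eigenspace A (complex_of_real \<mu>) \<noteq> {0}} \<subseteq> ev ` S"
  proof
   fix \<mu> assume "\<mu> \<in> {\<mu>. \<mu> > t \<and> eigenspace A (complex_of_real \<mu>) \<noteq> {0}}"
   then have \<mu>: "\<mu> > t" "eigenspace A (complex_of_real \<mu>) \<noteq> {0}" by auto
   moreover have "0 \<in> eigenspace A (complex_of_real \<mu>)" by (simp add: eigenspace_def bounded_clinearD[OF bc])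
   ultimately obtain u where "u \<in> eigenspace A (complex_of_real \<mu>)" "u \<noteq> 0" by blast
   then have "B \<mu> \<noteq> {}" using in_span[OF \<mu>(1), of u] by (auto simp: eigenspace_def)
   then show "\<mu> \<in> ev ` S" by (auto simp: B_def)
  qed
  show "ev ` S \<subseteq> {\<mu>. \<mu> > t \<and> eigenspace A (complex_of_real \<mu>) \<noteq> {0}}"
  proof (intro image_subsetI CollectI conjI)
   fix x assume x: "x \<in> S"
   show "ev x > t" using ev[OF x] by simp
   have "x \<in> eigenspace A (complex_of_real (ev x))" "x \<noteq> 0"
    using ev[OF x] orthonormal_norm[OF on x] by (auto simp: eigenspace_def)
   then show "eigenspace A (complex_of_real (ev x)) \<noteq> {0}" by blast
  qed
 qed
 have "n_plus t A = (\<Sum>\<mu>\<in>ev ` S. card (B \<mu>))"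
  unfolding n_plus_def set by (rule sum.cong) (use dim ev in auto)
 also have "\<dots> = (\<Sum>\<mu>\<in>ev ` S. \<Sum>x | x \<in> S \<and> ev x = \<mu>. 1)" by (simp add: B_def)
 also have "\<dots> = (\<Sum>x\<in>S. 1)" by (rule sum.group) (auto simp: fin)
 finally show ?thesis by simp
qed

lemma eigensystem_form:
 assumes S: "eigensystem t S" and ne: "(\<Sum>x\<in>S. c x *\<^sub>C x) \<noteq> 0"
 shows "Re (cinner (A (\<Sum>x\<in>S. c x *\<^sub>C x)) (\<Sum>x\<in>S. c x *\<^sub>C x)) > t * (norm (\<Sum>x\<in>S. c x *\<^sub>C x))^2"
proof -
 have on: "orthonormal S" and fin: "finite S" using S by (auto simp: eigensystem_def orthonormal_def)
 obtain ev where ev: "\<And>x. x \<in> S \<Longrightarrow> ev x > t \<and> A x = complex_of_real (ev x) *\<^sub>C x"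
  using S unfolding eigensystem_def by metis
 have "A (\<Sum>x\<in>S. c x *\<^sub>C x) = (\<Sum>x\<in>S. (c x * of_real (ev x)) *\<^sub>C x)"
  using ev by (simp add: bounded_clinearD[OF bc])
 then have "Re (cinner (A (\<Sum>x\<in>S. c x *\<^sub>C x)) (\<Sum>x\<in>S. c x *\<^sub>C x))
   = Re (\<Sum>x\<in>S. (c x * of_real (ev x)) * cnj (c x))"
  by (simp only: orthonormal_cinner_sum2[OF on])
 also have "\<dots> = (\<Sum>x\<in>S. Re ((c x * of_real (ev x)) * cnj (c x)))" by simp
 also have "\<dots> = (\<Sum>x\<in>S. ev x * (norm (c x))^2)"
  by (intro sum.cong refl) (simp only: cmod_power2, simp add: power2_eq_square algebra_simps)
 finally have 1: "Re (cinner (A (\<Sum>x\<in>S. c x *\<^sub>C x)) (\<Sum>x\<in>S. c x *\<^sub>C x)) = (\<Sum>x\<in>S. ev x * (norm (c x))^2)" .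
 have "\<exists>x\<in>S. c x \<noteq> 0"
 proof (rule ccontr)
  assume "\<not> (\<exists>x\<in>S. c x \<noteq> 0)"
  then show False using ne by simp
 qed
 then obtain x where x: "x \<in> S" "c x \<noteq> 0" by blast
 have "(\<Sum>x\<in>S. t * (norm (c x))^2) < (\<Sum>x\<in>S. ev x * (norm (c x))^2)"
 proof (rule sum_strict_mono_ex1[OF fin])
  show "\<forall>x\<in>S. t * (norm (c x))^2 \<le> ev x * (norm (c x))^2"
   using ev by (meson less_imp_le mult_right_mono zero_le_power2)
  show "\<exists>x\<in>S. t * (norm (c x))^2 < ev x * (norm (c x))^2"
   using ev[OF x(1)] x by (intro bexI[of _ x]) auto
 qed
 then show ?thesis unfolding 1 orthonormal_norm_sum[OF on] by (simp add: sum_distrib_left)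
qed

theorem n_plus_robust:
 assumes t: "t > 0"
 shows "robust (n_plus t A) (\<lambda>x. Re (cinner (A x) x) > t * (norm x)^2)"
proof -
 obtain S where S: "eigensystem t S"
  "\<And>x. (\<And>s. s \<in> S \<Longrightarrow> cinner x s = 0) \<Longrightarrow> Re (cinner (A x) x) \<le> t * (norm x)^2"
  using spectral_decomposition[OF t] by blast
 have on: "orthonormal S" using S by (simp add: eigensystem_def)
 have n: "n_plus t A = card S" by (rule n_plus_eq_card[OF t S])
 show ?thesis unfolding n
  by (rule robust_orthonormal_span[OF on]) (rule eigensystem_form[OF S(1)])
qed

text \<open>The vectors of a maximal eigensystem are themselves constraints that rule out every
  vector whose form exceeds \<open>t\<close>. Together with \<open>n_plus_robust\<close> this is the
  min-max principle.\<close>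

theorem robust_le_n_plus:
 assumes t: "t > 0" and n: "robust n (\<lambda>x. Re (cinner (A x) x) > t * (norm x)^2)"
 shows "n \<le> n_plus t A"
proof (rule ccontr)
 assume "\<not> n \<le> n_plus t A"
 obtain S where S: "eigensystem t S"
  "\<And>x. (\<And>s. s \<in> S \<Longrightarrow> cinner x s = 0) \<Longrightarrow> Re (cinner (A x) x) \<le> t * (norm x)^2"
  using spectral_decomposition[OF t] by blast
 have "finite S" using S by (simp add: eigensystem_def orthonormal_def)
 moreover have "card S < n" using n_plus_eq_card[OF t S] \<open>\<not> n \<le> n_plus t A\<close> by simp
 ultimately show False using n S(2) unfolding robust_def by (meson not_le)
qed

end

section \<open>Singular values through the Gram operator\<close>

lemma compact_operator_compose:
 assumes A: "compact_operator A" and B: "bounded_clinear B"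
 shows "compact_operator (B \<circ> A)"
proof -
 have cpt: "compact (B ` closure (A ` cball 0 1))"
  by (intro compact_continuous_image linear_continuous_on)
   (use A B in \<open>auto simp: compact_operator_def bounded_clinear_def\<close>)
 have "(B \<circ> A) ` cball 0 1 \<subseteq> B ` closure (A ` cball 0 1)"
  using closure_subset by (fastforce simp: image_comp[symmetric])
 then have "closure ((B \<circ> A) ` cball 0 1) \<subseteq> B ` closure (A ` cball 0 1)"
  by (rule closure_minimal) (rule compact_imp_closed[OF cpt])
 then have "compact (closure ((B \<circ> A) ` cball 0 1))"
  using cpt by (metis closed_closure compact_Int_closed inf.absorb_iff2)
 moreover have "bounded_clinear (B \<circ> A)"
  using A B by (intro bounded_clinear_compose) (auto simp: compact_operator_def)
 ultimately show ?thesis by (simp add: compact_operator_def)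
qed

lemma gram_operator:
 assumes K: "compact_operator K"
 shows "compact_self_adjoint (cadjoint K \<circ> K)"
  "Re (cinner ((cadjoint K \<circ> K) x) x) = (norm (K x))^2"
proof -
 have bK: "bounded_clinear K" using K by (simp add: compact_operator_def)
 note adj = cadjoint[OF bK]
 have adj': "cinner (cadjoint K y) x = cinner y (K x)" for x y
  using adj(2)[of x y] cinner_commute[of "cadjoint K y" x] cinner_commute[of y "K x"] by simp
 show "compact_self_adjoint (cadjoint K \<circ> K)"
 proof
  show "compact_operator (cadjoint K \<circ> K)" by (rule compact_operator_compose[OF K adj(1)])
  show "self_adjoint (cadjoint K \<circ> K)"
   by (simp add: self_adjoint_def adj' adj(2)[symmetric])
 qed
 show "Re (cinner ((cadjoint K \<circ> K) x) x) = (norm (K x))^2"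
  by (simp add: adj' cinner_self)
qed

lemma n_sing_eq_n_plus:
 assumes t: "t > 0"
 shows "n_sing t K = n_plus (t^2) (cadjoint K \<circ> K)"
proof -
 have set: "{\<mu>. \<mu> > t^2 \<and> eigenspace (cadjoint K \<circ> K) (complex_of_real \<mu>) \<noteq> {0}}
   = (\<lambda>s. s^2) ` {s. s > t \<and> s \<ge> 0 \<and> eigenspace (cadjoint K \<circ> K) (complex_of_real (s^2)) \<noteq> {0}}"
  (is "?L = ?f ` ?R")
 proof
  show "?L \<subseteq> ?f ` ?R"
  proof
   fix \<mu> assume \<mu>: "\<mu> \<in> ?L"
   then have "\<mu> > t^2" by simp
   then have "\<mu> > 0" using zero_le_power2[of t] by linarith
   have "sqrt \<mu> > t" using \<open>\<mu> > t^2\<close> by (rule real_less_rsqrt)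
   define s where "s = sqrt \<mu>"
   have s: "s^2 = \<mu>" "s > t" "s \<ge> 0" using \<open>\<mu> > 0\<close> \<open>sqrt \<mu> > t\<close> t by (simp_all add: s_def)
   have "s \<in> ?R" unfolding mem_Collect_eq s(1) using s(2,3) \<mu> by blast
   then show "\<mu> \<in> ?f ` ?R" using s(1) by blast
  qed
  show "?f ` ?R \<subseteq> ?L"
  proof (rule image_subsetI, unfold mem_Collect_eq, elim conjE, intro conjI)
   fix s assume "t < s"
   then show "t^2 < s^2" using t by (intro power_strict_mono) auto
  qed
 qed
 have inj: "inj_on ?f ?R"
  by (rule inj_onI, unfold mem_Collect_eq) (metis power2_eq_iff_nonneg)
 show ?thesis unfolding n_sing_def n_plus_def set sum.reindex[OF inj] by (simp only: o_def)
qed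

lemma n_sing_robust:
 assumes K: "compact_operator K" and t: "t > 0"
 shows "robust (n_sing t K) (\<lambda>x. norm (K x) > t * norm x)"
proof -
 interpret G: compact_self_adjoint "cadjoint K \<circ> K" by (rule gram_operator(1)[OF K])
 have "robust (n_sing t K) (\<lambda>x. (norm (K x))^2 > t^2 * (norm x)^2)"
  using G.n_plus_robust[of "t^2"] t unfolding gram_operator(2)[OF K] n_sing_eq_n_plus[OF t] by simp
 moreover have "(norm (K x))^2 > t^2 * (norm x)^2 \<longleftrightarrow> norm (K x) > t * norm x" for x
  using t power_mono_iff[of "norm (K x)" "t * norm x" 2] by (simp add: power_mult_distrib not_le[symmetric])
 ultimately show ?thesis by simp
qed

lemma robust_le_n_sing:
 assumes K: "compact_operator K" and t: "t > 0" and n: "robust n (\<lambda>x. norm (K x) > t * norm x)"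
 shows "n \<le> n_sing t K"
proof -
 interpret G: compact_self_adjoint "cadjoint K \<circ> K" by (rule gram_operator(1)[OF K])
 have "(norm (K x))^2 > t^2 * (norm x)^2 \<longleftrightarrow> norm (K x) > t * norm x" for x
  using t power_mono_iff[of "norm (K x)" "t * norm x" 2] by (simp add: power_mult_distrib not_le[symmetric])
 then have "robust n (\<lambda>x. (norm (K x))^2 > t^2 * (norm x)^2)" using n by simp
 then show ?thesis
  using G.robust_le_n_plus[of "t^2" n] t unfolding gram_operator(2)[OF K] n_sing_eq_n_plus[OF t] by simp
qed

text \<open>Eigenvectors above \<open>t\<close> and below \<open>- t\<close> belong to different
  eigenvalues, so together they form one orthonormal set, on whose span \<open>K\<close> stretches
  by more than \<open>t\<close>. The inequality is enough: it turns an upper bound for singular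
  values and a lower bound for one sign into an upper bound for the other sign.\<close>

lemma n_plus_add_n_minus_le_n_sing:
 assumes K: "compact_operator K" "self_adjoint K" and t: "t > 0"
 shows "n_plus t K + n_minus t K \<le> n_sing t K"
proof -
 interpret P: compact_self_adjoint K using K by unfold_locales
 have bK: "bounded_clinear K" by (rule P.bc)
 have mK: "compact_operator (\<lambda>x. - K x)"
  using compact_operator_compose[OF K(1), of "\<lambda>x. - x"]
   bounded_clinear_minus[of "\<lambda>x. x"] by (simp add: o_def bounded_clinear_def bounded_linear_ident)
 interpret Q: compact_self_adjoint "\<lambda>x. - K x"
  by unfold_locales (use mK K(2) in \<open>auto simp: self_adjoint_def\<close>)
 obtain S where S: "P.eigensystem t S"
  "\<And>x. (\<And>s. s \<in> S \<Longrightarrow> cinner x s = 0) \<Longrightarrow> Re (cinner (K x) x) \<le> t * (norm x)^2"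
  using P.spectral_decomposition[OF t] by blast
 obtain T where T: "Q.eigensystem t T"
  "\<And>x. (\<And>s. s \<in> T \<Longrightarrow> cinner x s = 0) \<Longrightarrow> Re (cinner (- K x) x) \<le> t * (norm x)^2"
  using Q.spectral_decomposition[OF t] by blast
 obtain ev where ev: "\<And>x. x \<in> S \<Longrightarrow> ev x > t \<and> K x = complex_of_real (ev x) *\<^sub>C x"
  using S unfolding P.eigensystem_def by metis
 have "\<exists>\<mu>. \<mu> < - t \<and> K x = complex_of_real \<mu> *\<^sub>C x" if x: "x \<in> T" for x
 proof -
  obtain \<mu> where \<mu>: "\<mu> > t" "- K x = complex_of_real \<mu> *\<^sub>C x"
   using x T(1) unfolding Q.eigensystem_def by blast
  then have "- (- K x) = complex_of_real (- \<mu>) *\<^sub>C x" by simp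
  then show ?thesis using \<mu>(1) by (intro exI[of _ "- \<mu>"]) simp
 qed
 then obtain ev' where ev': "\<And>x. x \<in> T \<Longrightarrow> ev' x < - t \<and> K x = complex_of_real (ev' x) *\<^sub>C x" by metis
 have on: "orthonormal S" "orthonormal T" and fin: "finite S" "finite T"
  using S(1) T(1) by (auto simp: P.eigensystem_def Q.eigensystem_def orthonormal_def)
 have ST: "cinner x y = 0" if xy: "x \<in> S" "y \<in> T" for x y
 proof -
  have "complex_of_real (ev x) * cinner x y = complex_of_real (ev' y) * cinner x y"
   using P.sym[of x y] ev[OF xy(1)] ev'[OF xy(2)] by simp
  moreover have "ev x \<noteq> ev' y" using ev[OF xy(1)] ev'[OF xy(2)] t by linarith
  ultimately show ?thesis by simp
 qed
 have TS: "cinner y x = 0" if xy: "x \<in> S" "y \<in> T" for x y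
  using ST[OF xy] cinner_commute[of y x] by simp
 have disj: "S \<inter> T = {}"
 proof (rule ccontr)
  assume "S \<inter> T \<noteq> {}"
  then obtain x where x: "x \<in> S" "x \<in> T" by blast
  have "cinner x x = 0" by (rule ST[OF x])
  then show False using orthonormal_norm[OF on(1) x(1)] by (simp add: cinner_self)
 qed
 have onST: "orthonormal (S \<union> T)"
  unfolding orthonormal_def
 proof (intro conjI ballI)
  show "finite (S \<union> T)" using fin by simp
  fix x y assume "x \<in> S \<union> T" "y \<in> S \<union> T"
  then show "cinner x y = (if x = y then 1 else 0)"
   using on ST TS disj unfolding orthonormal_def by (metis Un_iff disjoint_iff)
 qed
 define e where "e x = (if x \<in> S then ev x else ev' x)" for x
 have e: "\<bar>e x\<bar> > t \<and> K x = complex_of_real (e x) *\<^sub>C x" if "x \<in> S \<union> T" for x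
  using that ev[of x] ev'[of x] t by (cases "x \<in> S") (auto simp: e_def)
 have "robust (card (S \<union> T)) (\<lambda>x. norm (K x) > t * norm x)"
 proof (rule robust_orthonormal_span[OF onST])
  fix c assume ne: "(\<Sum>x\<in>S \<union> T. c x *\<^sub>C x) \<noteq> 0"
  have "K (\<Sum>x\<in>S \<union> T. c x *\<^sub>C x) = (\<Sum>x\<in>S \<union> T. (c x * of_real (e x)) *\<^sub>C x)"
   unfolding bounded_clinearD(6)[OF bK] bounded_clinearD(2)[OF bK]
   by (rule sum.cong) (use e in auto)
  then have 1: "(norm (K (\<Sum>x\<in>S \<union> T. c x *\<^sub>C x)))^2 = (\<Sum>x\<in>S \<union> T. (norm (c x * of_real (e x)))^2)"
   by (simp only: orthonormal_norm_sum[OF onST])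
  have "\<exists>x\<in>S \<union> T. c x \<noteq> 0"
  proof (rule ccontr)
   assume "\<not> (\<exists>x\<in>S \<union> T. c x \<noteq> 0)"
   then show False using ne by simp
  qed
  then obtain x where x: "x \<in> S \<union> T" "c x \<noteq> 0" by blast
  have le: "t^2 < (e x)^2" if "x \<in> S \<union> T" for x
   using e[OF that] t by (metis abs_of_pos abs_le_square_iff not_le)
  have "(\<Sum>x\<in>S \<union> T. t^2 * (norm (c x))^2) < (\<Sum>x\<in>S \<union> T. (norm (c x * of_real (e x)))^2)"
  proof (rule sum_strict_mono_ex1)
   show "\<forall>x\<in>S \<union> T. t^2 * (norm (c x))^2 \<le> (norm (c x * of_real (e x)))^2"
   proof
    fix x assume "x \<in> S \<union> T"
    from le[OF this] show "t^2 * (norm (c x))^2 \<le> (norm (c x * of_real (e x)))^2"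
     by (simp add: norm_mult power_mult_distrib mult.commute[of "(norm (c x))^2"] mult_right_mono less_imp_le)
   qed
   show "\<exists>x\<in>S \<union> T. t^2 * (norm (c x))^2 < (norm (c x * of_real (e x)))^2"
    using x le[OF x(1)] by (intro bexI[of _ x]) (auto simp: norm_mult power_mult_distrib mult.commute)
  qed (use fin in simp)
  also have "(\<Sum>x\<in>S \<union> T. t^2 * (norm (c x))^2) = (t * norm (\<Sum>x\<in>S \<union> T. c x *\<^sub>C x))^2"
   by (simp add: power_mult_distrib orthonormal_norm_sum[OF onST] sum_distrib_left)
  finally show "t * norm (\<Sum>x\<in>S \<union> T. c x *\<^sub>C x) < norm (K (\<Sum>x\<in>S \<union> T. c x *\<^sub>C x))"
   unfolding 1[symmetric] by (rule power2_less_imp_less) simp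
 qed
 then have "card (S \<union> T) \<le> n_sing t K" by (rule robust_le_n_sing[OF K(1) t])
 moreover have "n_plus t K = card S" by (rule P.n_plus_eq_card[OF t S])
 moreover have "n_minus t K = card T" unfolding n_minus_def by (rule Q.n_plus_eq_card[OF t T])
 ultimately show ?thesis using card_Un_disjoint[OF fin disj] by simp
qed

section \<open>Infinite matrices\<close>

lemma entry_eq_coord: "entry A j k = coord (A (std_basis j)) k"
 by (simp add: entry_def)

lemma entry_inject:
 assumes A: "bounded_clinear A" and B: "bounded_clinear B" and e: "entry A = entry B"
 shows "A = B"
proof
 fix x
 have "A (std_basis j) = B (std_basis j)" for j
  by (rule ell2_eqI) (use e in \<open>simp add: entry_eq_coord[symmetric]\<close>)
 then have eq: "A (\<Sum>k<n. coord x k *\<^sub>C std_basis k) = B (\<Sum>k<n. coord x k *\<^sub>C std_basis k)" for n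
  by (simp add: bounded_clinearD[OF A] bounded_clinearD[OF B])
 show "A x = B x"
 proof (rule LIMSEQ_unique)
  show "(\<lambda>n. A (\<Sum>k<n. coord x k *\<^sub>C std_basis k)) \<longlonglongrightarrow> A x"
   by (rule bounded_linear.tendsto[OF bounded_clinearD(1)[OF A] std_basis_expansion])
  show "(\<lambda>n. A (\<Sum>k<n. coord x k *\<^sub>C std_basis k)) \<longlonglongrightarrow> B x"
   unfolding eq by (rule bounded_linear.tendsto[OF bounded_clinearD(1)[OF B] std_basis_expansion])
 qed
qed

lemma matrix_operator_eqI:
 assumes A: "bounded_clinear A" and e: "\<And>j k. entry A j k = a j k"
 shows "matrix_operator a = A"
 unfolding matrix_operator_def
proof (rule the_equality)
 show eA: "bounded_clinear A \<and> entry A = a" using A e by (simp add: fun_eq_iff)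
 show "B = A" if B: "bounded_clinear B \<and> entry B = a" for B
  by (rule entry_inject) (use eA B in simp_all)
qed

lemma bounded_matrixD:
 assumes "bounded_matrix a"
 shows "bounded_clinear (matrix_operator a)" "entry (matrix_operator a) = a"
proof -
 obtain A where A: "bounded_clinear A" "entry A = a" using assms by (auto simp: bounded_matrix_def)
 have "matrix_operator a = A" by (rule matrix_operator_eqI) (simp_all add: A)
 then show "bounded_clinear (matrix_operator a)" "entry (matrix_operator a) = a" using A by simp_all
qed

lemma matrix_operator_add:
 assumes "bounded_matrix a" "bounded_matrix b"
 shows "bounded_matrix (\<lambda>j k. a j k + b j k)"
  "matrix_operator (\<lambda>j k. a j k + b j k) = (\<lambda>x. matrix_operator a x + matrix_operator b x)"
proof -
 have bc: "bounded_clinear (\<lambda>x. matrix_operator a x + matrix_operator b x)"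
  by (intro bounded_clinear_add bounded_matrixD assms)
 have en: "entry (\<lambda>x. matrix_operator a x + matrix_operator b x) j k = a j k + b j k" for j k
  using fun_cong[OF fun_cong[OF bounded_matrixD(2)[OF assms(1)]], of j k]
   fun_cong[OF fun_cong[OF bounded_matrixD(2)[OF assms(2)]], of j k]
  by (simp add: entry_eq_coord)
 show "matrix_operator (\<lambda>j k. a j k + b j k) = (\<lambda>x. matrix_operator a x + matrix_operator b x)"
  by (rule matrix_operator_eqI[OF bc en])
 show "bounded_matrix (\<lambda>j k. a j k + b j k)"
  unfolding bounded_matrix_def using bc en by blast
qed

lemma matrix_operator_scale:
 assumes "bounded_matrix a"
 shows "bounded_matrix (\<lambda>j k. c * a j k)" "matrix_operator (\<lambda>j k. c * a j k) = (\<lambda>x. c *\<^sub>C matrix_operator a x)"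
proof -
 note A = bounded_matrixD(1)[OF assms]
 have bc: "bounded_clinear (\<lambda>x. c *\<^sub>C matrix_operator a x)"
  unfolding bounded_clinear_def
 proof (intro conjI allI)
  show "bounded_linear (\<lambda>x. c *\<^sub>C matrix_operator a x)"
  proof (rule bounded_linear_intro[where K="onorm (matrix_operator a) * norm c"])
   show "norm (c *\<^sub>C matrix_operator a x) \<le> norm x * (onorm (matrix_operator a) * norm c)" for x
    using mult_left_mono[OF bounded_clinearD(7)[OF A, of x], of "norm c"] by (simp add: mult_ac)
  qed (auto simp: bounded_clinearD[OF A] cell2.scale_right_distrib scaleR_ell2_def mult.commute)
  show "c *\<^sub>C matrix_operator a (d *\<^sub>C x) = d *\<^sub>C c *\<^sub>C matrix_operator a x" for d x
   by (simp add: bounded_clinearD[OF A] mult.commute)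
 qed
 have en: "entry (\<lambda>x. c *\<^sub>C matrix_operator a x) j k = c * a j k" for j k
  using fun_cong[OF fun_cong[OF bounded_matrixD(2)[OF assms]], of j k] by (simp add: entry_eq_coord)
 show "matrix_operator (\<lambda>j k. c * a j k) = (\<lambda>x. c *\<^sub>C matrix_operator a x)"
  by (rule matrix_operator_eqI[OF bc en])
 show "bounded_matrix (\<lambda>j k. c * a j k)"
  unfolding bounded_matrix_def using bc en by blast
qed

lemma self_adjoint_matrix_operator:
 assumes a: "bounded_matrix a" and h: "\<And>j k. a j k = cnj (a k j)"
 shows "self_adjoint (matrix_operator a)"
proof -
 define A where "A = matrix_operator a"
 have A: "bounded_clinear A" "entry A = a" unfolding A_def by (rule bounded_matrixD[OF a])+
 have "entry (cadjoint A) j k = entry A j k" for j k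
 proof -
  have "entry (cadjoint A) j k = cnj (cinner (std_basis k) (cadjoint A (std_basis j)))"
   unfolding entry_def by (rule cinner_commute)
  also have "\<dots> = cnj (entry A k j)" unfolding entry_def cadjoint(2)[OF A(1), symmetric] ..
  also have "\<dots> = entry A j k" unfolding A(2) using h[of j k] by simp
  finally show ?thesis .
 qed
 then have "cadjoint A = A" by (intro entry_inject cadjoint(1) A) auto
 then show ?thesis using cadjoint(2)[OF A(1)] by (simp add: self_adjoint_def A_def)
qed

text \<open>Boundedness is tested on finite sections, so that it can be stated before any operator
  exists. The sum runs over the first index because \<open>entry A j k\<close> is the
  \<open>k\<close>-th coordinate of the image of the \<open>j\<close>-th basis vector.\<close>

definition section_bound :: "(nat \<Rightarrow> nat \<Rightarrow> complex) \<Rightarrow> real \<Rightarrow> bool" where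
 "section_bound a M \<longleftrightarrow> M \<ge> 0 \<and> (\<forall>n x. (\<Sum>k<n. (norm (\<Sum>j<n. a j k * x j))^2) \<le> M^2 * (\<Sum>j<n. (norm (x j))^2))"

lemma section_bound_operator:
 assumes a: "section_bound a M"
 shows "\<exists>A. bounded_clinear A \<and> entry A = a \<and> (\<forall>x. norm (A x) \<le> M * norm x)"
proof -
 have M: "M \<ge> 0" and sb: "\<And>n x. (\<Sum>k<n. (norm (\<Sum>j<n. a j k * x j))^2) \<le> M^2 * (\<Sum>j<n. (norm (x j))^2)"
  using a by (auto simp: section_bound_def)
 have col: "(\<Sum>j<n. (norm (cnj (a j k)))^2) \<le> M^2" for k n
 proof -
  \<comment> \<open>The section has to contain the index \<open>k\<close>. Tested on the vector
    \<open>cnj (a j k)\<close>, its output has \<open>k\<close>-th coordinate \<open>S\<close>, and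
    \<open>S^2 \<le> M^2 * S\<close> bounds the sum.\<close>
  define p where "p = max n (Suc k)"
  define S where "S = (\<Sum>j<p. (norm (a j k))^2)"
  have S0: "S \<ge> 0" by (simp add: S_def sum_nonneg)
  have "(\<Sum>j<p. a j k * cnj (a j k)) = complex_of_real S"
   by (simp add: S_def complex_norm_square del: of_real_power)
  then have "S^2 = (norm (\<Sum>j<p. a j k * cnj (a j k)))^2" using S0 by simp
  also have "\<dots> \<le> (\<Sum>l<p. (norm (\<Sum>j<p. a j l * cnj (a j k)))^2)"
   by (rule member_le_sum[where f="\<lambda>l. (norm (\<Sum>j<p. a j l * cnj (a j k)))^2"]) (auto simp: p_def)
  also have "\<dots> \<le> M^2 * S" using sb[where x="\<lambda>j. cnj (a j k)" and n=p] by (simp add: S_def)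
  finally have "S \<le> M^2" using S0 by (cases "S = 0") (auto simp: power2_eq_square)
  moreover have "(\<Sum>j<n. (norm (a j k))^2) \<le> S"
   unfolding S_def by (rule sum_mono2) (auto simp: p_def)
  ultimately show ?thesis by simp
 qed
 define row where "row k = Abs_ell2 (\<lambda>j. cnj (a j k))" for k
 have crow: "coord (row k) j = cnj (a j k)" for k j
  unfolding row_def by (subst coord_Abs[OF bounded_partial_summable(1)[OF col]]) simp
 have bd: "(\<Sum>k<n. (norm (cinner x (row k)))^2) \<le> (M * norm x)^2" for n x
 proof (rule tendsto_upperbound[where F=sequentially])
  show "(\<lambda>m. \<Sum>k<n. (norm (\<Sum>j<m. coord x j * cnj (coord (row k) j)))^2) \<longlonglongrightarrow> (\<Sum>k<n. (norm (cinner x (row k)))^2)"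
   unfolding cinner_def by (intro tendsto_intros summable_LIMSEQ summable_cinner)
  show "\<forall>\<^sub>F m in sequentially. (\<Sum>k<n. (norm (\<Sum>j<m. coord x j * cnj (coord (row k) j)))^2) \<le> (M * norm x)^2"
   unfolding eventually_sequentially
  proof (intro exI allI impI)
   fix m assume "n \<le> m"
   then have "(\<Sum>k<n. (norm (\<Sum>j<m. coord x j * cnj (coord (row k) j)))^2)
     \<le> (\<Sum>k<m. (norm (\<Sum>j<m. coord x j * cnj (coord (row k) j)))^2)"
    by (intro sum_mono2) auto
   also have "\<dots> \<le> M^2 * (\<Sum>j<m. (norm (coord x j))^2)"
    using sb[where x="coord x" and n=m] by (simp add: crow mult.commute)
   also have "\<dots> \<le> M^2 * (norm x)^2" by (intro mult_left_mono sum_coord_le) auto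
   finally show "(\<Sum>k<n. (norm (\<Sum>j<m. coord x j * cnj (coord (row k) j)))^2) \<le> (M * norm x)^2"
    by (simp add: power_mult_distrib)
  qed
 qed simp
 define A where "A x = Abs_ell2 (\<lambda>k. cinner x (row k))" for x
 have cA: "coord (A x) k = cinner x (row k)" for x k
  unfolding A_def by (subst coord_Abs[OF bounded_partial_summable(1)[OF bd]]) simp
 have nA: "norm (A x) \<le> M * norm x" for x
 proof -
  have "(norm (A x))^2 \<le> (M * norm x)^2" by (rule norm_ell2_le) (simp add: cA bd)
  then show ?thesis using M by (simp add: power2_le_iff_abs_le)
 qed
 have "bounded_linear A"
  by (rule bounded_linear_intro[where K=M])
   (auto intro!: ell2_eqI simp: cA cinner_add_left nA mult.commute[of "norm _" M])
 moreover have "A (c *\<^sub>C x) = c *\<^sub>C A x" for c x by (rule ell2_eqI) (simp add: cA)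
 moreover have "entry A = a" by (simp add: fun_eq_iff entry_eq_coord cA crow)
 ultimately show ?thesis using nA by (auto simp: bounded_clinear_def)
qed

lemma section_boundD:
 assumes "section_bound a M"
 shows "bounded_matrix a" "norm (matrix_operator a x) \<le> M * norm x"
proof -
 obtain A where A: "bounded_clinear A" "entry A = a" "\<And>x. norm (A x) \<le> M * norm x"
  using section_bound_operator[OF assms] by blast
 have "matrix_operator a = A" by (rule matrix_operator_eqI) (simp_all add: A)
 then show "norm (matrix_operator a x) \<le> M * norm x" using A by simp
 show "bounded_matrix a" using A unfolding bounded_matrix_def by blast
qed

section \<open>Hilbert--Schmidt operators\<close>

definition hs_bound :: "(nat \<Rightarrow> nat \<Rightarrow> complex) \<Rightarrow> real \<Rightarrow> bool" where
 "hs_bound a S \<longleftrightarrow> (\<forall>n. (\<Sum>k<n. \<Sum>j<n. (norm (a j k))^2) \<le> S)"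

lemma hs_bound_nonneg: "hs_bound a S \<Longrightarrow> S \<ge> 0"
 unfolding hs_bound_def by (drule spec[of _ 0]) simp

lemma hs_section_bound:
 assumes "hs_bound a S"
 shows "section_bound a (sqrt S)"
 unfolding section_bound_def
proof (intro conjI allI)
 show "0 \<le> sqrt S" using hs_bound_nonneg[OF assms] by simp
 fix n x
 have "(\<Sum>k<n. (norm (\<Sum>j<n. a j k * x j))^2) \<le> (\<Sum>k<n. (\<Sum>j<n. (norm (a j k))^2) * (\<Sum>j<n. (norm (x j))^2))"
 proof (rule sum_mono)
  fix k
  have "norm (\<Sum>j<n. a j k * x j) \<le> (\<Sum>j<n. norm (a j k) * norm (x j))"
   by (rule order_trans[OF norm_sum]) (simp add: norm_mult)
  then have "(norm (\<Sum>j<n. a j k * x j))^2 \<le> (\<Sum>j<n. norm (a j k) * norm (x j))^2"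
   by (intro power_mono) auto
  also have "\<dots> \<le> (\<Sum>j<n. (norm (a j k))^2) * (\<Sum>j<n. (norm (x j))^2)"
   by (rule Cauchy_Schwarz_ineq_sum)
  finally show "(norm (\<Sum>j<n. a j k * x j))^2 \<le> (\<Sum>j<n. (norm (a j k))^2) * (\<Sum>j<n. (norm (x j))^2)" .
 qed
 also have "\<dots> = (\<Sum>k<n. \<Sum>j<n. (norm (a j k))^2) * (\<Sum>j<n. (norm (x j))^2)"
  by (simp add: sum_distrib_right)
 also have "\<dots> \<le> S * (\<Sum>j<n. (norm (x j))^2)"
  using assms by (intro mult_right_mono) (auto simp: hs_bound_def sum_nonneg)
 finally show "(\<Sum>k<n. (norm (\<Sum>j<n. a j k * x j))^2) \<le> (sqrt S)^2 * (\<Sum>j<n. (norm (x j))^2)"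
  using hs_bound_nonneg[OF assms] by simp
qed

lemmas hs_bounded_matrix = section_boundD(1)[OF hs_section_bound]

text \<open>Interchanging the sums over \<open>X\<close> and over coordinates leaves Bessel's
  inequality for the images of the standard basis under the adjoint, whose squared norms add up to
  at most \<open>S\<close>.\<close>

lemma hs_orthonormal_sum:
 assumes a: "hs_bound a S" and X: "orthonormal X"
 shows "(\<Sum>x\<in>X. (norm (matrix_operator a x))^2) \<le> S"
proof -
 define A where "A = matrix_operator a"
 have A: "bounded_clinear A" "entry A = a"
  unfolding A_def by (rule bounded_matrixD[OF hs_bounded_matrix[OF a]])+
 define B where "B k = cadjoint A (std_basis k)" for k
 have cB: "norm (coord (B k) j) = norm (a j k)" for j k
 proof -
  have "cnj (coord (B k) j) = cinner (A (std_basis j)) (std_basis k)"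
   unfolding B_def cadjoint(2)[OF A(1)] by simp
  then have "cnj (coord (B k) j) = a j k" using A(2) by (simp add: entry_def fun_eq_iff)
  then show ?thesis by (metis complex_mod_cnj)
 qed
 have B: "(\<Sum>k<n. (norm (B k))^2) \<le> S" for n
 proof (rule tendsto_upperbound[where F=sequentially])
  show "(\<lambda>m. \<Sum>k<n. \<Sum>j<m. (norm (coord (B k) j))^2) \<longlonglongrightarrow> (\<Sum>k<n. (norm (B k))^2)"
   unfolding norm_ell2_sq by (intro tendsto_intros summable_LIMSEQ summable_coord)
  show "\<forall>\<^sub>F m in sequentially. (\<Sum>k<n. \<Sum>j<m. (norm (coord (B k) j))^2) \<le> S"
   unfolding eventually_sequentially
  proof (intro exI allI impI)
   fix m assume "n \<le> m"
   then have "(\<Sum>k<n. \<Sum>j<m. (norm (a j k))^2) \<le> (\<Sum>k<m. \<Sum>j<m. (norm (a j k))^2)"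
    by (intro sum_mono2) (auto intro: sum_nonneg)
   also have "\<dots> \<le> S" using a by (simp add: hs_bound_def)
   finally show "(\<Sum>k<n. \<Sum>j<m. (norm (coord (B k) j))^2) \<le> S" by (simp add: cB)
  qed
 qed simp
 have "(\<Sum>x\<in>X. (norm (A x))^2) \<le> S"
 proof (rule tendsto_upperbound[where F=sequentially])
  show "(\<lambda>n. \<Sum>x\<in>X. \<Sum>k<n. (norm (coord (A x) k))^2) \<longlonglongrightarrow> (\<Sum>x\<in>X. (norm (A x))^2)"
   unfolding norm_ell2_sq by (intro tendsto_intros summable_LIMSEQ summable_coord)
  have "(\<Sum>x\<in>X. \<Sum>k<n. (norm (coord (A x) k))^2) \<le> S" for n
  proof -
   have 1: "norm (coord (A x) k) = norm (cinner (B k) x)" for x k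
    using cadjoint(2)[OF A(1), of x "std_basis k"] cinner_commute[of x "B k"]
    by (simp add: B_def)
   have "(\<Sum>x\<in>X. \<Sum>k<n. (norm (coord (A x) k))^2) = (\<Sum>k<n. \<Sum>x\<in>X. (norm (cinner (B k) x))^2)"
    unfolding 1 by (rule sum.swap)
   also have "\<dots> \<le> (\<Sum>k<n. (norm (B k))^2)" by (intro sum_mono bessel_inequality X)
   also have "\<dots> \<le> S" by (rule B)
   finally show ?thesis .
  qed
  then show "\<forall>\<^sub>F n in sequentially. (\<Sum>x\<in>X. \<Sum>k<n. (norm (coord (A x) k))^2) \<le> S" by simp
 qed simp
 then show ?thesis by (simp add: A_def)
qed

text \<open>Take a largest orthonormal set of vectors stretched by more than \<open>d\<close>. Each
  of them uses more than \<open>d^2\<close> of the budget \<open>S\<close>, and a further such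
  vector orthogonal to the set would enlarge it. Thus an error that is not small costs only finitely
  many linear constraints.\<close>

lemma hs_small_off_few_vectors:
 assumes a: "hs_bound a S" and d: "d > 0"
 obtains X where "orthonormal X" "real (card X) \<le> S / d^2"
  "\<And>x. (\<And>y. y \<in> X \<Longrightarrow> cinner x y = 0) \<Longrightarrow> norm (matrix_operator a x) \<le> d * norm x"
proof -
 define A where "A = matrix_operator a"
 have A: "bounded_clinear A" unfolding A_def by (rule bounded_matrixD[OF hs_bounded_matrix[OF a]])
 define G where "G X \<longleftrightarrow> orthonormal X \<and> (\<forall>x\<in>X. norm (A x) > d)" for X
 have cardG: "real (card X) \<le> S / d^2" if "G X" for X
 proof -
  have "real (card X) * d^2 = (\<Sum>x\<in>X. d^2)" by simp
  also have "\<dots> \<le> (\<Sum>x\<in>X. (norm (A x))^2)"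
   using that d by (intro sum_mono power_mono) (auto simp: G_def intro: less_imp_le)
  also have "\<dots> \<le> S" using hs_orthonormal_sum[OF a] that by (simp add: G_def A_def)
  finally show ?thesis using d by (simp add: field_simps)
 qed
 have G_card: "\<forall>X. G X \<longrightarrow> card X < Suc (nat \<lfloor>S / d^2\<rfloor>)"
  using cardG by (simp add: le_nat_floor less_Suc_eq_le)
 have G_empty: "G {}" by (simp add: G_def)
 have "\<exists>X. G X \<and> (\<forall>Y. G Y \<longrightarrow> card Y \<le> card X)"
  by (rule ex_has_greatest_nat[OF G_empty G_card])
 then obtain X where X: "G X" "\<And>Y. G Y \<Longrightarrow> card Y \<le> card X" by blast
 have on: "orthonormal X" using X(1) by (simp add: G_def)
 show ?thesis
 proof (rule that[OF on cardG[OF X(1)]], rule ccontr)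
  fix x assume x: "\<And>y. y \<in> X \<Longrightarrow> cinner x y = 0" "\<not> norm (matrix_operator a x) \<le> d * norm x"
  have "x \<noteq> 0" using x(2) bounded_clinearD(4)[OF A] by (auto simp: A_def)
  define u where "u = (1 / norm x) *\<^sub>R x"
  have u: "norm u = 1" "\<And>y. y \<in> X \<Longrightarrow> cinner u y = 0" using \<open>x \<noteq> 0\<close> x(1) by (auto simp: u_def)
  have "norm (A u) > d"
   unfolding u_def bounded_clinearD(8)[OF A] using x(2) \<open>x \<noteq> 0\<close> by (simp add: A_def field_simps)
  then have "G (insert u X)" using X(1) orthonormal_insert(1)[OF on u] by (auto simp: G_def)
  from X(2)[OF this] show False
   using orthonormal_insert(2)[OF on u] on by (auto simp: orthonormal_def)
 qed
qed

section \<open>Compactness\<close>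

lemma compact_operatorI:
 assumes A: "bounded_clinear A"
  and tb: "\<And>e. e > 0 \<Longrightarrow> \<exists>F. finite F \<and> A ` cball 0 1 \<subseteq> (\<Union>y\<in>F. ball y e)"
 shows "compact_operator A"
 unfolding compact_operator_def compact_eq_totally_bounded
proof (intro conjI allI impI A)
 show "complete (closure (A ` cball 0 1))" by (simp add: complete_eq_closed)
 fix e :: real assume e: "e > 0"
 then have "e/2 > 0" by simp
 from tb[OF this] obtain F where F: "finite F" "A ` cball 0 1 \<subseteq> (\<Union>y\<in>F. ball y (e/2))"
  by blast
 have "closure (A ` cball 0 1) \<subseteq> (\<Union>y\<in>F. cball y (e/2))"
 proof (rule closure_minimal)
  show "A ` cball 0 1 \<subseteq> (\<Union>y\<in>F. cball y (e/2))" by (rule order_trans[OF F(2)]) (intro UN_mono order_refl ball_subset_cball)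
  show "closed (\<Union>y\<in>F. cball y (e/2))" using F(1) by (intro closed_UN) auto
 qed
 also have "\<dots> \<subseteq> (\<Union>y\<in>F. ball y e)"
  using e by (intro UN_mono order_refl subsetI) simp
 finally show "\<exists>k. finite k \<and> closure (A ` cball 0 1) \<subseteq> (\<Union>x\<in>k. ball x e)" using F(1) by blast
qed

lemma compact_operator_approx:
 assumes A: "bounded_clinear A"
  and appr: "\<And>e. e > 0 \<Longrightarrow> \<exists>B. compact_operator B \<and> (\<forall>x. norm (A x - B x) \<le> e * norm x)"
 shows "compact_operator A"
proof (rule compact_operatorI[OF A])
 fix e :: real assume e: "e > 0"
 then have "e/2 > 0" by simp
 from appr[OF this] obtain B where B: "compact_operator B" "\<And>x. norm (A x - B x) \<le> (e/2) * norm x"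
  by blast
 have "e/2 > 0" using e by simp
 from compact_operatorD(2)[OF B(1) this]
 obtain F where F: "finite F" "B ` cball 0 1 \<subseteq> (\<Union>y\<in>F. ball y (e/2))" by blast
 have "A ` cball 0 1 \<subseteq> (\<Union>y\<in>F. ball y e)"
 proof
  fix z assume "z \<in> A ` cball 0 1"
  then obtain x where x: "z = A x" "norm x \<le> 1" by auto
  then have "B x \<in> (\<Union>y\<in>F. ball y (e/2))" using F(2) by (auto simp: image_subset_iff)
  then obtain y where y: "y \<in> F" "dist y (B x) < e/2" by auto
  have "dist (B x) (A x) \<le> e/2"
   using order_trans[OF B(2)[of x] mult_left_mono[OF x(2), of "e/2"]] e by (simp add: dist_norm norm_minus_commute)
  then have "dist y (A x) < e" using y(2) dist_triangle[of y "A x" "B x"] by linarith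
  then show "z \<in> (\<Union>y\<in>F. ball y e)" using y(1) x(1) by auto
 qed
 then show "\<exists>F. finite F \<and> A ` cball 0 1 \<subseteq> (\<Union>y\<in>F. ball y e)" using F(1) by blast
qed

lemma compact_operator_add:
 assumes A: "compact_operator A" and B: "compact_operator B"
 shows "compact_operator (\<lambda>x. A x + B x)"
proof -
 have cpt: "compact {x + y | x y. x \<in> closure (A ` cball 0 1) \<and> y \<in> closure (B ` cball 0 1)}"
  using A B by (intro compact_sums) (auto simp: compact_operator_def)
 have "(\<lambda>x. A x + B x) ` cball 0 1 \<subseteq> {x + y | x y. x \<in> closure (A ` cball 0 1) \<and> y \<in> closure (B ` cball 0 1)}"
  using closure_subset[of "A ` cball 0 1"] closure_subset[of "B ` cball 0 1"] by blast
 then have "closure ((\<lambda>x. A x + B x) ` cball 0 1) \<subseteq> {x + y | x y. x \<in> closure (A ` cball 0 1) \<and> y \<in> closure (B ` cball 0 1)}"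
  by (rule closure_minimal) (rule compact_imp_closed[OF cpt])
 then have "compact (closure ((\<lambda>x. A x + B x) ` cball 0 1))"
  using cpt by (metis (no_types, lifting) closed_closure compact_Int_closed inf.absorb_iff2)
 then show ?thesis
  using A B by (simp add: compact_operator_def bounded_clinear_add)
qed

lemma compact_operator_rank_one: "compact_operator (\<lambda>x. cinner x s *\<^sub>C v)"
proof -
 have cont: "continuous_on UNIV (\<lambda>c. c *\<^sub>C v)"
  by (intro linear_continuous_on bounded_linear_intro[where K="norm v"])
   (auto simp: cell2.scale_left_distrib scaleR_ell2_def scaleR_conv_of_real)
 have cpt: "compact ((\<lambda>c. c *\<^sub>C v) ` cball 0 (norm s))"
  by (intro compact_continuous_image continuous_on_subset[OF cont]) auto
 have "(\<lambda>x. cinner x s *\<^sub>C v) ` cball 0 1 \<subseteq> (\<lambda>c. c *\<^sub>C v) ` cball 0 (norm s)"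
 proof (rule image_subsetI, rule imageI)
  fix x :: ell2 assume "x \<in> cball 0 1"
  then have "norm x \<le> 1" by simp
  then have "norm (cinner x s) \<le> norm s"
   using cinner_Cauchy_Schwarz[of x s] mult_right_mono[of "norm x" 1 "norm s"] by simp
  then show "cinner x s \<in> cball 0 (norm s)" by simp
 qed
 then have "closure ((\<lambda>x. cinner x s *\<^sub>C v) ` cball 0 1) \<subseteq> (\<lambda>c. c *\<^sub>C v) ` cball 0 (norm s)"
  by (rule closure_minimal) (rule compact_imp_closed[OF cpt])
 then have "compact (closure ((\<lambda>x. cinner x s *\<^sub>C v) ` cball 0 1))"
  using cpt by (metis (no_types, lifting) closed_closure compact_Int_closed inf.absorb_iff2)
 moreover have "bounded_clinear (\<lambda>x. cinner x s *\<^sub>C v)"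
  unfolding bounded_clinear_def
 proof (intro conjI allI)
  show "bounded_linear (\<lambda>x. cinner x s *\<^sub>C v)"
  proof (rule bounded_linear_intro[where K="norm s * norm v"])
   show "norm (cinner x s *\<^sub>C v) \<le> norm x * (norm s * norm v)" for x
    using mult_right_mono[OF cinner_Cauchy_Schwarz[of x s], of "norm v"] by (simp add: mult_ac)
  qed (auto simp: cinner_add_left cell2.scale_left_distrib scaleR_ell2_def)
 qed simp
 ultimately show ?thesis by (simp add: compact_operator_def)
qed

lemma compact_operator_zero: "compact_operator (\<lambda>x. 0)"
 using compact_operator_rank_one[of 0 0] by simp

lemma compact_operator_finite_rank:
 "finite X \<Longrightarrow> compact_operator (\<lambda>x. \<Sum>s\<in>X. cinner x s *\<^sub>C f s)"
 by (induction X rule: finite_induct)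
  (auto intro: compact_operator_add compact_operator_rank_one simp: compact_operator_zero)

text \<open>Removing the finite rank part carried by the few exceptional vectors leaves an operator
  of norm at most \<open>e\<close>.\<close>

lemma hs_compact:
 assumes a: "hs_bound a S"
 shows "compact_operator (matrix_operator a)"
proof (rule compact_operator_approx)
 define A where "A = matrix_operator a"
 show bcA: "bounded_clinear (matrix_operator a)" by (rule bounded_matrixD[OF hs_bounded_matrix[OF a]])
 fix e :: real assume "e > 0"
 then obtain X where X: "orthonormal X" "real (card X) \<le> S / e^2"
  "\<And>x. (\<And>y. y \<in> X \<Longrightarrow> cinner x y = 0) \<Longrightarrow> norm (matrix_operator a x) \<le> e * norm x"
  using hs_small_off_few_vectors[OF a] by metis
 define B where "B x = (\<Sum>s\<in>X. cinner x s *\<^sub>C A s)" for x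
 have "compact_operator B"
  unfolding B_def by (rule compact_operator_finite_rank) (use X(1) in \<open>simp add: orthonormal_def\<close>)
 moreover have "norm (matrix_operator a x - B x) \<le> e * norm x" for x
 proof -
  define p where "p = (\<Sum>s\<in>X. cinner x s *\<^sub>C s)"
  have orth: "cinner (x - p) y = 0" if "y \<in> X" for y
   unfolding p_def by (rule orthonormal_residual[OF X(1) that])
  have "matrix_operator a x - B x = matrix_operator a (x - p)"
   by (simp add: bounded_clinearD[OF bcA] B_def p_def A_def)
  then have 1: "norm (matrix_operator a x - B x) \<le> e * norm (x - p)" using X(3)[of "x - p"] orth by simp
  have "cinner (x - p) p = 0"
   by (subst (2) p_def, subst cinner_sum_right) (simp add: orth)
  then have "cinner (x - p) (x - p) = cinner (x - p) x" by (simp add: cinner_diff_right)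
  then have "complex_of_real ((norm (x - p))^2) = cinner (x - p) x" by (simp add: cinner_self)
  then have "(norm (x - p))^2 = norm (cinner (x - p) x)"
   by (metis abs_of_nonneg norm_of_real zero_le_power2)
  also have "\<dots> \<le> norm (x - p) * norm x" by (rule cinner_Cauchy_Schwarz)
  finally have "norm (x - p) \<le> norm x"
   by (cases "x - p = 0") (auto simp: power2_eq_square)
  then show ?thesis using 1 \<open>e > 0\<close> by (meson mult_left_mono order_trans less_imp_le)
 qed
 ultimately show "\<exists>B. compact_operator B \<and> (\<forall>x. norm (matrix_operator a x - B x) \<le> e * norm x)" by blast
qed

section \<open>Perturbation of counting functions\<close>

text \<open>The vectors of \<open>X\<close> are simply added to the constraints. When
  \<open>card X\<close> reaches \<open>n\<close>, the truncated difference is 0 and nothing is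
  claimed.\<close>

lemma robust_weaken:
 assumes Q: "robust n Q" and X: "finite X"
  and imp: "\<And>x. x \<noteq> 0 \<Longrightarrow> (\<And>y. y \<in> X \<Longrightarrow> cinner x y = 0) \<Longrightarrow> Q x \<Longrightarrow> Q' x"
 shows "robust (n - card X) Q'"
 unfolding robust_def
proof (intro allI impI)
 fix Y :: "ell2 set" assume Y: "finite Y \<and> card Y < n - card X"
 then have "finite (X \<union> Y)" "card (X \<union> Y) < n"
  using X card_Un_le[of X Y] by auto
 then obtain x where x: "x \<noteq> 0" "\<forall>y\<in>X \<union> Y. cinner x y = 0" "Q x"
  using Q unfolding robust_def by blast
 then have "Q' x" by (intro imp) auto
 then show "\<exists>x. x \<noteq> 0 \<and> (\<forall>y\<in>Y. cinner x y = 0) \<and> Q' x" using x by blast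
qed

lemma n_sing_perturb:
 assumes K: "compact_operator K" and H: "compact_operator H"
  and KH: "\<And>x. norm (H x - K x) \<le> norm (matrix_operator a x) + \<rho> * norm x"
  and a: "hs_bound a S" and d: "d > 0" and t: "t > 0" and \<rho>: "\<rho> \<ge> 0"
 shows "real (n_sing (t + d + \<rho>) H) \<le> real (n_sing t K) + S / d^2"
proof -
 obtain X where X: "orthonormal X" "real (card X) \<le> S / d^2"
  "\<And>x. (\<And>y. y \<in> X \<Longrightarrow> cinner x y = 0) \<Longrightarrow> norm (matrix_operator a x) \<le> d * norm x"
  using hs_small_off_few_vectors[OF a d] by metis
 have "robust (n_sing (t + d + \<rho>) H - card X) (\<lambda>x. norm (K x) > t * norm x)"
 proof (rule robust_weaken[OF n_sing_robust[OF H]])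
  show "0 < t + d + \<rho>" using t d \<rho> by simp
  show "finite X" using X(1) by (simp add: orthonormal_def)
  fix x assume "x \<noteq> 0" and x: "\<And>y. y \<in> X \<Longrightarrow> cinner x y = 0" and "(t + d + \<rho>) * norm x < norm (H x)"
  moreover have "norm (H x) \<le> norm (K x) + norm (H x - K x)" by (metis norm_triangle_sub add.commute)
  ultimately show "t * norm x < norm (K x)"
   using KH[of x] X(3)[OF x] by (simp add: algebra_simps)
 qed
 from robust_le_n_sing[OF K t this] X(2) show ?thesis by linarith
qed

lemma n_plus_perturb:
 assumes K: "compact_self_adjoint K" and H: "compact_self_adjoint H"
  and KH: "\<And>x. norm (H x - K x) \<le> norm (matrix_operator a x) + \<rho> * norm x"
  and a: "hs_bound a S" and d: "d > 0" and t: "t > 0" and \<rho>: "\<rho> \<ge> 0"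
 shows "real (n_plus (t + d + \<rho>) H) \<le> real (n_plus t K) + S / d^2"
proof -
 interpret K: compact_self_adjoint K by fact
 interpret H: compact_self_adjoint H by fact
 obtain X where X: "orthonormal X" "real (card X) \<le> S / d^2"
  "\<And>x. (\<And>y. y \<in> X \<Longrightarrow> cinner x y = 0) \<Longrightarrow> norm (matrix_operator a x) \<le> d * norm x"
  using hs_small_off_few_vectors[OF a d] by metis
 have "robust (n_plus (t + d + \<rho>) H - card X) (\<lambda>x. Re (cinner (K x) x) > t * (norm x)^2)"
 proof (rule robust_weaken[OF H.n_plus_robust])
  show "0 < t + d + \<rho>" using t d \<rho> by simp
  show "finite X" using X(1) by (simp add: orthonormal_def)
  fix x assume "x \<noteq> 0" and x: "\<And>y. y \<in> X \<Longrightarrow> cinner x y = 0"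
   and 1: "(t + d + \<rho>) * (norm x)^2 < Re (cinner (H x) x)"
  have "Re (cinner (H x) x) - Re (cinner (K x) x) = Re (cinner (H x - K x) x)"
   by (simp add: cinner_diff_left)
  also have "\<dots> \<le> norm (H x - K x) * norm x"
   by (rule order_trans[OF complex_Re_le_cmod cinner_Cauchy_Schwarz])
  also have "\<dots> \<le> ((d + \<rho>) * norm x) * norm x"
   using KH[of x] X(3)[OF x] by (intro mult_right_mono) (auto simp: algebra_simps)
  finally show "t * (norm x)^2 < Re (cinner (K x) x)"
   using 1 by (simp add: power2_eq_square algebra_simps)
 qed
 from K.robust_le_n_plus[OF t this] X(2) show ?thesis by linarith
qed

section \<open>Approximate singular vectors\<close>

lemma finite_support_expansion:
 assumes "\<And>k. k \<ge> m \<Longrightarrow> coord c k = 0"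
 shows "c = (\<Sum>j<m. coord c j *\<^sub>C std_basis j)"
proof (rule ell2_eqI)
 fix n
 have "(\<Sum>j<m. coord c j * (if n = j then 1 else 0)) = (if n < m then coord c n else 0)"
  by (simp add: if_distrib cong: if_cong)
 then show "coord c n = coord (\<Sum>j<m. coord c j *\<^sub>C std_basis j) n"
  using assms[of n] by auto
qed

lemma norm_finite_support:
 assumes "\<And>k. k \<ge> m \<Longrightarrow> coord c k = 0"
 shows "(norm c)^2 = (\<Sum>j<m. (norm (coord c j))^2)"
 unfolding norm_ell2_sq by (rule suminf_finite) (use assms in \<open>auto simp: not_less\<close>)

lemma matrix_operator_finite_support:
 assumes a: "bounded_matrix a" and c: "\<And>k. k \<ge> m \<Longrightarrow> coord c k = 0"
 shows "matrix_operator a c = (\<Sum>j<m. coord c j *\<^sub>C matrix_operator a (std_basis j))"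
  and "cinner (matrix_operator a c) c = (\<Sum>j<m. \<Sum>k<m. coord c j * cnj (coord c k) * a j k)"
proof -
 note A = bounded_matrixD(1)[OF a]
 show 1: "matrix_operator a c = (\<Sum>j<m. coord c j *\<^sub>C matrix_operator a (std_basis j))"
  by (subst finite_support_expansion[OF c]) (simp_all add: bounded_clinearD[OF A])
 have en: "cinner (matrix_operator a (std_basis j)) (std_basis k) = a j k" for j k
  using bounded_matrixD(2)[OF a] by (simp only: entry_def[symmetric])
 have "cinner (matrix_operator a c) c
   = cinner (\<Sum>j<m. coord c j *\<^sub>C matrix_operator a (std_basis j)) (\<Sum>k<m. coord c k *\<^sub>C std_basis k)"
  using 1 finite_support_expansion[OF c] by simp
 also have "\<dots> = (\<Sum>j<m. \<Sum>k<m. coord c j * cnj (coord c k) * a j k)"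
  by (subst cinner_sum_left) (simp only: cinner_sum_right cinner_scaleC_left cinner_scaleC_right en, simp add: sum_distrib_left mult_ac)
 finally show "cinner (matrix_operator a c) c = (\<Sum>j<m. \<Sum>k<m. coord c j * cnj (coord c k) * a j k)" .
qed

lemma hs_bound_finite:
 assumes z: "\<And>j k. j \<ge> m \<or> k \<ge> m \<Longrightarrow> a j k = 0"
  and S: "(\<Sum>j<m. \<Sum>k<m. (norm (a j k))^2) \<le> S"
 shows "hs_bound a S"
 unfolding hs_bound_def
proof
 fix n
 have "(\<Sum>k<n. \<Sum>j<n. (norm (a j k))^2) \<le> (\<Sum>k<max n m. \<Sum>j<max n m. (norm (a j k))^2)"
  by (intro order_trans[OF sum_mono sum_mono2] sum_mono2) (auto intro: sum_nonneg)
 also have "\<dots> = (\<Sum>k<m. \<Sum>j<max n m. (norm (a j k))^2)"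
  by (rule sum.mono_neutral_right) (auto simp: z)
 also have "\<dots> = (\<Sum>k<m. \<Sum>j<m. (norm (a j k))^2)"
  by (intro sum.cong refl sum.mono_neutral_right) (auto simp: z)
 also have "\<dots> \<le> S" by (subst sum.swap) (rule S)
 finally show "(\<Sum>k<n. \<Sum>j<n. (norm (a j k))^2) \<le> S" .
qed

text \<open>Everything is compared with the coefficient vector \<open>g\<close>. The Gram matrices
  of \<open>v\<close> and \<open>u\<close>, the Gram matrix weighted by \<open>lam\<close>, and the
  matrix of residuals deviate from their ideal values by Hilbert--Schmidt errors. On the coefficient
  vectors that satisfy four groups of at most \<open>\<Lambda>^2 * C / d^2\<close> constraints all
  four deviations have size at most \<open>d\<close>. Pairing \<open>H x\<close> with
  \<open>y\<close> instead of taking its norm serves both uses: Cauchy--Schwarz for singular values,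
  and \<open>u = v\<close> for the quadratic form.\<close>

lemma quasimodes_nat:
 fixes v u :: "nat \<Rightarrow> ell2" and lam :: "nat \<Rightarrow> real"
 assumes H: "bounded_clinear H"
  and Gv: "(\<Sum>i<m. \<Sum>j<m. (norm (cinner (v i) (v j) - (if i = j then 1 else 0)))^2) \<le> C"
  and Gu: "(\<Sum>i<m. \<Sum>j<m. (norm (cinner (u i) (u j) - (if i = j then 1 else 0)))^2) \<le> C"
  and err: "(\<Sum>i<m. (norm (H (v i) - lam i *\<^sub>R u i))^2) \<le> C"
  and lam: "\<And>i. i < m \<Longrightarrow> t' \<le> lam i \<and> lam i \<le> \<Lambda>" and t: "0 < t" "t < t'" "1 \<le> \<Lambda>"
  and d: "0 < d" "d \<le> 1/2" "t * (1 + d) < t' - 3 * d"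
  and X: "finite X" "card X + 4 * nat \<lfloor>\<Lambda>^2 * C / d^2\<rfloor> < m"
 shows "\<exists>c. (\<Sum>i<m. c i *\<^sub>C v i) \<noteq> 0 \<and> (\<forall>y\<in>X. cinner (\<Sum>i<m. c i *\<^sub>C v i) y = 0) \<and>
  t * (norm (\<Sum>i<m. c i *\<^sub>C v i) * norm (\<Sum>i<m. c i *\<^sub>C u i))
   < Re (cinner (H (\<Sum>i<m. c i *\<^sub>C v i)) (\<Sum>i<m. c i *\<^sub>C u i))"
proof -
 define r where "r = nat \<lfloor>\<Lambda>^2 * C / d^2\<rfloor>"
 \<comment> \<open>Errors of the two Gram matrices, of the Gram matrix weighted by
   \<open>lam\<close>, and the residuals \<open>w j\<close> as images of the basis vectors. They are
   extended by 0 so that the results on infinite matrices apply.\<close>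
 define a1 where "a1 j k = (if j < m \<and> k < m then cinner (v j) (v k) - (if j = k then 1 else 0) else 0)" for j k
 define a2 where "a2 j k = (if j < m \<and> k < m then cinner (u j) (u k) - (if j = k then 1 else 0) else 0)" for j k
 define a3 where "a3 j k = complex_of_real (if j < m then lam j else 0) * a2 j k" for j k
 define w where "w j = H (v j) - lam j *\<^sub>R u j" for j
 define a4 where "a4 j k = (if j < m then coord (w j) k else 0)" for j k
 have C0: "C \<ge> 0" by (rule order_trans[OF _ err]) (simp add: sum_nonneg)
 have CL: "C \<le> \<Lambda>^2 * C"
  using mult_right_mono[of 1 "\<Lambda>^2" C] t(3) C0 one_le_power[of \<Lambda> 2] by simp
 have hs1: "hs_bound a1 (\<Lambda>^2 * C)"
  by (rule hs_bound_finite[where m=m]) (use Gv CL in \<open>auto simp: a1_def\<close>)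
 have Gu': "(\<Sum>j<m. \<Sum>k<m. (norm (a2 j k))^2) \<le> C" using Gu by (simp add: a2_def)
 have hs2: "hs_bound a2 (\<Lambda>^2 * C)"
  by (rule hs_bound_finite[where m=m]) (use Gu' CL in \<open>auto simp: a2_def\<close>)
 have hs3: "hs_bound a3 (\<Lambda>^2 * C)"
 proof (rule hs_bound_finite[where m=m])
  have "(\<Sum>j<m. \<Sum>k<m. (norm (a3 j k))^2) \<le> (\<Sum>j<m. \<Sum>k<m. \<Lambda>^2 * (norm (a2 j k))^2)"
  proof (intro sum_mono)
   fix j k assume "j \<in> {..<m}" "k \<in> {..<m}"
   then have "\<bar>lam j\<bar> \<le> \<Lambda>" using lam[of j] t by auto
   then have "(lam j)^2 \<le> \<Lambda>^2" by (metis abs_ge_zero power2_abs power_mono)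
   then show "(norm (a3 j k))^2 \<le> \<Lambda>^2 * (norm (a2 j k))^2"
    using \<open>j \<in> {..<m}\<close> by (simp add: a3_def norm_mult power_mult_distrib mult_right_mono)
  qed
  also have "\<dots> = \<Lambda>^2 * (\<Sum>j<m. \<Sum>k<m. (norm (a2 j k))^2)" by (simp add: sum_distrib_left)
  also have "\<dots> \<le> \<Lambda>^2 * C" using Gu' by (intro mult_left_mono) auto
  finally show "(\<Sum>j<m. \<Sum>k<m. (norm (a3 j k))^2) \<le> \<Lambda>^2 * C" .
 qed (auto simp: a3_def a2_def)
 have hs4: "hs_bound a4 (\<Lambda>^2 * C)"
  unfolding hs_bound_def
 proof
  fix n
  have "(\<Sum>k<n. \<Sum>j<n. (norm (a4 j k))^2) = (\<Sum>j<n. \<Sum>k<n. (norm (a4 j k))^2)" by (rule sum.swap)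
  also have "\<dots> \<le> (\<Sum>j<max n m. \<Sum>k<n. (norm (a4 j k))^2)" by (rule sum_mono2) (auto intro: sum_nonneg)
  also have "\<dots> = (\<Sum>j<m. \<Sum>k<n. (norm (a4 j k))^2)"
   by (rule sum.mono_neutral_right) (auto simp: a4_def)
  also have "\<dots> \<le> (\<Sum>j<m. (norm (w j))^2)"
   by (rule sum_mono) (simp add: a4_def sum_coord_le)
  also have "\<dots> \<le> \<Lambda>^2 * C" using err CL by (simp add: w_def)
  finally show "(\<Sum>k<n. \<Sum>j<n. (norm (a4 j k))^2) \<le> \<Lambda>^2 * C" .
 qed
 have few: "\<exists>Y. finite Y \<and> card Y \<le> r \<and> (\<forall>x. (\<forall>y\<in>Y. cinner x y = 0) \<longrightarrow> norm (matrix_operator a x) \<le> d * norm x)"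
  if "hs_bound a (\<Lambda>^2 * C)" for a
 proof (rule hs_small_off_few_vectors[OF that d(1)])
  fix Y assume Y: "orthonormal Y" "real (card Y) \<le> \<Lambda>^2 * C / d^2"
   "\<And>x. (\<And>y. y \<in> Y \<Longrightarrow> cinner x y = 0) \<Longrightarrow> norm (matrix_operator a x) \<le> d * norm x"
  have "finite Y" using Y(1) by (simp add: orthonormal_def)
  moreover have "card Y \<le> r" using Y(2) by (simp add: r_def le_nat_floor)
  ultimately show ?thesis using Y(3) by blast
 qed
 obtain Y1 where Y1: "finite Y1" "card Y1 \<le> r" "\<And>x. \<forall>y\<in>Y1. cinner x y = 0 \<Longrightarrow> norm (matrix_operator a1 x) \<le> d * norm x"
  using few[OF hs1] by blast
 obtain Y2 where Y2: "finite Y2" "card Y2 \<le> r" "\<And>x. \<forall>y\<in>Y2. cinner x y = 0 \<Longrightarrow> norm (matrix_operator a2 x) \<le> d * norm x"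
  using few[OF hs2] by blast
 obtain Y3 where Y3: "finite Y3" "card Y3 \<le> r" "\<And>x. \<forall>y\<in>Y3. cinner x y = 0 \<Longrightarrow> norm (matrix_operator a3 x) \<le> d * norm x"
  using few[OF hs3] by blast
 obtain Y4 where Y4: "finite Y4" "card Y4 \<le> r" "\<And>x. \<forall>y\<in>Y4. cinner x y = 0 \<Longrightarrow> norm (matrix_operator a4 x) \<le> d * norm x"
  using few[OF hs4] by blast
 define Y where "Y = Y1 \<union> Y2 \<union> Y3 \<union> Y4"
 define J where "J = Inl ` Y \<union> Inr ` X"
 \<comment> \<open>Constraints of two kinds become one linear system in the coefficients: those on
   the coefficient vector itself, from the exceptional sets, and those of \<open>X\<close> on the
   combination of the \<open>v i\<close>.\<close>
 define M where "M j i = (case j of Inl y \<Rightarrow> cnj (coord y i) | Inr y \<Rightarrow> cinner (v i) y)" for j i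
 have finY: "finite Y" using Y1 Y2 Y3 Y4 by (simp add: Y_def)
 have "card Y \<le> 4 * r"
  unfolding Y_def using Y1(2) Y2(2) Y3(2) Y4(2) card_Un_le[of "Y1 \<union> Y2 \<union> Y3" Y4]
   card_Un_le[of "Y1 \<union> Y2" Y3] card_Un_le[of Y1 Y2] by linarith
 moreover have "card J \<le> card Y + card X"
  unfolding J_def
  using card_Un_le[of "Inl ` Y" "Inr ` X"] card_image_le[OF finY, of Inl] card_image_le[OF X(1), of Inr]
  by (meson add_mono order_trans)
 ultimately have "card J < card {..<m}" using X(2) by (simp add: r_def)
 moreover have "finite J" using finY X(1) by (simp add: J_def)
 ultimately obtain c where c: "\<exists>i\<in>{..<m}. c i \<noteq> 0" "\<forall>j\<in>J. (\<Sum>i<m. M j i * c i) = 0"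
  using homogeneous_system_solvable[of J "{..<m}" M] by blast
 define g where "g = (\<Sum>i<m. c i *\<^sub>C std_basis i)"
 define x where "x = (\<Sum>i<m. c i *\<^sub>C v i)"
 define y where "y = (\<Sum>i<m. c i *\<^sub>C u i)"
 have cg: "coord g k = (if k < m then c k else 0)" for k
  by (simp add: g_def if_distrib cong: if_cong)
 then have gz: "\<And>k. k \<ge> m \<Longrightarrow> coord g k = 0" by simp
 have gorth: "cinner g z = 0" if "z \<in> Y" for z
 proof -
  have "(\<Sum>i<m. M (Inl z) i * c i) = 0" using c(2) that by (simp add: J_def)
  then show ?thesis by (simp add: M_def g_def cinner_sum_left mult.commute)
 qed
 have xorth: "cinner x z = 0" if "z \<in> X" for z
 proof -
  have "(\<Sum>i<m. M (Inr z) i * c i) = 0" using c(2) that by (simp add: J_def)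
  then show ?thesis by (simp add: M_def x_def cinner_sum_left mult.commute)
 qed
 have ng: "(norm g)^2 = (\<Sum>j<m. (norm (c j))^2)" using norm_finite_support[OF gz] by (simp add: cg)
 have "g \<noteq> 0" using c(1) cg by (metis lessThan_iff zero_ell2.rep_eq)
 then have gpos: "(norm g)^2 > 0" by simp
 have form: "norm (cinner (matrix_operator a g) g) \<le> d * (norm g)^2"
  if "norm (matrix_operator a g) \<le> d * norm g" for a
  using order_trans[OF cinner_Cauchy_Schwarz mult_right_mono[OF that norm_ge_zero]]
  by (simp add: power2_eq_square mult_ac)
 have gram: "(norm z)^2 = (norm g)^2 + Re (cinner (matrix_operator a g) g)"
  if hs: "hs_bound a S" and z: "z = (\<Sum>i<m. c i *\<^sub>C s i)"
   and a: "\<And>j k. j < m \<Longrightarrow> k < m \<Longrightarrow> a j k = cinner (s j) (s k) - (if j = k then 1 else 0)" for a S z s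
 proof -
  have "cinner z z = (\<Sum>j<m. \<Sum>k<m. c j * cnj (c k) * cinner (s j) (s k))"
   unfolding z by (subst cinner_sum_left) (simp add: cinner_sum_right sum_distrib_left mult_ac)
  also have "\<dots> = (\<Sum>j<m. \<Sum>k<m. c j * cnj (c k) * a j k) + (\<Sum>j<m. \<Sum>k<m. c j * cnj (c k) * (if j = k then 1 else 0))"
   unfolding sum.distrib[symmetric] by (intro sum.cong refl) (auto simp: a algebra_simps)
  also have "(\<Sum>j<m. \<Sum>k<m. c j * cnj (c k) * (if j = k then 1 else 0)) = (\<Sum>j<m. c j * cnj (c j))"
   by (simp add: if_distrib cong: if_cong)
  also have "\<dots> = complex_of_real ((norm g)^2)"
   unfolding ng of_real_sum by (simp only: complex_norm_square)
  also have "(\<Sum>j<m. \<Sum>k<m. c j * cnj (c k) * a j k) = cinner (matrix_operator a g) g"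
   using matrix_operator_finite_support(2)[OF hs_bounded_matrix[OF hs] gz] by (simp add: cg)
  finally have "Re (cinner z z) = (norm g)^2 + Re (cinner (matrix_operator a g) g)" by simp
  then show ?thesis by (simp add: cinner_self)
 qed
 have x1: "\<bar>(norm x)^2 - (norm g)^2\<bar> \<le> d * (norm g)^2"
 proof -
  have "(norm x)^2 = (norm g)^2 + Re (cinner (matrix_operator a1 g) g)"
   by (rule gram[OF hs1 x_def]) (simp add: a1_def)
  moreover have "norm (cinner (matrix_operator a1 g) g) \<le> d * (norm g)^2"
   by (rule form, rule Y1(3)) (use gorth in \<open>auto simp: Y_def\<close>)
  ultimately show ?thesis using abs_Re_le_cmod[of "cinner (matrix_operator a1 g) g"] by simp
 qed
 have y1: "\<bar>(norm y)^2 - (norm g)^2\<bar> \<le> d * (norm g)^2"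
 proof -
  have "(norm y)^2 = (norm g)^2 + Re (cinner (matrix_operator a2 g) g)"
   by (rule gram[OF hs2 y_def]) (simp add: a2_def)
  moreover have "norm (cinner (matrix_operator a2 g) g) \<le> d * (norm g)^2"
   by (rule form, rule Y2(3)) (use gorth in \<open>auto simp: Y_def\<close>)
  ultimately show ?thesis using abs_Re_le_cmod[of "cinner (matrix_operator a2 g) g"] by simp
 qed
 \<comment> \<open>The image of \<open>x\<close> that exact singular vectors would give;
   \<open>H x - z\<close> is the residual matrix applied to \<open>g\<close>.\<close>
 define z where "z = (\<Sum>i<m. (c i * of_real (lam i)) *\<^sub>C u i)"
 have "cinner z y = (\<Sum>j<m. \<Sum>k<m. c j * cnj (c k) * (complex_of_real (lam j) * cinner (u j) (u k)))"
  unfolding z_def y_def by (subst cinner_sum_left) (simp add: cinner_sum_right sum_distrib_left mult_ac)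
 also have "\<dots> = (\<Sum>j<m. \<Sum>k<m. c j * cnj (c k) * a3 j k) + (\<Sum>j<m. \<Sum>k<m. c j * cnj (c k) * (if j = k then complex_of_real (lam j) else 0))"
  by (auto simp: a3_def a2_def algebra_simps sum.distrib[symmetric] intro!: sum.cong)
 also have "(\<Sum>j<m. \<Sum>k<m. c j * cnj (c k) * (if j = k then complex_of_real (lam j) else 0)) = (\<Sum>j<m. c j * cnj (c j) * of_real (lam j))"
  by (simp add: if_distrib cong: if_cong)
 also have "\<dots> = complex_of_real (\<Sum>j<m. (norm (c j))^2 * lam j)"
  unfolding of_real_sum of_real_mult by (simp only: complex_norm_square)
 also have "(\<Sum>j<m. \<Sum>k<m. c j * cnj (c k) * a3 j k) = cinner (matrix_operator a3 g) g"
  using matrix_operator_finite_support(2)[OF hs_bounded_matrix[OF hs3] gz] by (simp add: cg)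
 finally have "Re (cinner z y) = Re (cinner (matrix_operator a3 g) g) + (\<Sum>j<m. (norm (c j))^2 * lam j)" by simp
 moreover have "norm (cinner (matrix_operator a3 g) g) \<le> d * (norm g)^2"
  by (rule form, rule Y3(3)) (use gorth in \<open>auto simp: Y_def\<close>)
 moreover have "(norm g)^2 * t' \<le> (\<Sum>j<m. (norm (c j))^2 * lam j)"
  unfolding ng sum_distrib_right using lam by (intro sum_mono mult_left_mono) auto
 ultimately have zy: "Re (cinner z y) \<ge> (t' - d) * (norm g)^2"
  using abs_Re_le_cmod[of "cinner (matrix_operator a3 g) g"]
  by (simp add: algebra_simps)
 have basis4: "matrix_operator a4 (std_basis j) = w j" if "j < m" for j
 proof (rule ell2_eqI)
  fix k
  show "coord (matrix_operator a4 (std_basis j)) k = coord (w j) k"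
   using fun_cong[OF fun_cong[OF bounded_matrixD(2)[OF hs_bounded_matrix[OF hs4]]], of j k] that
   by (simp add: entry_eq_coord a4_def)
 qed
 have "matrix_operator a4 g = (\<Sum>j<m. c j *\<^sub>C w j)"
  using matrix_operator_finite_support(1)[OF hs_bounded_matrix[OF hs4] gz] by (simp add: cg basis4)
 also have "\<dots> = H x - z"
  by (simp add: x_def z_def w_def bounded_clinearD[OF H] cell2.scale_right_diff_distrib sum_subtractf scaleC_of_real[symmetric])
 finally have "norm (H x - z) \<le> d * norm g"
  using Y4(3)[of g] gorth by (auto simp: Y_def)
 have yg: "norm y \<le> 2 * norm g"
 proof (rule power2_le_imp_le)
  have "(norm y)^2 \<le> (1 + d) * (norm g)^2" using y1 by (simp add: algebra_simps abs_le_iff)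
  also have "\<dots> \<le> 4 * (norm g)^2" using d by (intro mult_right_mono) auto
  finally show "(norm y)^2 \<le> (2 * norm g)^2" by (simp add: power_mult_distrib)
 qed simp
 have "\<bar>Re (cinner (H x - z) y)\<bar> \<le> norm (H x - z) * norm y"
  by (rule order_trans[OF abs_Re_le_cmod cinner_Cauchy_Schwarz])
 also have "\<dots> \<le> (d * norm g) * (2 * norm g)"
  using \<open>norm (H x - z) \<le> d * norm g\<close> yg d by (intro mult_mono) auto
 finally have "\<bar>Re (cinner (H x) y) - Re (cinner z y)\<bar> \<le> 2 * d * (norm g)^2"
  by (simp add: cinner_diff_left power2_eq_square mult_ac)
 \<comment> \<open>The loss \<open>3 * d\<close> consists of \<open>d\<close> from the weighted Gram
   error and \<open>2 * d\<close> from the residual, as \<open>y\<close> is at most twice as long as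
   \<open>g\<close>.\<close>
 then have main: "Re (cinner (H x) y) \<ge> (t' - 3 * d) * (norm g)^2"
  using zy by (simp add: algebra_simps abs_le_iff)
 have "norm x * norm y \<le> (1 + d) * (norm g)^2"
 proof -
  have "0 \<le> (norm x - norm y)^2" by simp
  then have "2 * (norm x * norm y) \<le> (norm x)^2 + (norm y)^2" by (simp add: power2_diff algebra_simps)
  also have "\<dots> \<le> 2 * ((1 + d) * (norm g)^2)" using x1 y1 by (simp add: algebra_simps abs_le_iff)
  finally show ?thesis by simp
 qed
 then have "t * (norm x * norm y) \<le> t * ((1 + d) * (norm g)^2)" using t by (intro mult_left_mono) auto
 also have "\<dots> < (t' - 3 * d) * (norm g)^2"
  using mult_strict_right_mono[OF d(3) gpos] by (simp add: mult.assoc)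
 finally have "t * (norm x * norm y) < Re (cinner (H x) y)" using main by linarith
 moreover have "x \<noteq> 0"
 proof
  assume "x = 0"
  then have "(norm g)^2 \<le> d * (norm g)^2" using x1 by simp
  also have "\<dots> \<le> 1/2 * (norm g)^2" using d by (intro mult_right_mono) auto
  finally show False using gpos by simp
 qed
 ultimately show ?thesis using xorth unfolding x_def y_def by blast
qed

lemma quasimodes:
 fixes v u :: "'i \<Rightarrow> ell2" and lam :: "'i \<Rightarrow> real"
 assumes H: "bounded_clinear H" and I: "finite I"
  and Gv: "(\<Sum>i\<in>I. \<Sum>j\<in>I. (norm (cinner (v i) (v j) - (if i = j then 1 else 0)))^2) \<le> C"
  and Gu: "(\<Sum>i\<in>I. \<Sum>j\<in>I. (norm (cinner (u i) (u j) - (if i = j then 1 else 0)))^2) \<le> C"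
  and err: "(\<Sum>i\<in>I. (norm (H (v i) - lam i *\<^sub>R u i))^2) \<le> C"
  and lam: "\<And>i. i \<in> I \<Longrightarrow> t' \<le> lam i \<and> lam i \<le> \<Lambda>" and t: "0 < t" "t < t'" "1 \<le> \<Lambda>"
  and d: "0 < d" "d \<le> 1/2" "t * (1 + d) < t' - 3 * d"
  and X: "finite X" "card X + 4 * nat \<lfloor>\<Lambda>^2 * C / d^2\<rfloor> < card I"
 shows "\<exists>c. (\<Sum>i\<in>I. c i *\<^sub>C v i) \<noteq> 0 \<and> (\<forall>y\<in>X. cinner (\<Sum>i\<in>I. c i *\<^sub>C v i) y = 0) \<and>
  t * (norm (\<Sum>i\<in>I. c i *\<^sub>C v i) * norm (\<Sum>i\<in>I. c i *\<^sub>C u i))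
   < Re (cinner (H (\<Sum>i\<in>I. c i *\<^sub>C v i)) (\<Sum>i\<in>I. c i *\<^sub>C u i))"
proof -
 obtain h where h: "bij_betw h {..<card I} I"
  using ex_bij_betw_nat_finite[OF I] by (auto simp: atLeast0LessThan)
 have re: "(\<Sum>i<card I. f (h i)) = (\<Sum>i\<in>I. f i)" for f :: "'i \<Rightarrow> 'b::comm_monoid_add"
  by (rule sum.reindex_bij_betw[OF h])
 have inj: "i = j \<longleftrightarrow> h i = h j" if "i < card I" "j < card I" for i j
  using h that by (auto simp: bij_betw_def inj_on_def)
 have hI: "h i \<in> I" if "i < card I" for i using h that by (auto simp: bij_betw_def)
 have G: "(\<Sum>i<card I. \<Sum>j<card I. (norm (cinner (s (h i)) (s (h j)) - (if i = j then 1 else 0)))^2)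
   = (\<Sum>i\<in>I. \<Sum>j\<in>I. (norm (cinner (s i) (s j) - (if i = j then 1 else 0)))^2)" for s :: "'i \<Rightarrow> ell2"
  by (subst re[symmetric], intro sum.cong refl, subst re[symmetric], intro sum.cong refl)
   (simp add: inj)
 have E: "(\<Sum>i<card I. (norm (H (v (h i)) - lam (h i) *\<^sub>R u (h i)))^2) \<le> C"
  using err re[of "\<lambda>i. (norm (H (v i) - lam i *\<^sub>R u i))^2"] by simp
 have "\<exists>c. (\<Sum>i<card I. c i *\<^sub>C v (h i)) \<noteq> 0 \<and>
   (\<forall>y\<in>X. cinner (\<Sum>i<card I. c i *\<^sub>C v (h i)) y = 0) \<and>
  t * (norm (\<Sum>i<card I. c i *\<^sub>C v (h i)) * norm (\<Sum>i<card I. c i *\<^sub>C u (h i)))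
   < Re (cinner (H (\<Sum>i<card I. c i *\<^sub>C v (h i))) (\<Sum>i<card I. c i *\<^sub>C u (h i)))"
  by (rule quasimodes_nat[where v="\<lambda>i. v (h i)" and u="\<lambda>i. u (h i)" and lam="\<lambda>i. lam (h i)",
    OF H Gv[folded G] Gu[folded G] E lam[OF hI] t d X])
 then obtain c where c: "(\<Sum>i<card I. c i *\<^sub>C v (h i)) \<noteq> 0"
  "\<forall>y\<in>X. cinner (\<Sum>i<card I. c i *\<^sub>C v (h i)) y = 0"
  "t * (norm (\<Sum>i<card I. c i *\<^sub>C v (h i)) * norm (\<Sum>i<card I. c i *\<^sub>C u (h i)))
   < Re (cinner (H (\<Sum>i<card I. c i *\<^sub>C v (h i))) (\<Sum>i<card I. c i *\<^sub>C u (h i)))"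
  by (elim exE conjE)
 define c' where "c' i = c (inv_into {..<card I} h i)" for i
 have c': "c' (h i) = c i" if "i < card I" for i
  unfolding c'_def using h that by (simp add: bij_betw_def inv_into_f_f)
 have cc: "(\<Sum>i<card I. c i *\<^sub>C s (h i)) = (\<Sum>i\<in>I. c' i *\<^sub>C s i)" for s :: "'i \<Rightarrow> ell2"
  by (subst re[symmetric], intro sum.cong refl) (simp add: c')
 show ?thesis by (rule exI[of _ c'], intro conjI) (use c in \<open>simp_all add: cc\<close>)
qed

lemma quasimodes_n_sing:
 fixes v u :: "'i \<Rightarrow> ell2" and lam :: "'i \<Rightarrow> real"
 assumes H: "compact_operator H" and I: "finite I"
  and Gv: "(\<Sum>i\<in>I. \<Sum>j\<in>I. (norm (cinner (v i) (v j) - (if i = j then 1 else 0)))^2) \<le> C"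
  and Gu: "(\<Sum>i\<in>I. \<Sum>j\<in>I. (norm (cinner (u i) (u j) - (if i = j then 1 else 0)))^2) \<le> C"
  and err: "(\<Sum>i\<in>I. (norm (H (v i) - lam i *\<^sub>R u i))^2) \<le> C"
  and lam: "\<And>i. i \<in> I \<Longrightarrow> t' \<le> lam i \<and> lam i \<le> \<Lambda>" and t: "0 < t" "t < t'" "1 \<le> \<Lambda>"
  and d: "0 < d" "d \<le> 1/2" "t * (1 + d) < t' - 3 * d"
 shows "card I \<le> n_sing t H + 4 * nat \<lfloor>\<Lambda>^2 * C / d^2\<rfloor>"
proof -
 have bH: "bounded_clinear H" using H by (simp add: compact_operator_def)
 have "robust (card I - 4 * nat \<lfloor>\<Lambda>^2 * C / d^2\<rfloor>) (\<lambda>x. norm (H x) > t * norm x)"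
  unfolding robust_def
 proof (intro allI impI)
  fix X :: "ell2 set" assume X: "finite X \<and> card X < card I - 4 * nat \<lfloor>\<Lambda>^2 * C / d^2\<rfloor>"
  then have X': "finite X" "card X + 4 * nat \<lfloor>\<Lambda>^2 * C / d^2\<rfloor> < card I" by auto
  have ex: "\<exists>c. (\<Sum>i\<in>I. c i *\<^sub>C v i) \<noteq> 0 \<and> (\<forall>y\<in>X. cinner (\<Sum>i\<in>I. c i *\<^sub>C v i) y = 0) \<and>
   t * (norm (\<Sum>i\<in>I. c i *\<^sub>C v i) * norm (\<Sum>i\<in>I. c i *\<^sub>C u i))
    < Re (cinner (H (\<Sum>i\<in>I. c i *\<^sub>C v i)) (\<Sum>i\<in>I. c i *\<^sub>C u i))"
   by (rule quasimodes[OF bH I Gv Gu err lam t d X'])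
  obtain x y where x: "x \<noteq> 0" "\<forall>z\<in>X. cinner x z = 0"
   "t * (norm x * norm y) < Re (cinner (H x) y)"
   using ex by (elim exE conjE) (rule that)
  have "t * norm x * norm y < norm (H x) * norm y"
   using x(3) order_trans[OF complex_Re_le_cmod cinner_Cauchy_Schwarz, of "H x" y]
   by (simp add: mult.assoc)
  then have "t * norm x < norm (H x)" by (rule mult_right_less_imp_less) simp
  then show "\<exists>x. x \<noteq> 0 \<and> (\<forall>y\<in>X. cinner x y = 0) \<and> norm (H x) > t * norm x" using x by blast
 qed
 from robust_le_n_sing[OF H t(1) this] show ?thesis by simp
qed

lemma quasimodes_n_plus:
 fixes v :: "'i \<Rightarrow> ell2" and lam :: "'i \<Rightarrow> real"
 assumes H: "compact_self_adjoint H" and I: "finite I"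
  and Gv: "(\<Sum>i\<in>I. \<Sum>j\<in>I. (norm (cinner (v i) (v j) - (if i = j then 1 else 0)))^2) \<le> C"
  and err: "(\<Sum>i\<in>I. (norm (H (v i) - lam i *\<^sub>R v i))^2) \<le> C"
  and lam: "\<And>i. i \<in> I \<Longrightarrow> t' \<le> lam i \<and> lam i \<le> \<Lambda>" and t: "0 < t" "t < t'" "1 \<le> \<Lambda>"
  and d: "0 < d" "d \<le> 1/2" "t * (1 + d) < t' - 3 * d"
 shows "card I \<le> n_plus t H + 4 * nat \<lfloor>\<Lambda>^2 * C / d^2\<rfloor>"
proof -
 interpret compact_self_adjoint H by fact
 have "robust (card I - 4 * nat \<lfloor>\<Lambda>^2 * C / d^2\<rfloor>) (\<lambda>x. Re (cinner (H x) x) > t * (norm x)^2)"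
  unfolding robust_def
 proof (intro allI impI)
  fix X :: "ell2 set" assume X: "finite X \<and> card X < card I - 4 * nat \<lfloor>\<Lambda>^2 * C / d^2\<rfloor>"
  then have X': "finite X" "card X + 4 * nat \<lfloor>\<Lambda>^2 * C / d^2\<rfloor> < card I" by auto
  have ex: "\<exists>c. (\<Sum>i\<in>I. c i *\<^sub>C v i) \<noteq> 0 \<and> (\<forall>y\<in>X. cinner (\<Sum>i\<in>I. c i *\<^sub>C v i) y = 0) \<and>
   t * (norm (\<Sum>i\<in>I. c i *\<^sub>C v i) * norm (\<Sum>i\<in>I. c i *\<^sub>C v i))
    < Re (cinner (H (\<Sum>i\<in>I. c i *\<^sub>C v i)) (\<Sum>i\<in>I. c i *\<^sub>C v i))"
   by (rule quasimodes[OF bc I Gv Gv err lam t d X'])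
  obtain x where "x \<noteq> 0" "\<forall>z\<in>X. cinner x z = 0" "t * (norm x * norm x) < Re (cinner (H x) x)"
   using ex by (elim exE conjE) (rule that)
  then show "\<exists>x. x \<noteq> 0 \<and> (\<forall>y\<in>X. cinner x y = 0) \<and> Re (cinner (H x) x) > t * (norm x)^2"
   unfolding power2_eq_square by blast
 qed
 from robust_le_n_plus[OF t(1) this] show ?thesis by simp
qed

section \<open>Sums of slowly varying functions\<close>

text \<open>The value of the zeta function at 3/2; the term at 0 vanishes because division by 0
  gives 0. The exponent 3/2 is the decay rate assumed below for the derivatives of the
  summands.\<close>

definition zeta32 :: real where "zeta32 = (\<Sum>k. 1 / (real k * sqrt (real k)))"

lemma powr_three_halves: "0 < x \<Longrightarrow> (x::real) powr (-(3/2)) = 1 / (x * sqrt x)"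
proof -
 assume x: "0 < x"
 have "x powr (-(3/2)) = x powr (-1 + -(1/2))" by simp
 also have "\<dots> = x powr (-1) * x powr (-(1/2))" by (rule powr_add)
 also have "\<dots> = 1 / (x * sqrt x)" using x by (simp add: powr_minus powr_half_sqrt field_simps)
 finally show ?thesis .
qed

lemma summable_three_halves: "summable (\<lambda>k. 1 / (real k * sqrt (real k)))"
proof -
 have "summable (\<lambda>k. real k powr (-(3/2)))" by (subst summable_real_powr_iff) simp
 moreover have "real k powr (-(3/2)) = 1 / (real k * sqrt (real k))" for k
  by (cases "k = 0") (auto simp: powr_three_halves)
 ultimately show ?thesis by simp
qed

lemma sum_three_halves_le: "finite A \<Longrightarrow> (\<Sum>k\<in>A. 1 / (real k * sqrt (real k))) \<le> zeta32"
 unfolding zeta32_def by (rule sum_le_suminf[OF summable_three_halves]) auto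

lemma zeta32_nonneg: "zeta32 \<ge> 0"
 using sum_three_halves_le[of "{}"] by simp

lemma telescoping_norm_bound:
 fixes f :: "nat \<Rightarrow> complex"
 assumes D: "\<And>k. k \<ge> 1 \<Longrightarrow> norm (f (Suc k) - f k) \<le> D / (real k * sqrt (real k))"
  and f1: "norm (f 1) \<le> D" and N: "N \<ge> 1"
 shows "norm (f N) \<le> D * (1 + zeta32)" and "(\<Sum>k=1..<N. norm (f (Suc k) - f k)) \<le> D * zeta32"
proof -
 have D0: "D \<ge> 0" using order_trans[OF norm_ge_zero f1] .
 have "(\<Sum>k=1..<N. norm (f (Suc k) - f k)) \<le> (\<Sum>k=1..<N. D * (1 / (real k * sqrt (real k))))"
  using D by (intro sum_mono) auto
 also have "\<dots> \<le> D * zeta32"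
  unfolding sum_distrib_left[symmetric] using D0 by (intro mult_left_mono sum_three_halves_le) auto
 finally show s: "(\<Sum>k=1..<N. norm (f (Suc k) - f k)) \<le> D * zeta32" .
 have "f N = f 1 + (\<Sum>k=1..<N. f (Suc k) - f k)"
  using sum_Suc_diff'[of 1 N f] N by simp
 then have "norm (f N) \<le> norm (f 1) + norm (\<Sum>k=1..<N. f (Suc k) - f k)"
  by (simp only: norm_triangle_ineq)
 also have "\<dots> \<le> norm (f 1) + (\<Sum>k=1..<N. norm (f (Suc k) - f k))"
  by (intro add_left_mono norm_sum)
 finally have "norm (f N) \<le> norm (f 1) + (\<Sum>k=1..<N. norm (f (Suc k) - f k))" .
 then show "norm (f N) \<le> D * (1 + zeta32)" using s f1 by (simp add: algebra_simps)
qed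

text \<open>Summation by parts: the partial sums of \<open>z ^ k\<close> stay below
  \<open>2 / norm (1 - z)\<close>, and the total variation of \<open>f\<close> is finite.\<close>

lemma oscillating_sum_bound:
 fixes f :: "nat \<Rightarrow> complex"
 assumes D: "\<And>k. k \<ge> 1 \<Longrightarrow> norm (f (Suc k) - f k) \<le> D / (real k * sqrt (real k))"
  and f1: "norm (f 1) \<le> D" and z: "norm z = 1" "z \<noteq> 1"
 shows "norm (\<Sum>k=1..N. z ^ k * f k) \<le> 2 / norm (1 - z) * (D * (1 + 2 * zeta32))"
proof (cases "N \<ge> 1")
 case True
 define T where "T n = (\<Sum>k=1..n. z ^ k)" for n
 have T: "norm (T n) \<le> 2 / norm (1 - z)" for n
 proof -
  have "T n * (1 - z) = z - z ^ Suc n"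
  proof (induction n)
   case (Suc n)
   have "T (Suc n) * (1 - z) = T n * (1 - z) + z ^ Suc n * (1 - z)" by (simp add: T_def distrib_right)
   also have "\<dots> = z - z ^ Suc (Suc n)" unfolding Suc.IH by (simp add: algebra_simps)
   finally show ?case .
  qed (simp add: T_def)
  then have "norm (T n) * norm (1 - z) = norm (z - z ^ Suc n)" by (metis norm_mult)
  also have "\<dots> \<le> norm z + norm (z ^ Suc n)" by (rule norm_triangle_ineq4)
  also have "\<dots> = 2" using z by (simp add: norm_power norm_mult)
  finally show ?thesis using z(2) by (simp add: field_simps)
 qed
 have T_Suc: "T (Suc n) = T n + z ^ Suc n" for n by (simp add: T_def)
 have "(\<Sum>k=1..N. z ^ k * f k) = T N * f N - (\<Sum>k=1..<N. T k * (f (Suc k) - f k))"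
  using True
 proof (induction N rule: dec_induct)
  case base
  show ?case by (simp add: T_def)
 next
  case (step n)
  then show ?case by (simp only: sum.atLeastLessThan_Suc sum.cl_ivl_Suc T_Suc) (simp add: algebra_simps T_Suc)
 qed
 then have "norm (\<Sum>k=1..N. z ^ k * f k) \<le> norm (T N) * norm (f N) + norm (\<Sum>k=1..<N. T k * (f (Suc k) - f k))"
  by (simp only: norm_mult[symmetric] norm_triangle_ineq4)
 also have "\<dots> \<le> 2 / norm (1 - z) * norm (f N) + (\<Sum>k=1..<N. 2 / norm (1 - z) * norm (f (Suc k) - f k))"
 proof (intro add_mono mult_right_mono T norm_ge_zero sum_norm_le)
  show "norm (T k * (f (Suc k) - f k)) \<le> 2 / norm (1 - z) * norm (f (Suc k) - f k)" for k
   unfolding norm_mult by (intro mult_right_mono T norm_ge_zero)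
 qed
 also have "\<dots> = 2 / norm (1 - z) * (norm (f N) + (\<Sum>k=1..<N. norm (f (Suc k) - f k)))"
  by (simp add: sum_distrib_left distrib_left)
 also have "\<dots> \<le> 2 / norm (1 - z) * (D * (1 + zeta32) + D * zeta32)"
  by (intro mult_left_mono add_mono telescoping_norm_bound[of f D N, OF D f1 True]) auto
 finally show ?thesis by (simp add: algebra_simps)
next
 case False
 have "D \<ge> 0" using order_trans[OF norm_ge_zero f1] .
 then show ?thesis using False zeta32_nonneg by simp
qed

text \<open>On each unit interval \<open>f\<close> varies by at most
  \<open>D / k powr (3/2)\<close>. This is the hypothesis of the oscillating bound, and summed over
  all intervals it also bounds the difference between the sum and the integral.\<close>

lemma slowly_varying:
 fixes f F :: "real \<Rightarrow> complex"
 assumes f': "\<And>x. x \<ge> 1 \<Longrightarrow> (f has_vector_derivative f' x) (at x)"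
  and D: "\<And>x. x \<ge> 1 \<Longrightarrow> norm (f' x) \<le> D / (x * sqrt x)" and f1: "norm (f 1) \<le> D"
 shows "\<And>k. k \<ge> 1 \<Longrightarrow> norm (f (real (Suc k)) - f (real k)) \<le> D / (real k * sqrt (real k))"
  and "\<lbrakk>\<And>x. x \<ge> 1 \<Longrightarrow> (F has_vector_derivative f x) (at x); N \<ge> 1\<rbrakk> \<Longrightarrow>
   norm ((\<Sum>k=1..N. f (real k)) - (F (real N) - F 1)) \<le> D * (1 + 2 * zeta32)"
proof -
 have D0: "D \<ge> 0" using order_trans[OF norm_ge_zero f1] .
 have var: "norm (f y - f (real k)) \<le> D / (real k * sqrt (real k))"
  if k: "k \<ge> 1" and y: "real k \<le> y" "y \<le> real k + 1" for k y
 proof (cases "y = real k")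
  case False
  have "norm (f y - f (real k)) \<le> (D / (real k * sqrt (real k))) * y - (D / (real k * sqrt (real k))) * real k"
  proof (rule differentiable_bound_general[where \<phi>="\<lambda>y. (D / (real k * sqrt (real k))) * y" and f'=f' and \<phi>'="\<lambda>_. D / (real k * sqrt (real k))"])
   show "real k < y" using y False by simp
   show "continuous_on {real k..y} f"
    by (intro continuous_at_imp_continuous_on ballI has_vector_derivative_continuous[OF f']) (use k in auto)
   show "continuous_on {real k..y} (\<lambda>y. (D / (real k * sqrt (real k))) * y)" by (intro continuous_intros)
   fix x assume x: "real k < x" "x < y"
   show "(f has_vector_derivative f' x) (at x)" using f' x k by simp
   show "((\<lambda>y. (D / (real k * sqrt (real k))) * y) has_vector_derivative D / (real k * sqrt (real k))) (at x)"
    using has_real_derivative_iff_has_vector_derivative DERIV_cmult_Id by blast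
   have "norm (f' x) \<le> D / (x * sqrt x)" using D x k by simp
   also have "\<dots> \<le> D / (real k * sqrt (real k))"
    using x k D0 by (intro divide_left_mono mult_mono) auto
   finally show "norm (f' x) \<le> D / (real k * sqrt (real k))" .
  qed
  also have "\<dots> = D / (real k * sqrt (real k)) * (y - real k)" by (simp add: right_diff_distrib)
  also have "\<dots> \<le> D / (real k * sqrt (real k)) * 1" using y D0 by (intro mult_left_mono) auto
  finally show ?thesis by simp
 qed (use D0 in simp)
 show diff: "norm (f (real (Suc k)) - f (real k)) \<le> D / (real k * sqrt (real k))" if "k \<ge> 1" for k
  using var[OF that, of "real (Suc k)"] by simp
 assume F: "\<And>x. x \<ge> 1 \<Longrightarrow> (F has_vector_derivative f x) (at x)" and N: "N \<ge> 1"
 have step: "norm (F (real (Suc k)) - F (real k) - f (real k)) \<le> D / (real k * sqrt (real k))" if k: "k \<ge> 1" for k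
 proof -
  have "norm (F (real (Suc k)) - F (real k) - (real (Suc k) - real k) *\<^sub>R f (real k))
    \<le> norm (real (Suc k) - real k) * (D / (real k * sqrt (real k)))"
  proof (rule vector_differentiable_bound_linearization[where S="{real k..real (Suc k)}"])
   fix x assume x: "x \<in> {real k..real (Suc k)}"
   then show "(F has_vector_derivative f x) (at x within {real k..real (Suc k)})"
    using k by (intro has_vector_derivative_at_within[OF F]) auto
   show "norm (f x - f (real k)) \<le> D / (real k * sqrt (real k))" using var[OF k] x by simp
  qed (auto simp: closed_segment_eq_real_ivl)
  then show ?thesis by simp
 qed
 have "norm ((\<Sum>k=1..<N. f (real k)) - (F (real N) - F 1)) \<le> D * zeta32"
 proof -
  have "F (real N) - F 1 = (\<Sum>k=1..<N. F (real (Suc k)) - F (real k))"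
   using sum_Suc_diff'[of 1 N "\<lambda>k. F (real k)"] N by simp
  then have "(\<Sum>k=1..<N. f (real k)) - (F (real N) - F 1) = - (\<Sum>k=1..<N. F (real (Suc k)) - F (real k) - f (real k))"
   by (simp add: sum_subtractf)
  then have "norm ((\<Sum>k=1..<N. f (real k)) - (F (real N) - F 1)) \<le> (\<Sum>k=1..<N. D * (1 / (real k * sqrt (real k))))"
   using step by (simp only: norm_minus_cancel) (intro sum_norm_le, simp)
  also have "\<dots> \<le> D * zeta32"
   unfolding sum_distrib_left[symmetric] using D0 by (intro mult_left_mono sum_three_halves_le) auto
  finally show ?thesis .
 qed
 moreover have "norm (f (real N)) \<le> D * (1 + zeta32)"
  by (rule telescoping_norm_bound(1)[where f="\<lambda>k. f (real k)"]) (use diff f1 N in auto)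
 moreover have "(\<Sum>k=1..N. f (real k)) - (F (real N) - F 1) = ((\<Sum>k=1..<N. f (real k)) - (F (real N) - F 1)) + f (real N)"
  using N by (simp add: atLeastLessThanSuc_atLeastAtMost[symmetric] del: atLeastLessThanSuc_atLeastAtMost)
 ultimately show "norm ((\<Sum>k=1..N. f (real k)) - (F (real N) - F 1)) \<le> D * (1 + 2 * zeta32)"
  using norm_triangle_ineq[of "(\<Sum>k=1..<N. f (real k)) - (F (real N) - F 1)" "f (real N)"]
  by (simp add: algebra_simps)
qed

text \<open>Here \<open>cis (\<xi> * ln x)\<close> is the imaginary power of \<open>x\<close> with
  exponent \<open>\<i> * \<xi>\<close>; keeping it as a factor of the derivative makes norms
  immediate.\<close>

lemma cis_ln_mult_has_vector_derivative:
 assumes "0 < x" "(r has_real_derivative r') (at x)"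
 shows "((\<lambda>x. cis (\<xi> * ln x) * of_real (r x)) has_vector_derivative
  cis (\<xi> * ln x) * (complex_of_real r' + \<i> * of_real (\<xi> / x * r x))) (at x)"
proof -
 have "((\<lambda>x. \<xi> * ln x) has_derivative (\<lambda>t. t * (\<xi> / x))) (at x)"
  using assms(1) by (auto intro!: derivative_eq_intros simp: divide_simps)
 from has_derivative_cis[OF this]
 have 1: "((\<lambda>x. cis (\<xi> * ln x)) has_vector_derivative complex_of_real (\<xi> / x) * (\<i> * cis (\<xi> * ln x))) (at x)"
  by (simp add: has_vector_derivative_def scaleR_conv_of_real mult_ac)
 have 2: "((\<lambda>x. complex_of_real (r x)) has_vector_derivative complex_of_real r') (at x)"
  using assms(2) by (intro has_vector_derivative_of_real)
   (simp add: has_real_derivative_iff_has_vector_derivative)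
 show ?thesis
  using has_vector_derivative_mult[OF 1 2] by (simp add: algebra_simps)
qed

lemma norm_cis_ln_deriv_le:
 "norm (cis a * (complex_of_real r' + \<i> * of_real b)) \<le> \<bar>r'\<bar> + \<bar>b\<bar>"
proof -
 have "norm (complex_of_real r' + \<i> * of_real b) \<le> norm (complex_of_real r') + norm (\<i> * of_real b)"
  by (rule norm_triangle_ineq)
 then show ?thesis by (simp add: norm_mult)
qed

lemma inverse_slowly_varying:
 assumes "x \<ge> (1::real)"
 shows "((\<lambda>x. cis (\<eta> * ln x) * of_real (1 / x)) has_vector_derivative
   cis (\<eta> * ln x) * (complex_of_real (- 1 / x^2) + \<i> * of_real (\<eta> / x * (1 / x)))) (at x)"
  and "norm (cis (\<eta> * ln x) * (complex_of_real (- 1 / x^2) + \<i> * of_real (\<eta> / x * (1 / x)))) \<le> (1 + \<bar>\<eta>\<bar>) / (x * sqrt x)"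
proof -
 show "((\<lambda>x. cis (\<eta> * ln x) * of_real (1 / x)) has_vector_derivative
   cis (\<eta> * ln x) * (complex_of_real (- 1 / x^2) + \<i> * of_real (\<eta> / x * (1 / x)))) (at x)"
  by (rule cis_ln_mult_has_vector_derivative)
   (use assms in \<open>auto intro!: derivative_eq_intros simp: power2_eq_square\<close>)
 have "\<bar>- 1 / x^2\<bar> + \<bar>\<eta> / x * (1 / x)\<bar> = (1 + \<bar>\<eta>\<bar>) / (x * x)"
  using assms by (simp add: abs_mult power2_eq_square add_divide_distrib)
 also have "\<dots> \<le> (1 + \<bar>\<eta>\<bar>) / (x * sqrt x)"
  using assms real_le_lsqrt[of x x] by (intro divide_left_mono mult_left_mono) (auto simp: power2_eq_square)
 finally show "norm (cis (\<eta> * ln x) * (complex_of_real (- 1 / x^2) + \<i> * of_real (\<eta> / x * (1 / x)))) \<le> (1 + \<bar>\<eta>\<bar>) / (x * sqrt x)"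
  using norm_cis_ln_deriv_le[of "\<eta> * ln x" "- 1 / x^2" "\<eta> / x * (1 / x)"] by linarith
qed

lemma twisted_harmonic_sum_bound:
 assumes "norm z = 1" "z \<noteq> 1"
 shows "norm (\<Sum>k=1..N. z ^ k * (cis (\<eta> * ln (real k)) * of_real (1 / real k)))
  \<le> 2 / norm (1 - z) * ((1 + \<bar>\<eta>\<bar>) * (1 + 2 * zeta32))"
 by (rule oscillating_sum_bound[OF slowly_varying(1)[OF inverse_slowly_varying] _ assms]) auto

lemma harmonic_sum_approx:
 assumes "N \<ge> 1"
 shows "norm ((\<Sum>k=1..N. complex_of_real (1 / real k)) - complex_of_real (ln (real N))) \<le> 1 + 2 * zeta32"
proof -
 have F: "((\<lambda>x. complex_of_real (ln x)) has_vector_derivative cis (0 * ln x) * of_real (1 / x)) (at x)"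
  if "x \<ge> 1" for x :: real
 proof -
  have "(ln has_real_derivative 1 / x) (at x)"
   using that DERIV_ln_divide[of x] by simp
  then have "((\<lambda>x. complex_of_real (ln x)) has_vector_derivative complex_of_real (1 / x)) (at x)"
   by (intro has_vector_derivative_of_real) (simp add: has_real_derivative_iff_has_vector_derivative)
  then show ?thesis by simp
 qed
 show ?thesis
  using slowly_varying(2)[OF inverse_slowly_varying[of _ 0] _ F assms] by simp
qed

text \<open>The primitive is the imaginary power divided by \<open>\<i> * \<eta>\<close>. By
  hypothesis it takes the same value at 1 and at \<open>N\<close>, so no main term remains; this is
  why the frequencies are taken from a lattice.\<close>

lemma modulated_harmonic_sum_bound:
 assumes "N \<ge> 1" "\<eta> \<noteq> 0" "cis (\<eta> * ln (real N)) = 1"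
 shows "norm (\<Sum>k=1..N. cis (\<eta> * ln (real k)) * of_real (1 / real k)) \<le> (1 + \<bar>\<eta>\<bar>) * (1 + 2 * zeta32)"
proof -
 have F: "((\<lambda>x. (cis (\<eta> * ln x) * of_real 1) * (- \<i> / of_real \<eta>)) has_vector_derivative cis (\<eta> * ln x) * of_real (1 / x)) (at x)"
  if "x \<ge> 1" for x :: real
 proof -
  have "((\<lambda>x. cis (\<eta> * ln x) * of_real 1) has_vector_derivative
   cis (\<eta> * ln x) * (complex_of_real 0 + \<i> * of_real (\<eta> / x * 1))) (at x)"
   by (rule cis_ln_mult_has_vector_derivative) (use that in auto)
  from has_vector_derivative_mult_left[OF this, of "- \<i> / of_real \<eta>"]
  show ?thesis using assms(2) that by (simp add: divide_simps mult_ac)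
 qed
 show ?thesis
  using slowly_varying(2)[OF inverse_slowly_varying[of _ \<eta>] _ F assms(1)] assms(3) by simp
qed

section \<open>The Mellin transform of \<open>1/(1+x)\<close>\<close>

text \<open>Logarithmic differentiation of the reflection formula: the product
  \<open>Gamma z * Gamma (1 - z) * sin (pi * z)\<close> is constant on the strip. The identity is
  kept multiplied by the sine to avoid a quotient.\<close>

lemma Digamma_reflection:
 fixes z :: complex
 assumes "0 < Re z" "Re z < 1"
 shows "sin (of_real pi * z) \<noteq> 0" "(Digamma (1 - z) - Digamma z) * sin (of_real pi * z) = of_real pi * cos (of_real pi * z)"
proof -
 define S where "S = {z. 0 < Re z \<and> Re z < 1}"
 have "S = {z. 0 < Re z} \<inter> {z. Re z < 1}" by (auto simp: S_def)
 then have op: "open S" by (auto intro: open_halfspace_Re_gt open_halfspace_Re_lt)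
 have np: "Re u \<le> 0" if "u \<in> \<int>\<^sub>\<le>\<^sub>0" for u :: complex
  using that by (auto elim!: nonpos_Ints_cases)
 have nz: "w \<notin> \<int>\<^sub>\<le>\<^sub>0" "1 - w \<notin> \<int>\<^sub>\<le>\<^sub>0" if "w \<in> S" for w
  using that np[of w] np[of "1 - w"] by (auto simp: S_def)
 have sin_nz: "sin (of_real pi * w) \<noteq> 0" if "w \<in> S" for w
 proof
  assume "sin (of_real pi * w) = 0"
  then have "Gamma w * Gamma (1 - w) = 0" using Gamma_reflection_complex[of w] by simp
  then show False using nz[OF that] by (simp add: Gamma_eq_zero_iff)
 qed
 have const: "Gamma w * Gamma (1 - w) * sin (of_real pi * w) = of_real pi" if "w \<in> S" for w
  using Gamma_reflection_complex[of w] sin_nz[OF that] by simp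
 have zS: "z \<in> S" using assms by (simp add: S_def)
 have d1: "((\<lambda>w. Gamma w * Gamma (1 - w) * sin (of_real pi * w)) has_field_derivative
   Gamma z * Gamma (1 - z) * ((Digamma z - Digamma (1 - z)) * sin (of_real pi * z) + of_real pi * cos (of_real pi * z))) (at z)"
  using nz[OF zS] by (auto intro!: derivative_eq_intros simp: algebra_simps)
 have "((\<lambda>w. Gamma w * Gamma (1 - w) * sin (of_real pi * w)) has_field_derivative 0) (at z)"
  by (rule has_field_derivative_transform_within_open[OF _ op zS]) (auto simp: const)
 from DERIV_unique[OF d1 this]
 have "(Digamma z - Digamma (1 - z)) * sin (of_real pi * z) + of_real pi * cos (of_real pi * z) = 0"
  using nz[OF zS] by (simp add: Gamma_eq_zero_iff)
 then show "(Digamma (1 - z) - Digamma z) * sin (of_real pi * z) = of_real pi * cos (of_real pi * z)"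
  by (simp add: algebra_simps)
 show "sin (of_real pi * z) \<noteq> 0" by (rule sin_nz[OF zS])
qed

text \<open>The even and the odd terms are the sums in the limit formula of the digamma function at
  \<open>s / 2\<close> and \<open>(s + 1) / 2\<close>, and the two divergent logarithms
  cancel.\<close>

lemma alternating_reciprocals_limit:
 fixes s :: complex
 assumes "0 < Re s"
 shows "(\<lambda>M. \<Sum>n<2 * M. (-1) ^ n / (of_nat n + s)) \<longlonglongrightarrow> (Digamma ((s + 1) / 2) - Digamma (s / 2)) / 2"
proof -
 have nz: "s / 2 \<noteq> 0" "(s + 1) / 2 \<noteq> 0" using assms by (auto simp: complex_eq_iff)
 have eq: "(\<Sum>n<2 * M. (-1) ^ n / (of_nat n + s))
   = ((of_real (ln (real M)) - (\<Sum>n<M. inverse ((s + 1) / 2 + of_nat n)))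
    - (of_real (ln (real M)) - (\<Sum>n<M. inverse (s / 2 + of_nat n)))) / 2" for M
 proof -
  have "(\<Sum>n<2 * M. (-1) ^ n / (of_nat n + s)) = (\<Sum>n<M. inverse (s / 2 + of_nat n) / 2 - inverse ((s + 1) / 2 + of_nat n) / 2)"
  proof (induction M)
   case (Suc M)
   have e: "inverse (s / 2 + of_nat M) / 2 = 1 / (of_nat (2 * M) + s)"
    "inverse ((s + 1) / 2 + of_nat M) / 2 = 1 / (of_nat (2 * M + 1) + s)"
   proof -
    have h: "inverse a / 2 = 1 / (2 * a)" for a :: complex by (simp add: inverse_eq_divide)
    show "inverse (s / 2 + of_nat M) / 2 = 1 / (of_nat (2 * M) + s)"
     "inverse ((s + 1) / 2 + of_nat M) / 2 = 1 / (of_nat (2 * M + 1) + s)"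
     unfolding h by (simp_all add: distrib_left add_ac)
   qed
   have "2 * Suc M = Suc (Suc (2 * M))" by simp
   then show ?case using Suc.IH by (simp only: sum.lessThan_Suc e) simp
  qed simp
  then show ?thesis by (simp add: sum_subtractf sum_divide_distrib[symmetric] diff_divide_distrib)
 qed
 show ?thesis unfolding eq
  by (intro tendsto_intros Digamma_LIMSEQ nz) simp
qed

text \<open>The two halves are the Mellin integral of 1/(1 + x) over (0, 1) and, after inversion of
  \<open>x\<close>, over the rest. With \<open>w = s / 2\<close> and \<open>v = (1 - s) / 2\<close>
  the four arguments pair up as \<open>w\<close>, \<open>1 - w\<close> and \<open>v\<close>,
  \<open>1 - v\<close>. Reflection then gives half of \<pi> (cot + tan) at \<pi> w, which is \<pi> /
  sin (\<pi> s).\<close>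

lemma mellin_value:
 fixes \<xi> :: real
 defines "s \<equiv> 1/2 + \<i> * of_real \<xi>"
 shows "(Digamma ((s + 1) / 2) - Digamma (s / 2)) / 2 + (Digamma ((1 - s + 1) / 2) - Digamma ((1 - s) / 2)) / 2
  = of_real (pi / cosh (pi * \<xi>))"
proof -
 define w where "w = s / 2"
 define v where "v = (1 - s) / 2"
 have w: "0 < Re w" "Re w < 1" and v: "0 < Re v" "Re v < 1" by (auto simp: w_def v_def s_def)
 have e: "1 - w = (1 - s + 1) / 2" "1 - v = (s + 1) / 2" by (auto simp: w_def v_def field_simps)
 have piv: "of_real pi * v = of_real pi / 2 - of_real pi * w" by (simp add: v_def w_def field_simps)
 define S where "S = sin (of_real pi * w)"
 define C where "C = cos (of_real pi * w)"
 have vS: "sin (of_real pi * v) = C" "cos (of_real pi * v) = S"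
  unfolding piv S_def C_def by (simp_all add: sin_diff cos_diff sin_of_real cos_of_real)
 have r1: "S \<noteq> 0" "(Digamma (1 - w) - Digamma w) * S = of_real pi * C"
  using Digamma_reflection[OF w] by (auto simp: S_def C_def)
 have r2: "C \<noteq> 0" "(Digamma (1 - v) - Digamma v) * C = of_real pi * S"
  using Digamma_reflection[OF v] unfolding vS by auto
 have SC: "2 * S * C = sin (of_real pi * s)"
  using sin_double[of "of_real pi * w"] by (simp add: S_def C_def w_def)
 have "sin (of_real pi * s) = cos (\<i> * of_real (pi * \<xi>))"
 proof -
  have "of_real pi * s = of_real pi / 2 + \<i> * of_real (pi * \<xi>)" by (simp add: s_def field_simps)
  then show ?thesis
   using sin_cos_eq[of "of_real pi / 2 + \<i> * of_real (pi * \<xi>)"] by simp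
 qed
 also have "\<dots> = of_real (cosh (pi * \<xi>))"
  by (simp add: cosh_conv_cos[symmetric] cosh_def exp_of_real[symmetric] scaleR_conv_of_real del: of_real_mult)
 finally have sinp: "sin (of_real pi * s) = of_real (cosh (pi * \<xi>))" .
 have ch: "cosh (pi * \<xi>) > 0" by (rule cosh_real_pos)
 have one: "S * S + C * C = 1"
  using sin_cos_squared_add[of "of_real pi * w"] by (simp add: S_def C_def power2_eq_square)
 have "Digamma (1 - w) - Digamma w = of_real pi * C / S" "Digamma (1 - v) - Digamma v = of_real pi * S / C"
  using r1 r2 by (simp_all add: field_simps)
 then have "(Digamma (1 - v) - Digamma w) / 2 + (Digamma (1 - w) - Digamma v) / 2 = (of_real pi * C / S + of_real pi * S / C) / 2"
  by (simp add: field_simps)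
 also have "\<dots> = of_real pi * (S * S + C * C) / (2 * S * C)" using r1(1) r2(1) by (simp add: field_simps)
 also have "\<dots> = of_real (pi / cosh (pi * \<xi>))" unfolding one SC sinp by simp
 finally show ?thesis unfolding e by (simp add: w_def v_def)
qed

text \<open>The integrand of the Mellin transform of 1/(1 + x), that is \<open>x\<close> to the
  power \<open>s - 1\<close> divided by \<open>1 + x\<close>, on the line
  \<open>s = 1/2 + \<i> * \<xi>\<close>.\<close>

definition mellin_kernel :: "real \<Rightarrow> real \<Rightarrow> complex" where
 "mellin_kernel \<xi> x = cis (\<xi> * ln x) * of_real (1 / (sqrt x * (1 + x)))"

lemma sqrt_deriv_aux:
 assumes "x > 0"
 shows "((\<lambda>x. 2 * sqrt x) has_vector_derivative 1 / sqrt x) (at x)"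
  "((\<lambda>x. - 2 / sqrt x) has_vector_derivative 1 / (x * sqrt x)) (at x)"
 using assms unfolding has_real_derivative_iff_has_vector_derivative[symmetric]
 by (auto intro!: derivative_eq_intros simp: field_simps)

text \<open>The kernel is dominated by the powers -1/2 and -3/2 of \<open>x\<close>; the first bound
  controls the primitive near 0, the second near infinity.\<close>

lemma primitive_bounds:
 assumes H: "\<And>x. x > 0 \<Longrightarrow> (H has_vector_derivative mellin_kernel \<xi> x) (at x)"
  and xy: "0 < x" "x \<le> y"
 shows "norm (H y - H x) \<le> 2 * sqrt y - 2 * sqrt x" "norm (H y - H x) \<le> 2 / sqrt x - 2 / sqrt y"
proof -
 have nk: "norm (mellin_kernel \<xi> x) \<le> 1 / sqrt x" "norm (mellin_kernel \<xi> x) \<le> 1 / (x * sqrt x)" if "x > 0" for x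
 proof -
  have "norm (mellin_kernel \<xi> x) = 1 / (sqrt x * (1 + x))"
   using that by (simp only: mellin_kernel_def norm_mult norm_cis norm_of_real) simp
  moreover have "1 / (sqrt x * (1 + x)) \<le> 1 / (sqrt x * 1)" "1 / (sqrt x * (1 + x)) \<le> 1 / (sqrt x * x)"
   using that by (intro divide_left_mono mult_left_mono; simp)+
  ultimately show "norm (mellin_kernel \<xi> x) \<le> 1 / sqrt x" "norm (mellin_kernel \<xi> x) \<le> 1 / (x * sqrt x)"
   by (simp_all add: mult.commute)
 qed
 have cH: "continuous_on {x..y} H"
  by (intro continuous_at_imp_continuous_on ballI has_vector_derivative_continuous[OF H]) (use xy in auto)
 have "norm (H y - H x) \<le> 2 * sqrt y - 2 * sqrt x \<and> norm (H y - H x) \<le> (- 2 / sqrt y) - (- 2 / sqrt x)"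
 proof (cases "x = y")
  case False
  then have "x < y" using xy by simp
  show ?thesis
  proof
   show "norm (H y - H x) \<le> 2 * sqrt y - 2 * sqrt x"
    by (rule differentiable_bound_general[OF \<open>x < y\<close> cH _ H sqrt_deriv_aux(1) nk(1)])
     (use xy in \<open>auto intro!: continuous_intros\<close>)
   show "norm (H y - H x) \<le> (- 2 / sqrt y) - (- 2 / sqrt x)"
    by (rule differentiable_bound_general[OF \<open>x < y\<close> cH _ H sqrt_deriv_aux(2) nk(2)])
     (use xy in \<open>auto intro!: continuous_intros\<close>)
  qed
 qed auto
 then show "norm (H y - H x) \<le> 2 * sqrt y - 2 * sqrt x" "norm (H y - H x) \<le> 2 / sqrt x - 2 / sqrt y" by auto
qed

text \<open>Improper integrals are replaced by boundary values of a primitive: \<open>L\<close> is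
  its limit at 0, so \<open>H 1 - L\<close> stands for the integral over (0, 1). The alternating
  geometric series of 1/(1 + x), integrated term by term, gives the reciprocals.\<close>

lemma primitive_at_zero:
 assumes H: "\<And>x. x > 0 \<Longrightarrow> (H has_vector_derivative mellin_kernel \<xi> x) (at x)"
 obtains L where "\<And>x. x > 0 \<Longrightarrow> norm (H x - L) \<le> 2 * sqrt x"
  "(\<lambda>M. \<Sum>n<M. (-1) ^ n / (of_nat n + (1/2 + \<i> * of_real \<xi>))) \<longlonglongrightarrow> H 1 - L"
proof -
 \<comment> \<open>The square roots of these points are exactly \<open>1 / (n + 1)\<close>, the
   scale on which \<open>H\<close> varies near 0.\<close>
 define e where "e n = 1 / (real (Suc n))^2" for n
 have e0: "e n > 0" "sqrt (e n) = 1 / real (Suc n)" for n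
  by (simp_all add: e_def real_sqrt_divide del: of_nat_Suc)
 have e_lim: "(\<lambda>n. sqrt (e n)) \<longlonglongrightarrow> 0"
  unfolding e0(2) using LIMSEQ_inverse_real_of_nat by (simp add: inverse_eq_divide)
 have e_lim': "e \<longlonglongrightarrow> 0"
 proof -
  have "(\<lambda>n. (sqrt (e n))^2) \<longlonglongrightarrow> 0^2" by (intro tendsto_intros e_lim)
  moreover have "(sqrt (e n))^2 = e n" for n using e0(1)[of n] by simp
  ultimately show ?thesis by simp
 qed
 have e_mono: "e m \<le> e n" if "n \<le> m" for n m
  unfolding e_def using that by (intro divide_left_mono power_mono mult_pos_pos) auto
 have "Cauchy (\<lambda>n. H (e n))"
 proof (rule metric_CauchyI)
  fix d :: real assume "d > 0"
  then have "\<forall>\<^sub>F n in sequentially. 2 * sqrt (e n) < d"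
   using order_tendstoD(2)[OF tendsto_mult[OF tendsto_const[of 2] e_lim], of d] by simp
  then obtain n0 where n0: "\<And>n. n \<ge> n0 \<Longrightarrow> 2 * sqrt (e n) < d" by (auto simp: eventually_sequentially)
  have "norm (H (e n) - H (e m)) < d" if "n0 \<le> n" "n \<le> m" for n m
  proof -
   have "norm (H (e n) - H (e m)) \<le> 2 * sqrt (e n) - 2 * sqrt (e m)"
    by (rule primitive_bounds(1)[OF H e0(1) e_mono[OF that(2)]])
   also have "\<dots> < d" using n0[OF that(1)] e0(1)[of m] by (smt (verit) real_sqrt_ge_zero)
   finally show ?thesis .
  qed
  then show "\<exists>M. \<forall>m\<ge>M. \<forall>n\<ge>M. dist (H (e m)) (H (e n)) < d"
   by (metis dist_norm dist_commute nle_le)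
 qed
 then obtain L where L: "(\<lambda>n. H (e n)) \<longlonglongrightarrow> L" by (auto simp: Cauchy_convergent_iff convergent_def)
 have small: "\<forall>\<^sub>F n in sequentially. e n < x" if "x > 0" for x
  using order_tendstoD(2)[OF e_lim' that] .
 show ?thesis
 proof (rule that)
  show "norm (H x - L) \<le> 2 * sqrt x" if x: "x > 0" for x
  proof (rule tendsto_le[OF _ tendsto_const])
   show "(\<lambda>n. norm (H x - H (e n))) \<longlonglongrightarrow> norm (H x - L)" by (intro tendsto_intros L)
   show "\<forall>\<^sub>F n in sequentially. norm (H x - H (e n)) \<le> 2 * sqrt x"
    using small[OF x]
   proof eventually_elim
    case (elim n)
    show ?case using primitive_bounds(1)[OF H e0(1), of n x] elim e0(1)[of n] by (smt (verit) real_sqrt_ge_zero)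
   qed
  qed simp
  define s where "s = 1/2 + \<i> * of_real \<xi>"
  have s_nz: "of_nat n + s \<noteq> 0" for n by (auto simp: s_def complex_eq_iff)
  \<comment> \<open>The primitive of the \<open>n\<close>-th term of the series: the power
    \<open>n + s\<close> of \<open>x\<close> divided by \<open>n + s\<close>.\<close>
  define p where "p n x = cis (\<xi> * ln x) * of_real (x ^ n * sqrt x) / (of_nat n + s)" for n and x :: real
  have p': "(p n has_vector_derivative cis (\<xi> * ln x) * of_real (x ^ n / sqrt x)) (at x)" if "x > 0" for n x
  proof -
   have "((\<lambda>x. x ^ n * sqrt x) has_real_derivative (real n + 1/2) * (x ^ n / sqrt x)) (at x)"
   proof -
    have "((\<lambda>x. x ^ n * sqrt x) has_real_derivative real n * x ^ (n - 1) * sqrt x + x ^ n * (inverse (sqrt x) / 2)) (at x)"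
     using that by (auto intro!: derivative_eq_intros)
    moreover have "real n * x ^ (n - 1) * sqrt x = real n * (x ^ n / sqrt x)"
    proof (cases n)
     case (Suc m)
     have "x ^ n / sqrt x = x ^ m * (x / sqrt x)" by (simp add: Suc)
     then show ?thesis using that by (simp add: Suc real_div_sqrt)
    qed simp
    moreover have "x ^ n * (inverse (sqrt x) / 2) = 1/2 * (x ^ n / sqrt x)"
     by (simp only: divide_inverse mult_1_left mult_ac)
    ultimately show ?thesis by (simp only: distrib_right)
   qed
   note der = cis_ln_mult_has_vector_derivative[OF that this, of \<xi>]
   define q where "q = x ^ n / sqrt x"
   have "\<xi> / x * (x ^ n * sqrt x) = \<xi> / x * (x ^ n * (x / sqrt x))"
    using that by (simp only: real_div_sqrt[OF less_imp_le])
   also have "\<dots> = \<xi> * q" using that by (simp add: q_def)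
   finally have c: "\<xi> / x * (x ^ n * sqrt x) = \<xi> * q" .
   have "complex_of_real ((real n + 1/2) * q) + \<i> * of_real (\<xi> * q) = complex_of_real q * (of_nat n + s)"
    by (simp add: s_def algebra_simps)
   with der have "((\<lambda>x. cis (\<xi> * ln x) * of_real (x ^ n * sqrt x)) has_vector_derivative
    cis (\<xi> * ln x) * (complex_of_real q * (of_nat n + s))) (at x)"
    unfolding c q_def[symmetric] by simp
   then have "((\<lambda>x. cis (\<xi> * ln x) * of_real (x ^ n * sqrt x)) has_vector_derivative
    cis (\<xi> * ln x) * of_real (x ^ n / sqrt x) * (of_nat n + s)) (at x)"
    unfolding q_def by (simp only: mult.assoc)
   from has_vector_derivative_divide[OF this, of "of_nat n + s"] show ?thesis
    unfolding p_def using s_nz[of n] by simp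
  qed
  \<comment> \<open>The remainder after \<open>M\<close> terms. Its derivative is the kernel times
    \<open>(- x) ^ M\<close>, of modulus at most \<open>x\<close> to the power
    \<open>M - 1/2\<close>, which integrates to \<open>1 / (M + 1/2)\<close> over (0, 1).\<close>
  define Q where "Q M x = H x - (\<Sum>n<M. (-1) ^ n * p n x)" for M x
  have Q': "(Q M has_vector_derivative mellin_kernel \<xi> x * (- of_real x) ^ M) (at x)" if "x > 0" for M x
  proof -
   have "(Q M has_vector_derivative mellin_kernel \<xi> x - (\<Sum>n<M. (-1) ^ n * (cis (\<xi> * ln x) * of_real (x ^ n / sqrt x)))) (at x)"
    unfolding Q_def
    by (intro has_vector_derivative_diff H that has_vector_derivative_sum has_vector_derivative_mult_right p')
   also have "mellin_kernel \<xi> x - (\<Sum>n<M. (-1) ^ n * (cis (\<xi> * ln x) * of_real (x ^ n / sqrt x)))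
     = mellin_kernel \<xi> x * (- of_real x) ^ M"
   proof -
    have "mellin_kernel \<xi> x * (1 + of_real x) = cis (\<xi> * ln x) * of_real (1 / sqrt x)"
    proof -
     have "1 / (sqrt x * (1 + x)) * (1 + x) = 1 / sqrt x" using that by simp
     moreover have "1 + complex_of_real x = complex_of_real (1 + x)" by simp
     ultimately show ?thesis by (simp only: mellin_kernel_def mult.assoc of_real_mult[symmetric])
    qed
    note k = this
    have "(-1) ^ n * (cis (\<xi> * ln x) * of_real (x ^ n / sqrt x))
      = cis (\<xi> * ln x) * of_real (1 / sqrt x) * (- of_real x) ^ n" for n
    proof -
     have "(- complex_of_real x) ^ n = (-1) ^ n * of_real x ^ n" by (rule power_minus)
     moreover have "complex_of_real (x ^ n / sqrt x) = complex_of_real (1 / sqrt x) * of_real x ^ n" by simp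
     ultimately show ?thesis by (simp only: mult_ac)
    qed
    then have "(\<Sum>n<M. (-1) ^ n * (cis (\<xi> * ln x) * of_real (x ^ n / sqrt x)))
      = mellin_kernel \<xi> x * ((1 + of_real x) * (\<Sum>n<M. (- of_real x) ^ n))"
     by (simp only: sum_distrib_left[symmetric] k[symmetric] mult.assoc)
    also have "(1 + of_real x) * (\<Sum>n<M. (- of_real x) ^ n) = 1 - (- complex_of_real x) ^ M"
     using sum_gp_basic[of "- complex_of_real x"] one_diff_power_eq[of "- complex_of_real x" M] by simp
    finally show ?thesis by (simp add: algebra_simps)
   qed
   finally show ?thesis .
  qed
  have Qbd: "norm (Q M 1 - Q M x) \<le> 1 / (real M + 1/2)" if x: "0 < x" "x < 1" for M x
  proof -
   define c where "c = real M + 1/2"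
   have c0: "c > 0" by (simp add: c_def)
   have "norm (Q M 1 - Q M x) \<le> 1 powr c / c - x powr c / c"
   proof (rule differentiable_bound_general[OF x(2), where \<phi>="\<lambda>x. x powr c / c" and \<phi>'="\<lambda>x. x powr (c - 1)"])
    show "continuous_on {x..1} (Q M)"
     by (intro continuous_at_imp_continuous_on ballI has_vector_derivative_continuous[OF Q']) (use x in auto)
    show "continuous_on {x..1} (\<lambda>x. x powr c / c)" using x c0 by (auto intro!: continuous_intros)
    fix y assume y: "x < y" "y < 1"
    then have "y > 0" using x by simp
    then show "(Q M has_vector_derivative mellin_kernel \<xi> y * (- of_real y) ^ M) (at y)" by (rule Q')
    show "((\<lambda>x. x powr c / c) has_vector_derivative y powr (c - 1)) (at y)"
     unfolding has_real_derivative_iff_has_vector_derivative[symmetric]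
     using \<open>y > 0\<close> c0 by (auto intro!: derivative_eq_intros)
    have "y powr (c - 1) = y powr real M * y powr (- (1/2))"
     by (simp add: c_def powr_add[symmetric])
    then have pw: "y powr (c - 1) = y ^ M / sqrt y"
     by (simp only: powr_realpow[OF \<open>y > 0\<close>] powr_minus powr_half_sqrt[OF less_imp_le[OF \<open>y > 0\<close>]])
      (simp only: divide_inverse)
    have "norm (mellin_kernel \<xi> y * (- of_real y) ^ M) = y ^ M / (sqrt y * (1 + y))"
     using \<open>y > 0\<close> by (simp only: mellin_kernel_def norm_mult norm_power norm_cis norm_of_real norm_minus_cancel) simp
    also have "\<dots> \<le> y ^ M / (sqrt y * 1)"
     using \<open>y > 0\<close> by (intro divide_left_mono mult_left_mono mult_pos_pos) auto
    finally show "norm (mellin_kernel \<xi> y * (- of_real y) ^ M) \<le> y powr (c - 1)" by (simp add: pw)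
   qed
   also have "\<dots> \<le> 1 / c" using c0 by simp
   finally show ?thesis by (simp add: c_def)
  qed
  have p_lim: "(\<lambda>n. p m (e n)) \<longlonglongrightarrow> 0" for m
  proof (rule Lim_null_comparison)
   show "\<forall>\<^sub>F n in sequentially. norm (p m (e n)) \<le> (e n ^ m * sqrt (e n)) / norm (of_nat m + s)"
    using e0(1) by (intro always_eventually allI) (simp add: p_def norm_mult norm_divide norm_power abs_of_pos less_imp_le)
   have "(\<lambda>n. (e n ^ m * sqrt (e n)) / norm (of_nat m + s)) \<longlonglongrightarrow> (0 ^ m * 0) / norm (of_nat m + s)"
    by (intro tendsto_intros e_lim e_lim') (use s_nz in auto)
   then show "(\<lambda>n. (e n ^ m * sqrt (e n)) / norm (of_nat m + s)) \<longlonglongrightarrow> 0" by simp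
  qed
  have Qe: "(\<lambda>n. Q M (e n)) \<longlonglongrightarrow> L" for M
  proof -
   have "(\<lambda>n. Q M (e n)) \<longlonglongrightarrow> L - (\<Sum>n<M. (-1) ^ n * 0)"
    unfolding Q_def by (intro tendsto_intros L p_lim)
   then show ?thesis by simp
  qed
  have "norm (Q M 1 - L) \<le> 1 / (real M + 1/2)" for M
  proof (rule tendsto_le[OF _ tendsto_const])
   show "(\<lambda>n. norm (Q M 1 - Q M (e n))) \<longlonglongrightarrow> norm (Q M 1 - L)" by (intro tendsto_intros Qe)
   show "\<forall>\<^sub>F n in sequentially. norm (Q M 1 - Q M (e n)) \<le> 1 / (real M + 1/2)"
    using small[OF zero_less_one] by (rule eventually_mono) (use Qbd e0(1) in auto)
  qed simp
  moreover have "(\<Sum>n<M. (-1) ^ n / (of_nat n + s)) - (H 1 - L) = - (Q M 1 - L)" for M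
   by (simp add: Q_def p_def)
  ultimately have bd: "norm ((\<Sum>n<M. (-1) ^ n / (of_nat n + s)) - (H 1 - L)) \<le> 1 / (real M + 1/2)" for M
   by (simp only: norm_minus_cancel)
  have "(\<lambda>M. (\<Sum>n<M. (-1) ^ n / (of_nat n + s)) - (H 1 - L)) \<longlonglongrightarrow> 0"
   by (rule Lim_null_comparison[OF always_eventually[OF allI[OF bd]]]) real_asymp
  then show "(\<lambda>M. \<Sum>n<M. (-1) ^ n / (of_nat n + (1/2 + \<i> * of_real \<xi>))) \<longlonglongrightarrow> H 1 - L"
   unfolding s_def[symmetric] by (simp add: LIM_zero_iff)
 qed
qed

text \<open>The primitive is normalized to vanish at 0; its limit at infinity is then the whole
  Mellin integral, and both limits come with rates.\<close>

lemma mellin_primitive: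
 obtains G where "\<And>x. x > 0 \<Longrightarrow> (G has_vector_derivative mellin_kernel \<xi> x) (at x)"
  "\<And>x. x > 0 \<Longrightarrow> norm (G x) \<le> 2 * sqrt x"
  "\<And>x. x > 0 \<Longrightarrow> norm (G x - complex_of_real (pi / cosh (pi * \<xi>))) \<le> 2 / sqrt x"
proof -
 have "\<exists>H. \<forall>x::real. (0::ereal) < ereal x \<longrightarrow> ereal x < \<infinity> \<longrightarrow> (H has_vector_derivative mellin_kernel \<xi> x) (at x)"
 proof (rule einterval_antiderivative)
  fix x :: real assume "0 < ereal x"
  then have x: "x > 0" by simp
  have "continuous_on {0<..} (mellin_kernel \<xi>)"
   unfolding mellin_kernel_def by (intro continuous_intros) auto
  then show "isCont (mellin_kernel \<xi>) x"
   by (rule continuous_on_interior) (use x in \<open>simp add: interior_open\<close>)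
 qed simp
 then obtain H where H: "\<And>x. x > 0 \<Longrightarrow> (H has_vector_derivative mellin_kernel \<xi> x) (at x)" by auto
 obtain L0 where L0: "\<And>x. x > 0 \<Longrightarrow> norm (H x - L0) \<le> 2 * sqrt x"
  "(\<lambda>M. \<Sum>n<M. (-1) ^ n / (of_nat n + (1/2 + \<i> * of_real \<xi>))) \<longlonglongrightarrow> H 1 - L0"
  using primitive_at_zero[OF H] by blast
 \<comment> \<open>Inversion turns \<open>H\<close> into a primitive for the frequency
   \<open>- \<xi>\<close>, so the behaviour of \<open>H\<close> at infinity is that of
   \<open>K\<close> at 0.\<close>
 define K where "K x = - H (1 / x)" for x
 have K: "(K has_vector_derivative mellin_kernel (- \<xi>) x) (at x)" if "x > 0" for x
 proof -
  have "((\<lambda>x. 1 / x) has_real_derivative - 1 / x^2) (at x)"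
   using that by (auto intro!: derivative_eq_intros simp: power2_eq_square)
  then have "((\<lambda>x. 1 / x) has_vector_derivative - 1 / x^2) (at x)"
   by (simp add: has_real_derivative_iff_has_vector_derivative)
  from vector_diff_chain_at[OF this, of H "mellin_kernel \<xi> (1 / x)"] H[of "1 / x"] that
  have "((\<lambda>x. H (1 / x)) has_vector_derivative (- 1 / x^2) *\<^sub>R mellin_kernel \<xi> (1 / x)) (at x)"
   by (simp add: o_def)
  then have "(K has_vector_derivative - ((- 1 / x^2) *\<^sub>R mellin_kernel \<xi> (1 / x))) (at x)"
   unfolding K_def by (rule has_vector_derivative_minus)
  moreover have "- ((- 1 / x^2) *\<^sub>R mellin_kernel \<xi> (1 / x)) = mellin_kernel (- \<xi>) x"
  proof -
   have "1 / x^2 * (1 / (sqrt (1 / x) * (1 + 1 / x))) = 1 / (sqrt x * (1 + x))"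
   proof -
    have "x^2 * (sqrt (1 / x) * (1 + 1 / x)) = (x / sqrt x) * (x + 1)"
     using that by (simp add: real_sqrt_divide power2_eq_square field_simps)
    then have "x^2 * (sqrt (1 / x) * (1 + 1 / x)) = sqrt x * (1 + x)"
     using that by (simp add: real_div_sqrt add.commute)
    then show ?thesis by (simp only: times_divide_times_eq mult_1_left)
   qed
   moreover have "- ((- 1 / x^2) *\<^sub>R mellin_kernel \<xi> (1 / x))
     = cis (\<xi> * ln (1 / x)) * of_real (1 / x^2 * (1 / (sqrt (1 / x) * (1 + 1 / x))))"
    by (simp only: mellin_kernel_def scaleR_conv_of_real of_real_mult) simp
   ultimately show ?thesis using that by (simp only: mellin_kernel_def) (simp add: ln_div)
  qed
  ultimately show ?thesis by simp
 qed
 obtain L1 where L1: "\<And>x. x > 0 \<Longrightarrow> norm (K x - L1) \<le> 2 * sqrt x"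
  "(\<lambda>M. \<Sum>n<M. (-1) ^ n / (of_nat n + (1/2 + \<i> * of_real (- \<xi>)))) \<longlonglongrightarrow> K 1 - L1"
  using primitive_at_zero[OF K] by blast
 define s where "s = 1/2 + \<i> * of_real \<xi>"
 have s': "1 - s = 1/2 + \<i> * of_real (- \<xi>)" by (simp add: s_def)
 have sub: "strict_mono (\<lambda>M::nat. 2 * M)" by (simp add: strict_mono_def)
 have "H 1 - L0 = (Digamma ((s + 1) / 2) - Digamma (s / 2)) / 2"
 proof (rule LIMSEQ_unique)
  show "(\<lambda>M. \<Sum>n<2 * M. (-1) ^ n / (of_nat n + s)) \<longlonglongrightarrow> H 1 - L0"
   using LIMSEQ_subseq_LIMSEQ[OF L0(2) sub] by (simp add: o_def s_def)
  show "(\<lambda>M. \<Sum>n<2 * M. (-1) ^ n / (of_nat n + s)) \<longlonglongrightarrow> (Digamma ((s + 1) / 2) - Digamma (s / 2)) / 2"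
   by (rule alternating_reciprocals_limit) (simp add: s_def)
 qed
 moreover have "K 1 - L1 = (Digamma ((1 - s + 1) / 2) - Digamma ((1 - s) / 2)) / 2"
 proof (rule LIMSEQ_unique)
  show "(\<lambda>M. \<Sum>n<2 * M. (-1) ^ n / (of_nat n + (1 - s))) \<longlonglongrightarrow> K 1 - L1"
   using LIMSEQ_subseq_LIMSEQ[OF L1(2) sub] unfolding s'[symmetric] by (simp add: o_def)
  show "(\<lambda>M. \<Sum>n<2 * M. (-1) ^ n / (of_nat n + (1 - s))) \<longlonglongrightarrow> (Digamma ((1 - s + 1) / 2) - Digamma ((1 - s) / 2)) / 2"
   by (rule alternating_reciprocals_limit) (simp add: s_def)
 qed
 ultimately have "(H 1 - L0) + (K 1 - L1) = of_real (pi / cosh (pi * \<xi>))"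
  using mellin_value[of \<xi>] by (simp only: s_def)
 moreover have "- L1 - L0 = (H 1 - L0) + (K 1 - L1)" by (simp add: K_def)
 ultimately have val: "- L1 - L0 = of_real (pi / cosh (pi * \<xi>))" by (simp only:)
 show ?thesis
 proof (rule that[of "\<lambda>x. H x - L0"])
  fix x :: real assume x: "x > 0"
  show "((\<lambda>x. H x - L0) has_vector_derivative mellin_kernel \<xi> x) (at x)"
   using has_vector_derivative_diff_const[of H L0] H[OF x] by simp
  show "norm (H x - L0) \<le> 2 * sqrt x" by (rule L0(1)[OF x])
  have "H x - L0 - of_real (pi / cosh (pi * \<xi>)) = - (K (1 / x) - L1)"
   unfolding val[symmetric] using x by (simp add: K_def)
  then show "norm (H x - L0 - of_real (pi / cosh (pi * \<xi>))) \<le> 2 / sqrt x"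
   using L1(1)[of "1 / x"] x by (simp add: real_sqrt_divide norm_minus_commute del: of_real_divide)
 qed
qed

text \<open>In the application \<open>c\<close> is a row index of the matrix. The factor
  \<open>1 / c\<close> in the bound makes the errors of all rows square summable.\<close>

lemma hilbert_kernel_slowly_varying:
 fixes c x :: real
 assumes "x \<ge> 1" "c \<ge> 1"
 shows "((\<lambda>x. cis (\<xi> * ln x) * of_real (1 / (sqrt x * (c + x)))) has_vector_derivative
   cis (\<xi> * ln x) * (complex_of_real (- (1 / (2 * x) + 1 / (c + x)) * (1 / (sqrt x * (c + x)))) + \<i> * of_real (\<xi> / x * (1 / (sqrt x * (c + x)))))) (at x)"
  and "norm (cis (\<xi> * ln x) * (complex_of_real (- (1 / (2 * x) + 1 / (c + x)) * (1 / (sqrt x * (c + x)))) + \<i> * of_real (\<xi> / x * (1 / (sqrt x * (c + x))))))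
   \<le> ((2 + \<bar>\<xi>\<bar>) / c) / (x * sqrt x)"
proof -
 define r where "r = 1 / (sqrt x * (c + x))"
 have r: "r \<ge> 0" using assms by (simp add: r_def)
 have "((\<lambda>x. 1 / (sqrt x * (c + x))) has_real_derivative - (inverse (sqrt x) / 2 * (c + x) + sqrt x) / (sqrt x * (c + x))^2) (at x)"
  using assms by (auto intro!: derivative_eq_intros simp: power2_eq_square)
 moreover have "- (inverse (sqrt x) / 2 * (c + x) + sqrt x) / (sqrt x * (c + x))^2 = - (1 / (2 * x) + 1 / (c + x)) * (1 / (sqrt x * (c + x)))"
 proof -
  have "inverse (sqrt x) / 2 * (c + x) + sqrt x = (1 / (2 * x) + 1 / (c + x)) * (sqrt x * (c + x))"
  proof -
   have "1 / (2 * x) * (sqrt x * (c + x)) = inverse (sqrt x) / 2 * (c + x)"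
   proof -
    have "1 / (2 * x) * sqrt x = inverse (sqrt x) / 2"
     using assms real_div_sqrt[of x] by (simp add: divide_simps)
    then show ?thesis by (simp only: mult.assoc[symmetric])
   qed
   moreover have "1 / (c + x) * (sqrt x * (c + x)) = sqrt x" using assms by simp
   ultimately show ?thesis by (simp only: distrib_right)
  qed
  moreover have "- (w * s) / s^2 = - w * (1 / s)" if "s \<noteq> 0" for w s :: real
   using that by (simp add: power2_eq_square)
  moreover have "sqrt x * (c + x) \<noteq> 0" using assms by simp
  ultimately show ?thesis by (simp only:)
 qed
 ultimately have "((\<lambda>x. 1 / (sqrt x * (c + x))) has_real_derivative - (1 / (2 * x) + 1 / (c + x)) * (1 / (sqrt x * (c + x)))) (at x)"
  by (simp only:)
 from cis_ln_mult_has_vector_derivative[OF _ this, of \<xi>] assms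
 show "((\<lambda>x. cis (\<xi> * ln x) * of_real (1 / (sqrt x * (c + x)))) has_vector_derivative
   cis (\<xi> * ln x) * (complex_of_real (- (1 / (2 * x) + 1 / (c + x)) * (1 / (sqrt x * (c + x)))) + \<i> * of_real (\<xi> / x * (1 / (sqrt x * (c + x)))))) (at x)"
  by simp
 have "\<bar>- (1 / (2 * x) + 1 / (c + x)) * r\<bar> + \<bar>\<xi> / x * r\<bar> = (1 / (2 * x) + 1 / (c + x) + \<bar>\<xi>\<bar> / x) * r"
  using assms r by (simp add: abs_mult abs_minus_commute distrib_right)
 also have "\<dots> \<le> ((2 + \<bar>\<xi>\<bar>) / x) * r"
 proof (rule mult_right_mono[OF _ r])
  have "1 / (2 * x) \<le> 1 / x" "1 / (c + x) \<le> 1 / x" using assms by (auto intro!: divide_left_mono)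
  then show "1 / (2 * x) + 1 / (c + x) + \<bar>\<xi>\<bar> / x \<le> (2 + \<bar>\<xi>\<bar>) / x" by (simp add: add_divide_distrib)
 qed
 also have "\<dots> \<le> ((2 + \<bar>\<xi>\<bar>) / x) * (1 / (sqrt x * c))"
  unfolding r_def using assms by (intro mult_left_mono divide_left_mono) auto
 also have "\<dots> = ((2 + \<bar>\<xi>\<bar>) / c) / (x * sqrt x)" by (simp add: mult_ac)
 finally show "norm (cis (\<xi> * ln x) * (complex_of_real (- (1 / (2 * x) + 1 / (c + x)) * (1 / (sqrt x * (c + x)))) + \<i> * of_real (\<xi> / x * (1 / (sqrt x * (c + x))))))
   \<le> ((2 + \<bar>\<xi>\<bar>) / c) / (x * sqrt x)"
  using norm_cis_ln_deriv_le[of "\<xi> * ln x" "- (1 / (2 * x) + 1 / (c + x)) * r" "\<xi> / x * r"] unfolding r_def by linarith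
qed

lemma twisted_hilbert_sum_bound:
 assumes c: "c \<ge> 1" and z: "norm z = 1" "z \<noteq> 1"
 shows "norm (\<Sum>k=1..N. z ^ k * (cis (\<xi> * ln (real k)) * of_real (1 / (sqrt (real k) * (c + real k)))))
  \<le> 2 / norm (1 - z) * ((2 + \<bar>\<xi>\<bar>) / c * (1 + 2 * zeta32))"
proof (rule oscillating_sum_bound[OF slowly_varying(1)[OF hilbert_kernel_slowly_varying[OF _ c]] _ z])
 have "1 / (1 + c) \<le> (2 + \<bar>\<xi>\<bar>) / c" using c by (intro frac_le) auto
 then show "norm (cis (\<xi> * ln 1) * of_real (1 / (sqrt 1 * (c + 1)))) \<le> (2 + \<bar>\<xi>\<bar>) / c"
  "norm (cis (\<xi> * ln (real 1)) * of_real (1 / (sqrt (real 1) * (c + real 1)))) \<le> (2 + \<bar>\<xi>\<bar>) / c"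
  using c by (simp_all add: norm_divide add.commute del: of_real_add of_real_divide)
qed

text \<open>Scaling by \<open>c\<close> expresses the primitive through \<open>G\<close> at
  \<open>x / c\<close>. The integral from 1 to \<open>N\<close> is then the full Mellin integral up
  to its two ends: of order \<open>1 / c\<close> below 1, and at most \<open>2 / sqrt N\<close>
  beyond \<open>N\<close>. Both have bounded square sums over the rows \<open>1\<close> to
  \<open>N\<close>, uniformly in \<open>N\<close>.\<close>

lemma hilbert_sum_approx:
 assumes c: "c \<ge> 1" and N: "N \<ge> 1"
 shows "norm ((\<Sum>k=1..N. cis (\<xi> * ln (real k)) * of_real (1 / (sqrt (real k) * (c + real k))))
   - complex_of_real (pi / cosh (pi * \<xi>)) * (cis (\<xi> * ln c) * of_real (1 / sqrt c)))
  \<le> (2 + \<bar>\<xi>\<bar>) / c * (3 + 2 * zeta32) + 2 / sqrt (real N)"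
proof -
 obtain G where G: "\<And>x. x > 0 \<Longrightarrow> (G has_vector_derivative mellin_kernel \<xi> x) (at x)"
  "\<And>x. x > 0 \<Longrightarrow> norm (G x) \<le> 2 * sqrt x"
  "\<And>x. x > 0 \<Longrightarrow> norm (G x - complex_of_real (pi / cosh (pi * \<xi>))) \<le> 2 / sqrt x"
  using mellin_primitive by blast
 \<comment> \<open>The scaling factor, which is the power \<open>- 1/2 + \<i> * \<xi>\<close> of
   \<open>c\<close>; it is also the \<open>c\<close>-th coordinate of the mode that the matrix
   reproduces.\<close>
 define b where "b = cis (\<xi> * ln c) * of_real (1 / sqrt c)"
 have nb: "norm b = 1 / sqrt c" using c by (simp add: b_def norm_mult norm_divide)
 define F where "F x = b * G (x / c)" for x
 have F: "(F has_vector_derivative cis (\<xi> * ln x) * of_real (1 / (sqrt x * (c + x)))) (at x)" if x: "x \<ge> 1" for x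
 proof -
  have "((\<lambda>x. x / c) has_real_derivative 1 / c) (at x)"
   using c by (auto intro!: derivative_eq_intros)
  then have "((\<lambda>x. x / c) has_vector_derivative 1 / c) (at x)"
   by (simp add: has_real_derivative_iff_has_vector_derivative)
  from vector_diff_chain_at[OF this, of G "mellin_kernel \<xi> (x / c)"] G(1)[of "x / c"] c x
  have "((\<lambda>x. G (x / c)) has_vector_derivative (1 / c) *\<^sub>R mellin_kernel \<xi> (x / c)) (at x)"
   by (simp add: o_def)
  then have "(F has_vector_derivative b * ((1 / c) *\<^sub>R mellin_kernel \<xi> (x / c))) (at x)"
   unfolding F_def by (rule has_vector_derivative_mult_right)
  moreover have "b * ((1 / c) *\<^sub>R mellin_kernel \<xi> (x / c)) = cis (\<xi> * ln x) * of_real (1 / (sqrt x * (c + x)))"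
  proof -
   have "1 / sqrt c * (1 / c * (1 / (sqrt (x / c) * (1 + x / c)))) = 1 / (sqrt x * (c + x))"
   proof -
    have "sqrt c * (c * (sqrt (x / c) * (1 + x / c))) = (sqrt c * sqrt (x / c)) * (c * (1 + x / c))" by (simp only: mult_ac)
    also have "sqrt c * sqrt (x / c) = sqrt x" using c by (simp add: real_sqrt_mult[symmetric])
    also have "c * (1 + x / c) = c + x" using c by (simp add: distrib_left)
    finally show ?thesis by (simp only: times_divide_times_eq mult_1_left)
   qed
   moreover have "cis (\<xi> * ln c) * cis (\<xi> * ln (x / c)) = cis (\<xi> * ln x)"
    using c x by (simp add: cis_mult ln_div algebra_simps)
   moreover have "b * ((1 / c) *\<^sub>R mellin_kernel \<xi> (x / c))
     = (cis (\<xi> * ln c) * cis (\<xi> * ln (x / c))) * of_real (1 / sqrt c * (1 / c * (1 / (sqrt (x / c) * (1 + x / c)))))"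
    by (simp only: b_def mellin_kernel_def scaleR_conv_of_real of_real_mult mult_ac)
   ultimately show ?thesis by (simp only:)
  qed
  ultimately show ?thesis by simp
 qed
 define D where "D = (2 + \<bar>\<xi>\<bar>) / c"
 have "1 / (1 + c) \<le> D" unfolding D_def using c by (intro frac_le) auto
 then have f1: "norm (cis (\<xi> * ln 1) * of_real (1 / (sqrt 1 * (c + 1)))) \<le> D"
  using c by (simp add: norm_divide add.commute del: of_real_add of_real_divide)
 have 1: "norm ((\<Sum>k=1..N. cis (\<xi> * ln (real k)) * of_real (1 / (sqrt (real k) * (c + real k)))) - (F (real N) - F 1)) \<le> D * (1 + 2 * zeta32)"
  by (rule slowly_varying(2)[where f="\<lambda>x. cis (\<xi> * ln x) * of_real (1 / (sqrt x * (c + x)))" and F=F and D=D,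
     OF hilbert_kernel_slowly_varying(1)[where \<xi>=\<xi>, OF _ c] hilbert_kernel_slowly_varying(2)[where \<xi>=\<xi>, OF _ c, folded D_def] f1 F N])
 have "norm (F 1) \<le> 1 / sqrt c * (2 * sqrt (1 / c))"
  unfolding F_def norm_mult nb using G(2)[of "1 / c"] c by (intro mult_left_mono) auto
 also have "\<dots> = 2 / c" using c by (simp add: real_sqrt_divide)
 also have "\<dots> \<le> D" unfolding D_def using c by (intro divide_right_mono) auto
 finally have 2: "norm (F 1) \<le> D" .
 have D0: "D \<ge> 0" using 2 norm_ge_zero order_trans by blast
 have "norm (F (real N) - complex_of_real (pi / cosh (pi * \<xi>)) * b) = norm b * norm (G (real N / c) - complex_of_real (pi / cosh (pi * \<xi>)))"
  by (simp only: norm_mult[symmetric] F_def right_diff_distrib mult.commute)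
 also have "\<dots> \<le> 1 / sqrt c * (2 / sqrt (real N / c))"
  unfolding nb using G(3)[of "real N / c"] c N by (intro mult_left_mono) auto
 also have "\<dots> = 2 / sqrt (real N)" using c N by (simp add: real_sqrt_divide)
 finally have 3: "norm (F (real N) - complex_of_real (pi / cosh (pi * \<xi>)) * b) \<le> 2 / sqrt (real N)" .
 have "norm (S - p) \<le> norm (S - (FN - F1)) + norm (FN - p) + norm F1" for S FN F1 p :: complex
  using norm_triangle_ineq4[of "(S - (FN - F1)) + (FN - p)" F1] norm_triangle_ineq[of "S - (FN - F1)" "FN - p"]
  by (simp add: algebra_simps)
 from order_trans[OF this add_mono[OF add_mono[OF 1 3] 2]]
 show ?thesis unfolding b_def[symmetric] D_def[symmetric] using D0 by (simp add: algebra_simps)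
qed

section \<open>Quasi-modes of truncated Hankel matrices with finitely many jumps\<close>

text \<open>A truncated Hankel matrix of Fourier coefficients of a step function with weights
  \<open>a z\<close> at its jumps. Row and column 0 are left out along with everything beyond
  \<open>N\<close>; their contribution is accounted for with the multiplier remainder.\<close>

definition jump_section :: "(complex \<Rightarrow> complex) \<Rightarrow> complex set \<Rightarrow> nat \<Rightarrow> nat \<Rightarrow> nat \<Rightarrow> complex" where
 "jump_section a Z N j k = (if j \<in> {1..N} \<and> k \<in> {1..N}
  then (\<Sum>z\<in>Z. a z * cnj z ^ (j + k)) / of_real (pi * real (j + k)) else 0)"

abbreviation jump_operator :: "(complex \<Rightarrow> complex) \<Rightarrow> complex set \<Rightarrow> nat \<Rightarrow> ell2 \<Rightarrow> ell2" where
 "jump_operator a Z N \<equiv> matrix_operator (jump_section a Z N)"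

lemma jump_section_hs: "\<exists>S. hs_bound (jump_section a Z N) S"
 by (rule exI, rule hs_bound_finite[where m="Suc N", OF _ order_refl]) (auto simp: jump_section_def)

lemma jump_section_bounded: "bounded_matrix (jump_section a Z N)"
 using jump_section_hs hs_bounded_matrix by blast

lemma jump_section_compact: "compact_operator (jump_operator a Z N)"
 using jump_section_hs hs_compact by blast

lemma coord_matrix_operator_finite:
 assumes a: "bounded_matrix a" and x: "\<And>k. k \<ge> m \<Longrightarrow> coord x k = 0"
 shows "coord (matrix_operator a x) k = (\<Sum>j<m. coord x j * a j k)"
proof -
 have "coord (matrix_operator a (std_basis j)) k = a j k" for j
  using bounded_matrixD(2)[OF a] by (simp only: entry_eq_coord[symmetric])
 then show ?thesis using matrix_operator_finite_support(1)[OF a x] by simp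
qed

text \<open>The divisor normalizes up to an error of order \<open>1 / ln N\<close>, because the
  squared moduli of the numerators are the terms of the harmonic sum.\<close>

definition mode :: "nat \<Rightarrow> complex \<Rightarrow> real \<Rightarrow> ell2" where
 "mode N z \<xi> = Abs_ell2 (\<lambda>j. if j \<in> {1..N}
  then z ^ j * (cis (\<xi> * ln (real j)) * of_real (1 / sqrt (real j))) / of_real (sqrt (ln (real N))) else 0)"

lemma coord_mode: "coord (mode N z \<xi>) j = (if j \<in> {1..N}
  then z ^ j * (cis (\<xi> * ln (real j)) * of_real (1 / sqrt (real j))) / of_real (sqrt (ln (real N))) else 0)"
 unfolding mode_def by (subst coord_Abs) (auto intro!: summable_finite[of "{1..N}"])

lemma mode_support: "k \<ge> Suc N \<Longrightarrow> coord (mode N z \<xi>) k = 0"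
 by (simp add: coord_mode)

lemma cinner_mode:
 assumes "N \<ge> 2"
 shows "cinner (mode N z \<xi>) (mode N w \<eta>)
  = (\<Sum>k=1..N. (z * cnj w) ^ k * (cis ((\<xi> - \<eta>) * ln (real k)) * of_real (1 / real k))) / of_real (ln (real N))"
proof -
 have L: "ln (real N) > 0" using assms by simp
 have sq: "complex_of_real (sqrt x) * of_real (sqrt x) = complex_of_real x" if "x \<ge> 0" for x
  using that by (simp add: of_real_mult[symmetric] del: of_real_mult)
 have "cinner (mode N z \<xi>) (mode N w \<eta>) = (\<Sum>k\<in>{1..N}. coord (mode N z \<xi>) k * cnj (coord (mode N w \<eta>) k))"
  unfolding cinner_def by (rule suminf_finite) (auto simp: coord_mode)
 also have "\<dots> = (\<Sum>k=1..N. (z * cnj w) ^ k * (cis ((\<xi> - \<eta>) * ln (real k)) * of_real (1 / real k)) / of_real (ln (real N)))"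
 proof (rule sum.cong[OF refl])
  fix k assume k: "k \<in> {1..N}"
  have c: "cis (\<xi> * ln (real k)) * cis (- (\<eta> * ln (real k))) = cis ((\<xi> - \<eta>) * ln (real k))"
   by (simp add: cis_mult algebra_simps)
  have "coord (mode N z \<xi>) k * cnj (coord (mode N w \<eta>) k)
    = (z ^ k * cnj w ^ k) * (cis (\<xi> * ln (real k)) * cis (- (\<eta> * ln (real k))))
     / ((complex_of_real (sqrt (real k)) * of_real (sqrt (real k))) * (complex_of_real (sqrt (ln (real N))) * of_real (sqrt (ln (real N)))))"
   using k by (simp add: coord_mode cis_cnj mult_ac)
  also have "\<dots> = (z * cnj w) ^ k * (cis ((\<xi> - \<eta>) * ln (real k)) * of_real (1 / real k)) / of_real (ln (real N))"
   unfolding c using L sq[of "real k"] sq[of "ln (real N)"] by (simp add: power_mult_distrib)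
  finally show "coord (mode N z \<xi>) k * cnj (coord (mode N w \<eta>) k)
   = (z * cnj w) ^ k * (cis ((\<xi> - \<eta>) * ln (real k)) * of_real (1 / real k)) / of_real (ln (real N))" .
 qed
 finally show ?thesis by (simp add: sum_divide_distrib)
qed

lemma unit_mult_cnj: "norm z = 1 \<Longrightarrow> z * cnj z = 1" for z :: complex
 by (simp add: complex_norm_square[symmetric])

lemma unit_mult_cnj_eq_1: "norm z = 1 \<Longrightarrow> norm w = 1 \<Longrightarrow> z * cnj w = 1 \<longleftrightarrow> z = w" for z w :: complex
proof
 assume "norm z = 1" "norm w = 1" "z * cnj w = 1"
 then have "z * (cnj w * w) = w" by (simp add: mult.assoc[symmetric])
 then show "z = w" using unit_mult_cnj[OF \<open>norm w = 1\<close>] by (simp add: mult.commute)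
qed (simp add: unit_mult_cnj)

text \<open>Closure under conjugation is imposed because the matrix sends modes at \<open>z\<close>
  to modes at \<open>cnj z\<close>; points without a jump may be included with weight 0.\<close>

locale jump_data =
 fixes Z :: "complex set"
 assumes fin: "finite Z" and unit: "\<And>z. z \<in> Z \<Longrightarrow> norm z = 1" and cnj_closed: "\<And>z. z \<in> Z \<Longrightarrow> cnj z \<in> Z"
begin

text \<open>The diagonal terms contribute \<open>2 / 0 = 0\<close>.\<close>

definition separation :: real where
 "separation = (\<Sum>z\<in>Z. \<Sum>w\<in>Z. 2 / norm (1 - z * cnj w))"

lemma separation_nonneg: "separation \<ge> 0"
 unfolding separation_def by (intro sum_nonneg) auto

lemma le_separation:
 assumes "z \<in> Z" "w \<in> Z"
 shows "2 / norm (1 - z * cnj w) \<le> separation"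
proof -
 have "2 / norm (1 - z * cnj w) \<le> (\<Sum>w\<in>Z. 2 / norm (1 - z * cnj w))"
  by (rule member_le_sum[OF assms(2)]) (use fin in auto)
 also have "\<dots> \<le> separation"
  unfolding separation_def
  by (rule member_le_sum[OF assms(1), where f="\<lambda>z. \<Sum>w\<in>Z. 2 / norm (1 - z * cnj w)"]) (use fin in \<open>auto intro: sum_nonneg\<close>)
 finally show ?thesis .
qed

text \<open>Three mechanisms: different points oscillate against each other, different lattice
  frequencies at the same point cancel between 1 and \<open>N\<close>, and equal labels give the
  harmonic sum.\<close>

lemma mode_gram:
 assumes N: "N \<ge> 2" and z: "z \<in> Z" "w \<in> Z" and R: "\<bar>\<xi>\<bar> \<le> R" "\<bar>\<eta>\<bar> \<le> R"
  and lat: "cis ((\<xi> - \<eta>) * ln (real N)) = 1"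
 shows "norm (cinner (mode N z \<xi>) (mode N w \<eta>) - (if z = w \<and> \<xi> = \<eta> then 1 else 0))
  \<le> (1 + separation) * (1 + 2 * R) * (1 + 2 * zeta32) / ln (real N)"
proof -
 have L: "ln (real N) > 0" using N by simp
 define S where "S = (\<Sum>k=1..N. (z * cnj w) ^ k * (cis ((\<xi> - \<eta>) * ln (real k)) * of_real (1 / real k)))"
 define e where "e = (if z = w \<and> \<xi> = \<eta> then complex_of_real (ln (real N)) else 0)"
 have d: "1 + \<bar>\<xi> - \<eta>\<bar> \<le> 1 + 2 * R" using R by linarith
 have zt: "1 + 2 * zeta32 \<ge> 0" using zeta32_nonneg by simp
 have R0: "1 + 2 * R \<ge> 1" using R(1) by linarith
 have "norm (S - e) \<le> (1 + separation) * (1 + 2 * R) * (1 + 2 * zeta32)"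
 proof (cases "z = w")
  case False
  then have ne: "z * cnj w \<noteq> 1" using unit_mult_cnj_eq_1 unit z by blast
  have n1: "norm (z * cnj w) = 1" using unit z by (simp add: norm_mult)
  have "norm S \<le> 2 / norm (1 - z * cnj w) * ((1 + \<bar>\<xi> - \<eta>\<bar>) * (1 + 2 * zeta32))"
   unfolding S_def by (rule twisted_harmonic_sum_bound[OF n1 ne])
  also have "\<dots> \<le> (1 + separation) * ((1 + 2 * R) * (1 + 2 * zeta32))"
   using le_separation[OF z] d zt separation_nonneg R0 by (intro mult_mono mult_right_mono) auto
  finally show ?thesis using False by (simp add: e_def mult.assoc)
 next
  case True
  have S: "S = (\<Sum>k=1..N. cis ((\<xi> - \<eta>) * ln (real k)) * of_real (1 / real k))"
   unfolding S_def True unit_mult_cnj[OF unit[OF z(2)]] by simp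
  have "norm (S - e) \<le> (1 + \<bar>\<xi> - \<eta>\<bar>) * (1 + 2 * zeta32)"
  proof (cases "\<xi> = \<eta>")
   case True
   then show ?thesis using harmonic_sum_approx[of N] N \<open>z = w\<close> by (simp add: S e_def)
  next
   case False
   then show ?thesis using modulated_harmonic_sum_bound[of N "\<xi> - \<eta>"] N lat by (simp add: S e_def)
  qed
  also have "\<dots> \<le> (1 + 2 * R) * (1 + 2 * zeta32)" using d zt by (intro mult_right_mono)
  also have "\<dots> \<le> (1 + separation) * ((1 + 2 * R) * (1 + 2 * zeta32))"
   using mult_right_mono[of 1 "1 + separation" "(1 + 2 * R) * (1 + 2 * zeta32)"] separation_nonneg zt R0 by simp
  finally show ?thesis by (simp add: mult.assoc)
 qed
 moreover have "cinner (mode N z \<xi>) (mode N w \<eta>) - (if z = w \<and> \<xi> = \<eta> then 1 else 0) = (S - e) / of_real (ln (real N))"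
  unfolding cinner_mode[OF N] S_def[symmetric] e_def using L by (simp add: diff_divide_distrib)
 ultimately show ?thesis using L by (simp add: norm_divide divide_right_mono)
qed

text \<open>The square of the common constant of the row errors, times a bound for the sum of
  \<open>2 / (j * sqrt j) + 2 / N\<close> over \<open>1 \<le> j \<le> N\<close>.\<close>

definition action_const :: "(complex \<Rightarrow> complex) \<Rightarrow> real \<Rightarrow> real" where
 "action_const a R = ((\<Sum>w\<in>Z. norm (a w)) * ((2 + R) * (1 + separation) * (3 + 2 * zeta32)))^2 * (2 * zeta32 + 2)"

text \<open>Row \<open>j\<close> of the image is a combination of the sums \<open>S j w\<close>,
  each the Hilbert kernel tested against an imaginary power twisted by \<open>z * cnj w\<close>.
  Only \<open>w = z\<close> is free of oscillation; it yields the Mellin value and the outer factor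
  \<open>cnj z ^ j\<close>, that is a mode at \<open>cnj z\<close>.\<close>

lemma mode_action:
 assumes N: "N \<ge> 2" and z: "z \<in> Z" and R: "\<bar>\<xi>\<bar> \<le> R"
 shows "(norm (jump_operator a Z N (mode N z \<xi>) - (a z / of_real (cosh (pi * \<xi>))) *\<^sub>C mode N (cnj z) \<xi>))^2
  \<le> action_const a R / ln (real N)"
proof -
 define L where "L = ln (real N)"
 have L: "L > 0" using N by (simp add: L_def)
 define D where "D = (2 + R) * (1 + separation) * (3 + 2 * zeta32)"
 define A where "A = (\<Sum>w\<in>Z. norm (a w))"
 have A0: "A \<ge> 0" by (simp add: A_def sum_nonneg)
 have R0: "R \<ge> 0" using R by linarith
 have zt: "zeta32 \<ge> 0" by (rule zeta32_nonneg)
 have D2: "D \<ge> 2"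
 proof -
  have "2 * 1 * 1 \<le> (2 + R) * (1 + separation) * (3 + 2 * zeta32)"
   using R0 zt separation_nonneg by (intro mult_mono) auto
  then show ?thesis by (simp add: D_def)
 qed
 define v where "v = jump_operator a Z N (mode N z \<xi>) - (a z / of_real (cosh (pi * \<xi>))) *\<^sub>C mode N (cnj z) \<xi>"
 define g where "g j = cis (\<xi> * ln (real j)) * of_real (1 / sqrt (real j))" for j
 define S where "S j w = (\<Sum>k=1..N. (z * cnj w) ^ k * (cis (\<xi> * ln (real k)) * of_real (1 / (sqrt (real k) * (real j + real k)))))" for j w
 define e where "e j w = (if w = z then complex_of_real (pi / cosh (pi * \<xi>)) * g j else 0)" for j w
 have cosh0: "cosh (pi * \<xi>) \<noteq> 0" using cosh_real_pos[of "pi * \<xi>"] by simp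
 have cv: "coord v j = (if j \<in> {1..N} then (\<Sum>w\<in>Z. a w * cnj w ^ j * (S j w - e j w)) / of_real (pi * sqrt L) else 0)" for j
 proof (cases "j \<in> {1..N}")
  case j: True
  have "coord (jump_operator a Z N (mode N z \<xi>)) j = (\<Sum>k<Suc N. coord (mode N z \<xi>) k * jump_section a Z N k j)"
   by (rule coord_matrix_operator_finite[OF jump_section_bounded mode_support])
  also have "\<dots> = (\<Sum>k=1..N. coord (mode N z \<xi>) k * jump_section a Z N k j)"
   by (rule sum.mono_neutral_right) (auto simp: coord_mode)
  also have "\<dots> = (\<Sum>k=1..N. \<Sum>w\<in>Z. a w * cnj w ^ j * ((z * cnj w) ^ k * (cis (\<xi> * ln (real k)) * of_real (1 / (sqrt (real k) * (real j + real k))))) / of_real (pi * sqrt L))"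
  proof (rule sum.cong[OF refl])
   fix k assume k: "k \<in> {1..N}"
   have "coord (mode N z \<xi>) k * jump_section a Z N k j
    = (\<Sum>w\<in>Z. z ^ k * (cis (\<xi> * ln (real k)) * of_real (1 / sqrt (real k))) / of_real (sqrt L) * (a w * cnj w ^ (k + j) / of_real (pi * real (k + j))))"
    using j k by (simp add: coord_mode jump_section_def L_def sum_distrib_left sum_divide_distrib)
   also have "\<dots> = (\<Sum>w\<in>Z. a w * cnj w ^ j * ((z * cnj w) ^ k * (cis (\<xi> * ln (real k)) * of_real (1 / (sqrt (real k) * (real j + real k))))) / of_real (pi * sqrt L))"
    by (intro sum.cong refl) (simp add: power_add power_mult_distrib add.commute mult_ac)
   finally show "coord (mode N z \<xi>) k * jump_section a Z N k j
    = (\<Sum>w\<in>Z. a w * cnj w ^ j * ((z * cnj w) ^ k * (cis (\<xi> * ln (real k)) * of_real (1 / (sqrt (real k) * (real j + real k))))) / of_real (pi * sqrt L))" .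
  qed
  also have "\<dots> = (\<Sum>w\<in>Z. a w * cnj w ^ j * S j w / of_real (pi * sqrt L))"
   unfolding S_def by (subst sum.swap) (simp add: sum_distrib_left sum_divide_distrib)
  finally have 1: "coord (jump_operator a Z N (mode N z \<xi>)) j = (\<Sum>w\<in>Z. a w * cnj w ^ j * S j w / of_real (pi * sqrt L))" .
  have "(\<Sum>w\<in>Z. a w * cnj w ^ j * e j w / of_real (pi * sqrt L)) = (\<Sum>w\<in>Z. if w = z then a z * cnj z ^ j * (complex_of_real (pi / cosh (pi * \<xi>)) * g j) / of_real (pi * sqrt L) else 0)"
   by (intro sum.cong) (auto simp: e_def)
  also have "\<dots> = a z * cnj z ^ j * (complex_of_real (pi / cosh (pi * \<xi>)) * g j) / of_real (pi * sqrt L)"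
   using fin z by simp
  also have "\<dots> = coord ((a z / of_real (cosh (pi * \<xi>))) *\<^sub>C mode N (cnj z) \<xi>) j"
   using j by (simp add: coord_mode g_def L_def)
  finally show ?thesis using j 1
   by (simp add: v_def sum_divide_distrib right_diff_distrib diff_divide_distrib sum_subtractf)
 next
  case False
  have "coord (jump_operator a Z N (mode N z \<xi>)) j = (\<Sum>k<Suc N. coord (mode N z \<xi>) k * jump_section a Z N k j)"
   by (rule coord_matrix_operator_finite[OF jump_section_bounded mode_support])
  also have "\<dots> = 0" using False by (intro sum.neutral) (auto simp: jump_section_def)
  finally show ?thesis using False by (auto simp: v_def coord_mode)
 qed
 have bd: "norm (S j w - e j w) \<le> D * (1 / real j + 1 / sqrt (real N))" if j: "j \<in> {1..N}" and w: "w \<in> Z" for j w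
 proof (cases "w = z")
  case True
  have "norm (S j w - e j w) \<le> (2 + \<bar>\<xi>\<bar>) / real j * (3 + 2 * zeta32) + 2 / sqrt (real N)"
   using hilbert_sum_approx[of "real j" N \<xi>] j N unfolding S_def e_def True unit_mult_cnj[OF unit[OF z]] g_def by simp
  also have "(2 + \<bar>\<xi>\<bar>) / real j * (3 + 2 * zeta32) = (2 + \<bar>\<xi>\<bar>) * 1 * (3 + 2 * zeta32) / real j" by simp
  also have "\<dots> \<le> D / real j"
   unfolding D_def using R separation_nonneg zt by (intro divide_right_mono mult_right_mono mult_mono) auto
  also have "2 / sqrt (real N) \<le> D / sqrt (real N)" using D2 by (intro divide_right_mono) auto
  finally show ?thesis by (simp add: distrib_left)
 next
  case False
  then have ne: "z * cnj w \<noteq> 1" using unit_mult_cnj_eq_1 unit z w by metis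
  have n1: "norm (z * cnj w) = 1" using unit z w by (simp add: norm_mult)
  have "norm (S j w - e j w) \<le> 2 / norm (1 - z * cnj w) * ((2 + \<bar>\<xi>\<bar>) / real j * (1 + 2 * zeta32))"
   using twisted_hilbert_sum_bound[OF _ n1 ne, of "real j" \<xi> N] j False unfolding S_def e_def by simp
  also have "\<dots> \<le> (1 + separation) * ((2 + R) / real j * (3 + 2 * zeta32))"
   using le_separation[OF z w] R zt separation_nonneg R0 by (intro mult_mono divide_right_mono) auto
  also have "\<dots> = D / real j" by (simp add: D_def mult_ac)
  also have "\<dots> \<le> D * (1 / real j + 1 / sqrt (real N))" using D2 by (simp add: distrib_left)
  finally show ?thesis .
 qed
 have cb: "norm (coord v j) \<le> A * D * (1 / real j + 1 / sqrt (real N)) / sqrt L" if j: "j \<in> {1..N}" for j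
 proof -
  have "norm (\<Sum>w\<in>Z. a w * cnj w ^ j * (S j w - e j w)) \<le> (\<Sum>w\<in>Z. norm (a w) * (D * (1 / real j + 1 / sqrt (real N))))"
  proof (rule sum_norm_le)
   fix w assume w: "w \<in> Z"
   show "norm (a w * cnj w ^ j * (S j w - e j w)) \<le> norm (a w) * (D * (1 / real j + 1 / sqrt (real N)))"
    unfolding norm_mult norm_power using unit[OF w] bd[OF j w] by (simp add: mult_left_mono)
  qed
  also have "\<dots> = A * (D * (1 / real j + 1 / sqrt (real N)))" by (simp add: A_def sum_distrib_right)
  finally have 1: "norm (\<Sum>w\<in>Z. a w * cnj w ^ j * (S j w - e j w)) \<le> A * D * (1 / real j + 1 / sqrt (real N))"
   by (simp add: mult.assoc)
  have "norm (coord v j) = norm (\<Sum>w\<in>Z. a w * cnj w ^ j * (S j w - e j w)) / (pi * sqrt L)"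
   using j L by (simp add: cv norm_divide norm_mult)
  also have "\<dots> \<le> A * D * (1 / real j + 1 / sqrt (real N)) / (pi * sqrt L)"
   using 1 L by (intro divide_right_mono) auto
  also have "\<dots> \<le> A * D * (1 / real j + 1 / sqrt (real N)) / (1 * sqrt L)"
   using L A0 D2 pi_ge_two by (intro divide_left_mono mult_right_mono mult_pos_pos mult_nonneg_nonneg add_nonneg_nonneg) auto
  finally show ?thesis by simp
 qed
 have "(norm v)^2 = (\<Sum>j<Suc N. (norm (coord v j))^2)"
  by (rule norm_finite_support) (simp add: cv)
 also have "\<dots> = (\<Sum>j=1..N. (norm (coord v j))^2)"
  by (rule sum.mono_neutral_right) (auto simp: cv)
 also have "\<dots> \<le> (\<Sum>j=1..N. (A * D)^2 / L * (2 * (1 / (real j * sqrt (real j))) + 2 * (1 / real N)))"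
 proof (rule sum_mono)
  fix j assume j: "j \<in> {1..N}"
  have "(norm (coord v j))^2 \<le> (A * D * (1 / real j + 1 / sqrt (real N)) / sqrt L)^2"
   by (rule power_mono[OF cb[OF j]]) simp
  also have "\<dots> = (A * D)^2 / L * (1 / real j + 1 / sqrt (real N))^2"
   using L by (simp add: power_mult_distrib power_divide)
  also have "\<dots> \<le> (A * D)^2 / L * (2 * (1 / (real j * sqrt (real j))) + 2 * (1 / real N))"
  proof (rule mult_left_mono)
   have "(1 / real j + 1 / sqrt (real N))^2 \<le> 2 * (1 / real j)^2 + 2 * (1 / sqrt (real N))^2"
    using sum_squares_bound[of "1 / real j" "1 / sqrt (real N)"] by (simp add: power2_sum)
   also have "(1 / sqrt (real N))^2 = 1 / real N" by (simp add: power_divide)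
   \<comment> \<open>Weakening the exponent 2 to 3/2 lets \<open>zeta32\<close> bound this sum as
     well.\<close>
   also have "(1 / real j)^2 \<le> 1 / (real j * sqrt (real j))"
   proof -
    have "sqrt (real j) \<le> real j" using j by (intro real_le_lsqrt) (auto simp: power2_eq_square)
    then have "1 / (real j * real j) \<le> 1 / (real j * sqrt (real j))"
     using j by (intro divide_left_mono mult_left_mono mult_pos_pos) auto
    then show ?thesis by (simp add: power2_eq_square)
   qed
   finally show "(1 / real j + 1 / sqrt (real N))^2 \<le> 2 * (1 / (real j * sqrt (real j))) + 2 * (1 / real N)" by simp
  qed (use L in simp)
  finally show "(norm (coord v j))^2 \<le> (A * D)^2 / L * (2 * (1 / (real j * sqrt (real j))) + 2 * (1 / real N))" .
 qed
 also have "\<dots> = (A * D)^2 / L * (2 * (\<Sum>j=1..N. 1 / (real j * sqrt (real j))) + 2)"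
  using N by (simp only: sum_distrib_left[symmetric] sum.distrib) simp
 also have "\<dots> \<le> (A * D)^2 / L * (2 * zeta32 + 2)"
  using sum_three_halves_le[of "{1..N}"] L by (intro mult_left_mono) auto
 finally show ?thesis by (simp add: v_def action_const_def A_def D_def L_def)
qed

text \<open>A type \<open>p\<close> of quasi-modes is a unit vector \<open>\<alpha> p\<close> over the jumps which the matrix of jumps,
 acting by \<open>z \<mapsto> a z\<close> followed by conjugation of \<open>z\<close>, maps to \<open>lam p\<close> times the unit vector \<open>\<beta> p\<close>.\<close>

definition qmode :: "(complex \<Rightarrow> complex) \<Rightarrow> nat \<Rightarrow> int \<Rightarrow> ell2" where
 "qmode \<alpha> N n = (\<Sum>z\<in>Z. \<alpha> z *\<^sub>C mode N z (2 * pi * of_int n / ln (real N)))"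

lemma qmode_gram:
 fixes \<alpha> :: "'p \<Rightarrow> complex \<Rightarrow> complex"
 assumes on: "\<And>p q. p \<in> P \<Longrightarrow> q \<in> P \<Longrightarrow> (\<Sum>z\<in>Z. \<alpha> p z * cnj (\<alpha> q z)) = (if p = q then 1 else 0)"
  and N: "N \<ge> 2" and p: "p \<in> P" "q \<in> P"
  and R: "\<bar>2 * pi * of_int n / ln (real N)\<bar> \<le> R" "\<bar>2 * pi * of_int m / ln (real N)\<bar> \<le> R"
 shows "norm (cinner (qmode (\<alpha> p) N n) (qmode (\<alpha> q) N m) - (if (p, n) = (q, m) then 1 else 0))
  \<le> (real (card Z))^2 * ((1 + separation) * (1 + 2 * R) * (1 + 2 * zeta32)) / ln (real N)"
proof -
 have L: "ln (real N) > 0" using N by simp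
 define K where "K = (1 + separation) * (1 + 2 * R) * (1 + 2 * zeta32) / ln (real N)"
 define \<xi> where "\<xi> n = 2 * pi * of_int n / ln (real N)" for n :: int
 have \<xi>_eq: "\<xi> n = \<xi> m \<longleftrightarrow> n = m" using L by (simp add: \<xi>_def)
 \<comment> \<open>Lattice differences are multiples of \<open>2 * pi / ln N\<close>, the condition
   under which imaginary powers agree at 1 and \<open>N\<close>.\<close>
 have lat: "cis ((\<xi> n - \<xi> m) * ln (real N)) = 1"
 proof -
  have "(\<xi> n - \<xi> m) * ln (real N) = 2 * pi * real_of_int (n - m)" using L by (simp add: \<xi>_def field_simps)
  then show ?thesis by (simp only: cis_multiple_2pi Ints_of_int)
 qed
 have a1: "norm (\<alpha> p z) \<le> 1" if "p \<in> P" "z \<in> Z" for p z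
 proof -
  have "(\<Sum>z\<in>Z. \<alpha> p z * cnj (\<alpha> p z)) = complex_of_real (\<Sum>z\<in>Z. (norm (\<alpha> p z))^2)"
   by (simp only: complex_norm_square of_real_sum)
  then have "complex_of_real (\<Sum>z\<in>Z. (norm (\<alpha> p z))^2) = complex_of_real 1" using on[of p p] that by simp
  then have "(\<Sum>z\<in>Z. (norm (\<alpha> p z))^2) = 1" by (simp only: of_real_eq_iff)
  moreover have "(norm (\<alpha> p z))^2 \<le> (\<Sum>z\<in>Z. (norm (\<alpha> p z))^2)"
   using that fin by (intro member_le_sum) auto
  ultimately show ?thesis by (simp add: abs_square_le_1)
 qed
 have "(if (p, n) = (q, m) then 1 else 0) = (\<Sum>z\<in>Z. \<Sum>w\<in>Z. \<alpha> p z * cnj (\<alpha> q w) * (if z = w \<and> \<xi> n = \<xi> m then 1 else 0))"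
 proof -
  have "(\<Sum>z\<in>Z. \<Sum>w\<in>Z. \<alpha> p z * cnj (\<alpha> q w) * (if z = w \<and> \<xi> n = \<xi> m then 1 else 0))
    = (\<Sum>z\<in>Z. if n = m then \<alpha> p z * cnj (\<alpha> q z) else 0)"
   using fin by (intro sum.cong refl) (auto simp: \<xi>_eq if_distrib cong: if_cong)
  then show ?thesis using on[OF p] by (cases "n = m") auto
 qed
 moreover have "cinner (qmode (\<alpha> p) N n) (qmode (\<alpha> q) N m) = (\<Sum>z\<in>Z. \<Sum>w\<in>Z. \<alpha> p z * cnj (\<alpha> q w) * cinner (mode N z (\<xi> n)) (mode N w (\<xi> m)))"
  unfolding qmode_def \<xi>_def[symmetric]
  by (subst cinner_sum_left) (simp add: cinner_sum_right sum_distrib_left mult_ac)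
 ultimately have "cinner (qmode (\<alpha> p) N n) (qmode (\<alpha> q) N m) - (if (p, n) = (q, m) then 1 else 0)
   = (\<Sum>z\<in>Z. \<Sum>w\<in>Z. \<alpha> p z * cnj (\<alpha> q w) * (cinner (mode N z (\<xi> n)) (mode N w (\<xi> m)) - (if z = w \<and> \<xi> n = \<xi> m then 1 else 0)))"
  by (simp only: right_diff_distrib sum_subtractf)
 also have "norm \<dots> \<le> (\<Sum>z\<in>Z. \<Sum>w\<in>Z. K)"
 proof (intro sum_norm_le)
  fix z w assume z: "z \<in> Z" "w \<in> Z"
  have "norm (\<alpha> p z) * norm (\<alpha> q w) * norm (cinner (mode N z (\<xi> n)) (mode N w (\<xi> m)) - (if z = w \<and> \<xi> n = \<xi> m then 1 else 0)) \<le> 1 * 1 * K"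
   unfolding K_def
   by (intro mult_mono a1 p z mode_gram[OF N z _ _ lat]) (use R in \<open>auto simp: \<xi>_def\<close>)
  then show "norm (\<alpha> p z * cnj (\<alpha> q w) * (cinner (mode N z (\<xi> n)) (mode N w (\<xi> m)) - (if z = w \<and> \<xi> n = \<xi> m then 1 else 0))) \<le> K"
   by (simp add: norm_mult)
 qed
 also have "\<dots> = (real (card Z))^2 * ((1 + separation) * (1 + 2 * R) * (1 + 2 * zeta32)) / ln (real N)"
  by (simp add: K_def power2_eq_square)
 finally show ?thesis .
qed

lemma qmode_action:
 assumes N: "N \<ge> 2" and R: "\<bar>2 * pi * of_int n / ln (real N)\<bar> \<le> R"
  and a1: "\<And>z. z \<in> Z \<Longrightarrow> norm (\<alpha> z) \<le> 1"
  and rel: "\<And>z. z \<in> Z \<Longrightarrow> \<alpha> z * a z = complex_of_real lam * \<beta> (cnj z)"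
 shows "(norm (jump_operator a Z N (qmode \<alpha> N n) - (lam / cosh (pi * (2 * pi * of_int n / ln (real N)))) *\<^sub>R qmode \<beta> N n))^2
  \<le> (real (card Z))^2 * action_const a R / ln (real N)"
proof -
 define H where "H = jump_operator a Z N"
 have H: "bounded_clinear H" unfolding H_def by (rule bounded_matrixD(1)[OF jump_section_bounded])
 define \<xi> where "\<xi> = 2 * pi * of_int n / ln (real N)"
 define ch where "ch = cosh (pi * \<xi>)"
 have bij: "bij_betw cnj Z Z"
  by (rule bij_betwI[where g=cnj]) (auto simp: cnj_closed)
 have "(lam / ch) *\<^sub>R qmode \<beta> N n = (\<Sum>z\<in>Z. (complex_of_real (lam / ch) * \<beta> z) *\<^sub>C mode N z \<xi>)"
  by (simp add: qmode_def \<xi>_def scaleR_ell2_def cell2.scale_sum_right)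
 \<comment> \<open>Reindexing by conjugation matches the target modes with the images of the
   individual modes.\<close>
 also have "\<dots> = (\<Sum>z\<in>Z. (complex_of_real (lam / ch) * \<beta> (cnj z)) *\<^sub>C mode N (cnj z) \<xi>)"
  by (rule sum.reindex_bij_betw[OF bij, symmetric])
 also have "\<dots> = (\<Sum>z\<in>Z. \<alpha> z *\<^sub>C ((a z / of_real ch) *\<^sub>C mode N (cnj z) \<xi>))"
 proof (rule sum.cong[OF refl])
  fix z assume "z \<in> Z"
  have "complex_of_real (lam / ch) * \<beta> (cnj z) = \<alpha> z * (a z / of_real ch)"
   using rel[OF \<open>z \<in> Z\<close>] by simp
  then show "(complex_of_real (lam / ch) * \<beta> (cnj z)) *\<^sub>C mode N (cnj z) \<xi> = \<alpha> z *\<^sub>C ((a z / of_real ch) *\<^sub>C mode N (cnj z) \<xi>)"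
   by simp
 qed
 finally have "H (qmode \<alpha> N n) - (lam / ch) *\<^sub>R qmode \<beta> N n = (\<Sum>z\<in>Z. \<alpha> z *\<^sub>C (H (mode N z \<xi>) - (a z / of_real ch) *\<^sub>C mode N (cnj z) \<xi>))"
  by (simp add: qmode_def \<xi>_def bounded_clinearD[OF H] cell2.scale_right_diff_distrib sum_subtractf)
 also have "norm \<dots> \<le> (\<Sum>z\<in>Z. sqrt (action_const a R / ln (real N)))"
 proof (rule sum_norm_le)
  fix z assume z: "z \<in> Z"
  have "norm (H (mode N z \<xi>) - (a z / of_real ch) *\<^sub>C mode N (cnj z) \<xi>) \<le> sqrt (action_const a R / ln (real N))"
   unfolding H_def ch_def by (rule real_le_rsqrt[OF mode_action[OF N z]]) (use R in \<open>simp add: \<xi>_def\<close>)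
  then show "norm (\<alpha> z *\<^sub>C (H (mode N z \<xi>) - (a z / of_real ch) *\<^sub>C mode N (cnj z) \<xi>)) \<le> sqrt (action_const a R / ln (real N))"
   using mult_mono[OF a1[OF z], of _ "sqrt (action_const a R / ln (real N))"] by simp
 qed
 also have "\<dots> = real (card Z) * sqrt (action_const a R / ln (real N))" by simp
 finally have "(norm (H (qmode \<alpha> N n) - (lam / ch) *\<^sub>R qmode \<beta> N n))^2 \<le> (real (card Z) * sqrt (action_const a R / ln (real N)))^2"
  by (rule power_mono) simp
 also have "\<dots> = (real (card Z))^2 * action_const a R / ln (real N)"
 proof -
  have "action_const a R \<ge> 0" unfolding action_const_def using zeta32_nonneg by simp
  then show ?thesis using N by (simp add: power_mult_distrib)
 qed
 finally show ?thesis by (simp add: H_def ch_def \<xi>_def)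
qed

end

section \<open>The function \<open>cfun\<close>\<close>

lemma cfun_nonneg: "cfun t \<ge> 0"
proof (cases "0 < t \<and> t \<le> 1")
 case True
 then have "1 \<le> (1 + sqrt (1 - t^2)) / t" by (simp add: power_le_one add_increasing2)
 then show ?thesis by (simp add: cfun_def)
qed (auto simp: cfun_def)

text \<open>Cutting the argument at 1 gives a single formula on both sides of 1, so that
  monotonicity and continuity need no case distinction there.\<close>

lemma cfun_eq_min:
 assumes "t > 0"
 shows "cfun t = ln ((1 + sqrt (1 - (min t 1)^2)) / min t 1) / pi^2"
 using assms by (auto simp: cfun_def min_def)

lemma cfun_eq_0: "t \<ge> 1 \<Longrightarrow> cfun t = 0"
 using cfun_eq_min[of t] by (simp add: min_def)

lemma cfun_antimono:
 assumes "0 < s" "s \<le> t"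
 shows "cfun t \<le> cfun s"
proof -
 have m: "0 < min s 1" "min s 1 \<le> min t 1" "min t 1 \<le> 1" using assms by auto
 have "(1 + sqrt (1 - (min t 1)^2)) / min t 1 \<le> (1 + sqrt (1 - (min s 1)^2)) / min s 1"
  using m by (intro frac_le add_left_mono real_sqrt_le_mono diff_left_mono power_mono) (auto simp: power_le_one)
 moreover have "0 < (1 + sqrt (1 - (min t 1)^2)) / min t 1"
  using m by (intro divide_pos_pos add_pos_nonneg) (auto simp: power_le_one)
 ultimately have "ln ((1 + sqrt (1 - (min t 1)^2)) / min t 1) \<le> ln ((1 + sqrt (1 - (min s 1)^2)) / min s 1)"
  by (meson ln_le_cancel_iff order_less_le_trans)
 then show ?thesis using assms by (simp add: cfun_eq_min divide_right_mono)
qed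

lemma isCont_cfun:
 assumes "t > 0"
 shows "isCont cfun t"
proof -
 have "continuous_on {0<..} (\<lambda>t::real. ln ((1 + sqrt (1 - (min t 1)^2)) / min t 1) / pi^2)"
 proof (intro continuous_intros ballI)
  fix t :: real assume "t \<in> {0<..}"
  then have m: "0 < min t 1" "min t 1 \<le> 1" by auto
  show "min t 1 \<noteq> 0" using m by simp
  have "0 < (1 + sqrt (1 - (min t 1)^2)) / min t 1"
   using m by (intro divide_pos_pos add_pos_nonneg) (auto simp: power_le_one)
  then show "(1 + sqrt (1 - (min t 1)^2)) / min t 1 \<noteq> 0" by (metis less_irrefl)
 qed auto
 then have "continuous_on {0<..} cfun"
  by (rule continuous_on_eq) (simp add: cfun_eq_min)
 then show ?thesis
  by (rule continuous_on_interior) (use assms in \<open>simp add: interior_open\<close>)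
qed

text \<open>This is the link with the quasi-modes: \<open>a / cosh (pi * \<xi>)\<close> is at least
  \<open>t\<close> exactly when \<open>pi * \<bar>\<xi>\<bar>\<close> is at most
  \<open>arcosh (a / t)\<close>.\<close>

lemma cfun_arcosh:
 assumes "0 < t" "t \<le> a"
 shows "cfun (t / a) = arcosh (a / t) / pi^2" "arcosh (a / t) \<ge> 0"
proof -
 have x: "a / t \<ge> 1" using assms by simp
 have "(1 + sqrt (1 - (t / a)^2)) / (t / a) = a / t + sqrt ((a / t)^2 - 1)"
 proof -
  have "sqrt ((a / t)^2 - 1) = sqrt ((a / t)^2 * (1 - (t / a)^2))"
   using assms by (intro arg_cong[where f=sqrt]) (simp add: right_diff_distrib power_divide)
  also have "\<dots> = a / t * sqrt (1 - (t / a)^2)" using assms by (simp add: real_sqrt_mult)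
  finally show ?thesis using assms by (simp add: field_simps)
 qed
 then show "cfun (t / a) = arcosh (a / t) / pi^2"
  using assms x by (simp add: cfun_def arcosh_real_def)
 have "1 \<le> a / t + sqrt ((a / t)^2 - 1)" using x by (simp add: add_increasing2)
 then show "arcosh (a / t) \<ge> 0" using x by (simp add: arcosh_real_def)
qed

text \<open>The integral of \<open>2 * s * cfun s\<close> from \<open>u\<close> to 1 in closed form.
  It weighs the counting function with the derivative of \<open>s^2\<close> and so measures the
  share of the squared Hilbert--Schmidt norm above the level \<open>u\<close>.\<close>

definition cfun_primitive :: "real \<Rightarrow> real" where
 "cfun_primitive u = (if u < 1 then (sqrt (1 - u^2) - u^2 * ln ((1 + sqrt (1 - u^2)) / u)) / pi^2 else 0)"

lemma cfun_primitive_deriv: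
 assumes "0 < s" "s < 1"
 shows "(cfun_primitive has_real_derivative - (2 * s * cfun s)) (at s)"
proof -
 define r where "r = sqrt (1 - s^2)"
 have s2: "s^2 < 1" using assms by (simp add: power_less_one_iff)
 have r: "r > 0" "r^2 = 1 - s^2" using s2 by (auto simp: r_def)
 have dr: "((\<lambda>s. sqrt (1 - s^2)) has_real_derivative - s / r) (at s)"
  using s2 by (auto intro!: derivative_eq_intros simp: r_def field_simps)
 have dq: "((\<lambda>s. ln ((1 + sqrt (1 - s^2)) / s)) has_real_derivative - 1 / (s * r)) (at s)"
 proof -
  have "((\<lambda>s. ln (1 + sqrt (1 - s^2)) - ln s) has_real_derivative (1 / (1 + r)) * (- s / r) - 1 / s) (at s)"
  proof -
   have p: "1 + sqrt (1 - s^2) > 0" "s > 0" using s2 assms by (auto intro: add_pos_nonneg)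
   have "((\<lambda>s. 1 + sqrt (1 - s^2)) has_real_derivative 0 + - s / r) (at s)"
    by (rule DERIV_add[OF DERIV_const dr])
   from DERIV_diff[OF DERIV_chain2[OF DERIV_ln_divide[OF p(1)] this] DERIV_ln_divide[OF p(2)]]
   show ?thesis by (simp add: r_def[symmetric])
  qed
  also have "(1 / (1 + r)) * (- s / r) - 1 / s = - 1 / (s * r)"
  proof -
   have "(1 / (1 + r)) * (- s / r) - 1 / s = - (s^2 + r + r^2) / (s * r * (1 + r))"
    using assms r(1) by (simp add: divide_simps power2_eq_square) (simp add: algebra_simps)
   also have "s^2 + r + r^2 = 1 * (1 + r)" using r(2) by simp
   also have "- (1 * (1 + r)) / (s * r * (1 + r)) = - 1 / (s * r)"
    using r(1) by (simp only: minus_mult_left nonzero_mult_divide_mult_cancel_right)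
   finally show ?thesis .
  qed
  finally have d: "((\<lambda>s. ln (1 + sqrt (1 - s^2)) - ln s) has_real_derivative - 1 / (s * r)) (at s)" .
  show ?thesis
  proof (rule has_field_derivative_transform_within_open[OF d, of "{0<..<1}"])
   fix x :: real assume "x \<in> {0<..<1}"
   then have "1 + sqrt (1 - x^2) > 0" "x > 0" by (auto intro!: add_pos_nonneg simp: power_le_one)
   then show "ln (1 + sqrt (1 - x^2)) - ln x = ln ((1 + sqrt (1 - x^2)) / x)" by (simp add: ln_div)
  qed (use assms in auto)
 qed
 have "((\<lambda>u. (sqrt (1 - u^2) - u^2 * ln ((1 + sqrt (1 - u^2)) / u)) / pi^2) has_real_derivative
   (- s / r - (2 * s * ln ((1 + r) / s) + s^2 * (- 1 / (s * r)))) / pi^2) (at s)"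
  using DERIV_cdivide[OF DERIV_diff[OF dr DERIV_mult[OF DERIV_power[OF DERIV_ident, of 2] dq]], of "pi^2"]
  by (simp add: r_def[symmetric] mult.commute)
 also have "(- s / r - (2 * s * ln ((1 + r) / s) + s^2 * (- 1 / (s * r)))) / pi^2 = - (2 * s * cfun s)"
 proof -
  have "cfun s = ln ((1 + r) / s) / pi^2" using assms by (simp add: cfun_def r_def)
  moreover have "s^2 * (- 1 / (s * r)) = - s / r" using assms by (simp add: power2_eq_square)
  ultimately show ?thesis by simp
 qed
 finally have d: "((\<lambda>u. (sqrt (1 - u^2) - u^2 * ln ((1 + sqrt (1 - u^2)) / u)) / pi^2) has_real_derivative - (2 * s * cfun s)) (at s)" .
 show ?thesis
  by (rule has_field_derivative_transform_within_open[OF d, of "{0<..<1}"])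
   (use assms in \<open>auto simp: cfun_primitive_def\<close>)
qed

text \<open>The integral of \<open>2 * s * cfun s\<close> between \<open>x\<close> and
  \<open>y\<close> is estimated by the largest value of \<open>cfun\<close>. Equivalently, the
  auxiliary function \<open>k\<close> increases up to 1; beyond 1 only its quadratic term is
  left.\<close>

lemma cfun_primitive_diff:
 assumes "0 < x" "x \<le> y"
 shows "cfun_primitive x - cfun_primitive y \<le> cfun x * (y^2 - x^2)"
proof -
 define k where "k s = cfun_primitive s + cfun x * s^2" for s
 have m: "k x \<le> k z" if z: "x \<le> z" "z \<le> 1" for z
 proof (rule DERIV_nonneg_imp_increasing_open[OF z(1)])
  fix s assume s: "x < s" "s < z"
  have "(k has_real_derivative - (2 * s * cfun s) + cfun x * (2 * s)) (at s)"
   unfolding k_def using cfun_primitive_deriv[of s] s assms z by (auto intro!: derivative_eq_intros)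
  moreover have "- (2 * s * cfun s) + cfun x * (2 * s) \<ge> 0"
   using mult_left_mono[OF cfun_antimono[of x s], of "2 * s"] s assms by simp
  ultimately show "\<exists>d. (k has_real_derivative d) (at s) \<and> d \<ge> 0" by blast
 next
  have "continuous_on {x..z} (\<lambda>u. (sqrt (1 - u^2) - u^2 * ln ((1 + sqrt (1 - u^2)) / u)) / pi^2)"
  proof (intro continuous_intros ballI)
   fix u assume "u \<in> {x..z}"
   then have u: "0 < u" "u \<le> 1" using assms z by auto
   show "u \<noteq> 0" using u by simp
   have "0 < (1 + sqrt (1 - u^2)) / u"
    using u by (intro divide_pos_pos add_pos_nonneg) (auto simp: power_le_one)
   then show "(1 + sqrt (1 - u^2)) / u \<noteq> 0" by (metis less_irrefl)
  qed auto
  then have "continuous_on {x..z} cfun_primitive"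
  proof (rule continuous_on_eq)
   fix u assume "u \<in> {x..z}"
   then have "u < 1 \<or> u = 1" using z by auto
   then show "(sqrt (1 - u^2) - u^2 * ln ((1 + sqrt (1 - u^2)) / u)) / pi^2 = cfun_primitive u"
    by (auto simp: cfun_primitive_def)
  qed
  then show "continuous_on {x..z} k" unfolding k_def by (intro continuous_intros)
 qed
 have "k x \<le> k y"
 proof (cases "y \<le> 1")
  case False
  have "cfun x * (max x 1)^2 \<le> cfun x * y^2"
   using assms False by (intro mult_left_mono power_mono cfun_nonneg) auto
  moreover have "k x \<le> k (max x 1)" using m[of 1] by (auto simp: max_def)
  ultimately show ?thesis using False by (simp add: k_def cfun_primitive_def)
 qed (use m assms in auto)
 then show ?thesis by (simp add: k_def algebra_simps)
qed

lemma cfun_primitive_at_0: "(cfun_primitive \<longlongrightarrow> 1 / pi^2) (at_right 0)"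
proof -
 have "((\<lambda>u. (sqrt (1 - u^2) - u^2 * ln ((1 + sqrt (1 - u^2)) / u)) / pi^2) \<longlongrightarrow> inverse (pi^2)) (at_right 0)"
  by real_asymp
 then have "((\<lambda>u. (sqrt (1 - u^2) - u^2 * ln ((1 + sqrt (1 - u^2)) / u)) / pi^2) \<longlongrightarrow> 1 / pi^2) (at_right 0)"
  by (simp only: inverse_eq_divide)
 moreover have "\<forall>\<^sub>F u in at_right 0. (sqrt (1 - u^2) - u^2 * ln ((1 + sqrt (1 - u^2)) / u)) / pi^2 = cfun_primitive u"
  using eventually_at_right_less[of "0::real"] eventually_at_right[of 0 "1::real"]
  by (auto simp: cfun_primitive_def eventually_at_right_field intro!: exI[of _ 1])
 ultimately show ?thesis by (rule Lim_transform_eventually)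
qed

section \<open>Lower bounds for the counting functions\<close>

text \<open>There are about \<open>ln N\<close> modes, with Gram errors of order
  \<open>1 / ln N\<close> per pair and squared residuals of order \<open>1 / ln N\<close> per mode.
  Hence both square sums are bounded and only a bounded number \<open>K\<close> of modes is lost.
  The gap between \<open>t\<close> and \<open>t'\<close> provides the room for
  \<open>d\<close>.\<close>

lemma (in jump_data) count_lower:
 fixes \<alpha> \<beta> :: "'p \<Rightarrow> complex \<Rightarrow> complex" and lam :: "'p \<Rightarrow> real"
 assumes P: "finite P"
  and on\<alpha>: "\<And>p q. p \<in> P \<Longrightarrow> q \<in> P \<Longrightarrow> (\<Sum>z\<in>Z. \<alpha> p z * cnj (\<alpha> q z)) = (if p = q then 1 else 0)"
  and on\<beta>: "\<And>p q. p \<in> P \<Longrightarrow> q \<in> P \<Longrightarrow> (\<Sum>z\<in>Z. \<beta> p z * cnj (\<beta> q z)) = (if p = q then 1 else 0)"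
  and a1: "\<And>p z. p \<in> P \<Longrightarrow> z \<in> Z \<Longrightarrow> norm (\<alpha> p z) \<le> 1"
  and rel: "\<And>p z. p \<in> P \<Longrightarrow> z \<in> Z \<Longrightarrow> \<alpha> p z * a z = complex_of_real (lam p) * \<beta> p (cnj z)"
  and t: "0 < t" "t < t'" and lam: "\<And>p. p \<in> P \<Longrightarrow> t' \<le> lam p"
 obtains K where
  "\<And>N. N \<ge> 2 \<Longrightarrow> ln (real N) * (\<Sum>p\<in>P. cfun (t' / lam p)) - K \<le> real (n_sing t (jump_operator a Z N))"
  "\<And>N. N \<ge> 2 \<Longrightarrow> \<alpha> = \<beta> \<Longrightarrow> self_adjoint (jump_operator a Z N) \<Longrightarrow>
   ln (real N) * (\<Sum>p\<in>P. cfun (t' / lam p)) - K \<le> real (n_plus t (jump_operator a Z N))"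
proof -
 \<comment> \<open>The largest frequency at which the quasi-singular value
   \<open>lam p / cosh (pi * \<xi>)\<close> is still at least \<open>t'\<close>.\<close>
 define r where "r p = arcosh (lam p / t') / pi" for p
 have t': "t' > 0" using t by simp
 have r0: "r p \<ge> 0" if "p \<in> P" for p
  using cfun_arcosh(2)[OF t' lam[OF that]] by (simp add: r_def)
 have rc: "r p / pi = cfun (t' / lam p)" if "p \<in> P" for p
  using cfun_arcosh(1)[OF t' lam[OF that]] by (simp add: r_def power2_eq_square)
 define R where "R = (\<Sum>p\<in>P. r p)"
 have rR: "r p \<le> R" if "p \<in> P" for p
  unfolding R_def using that P r0 by (intro member_le_sum) auto
 define \<Lambda> where "\<Lambda> = 1 + (\<Sum>p\<in>P. lam p)"
 have lam0: "lam p > 0" if "p \<in> P" for p using lam[OF that] t' by simp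
 have \<Lambda>1: "\<Lambda> \<ge> 1" unfolding \<Lambda>_def using lam0 by (simp add: sum_nonneg less_imp_le)
 have lam\<Lambda>: "lam p \<le> \<Lambda>" if "p \<in> P" for p
  using member_le_sum[of p P lam] that P lam0 by (fastforce simp: \<Lambda>_def less_imp_le)
 \<comment> \<open>Half of the value of \<open>d\<close> at which \<open>t * (1 + d)\<close> and
   \<open>t' - 3 * d\<close> would coincide, which makes the inequality strict.\<close>
 define d where "d = min (1/2) ((t' - t) / (2 * (t + 3)))"
 have d: "0 < d" "d \<le> 1/2" "t * (1 + d) < t' - 3 * d"
 proof -
  show "0 < d" using t by (auto simp: d_def)
  show "d \<le> 1/2" unfolding d_def by (rule min.cobounded1)
  have "d \<le> (t' - t) / (2 * (t + 3))" by (simp add: d_def)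
  then have "d * (2 * (t + 3)) \<le> t' - t" using t by (simp add: pos_le_divide_eq)
  moreover have "d * (t + 3) > 0" using \<open>0 < d\<close> t by simp
  ultimately show "t * (1 + d) < t' - 3 * d" by (simp add: algebra_simps)
 qed
 \<comment> \<open>Chosen so that \<open>L * B\<close> bounds the number of modes: the additive 1 of
   each type is absorbed by \<open>L \<ge> ln 2\<close>, which holds since
   \<open>N \<ge> 2\<close>.\<close>
 define B where "B = (\<Sum>p\<in>P. r p / pi) + real (card P) / ln 2"
 define Kg where "Kg = (real (card Z))^2 * ((1 + separation) * (1 + 2 * R) * (1 + 2 * zeta32))"
 define Ke where "Ke = (real (card Z))^2 * action_const a R"
 define C where "C = (B * Kg)^2 + B * Ke"
 have Ke0: "Ke \<ge> 0" unfolding Ke_def action_const_def using zeta32_nonneg by simp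
 have B0: "B \<ge> 0" unfolding B_def using r0 by (intro add_nonneg_nonneg sum_nonneg divide_nonneg_nonneg) auto
 have main: "ln (real N) * (\<Sum>p\<in>P. cfun (t' / lam p)) - real (card P) - 4 * real (nat \<lfloor>\<Lambda>^2 * C / d^2\<rfloor>) \<le> real n"
  if N: "N \<ge> 2" and n: "n = n_sing t (jump_operator a Z N) \<or>
   (n = n_plus t (jump_operator a Z N) \<and> \<alpha> = \<beta> \<and> self_adjoint (jump_operator a Z N))" for N n
 proof -
  define L where "L = ln (real N)"
  have L2: "L \<ge> ln 2" using N by (simp add: L_def)
  have L: "L > 0" using L2 ln_2_less_1 by (smt (verit) ln_gt_zero)
  \<comment> \<open>The frequencies \<open>2 * pi * n / L\<close> with
    \<open>\<bar>n\<bar> \<le> m p\<close> are those of modulus at most \<open>r p\<close>; there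
    are \<open>2 * m p + 1\<close> of them, counting 0.\<close>
  define m where "m p = \<lfloor>L * r p / (2 * pi)\<rfloor>" for p
  have m0: "m p \<ge> 0" if "p \<in> P" for p using r0[OF that] L by (simp add: m_def)
  define I where "I = Sigma P (\<lambda>p. {- m p..m p})"
  define \<xi> where "\<xi> n = 2 * pi * of_int n / L" for n :: int
  have finI: "finite I" using P by (simp add: I_def)
  have \<xi>r: "\<bar>\<xi> n\<bar> \<le> r p" if "(p, n) \<in> I" for p n
  proof -
   have "\<bar>n\<bar> \<le> m p" using that by (auto simp: I_def)
   then have "real_of_int \<bar>n\<bar> \<le> L * r p / (2 * pi)" unfolding m_def by (simp add: le_floor_iff)
   then have "2 * pi * real_of_int \<bar>n\<bar> / L \<le> r p" using L by (simp add: field_simps)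
   then show ?thesis using L by (simp add: \<xi>_def abs_mult)
  qed
  have cardI: "real (card I) = (\<Sum>p\<in>P. 2 * real_of_int (m p) + 1)"
  proof -
   have "card I = (\<Sum>p\<in>P. card {- m p..m p})" unfolding I_def using P by (simp add: card_SigmaI)
   also have "real \<dots> = (\<Sum>p\<in>P. 2 * real_of_int (m p) + 1)"
    unfolding of_nat_sum by (intro sum.cong refl) (use m0 in simp)
   finally show ?thesis .
  qed
  have "(\<Sum>p\<in>P. L * (r p / pi) - 1) \<le> (\<Sum>p\<in>P. 2 * real_of_int (m p) + 1)"
  proof (rule sum_mono)
   fix p
   have "L * r p / (2 * pi) - 1 \<le> real_of_int (m p)" unfolding m_def by linarith
   moreover have "L * (r p / pi) = 2 * (L * r p / (2 * pi))" by simp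
   ultimately show "L * (r p / pi) - 1 \<le> 2 * real_of_int (m p) + 1" by linarith
  qed
  then have lower: "L * (\<Sum>p\<in>P. cfun (t' / lam p)) - real (card P) \<le> real (card I)"
   unfolding cardI using rc by (simp add: sum_subtractf sum_distrib_left)
  have "(\<Sum>p\<in>P. 2 * real_of_int (m p) + 1) \<le> (\<Sum>p\<in>P. L * (r p / pi) + 1)"
  proof (rule sum_mono)
   fix p
   have "real_of_int (m p) \<le> L * r p / (2 * pi)" unfolding m_def by linarith
   moreover have "L * (r p / pi) = 2 * (L * r p / (2 * pi))" by simp
   ultimately show "2 * real_of_int (m p) + 1 \<le> L * (r p / pi) + 1" by linarith
  qed
  also have "\<dots> = L * (\<Sum>p\<in>P. r p / pi) + real (card P)" by (simp add: sum.distrib sum_distrib_left)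
  also have "\<dots> \<le> L * (\<Sum>p\<in>P. r p / pi) + L * (real (card P) / ln 2)"
  proof -
   have "real (card P) / ln 2 * ln 2 \<le> real (card P) / ln 2 * L" using L2 by (intro mult_left_mono) auto
   then show ?thesis by (simp add: mult.commute)
  qed
  finally have upper: "real (card I) \<le> L * B" unfolding cardI B_def by (simp add: distrib_left)
  have Gram: "(\<Sum>i\<in>I. \<Sum>j\<in>I. (norm (cinner (qmode (\<gamma> (fst i)) N (snd i)) (qmode (\<gamma> (fst j)) N (snd j)) - (if i = j then 1 else 0)))^2) \<le> C"
   if on: "\<And>p q. p \<in> P \<Longrightarrow> q \<in> P \<Longrightarrow> (\<Sum>z\<in>Z. \<gamma> p z * cnj (\<gamma> q z)) = (if p = q then 1 else 0)" for \<gamma> :: "'p \<Rightarrow> complex \<Rightarrow> complex"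
  proof -
   have "(\<Sum>i\<in>I. \<Sum>j\<in>I. (norm (cinner (qmode (\<gamma> (fst i)) N (snd i)) (qmode (\<gamma> (fst j)) N (snd j)) - (if i = j then 1 else 0)))^2) \<le> (\<Sum>i\<in>I. \<Sum>j\<in>I. (Kg / L)^2)"
   proof (intro sum_mono power_mono)
    fix i j assume ij: "i \<in> I" "j \<in> I"
    obtain p n q k where e: "i = (p, n)" "j = (q, k)" by fastforce
    have pq: "p \<in> P" "q \<in> P" using ij by (auto simp: e I_def)
    have "\<bar>2 * pi * of_int n / ln (real N)\<bar> \<le> R" "\<bar>2 * pi * of_int k / ln (real N)\<bar> \<le> R"
     using \<xi>r[of p n] \<xi>r[of q k] ij rR[OF pq(1)] rR[OF pq(2)] by (auto simp: e \<xi>_def L_def)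
    from qmode_gram[OF on N pq this]
    show "norm (cinner (qmode (\<gamma> (fst i)) N (snd i)) (qmode (\<gamma> (fst j)) N (snd j)) - (if i = j then 1 else 0)) \<le> Kg / L"
     by (simp add: e Kg_def L_def)
   qed simp
   also have "\<dots> = (real (card I) * (Kg / L))^2" by (simp add: power2_eq_square)
   also have "\<dots> \<le> (L * B * (Kg / L))^2"
   proof (rule power_mono)
    have "Kg \<ge> 0" unfolding Kg_def R_def using separation_nonneg zeta32_nonneg r0 by (simp add: sum_nonneg)
    then have "Kg / L \<ge> 0" using L by simp
    then show "real (card I) * (Kg / L) \<le> L * B * (Kg / L)" "0 \<le> real (card I) * (Kg / L)"
     by (intro mult_right_mono upper mult_nonneg_nonneg; simp)+
   qed
   also have "\<dots> \<le> C" using L B0 Ke0 by (simp add: C_def)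
   finally show ?thesis .
  qed
  define \<mu> where "\<mu> i = lam (fst i) / cosh (pi * (2 * pi * of_int (snd i) / ln (real N)))" for i :: "'p \<times> int"
  define H where "H = jump_operator a Z N"
  have err: "(\<Sum>i\<in>I. (norm (H (qmode (\<alpha> (fst i)) N (snd i)) - \<mu> i *\<^sub>R qmode (\<beta> (fst i)) N (snd i)))^2) \<le> C"
  proof -
   have "(\<Sum>i\<in>I. (norm (H (qmode (\<alpha> (fst i)) N (snd i)) - \<mu> i *\<^sub>R qmode (\<beta> (fst i)) N (snd i)))^2) \<le> (\<Sum>i\<in>I. Ke / L)"
   proof (rule sum_mono)
    fix i assume i: "i \<in> I"
    obtain p n where e: "i = (p, n)" by fastforce
    have p: "p \<in> P" using i by (auto simp: e I_def)
    have "\<bar>2 * pi * of_int n / ln (real N)\<bar> \<le> R"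
     using \<xi>r[of p n] i rR[OF p] by (auto simp: e \<xi>_def L_def)
    from qmode_action[where \<alpha>="\<alpha> p" and \<beta>="\<beta> p" and lam="lam p" and a=a, OF N this a1[OF p] rel[OF p]]
    show "(norm (H (qmode (\<alpha> (fst i)) N (snd i)) - \<mu> i *\<^sub>R qmode (\<beta> (fst i)) N (snd i)))^2 \<le> Ke / L"
     by (simp add: e \<mu>_def H_def Ke_def L_def)
   qed
   also have "\<dots> = real (card I) * (Ke / L)" by simp
   also have "\<dots> \<le> L * B * (Ke / L)" using upper Ke0 L by (intro mult_right_mono) auto
   also have "\<dots> \<le> C" using L by (simp add: C_def)
   finally show ?thesis .
  qed
  have \<mu>: "t' \<le> \<mu> i \<and> \<mu> i \<le> \<Lambda>" if i: "i \<in> I" for i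
  proof -
   obtain p n where e: "i = (p, n)" by fastforce
   have p: "p \<in> P" using i by (auto simp: e I_def)
   define c where "c = cosh (pi * \<xi> n)"
   have c1: "c \<ge> 1" unfolding c_def by (rule cosh_real_ge_1)
   have "\<bar>pi * \<xi> n\<bar> \<le> arcosh (lam p / t')"
    using \<xi>r[of p n] i by (simp add: e r_def abs_mult pos_le_divide_eq mult.commute)
   then have "cosh \<bar>pi * \<xi> n\<bar> \<le> cosh (arcosh (lam p / t'))"
    using cfun_arcosh(2)[OF t' lam[OF p]] by (subst cosh_real_nonneg_le_iff) auto
   then have "c \<le> lam p / t'" using lam[OF p] t' by (simp add: c_def)
   then have "t' \<le> lam p / c" using c1 t' by (simp add: field_simps)
   moreover have "lam p / c \<le> lam p / 1" using c1 lam0[OF p] by (intro divide_left_mono) auto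
   ultimately show ?thesis using lam\<Lambda>[OF p] by (simp add: e \<mu>_def c_def \<xi>_def L_def)
  qed
  have "card I \<le> n + 4 * nat \<lfloor>\<Lambda>^2 * C / d^2\<rfloor>"
   using n
  proof
   assume n: "n = n_sing t (jump_operator a Z N)"
   show ?thesis unfolding n H_def[symmetric]
    by (rule quasimodes_n_sing[OF _ finI Gram[OF on\<alpha>] Gram[OF on\<beta>] err \<mu> t \<Lambda>1 d])
     (auto simp: H_def jump_section_compact)
  next
   assume n: "n = n_plus t (jump_operator a Z N) \<and> \<alpha> = \<beta> \<and> self_adjoint (jump_operator a Z N)"
   have csa: "compact_self_adjoint H" using n by unfold_locales (auto simp: H_def jump_section_compact)
   have err': "(\<Sum>i\<in>I. (norm (H (qmode (\<alpha> (fst i)) N (snd i)) - \<mu> i *\<^sub>R qmode (\<alpha> (fst i)) N (snd i)))^2) \<le> C"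
    using err n by simp
   show ?thesis unfolding conjunct1[OF n] H_def[symmetric]
    by (rule quasimodes_n_plus[OF csa finI Gram[OF on\<alpha>] err' \<mu> t \<Lambda>1 d])
  qed
  then have "real (card I) \<le> real n + 4 * real (nat \<lfloor>\<Lambda>^2 * C / d^2\<rfloor>)" by linarith
  then show ?thesis using lower by (simp add: L_def)
 qed
 show ?thesis
 proof (rule that[of "real (card P) + 4 * real (nat \<lfloor>\<Lambda>^2 * C / d^2\<rfloor>)"])
  fix N :: nat assume N: "N \<ge> 2"
  show "ln (real N) * (\<Sum>p\<in>P. cfun (t' / lam p)) - (real (card P) + 4 * real (nat \<lfloor>\<Lambda>^2 * C / d^2\<rfloor>)) \<le> real (n_sing t (jump_operator a Z N))"
   using main[OF N disjI1[OF refl]] by simp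
  assume "\<alpha> = \<beta>" "self_adjoint (jump_operator a Z N)"
  then show "ln (real N) * (\<Sum>p\<in>P. cfun (t' / lam p)) - (real (card P) + 4 * real (nat \<lfloor>\<Lambda>^2 * C / d^2\<rfloor>)) \<le> real (n_plus t (jump_operator a Z N))"
   using main[OF N, of "n_plus t (jump_operator a Z N)"] by simp
 qed
qed

section \<open>Upper bounds for the counting functions\<close>

text \<open>At most \<open>m + 1\<close> index pairs have sum \<open>m\<close>.\<close>

lemma diagonal_sum_le:
 fixes f :: "nat \<Rightarrow> real"
 assumes "\<And>m. f m \<ge> 0"
 shows "(\<Sum>j<n. \<Sum>k<n. f (j + k)) \<le> (\<Sum>m<2 * n. real (m + 1) * f m)"
proof -
 have "(\<Sum>k<n. f (j + k)) \<le> (\<Sum>m<2 * n. if j \<le> m then f m else 0)" if "j < n" for j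
 proof -
  have "(\<Sum>k<n. f (j + k)) = (\<Sum>m\<in>(+) j ` {..<n}. f m)" by (subst sum.reindex) auto
  also have "\<dots> \<le> (\<Sum>m\<in>{m\<in>{..<2 * n}. j \<le> m}. f m)"
   using that assms by (intro sum_mono2) auto
  also have "\<dots> = (\<Sum>m<2 * n. if j \<le> m then f m else 0)"
   by (rule sum.inter_filter) simp
  finally show ?thesis .
 qed
 then have "(\<Sum>j<n. \<Sum>k<n. f (j + k)) \<le> (\<Sum>j<n. \<Sum>m<2 * n. if j \<le> m then f m else 0)"
  by (intro sum_mono) auto
 also have "\<dots> = (\<Sum>m<2 * n. \<Sum>j<n. if j \<le> m then f m else 0)" by (rule sum.swap)
 also have "\<dots> \<le> (\<Sum>m<2 * n. real (m + 1) * f m)"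
 proof (rule sum_mono)
  fix m
  have "(\<Sum>j<n. if j \<le> m then f m else 0) = (\<Sum>j\<in>{j\<in>{..<n}. j \<le> m}. f m)"
   by (rule sum.inter_filter[symmetric]) simp
  also have "\<dots> = real (card {j\<in>{..<n}. j \<le> m}) * f m" by simp
  also have "\<dots> \<le> real (card {..m}) * f m"
  proof (intro mult_right_mono assms)
   have "card {j\<in>{..<n}. j \<le> m} \<le> card {..m}" by (intro card_mono) auto
   then show "real (card {j\<in>{..<n}. j \<le> m}) \<le> real (card {..m})" by (simp only: of_nat_le_iff)
  qed
  finally show "(\<Sum>j<n. if j \<le> m then f m else 0) \<le> real (m + 1) * f m" by simp
 qed
 finally show ?thesis .
qed

section \<open>The squared Hilbert--Schmidt norm of a jump section\<close>

context jump_data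
begin

text \<open>Expanding the square leaves harmonic sums twisted by \<open>w * cnj z\<close>. Only the
  diagonal \<open>z = w\<close> does not oscillate, and it alone produces
  \<open>ln M\<close>.\<close>

lemma jump_coeff_sum:
 assumes M: "M \<ge> 1"
 shows "(\<Sum>m=1..M. (norm (\<Sum>z\<in>Z. a z * cnj z ^ m))^2 / real m)
  \<le> (\<Sum>z\<in>Z. (norm (a z))^2) * ln (real M) + (\<Sum>z\<in>Z. norm (a z))^2 * ((1 + separation) * (1 + 2 * zeta32))"
proof -
 define B where "B = (1 + separation) * (1 + 2 * zeta32)"
 define T where "T z w = (\<Sum>m=1..M. (w * cnj z) ^ m * of_real (1 / real m))" for z w
 have T: "norm (T z w - (if z = w then complex_of_real (ln (real M)) else 0)) \<le> B" if z: "z \<in> Z" "w \<in> Z" for z w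
 proof (cases "z = w")
  case True
  have "norm (T z w - complex_of_real (ln (real M))) \<le> 1 + 2 * zeta32"
   using harmonic_sum_approx[OF M] unfolding T_def True unit_mult_cnj[OF unit[OF z(2)]] by simp
  also have "\<dots> \<le> B" unfolding B_def
   using mult_right_mono[of 1 "1 + separation" "1 + 2 * zeta32"] separation_nonneg zeta32_nonneg by simp
  finally show ?thesis using True by simp
 next
  case False
  have ne: "w * cnj z \<noteq> 1" using False unit_mult_cnj_eq_1 unit z by metis
  have n1: "norm (w * cnj z) = 1" using unit z by (simp add: norm_mult)
  have "norm (T z w) \<le> 2 / norm (1 - w * cnj z) * (1 * (1 + 2 * zeta32))"
   using twisted_harmonic_sum_bound[OF n1 ne, where \<eta>=0 and N=M] unfolding T_def by simp
  also have "\<dots> \<le> (1 + separation) * (1 * (1 + 2 * zeta32))"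
   using le_separation[OF z(2,1)] zeta32_nonneg by (intro mult_right_mono) auto
  finally show ?thesis using False by (simp add: B_def)
 qed
 have "complex_of_real (\<Sum>m=1..M. (norm (\<Sum>z\<in>Z. a z * cnj z ^ m))^2 / real m)
   = (\<Sum>m=1..M. \<Sum>z\<in>Z. \<Sum>w\<in>Z. a z * cnj (a w) * ((w * cnj z) ^ m * of_real (1 / real m)))"
  unfolding of_real_sum
 proof (rule sum.cong[OF refl])
  fix m assume "m \<in> {1..M}"
  have "complex_of_real ((norm (\<Sum>z\<in>Z. a z * cnj z ^ m))^2 / real m)
    = (\<Sum>z\<in>Z. a z * cnj z ^ m) * cnj (\<Sum>w\<in>Z. a w * cnj w ^ m) * of_real (1 / real m)"
   by (simp only: complex_norm_square[symmetric] of_real_mult[symmetric]) simp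
  also have "\<dots> = (\<Sum>z\<in>Z. \<Sum>w\<in>Z. a z * cnj (a w) * ((w * cnj z) ^ m * of_real (1 / real m)))"
   unfolding cnj_sum sum_product
   unfolding sum_distrib_right
   by (intro sum.cong refl) (simp add: power_mult_distrib mult_ac)
  finally show "complex_of_real ((norm (\<Sum>z\<in>Z. a z * cnj z ^ m))^2 / real m)
   = (\<Sum>z\<in>Z. \<Sum>w\<in>Z. a z * cnj (a w) * ((w * cnj z) ^ m * of_real (1 / real m)))" .
 qed
 also have "\<dots> = (\<Sum>z\<in>Z. \<Sum>w\<in>Z. a z * cnj (a w) * T z w)"
  unfolding T_def sum_distrib_left by (subst sum.swap, rule sum.cong[OF refl], rule sum.swap)
 finally have e1: "complex_of_real (\<Sum>m=1..M. (norm (\<Sum>z\<in>Z. a z * cnj z ^ m))^2 / real m) = (\<Sum>z\<in>Z. \<Sum>w\<in>Z. a z * cnj (a w) * T z w)" .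
 have e2: "complex_of_real ((\<Sum>z\<in>Z. (norm (a z))^2) * ln (real M))
   = (\<Sum>z\<in>Z. \<Sum>w\<in>Z. a z * cnj (a w) * (if z = w then complex_of_real (ln (real M)) else 0))"
 proof -
  have "(\<Sum>z\<in>Z. \<Sum>w\<in>Z. a z * cnj (a w) * (if z = w then complex_of_real (ln (real M)) else 0))
    = (\<Sum>z\<in>Z. a z * cnj (a z) * of_real (ln (real M)))"
   using fin by (intro sum.cong refl) (simp add: if_distrib cong: if_cong)
  also have "\<dots> = complex_of_real ((\<Sum>z\<in>Z. (norm (a z))^2) * ln (real M))"
   by (simp only: complex_norm_square[symmetric] sum_distrib_right of_real_sum of_real_mult)
  finally show ?thesis by simp
 qed
 have "complex_of_real ((\<Sum>m=1..M. (norm (\<Sum>z\<in>Z. a z * cnj z ^ m))^2 / real m) - (\<Sum>z\<in>Z. (norm (a z))^2) * ln (real M))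
   = (\<Sum>z\<in>Z. \<Sum>w\<in>Z. a z * cnj (a w) * (T z w - (if z = w then complex_of_real (ln (real M)) else 0)))"
  unfolding of_real_diff e1 e2 by (simp only: right_diff_distrib sum_subtractf)
 also have "norm \<dots> \<le> (\<Sum>z\<in>Z. \<Sum>w\<in>Z. norm (a z) * norm (a w) * B)"
  by (intro sum_norm_le) (simp add: norm_mult T mult_left_mono)
 also have "\<dots> = (\<Sum>z\<in>Z. norm (a z))^2 * B"
  by (simp only: power2_eq_square sum_product) (simp only: sum_distrib_right)
 finally show ?thesis unfolding norm_of_real B_def by linarith
qed

lemma jump_section_hs_asymp:
 "\<exists>K. \<forall>N\<ge>2. hs_bound (jump_section a Z N) (ln (real N) * (\<Sum>z\<in>Z. (norm (a z))^2) / pi^2 + K)"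
proof -
 define A where "A = (\<Sum>z\<in>Z. norm (a z))"
 define A2 where "A2 = (\<Sum>z\<in>Z. (norm (a z))^2)"
 define B where "B = (1 + separation) * (1 + 2 * zeta32)"
 define s where "s m = (\<Sum>z\<in>Z. a z * cnj z ^ m)" for m
 define f where "f m = (norm (s m))^2 / (pi * real m)^2" for m
 have sA: "norm (s m) \<le> A" for m
  unfolding s_def A_def by (rule sum_norm_le) (simp add: norm_mult norm_power unit)
 have A20: "A2 \<ge> 0" by (simp add: A2_def sum_nonneg)
 define K where "K = (A2 * ln 4 + A^2 * B + A^2 * zeta32) / pi^2"
 have "hs_bound (jump_section a Z N) (ln (real N) * A2 / pi^2 + K)" if N: "N \<ge> 2" for N
 proof (rule hs_bound_finite[where m="Suc N"])
  \<comment> \<open>Antidiagonals beyond \<open>N\<close> are counted with \<open>m + 1\<close>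
    pairs although they are shorter. The overcount costs only the difference of \<open>ln M\<close>
    and \<open>ln N\<close>, at most \<open>ln 4\<close>, so the leading coefficient is
    unaffected.\<close>
  define M where "M = 2 * N + 1"
  have "(\<Sum>j<Suc N. \<Sum>k<Suc N. (norm (jump_section a Z N j k))^2) \<le> (\<Sum>j<Suc N. \<Sum>k<Suc N. f (j + k))"
   by (intro sum_mono) (auto simp: jump_section_def f_def s_def norm_divide power_divide norm_mult simp del: of_nat_add)
  also have "\<dots> \<le> (\<Sum>m<2 * Suc N. real (m + 1) * f m)" by (rule diagonal_sum_le) (simp add: f_def)
  also have "\<dots> = (\<Sum>m=1..M. real (m + 1) * f m)"
   by (rule sum.mono_neutral_right) (auto simp: M_def f_def not_le less_Suc_eq_le)
  also have "\<dots> \<le> (\<Sum>m=1..M. 1 / pi^2 * ((norm (s m))^2 / real m + A^2 * (1 / (real m * sqrt (real m)))))"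
  proof (rule sum_mono)
   fix m assume m: "m \<in> {1..M}"
   \<comment> \<open>Splitting \<open>(m + 1) / m^2\<close> into \<open>1 / m\<close> and
     \<open>1 / m^2\<close> separates the logarithmic part from a convergent one.\<close>
   have "real (m + 1) * f m = 1 / pi^2 * ((norm (s m))^2 / real m + (norm (s m))^2 * (1 / (real m * real m)))"
    using m by (simp add: f_def power2_eq_square field_simps)
   also have "\<dots> \<le> 1 / pi^2 * ((norm (s m))^2 / real m + A^2 * (1 / (real m * sqrt (real m))))"
   proof (intro mult_left_mono add_left_mono mult_mono)
    show "(norm (s m))^2 \<le> A^2" by (rule power_mono[OF sA]) simp
    have "sqrt (real m) \<le> real m" using m by (intro real_le_lsqrt) (auto simp: power2_eq_square)
    then show "1 / (real m * real m) \<le> 1 / (real m * sqrt (real m))"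
     using m by (intro divide_left_mono mult_left_mono mult_pos_pos) auto
   qed auto
   finally show "real (m + 1) * f m \<le> 1 / pi^2 * ((norm (s m))^2 / real m + A^2 * (1 / (real m * sqrt (real m))))" .
  qed
  also have "\<dots> = 1 / pi^2 * ((\<Sum>m=1..M. (norm (s m))^2 / real m) + A^2 * (\<Sum>m=1..M. 1 / (real m * sqrt (real m))))"
   by (simp only: sum_distrib_left sum.distrib distrib_left)
  also have "\<dots> \<le> 1 / pi^2 * ((A2 * ln (real M) + A^2 * B) + A^2 * zeta32)"
   using jump_coeff_sum[of M a] sum_three_halves_le[of "{1..M}"]
   by (intro mult_left_mono add_mono) (auto simp: s_def A2_def A_def B_def M_def)
  also have "\<dots> \<le> 1 / pi^2 * ((A2 * (ln (real N) + ln 4) + A^2 * B) + A^2 * zeta32)"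
  proof (intro mult_left_mono add_mono A20)
   have "ln (real M) \<le> ln (real N * 4)" using N by (subst ln_le_cancel_iff) (auto simp: M_def)
   also have "\<dots> = ln (real N) + ln 4" using N by (simp add: ln_mult)
   finally show "ln (real M) \<le> ln (real N) + ln 4" .
  qed auto
  also have "\<dots> = ln (real N) * A2 / pi^2 + K"
   by (simp add: K_def algebra_simps add_divide_distrib)
  finally show "(\<Sum>j<Suc N. \<Sum>k<Suc N. (norm (jump_section a Z N j k))^2) \<le> ln (real N) * A2 / pi^2 + K" .
 qed (auto simp: jump_section_def)
 then show ?thesis unfolding A2_def by blast
qed

end

text \<open>One maximal eigensystem at a low level describes the counting function at all higher
  levels. This makes counts at different levels comparable vector by vector. The form splits without
  cross terms between the span of \<open>S\<close> and its complement.\<close>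

lemma (in compact_self_adjoint) eigensystem_restrict:
 assumes t: "t > 0" "t \<le> t'" and S: "eigensystem t S"
  and ev: "\<And>x. x \<in> S \<Longrightarrow> A x = complex_of_real (ev x) *\<^sub>C x"
  and max: "\<And>x. (\<And>s. s \<in> S \<Longrightarrow> cinner x s = 0) \<Longrightarrow> Re (cinner (A x) x) \<le> t * (norm x)^2"
 shows "n_plus t' A = card {x \<in> S. ev x > t'}"
proof (rule n_plus_eq_card)
 have on: "orthonormal S" and fin: "finite S" using S by (auto simp: eigensystem_def orthonormal_def)
 show "t' > 0" using t by simp
 show "eigensystem t' {x \<in> S. ev x > t'}"
  using on ev unfolding eigensystem_def orthonormal_def by auto
 fix x assume x: "\<And>s. s \<in> {x \<in> S. ev x > t'} \<Longrightarrow> cinner x s = 0"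
 define p where "p = (\<Sum>s\<in>S. cinner x s *\<^sub>C s)"
 define w where "w = x - p"
 have xw: "x = p + w" by (simp add: w_def)
 have w: "cinner w s = 0" if "s \<in> S" for s
  unfolding w_def p_def by (rule orthonormal_residual[OF on that])
 have Ap: "A p = (\<Sum>s\<in>S. (cinner x s * of_real (ev s)) *\<^sub>C s)"
  using ev by (simp add: p_def bounded_clinearD[OF bc])
 have wAp: "cinner w (A p) = 0" unfolding Ap cinner_sum_right by (simp add: w)
 have wp: "cinner w p = 0" unfolding p_def cinner_sum_right by (simp add: w)
 have Apw: "cinner (A p) w = 0" using wAp cinner_commute[of "A p" w] by simp
 have pw: "cinner p w = 0" using wp cinner_commute[of p w] by simp
 have "cinner (A x) x = cinner (A p) p + cinner (A w) w"
  unfolding xw bounded_clinearD(3)[OF bc] cinner_add_left cinner_add_right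
  using wAp Apw sym[of w p] by simp
 then have 1: "Re (cinner (A x) x) = Re (cinner (A p) p) + Re (cinner (A w) w)" by simp
 have "cinner x x = cinner p p + cinner w w"
  by (subst (1 2) xw) (simp add: cinner_add_left cinner_add_right wp pw)
 then have "complex_of_real ((norm x)^2) = complex_of_real ((norm p)^2 + (norm w)^2)"
  by (simp add: cinner_self)
 then have 2: "(norm x)^2 = (norm p)^2 + (norm w)^2" by (simp only: of_real_eq_iff)
 have 3: "(norm p)^2 = (\<Sum>s\<in>S. (norm (cinner x s))^2)" unfolding p_def by (rule orthonormal_norm_sum[OF on])
 have "cinner (A p) p = (\<Sum>s\<in>S. (cinner x s * of_real (ev s)) * cnj (cinner x s))"
  unfolding Ap unfolding p_def by (rule orthonormal_cinner_sum2[OF on])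
 then have "Re (cinner (A p) p) = (\<Sum>s\<in>S. Re ((cinner x s * of_real (ev s)) * cnj (cinner x s)))" by simp
 also have "\<dots> = (\<Sum>s\<in>S. ev s * (norm (cinner x s))^2)"
  by (intro sum.cong refl) (simp only: cmod_power2, simp add: power2_eq_square algebra_simps)
 also have "\<dots> \<le> (\<Sum>s\<in>S. t' * (norm (cinner x s))^2)"
 proof (rule sum_mono)
  fix s assume s: "s \<in> S"
  show "ev s * (norm (cinner x s))^2 \<le> t' * (norm (cinner x s))^2"
   using x[of s] s by (cases "ev s > t'") (auto intro: mult_right_mono)
 qed
 finally have 4: "Re (cinner (A p) p) \<le> t' * (norm p)^2" by (simp add: 3 sum_distrib_left)
 have "Re (cinner (A w) w) \<le> t * (norm w)^2" by (rule max[OF w])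
 also have "\<dots> \<le> t' * (norm w)^2" using t by (intro mult_right_mono) auto
 finally show "Re (cinner (A x) x) \<le> t' * (norm x)^2" using 4 unfolding 1 2 by (simp add: distrib_left)
qed

text \<open>The eigenvalue of the Gram operator at a unit eigenvector \<open>x\<close> is
  \<open>(norm (K x))^2\<close>, so the squared singular values add up to at most \<open>S\<close>.
  The cutoff \<open>c\<close> keeps the list finite.\<close>

lemma singular_values_hs:
 assumes a: "hs_bound a S" and c: "c > 0"
 obtains X :: "ell2 set" and s where "finite X" "(\<Sum>x\<in>X. (s x)^2) \<le> S" "\<And>x. x \<in> X \<Longrightarrow> s x \<ge> 0"
  "\<And>t. t \<ge> c \<Longrightarrow> n_sing t (matrix_operator a) = card {x \<in> X. s x > t}"
proof -
 define K where "K = matrix_operator a"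
 have K: "compact_operator K" unfolding K_def by (rule hs_compact[OF a])
 interpret G: compact_self_adjoint "cadjoint K \<circ> K" by (rule gram_operator(1)[OF K])
 have c2: "c^2 > 0" using c by simp
 obtain X where X: "G.eigensystem (c^2) X"
  "\<And>x. (\<And>s. s \<in> X \<Longrightarrow> cinner x s = 0) \<Longrightarrow> Re (cinner ((cadjoint K \<circ> K) x) x) \<le> c^2 * (norm x)^2"
  using G.spectral_decomposition[OF c2] by blast
 have on: "orthonormal X" and fin: "finite X" using X by (auto simp: G.eigensystem_def orthonormal_def)
 obtain ev where ev: "\<And>x. x \<in> X \<Longrightarrow> ev x > c^2 \<and> (cadjoint K \<circ> K) x = complex_of_real (ev x) *\<^sub>C x"
  using X(1) unfolding G.eigensystem_def by metis
 have ev0: "ev x \<ge> 0" if "x \<in> X" for x using ev[OF that] c2 by linarith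
 show ?thesis
 proof (rule that[OF fin, of "\<lambda>x. sqrt (ev x)"])
  have "ev x = (norm (K x))^2" if "x \<in> X" for x
  proof -
   have "(norm (K x))^2 = Re (cinner (complex_of_real (ev x) *\<^sub>C x) x)"
    using ev[OF that] gram_operator(2)[OF K, of x] by simp
   then show ?thesis using orthonormal_norm[OF on that] by (simp add: cinner_self)
  qed
  then have "(\<Sum>x\<in>X. (sqrt (ev x))^2) = (\<Sum>x\<in>X. (norm (K x))^2)" using ev0 by (intro sum.cong) auto
  then show "(\<Sum>x\<in>X. (sqrt (ev x))^2) \<le> S" using hs_orthonormal_sum[OF a on] by (simp add: K_def)
  show "sqrt (ev x) \<ge> 0" if "x \<in> X" for x using ev0[OF that] by simp
  fix t assume t: "t \<ge> c"
  have "n_sing t K = n_plus (t^2) (cadjoint K \<circ> K)" using t c by (intro n_sing_eq_n_plus) simp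
  also have "\<dots> = card {x \<in> X. ev x > t^2}"
   by (rule G.eigensystem_restrict[OF c2 _ X(1) _ X(2)]) (use ev t c in \<open>auto intro: power_mono\<close>)
  also have "{x \<in> X. ev x > t^2} = {x \<in> X. sqrt (ev x) > t}"
   using t c real_less_rsqrt[of t] by (auto simp: real_less_lsqrt) (metis less_le_trans not_le order.strict_trans1 real_le_lsqrt less_imp_le ev0)
  finally show "n_sing t (matrix_operator a) = card {x \<in> X. sqrt (ev x) > t}" by (simp add: K_def)
 qed
qed

text \<open>A discrete layer-cake formula: a layer lying wholly below \<open>s\<close> contributes
  its full height in squares, and any other layer counts 0.\<close>

lemma layer_sum_le:
 fixes \<tau> :: "nat \<Rightarrow> real"
 assumes \<tau>: "\<And>p. 0 \<le> \<tau> p" "\<And>p. \<tau> p \<le> \<tau> (Suc p)" and s: "s \<ge> 0"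
 shows "(\<Sum>p<m. ((\<tau> (Suc p))^2 - (\<tau> p)^2) * (if s > \<tau> (Suc p) then 1 else 0)) \<le> (min s (\<tau> m))^2 - (min s (\<tau> 0))^2"
proof (induction m)
 case (Suc m)
 have "((\<tau> (Suc m))^2 - (\<tau> m)^2) * (if s > \<tau> (Suc m) then 1 else 0) \<le> (min s (\<tau> (Suc m)))^2 - (min s (\<tau> m))^2"
 proof (cases "s > \<tau> (Suc m)")
  case True
  then show ?thesis using \<tau>(2)[of m] by (simp add: min_def)
 next
  case False
  have "(min s (\<tau> m))^2 \<le> (min s (\<tau> (Suc m)))^2" using \<tau>(1)[of m] \<tau>(2)[of m] s by (intro power_mono) auto
  then show ?thesis using False by simp
 qed
 then show ?case using Suc by simp
qed simp

text \<open>\<open>\<Phi>\<close> acts as the tail integral of \<open>2 * s * F s\<close>. On an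
  equidistant mesh the squares grow by at most \<open>2 * d^2 / m\<close> per step, and since
  \<open>F\<close> decreases, the errors of all steps telescope to at most \<open>F x\<close> times
  this increment.\<close>

lemma riemann_lower:
 fixes F \<Phi> :: "real \<Rightarrow> real"
 assumes F: "\<And>x y. 0 < x \<Longrightarrow> x \<le> y \<Longrightarrow> F y \<le> F x" "\<And>x. F x \<ge> 0"
  and \<Phi>: "\<And>x y. 0 < x \<Longrightarrow> x \<le> y \<Longrightarrow> \<Phi> x - \<Phi> y \<le> F x * (y^2 - x^2)"
  and x: "0 < x" "x \<le> y" "y \<le> d" and m: "m \<ge> 1"
 defines "\<tau> \<equiv> \<lambda>p. x + (y - x) * real p / real m"
 shows "\<Phi> x - \<Phi> y - 2 * d^2 / real m * F x \<le> (\<Sum>p<m. ((\<tau> (Suc p))^2 - (\<tau> p)^2) * F (\<tau> (Suc p)))"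
proof -
 have \<tau>0: "\<tau> 0 = x" "\<tau> m = y" using m by (auto simp: \<tau>_def)
 have \<tau>S: "\<tau> (Suc p) = \<tau> p + (y - x) / real m" for p by (simp add: \<tau>_def add_divide_distrib distrib_left)
 have mono: "\<tau> p \<le> \<tau> (Suc p)" for p unfolding \<tau>S using x by simp
 have pos: "\<tau> p > 0" for p unfolding \<tau>_def using x by (intro add_pos_nonneg) auto
 have le_d: "\<tau> p \<le> d" if "p \<le> m" for p
 proof -
  have "(y - x) * (real p / real m) \<le> (y - x) * 1" using that x m by (intro mult_left_mono) auto
  then show ?thesis using x by (simp add: \<tau>_def)
 qed
 have "(\<Sum>p<m. \<Phi> (\<tau> p) - \<Phi> (\<tau> (Suc p)) - 2 * d^2 / real m * (F (\<tau> p) - F (\<tau> (Suc p))))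
   \<le> (\<Sum>p<m. ((\<tau> (Suc p))^2 - (\<tau> p)^2) * F (\<tau> (Suc p)))"
 proof (rule sum_mono)
  fix p assume p: "p \<in> {..<m}"
  have "(\<tau> (Suc p))^2 - (\<tau> p)^2 = (y - x) / real m * (\<tau> (Suc p) + \<tau> p)"
   unfolding \<tau>S by (simp add: power2_eq_square algebra_simps)
  also have "\<dots> \<le> d / real m * (d + d)"
  proof (rule mult_mono)
   show "(y - x) / real m \<le> d / real m" using x by (intro divide_right_mono) auto
   show "\<tau> (Suc p) + \<tau> p \<le> d + d" using p le_d[of p] le_d[of "Suc p"] by simp
  qed (use x pos[of p] pos[of "Suc p"] in auto)
  finally have "(\<tau> (Suc p))^2 - (\<tau> p)^2 \<le> 2 * d^2 / real m" by (simp add: power2_eq_square mult_ac)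
  moreover have "F (\<tau> (Suc p)) \<le> F (\<tau> p)" by (rule F(1)[OF pos mono])
  ultimately have "((\<tau> (Suc p))^2 - (\<tau> p)^2) * (F (\<tau> p) - F (\<tau> (Suc p))) \<le> 2 * d^2 / real m * (F (\<tau> p) - F (\<tau> (Suc p)))"
   by (intro mult_right_mono) auto
  moreover have "\<Phi> (\<tau> p) - \<Phi> (\<tau> (Suc p)) \<le> F (\<tau> p) * ((\<tau> (Suc p))^2 - (\<tau> p)^2)" by (rule \<Phi>[OF pos mono])
  ultimately show "\<Phi> (\<tau> p) - \<Phi> (\<tau> (Suc p)) - 2 * d^2 / real m * (F (\<tau> p) - F (\<tau> (Suc p))) \<le> ((\<tau> (Suc p))^2 - (\<tau> p)^2) * F (\<tau> (Suc p))"
   by (simp add: algebra_simps)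
 qed
 moreover have "(\<Sum>p<m. \<Phi> (\<tau> p) - \<Phi> (\<tau> (Suc p)) - 2 * d^2 / real m * (F (\<tau> p) - F (\<tau> (Suc p)))) = \<Phi> x - \<Phi> y - 2 * d^2 / real m * (F x - F y)"
  unfolding sum_subtractf sum_distrib_left[symmetric]
  using sum_lessThan_telescope'[of "\<lambda>p. \<Phi> (\<tau> p)" m] sum_lessThan_telescope'[of "\<lambda>p. F (\<tau> p)" m]
  by (simp add: sum_subtractf \<tau>0)
 moreover have "2 * d^2 / real m * (F x - F y) \<le> 2 * d^2 / real m * F x"
  using F(2)[of y] by (intro mult_left_mono) auto
 ultimately show ?thesis by linarith
qed

text \<open>The lower bounds for the counting functions at all levels exhaust the Hilbert--Schmidt norm, and
 therefore have to be sharp.\<close>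

lemma counting_upper:
 fixes F \<Phi> :: "real \<Rightarrow> real" and n :: "nat \<Rightarrow> real \<Rightarrow> nat" and L :: "nat \<Rightarrow> real"
 assumes F: "\<And>x y. 0 < x \<Longrightarrow> x \<le> y \<Longrightarrow> F y \<le> F x" "\<And>x. F x \<ge> 0" "\<And>x. x > 0 \<Longrightarrow> isCont F x"
  and \<Phi>: "\<And>x y. 0 < x \<Longrightarrow> x \<le> y \<Longrightarrow> \<Phi> x - \<Phi> y \<le> F x * (y^2 - x^2)"
  and \<Phi>0: "(\<Phi> \<longlongrightarrow> M) (at_right 0)" and \<Phi>D: "\<And>d. d \<ge> D \<Longrightarrow> \<Phi> d = 0"
  and layers: "\<And>N c. N \<ge> 2 \<Longrightarrow> c > 0 \<Longrightarrow> \<exists>X s. finite (X :: 'x set) \<and> (\<Sum>x\<in>X. (s x)^2) \<le> L N * M + K \<and>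
   (\<forall>x\<in>X. s x \<ge> 0) \<and> (\<forall>t\<ge>c. n N t = card {x \<in> X. s x > t})"
  and lower: "\<And>t \<epsilon>. t > 0 \<Longrightarrow> \<epsilon> > 0 \<Longrightarrow> \<forall>\<^sub>F N in sequentially. (F t - \<epsilon>) * L N \<le> real (n N t)"
  and L: "filterlim L at_top sequentially"
  and t: "t > 0" and \<epsilon>: "\<epsilon> > 0"
 shows "\<forall>\<^sub>F N in sequentially. real (n N t) \<le> (F t + \<epsilon>) * L N"
proof -
 have "\<forall>\<^sub>F x in at_left t. F x < F t + \<epsilon> / 4"
  using order_tendstoD(2)[of F "F t" "at_left t" "F t + \<epsilon> / 4"] F(3)[OF t] \<epsilon>
  by (simp add: isCont_def filterlim_at_split)
 moreover have "\<forall>\<^sub>F x in at_left t. 0 < x \<and> x < t"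
  using t by (auto simp: eventually_at_left_field intro!: exI[of _ 0])
 ultimately have "\<forall>\<^sub>F x in at_left t. F x < F t + \<epsilon> / 4 \<and> 0 < x \<and> x < t" by (rule eventually_conj)
 \<comment> \<open>A level slightly below \<open>t\<close> with nearly the same value of
   \<open>F\<close>. The count at \<open>t\<close> is estimated through the layer between
   \<open>t0\<close> and \<open>t\<close>, each of whose levels has at least that count.\<close>
 from eventually_happens'[OF _ this] obtain t0 where t0: "F t0 < F t + \<epsilon> / 4" "0 < t0" "t0 < t"
  by (auto simp: trivial_limit_at_left_real)
 define B where "B = t^2 - t0^2"
 have B: "B > 0" unfolding B_def using t0 by (simp add: power_strict_mono)
 \<comment> \<open>Five errors of size \<kappa> enter the final balance. They amount to
   \<open>5/8 * \<epsilon>\<close> after division by \<open>B\<close>, and with the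
   \<open>\<epsilon> / 4\<close> from the choice of \<open>t0\<close> they stay below
   \<epsilon>.\<close>
 define \<kappa> where "\<kappa> = \<epsilon> * B / 8"
 have \<kappa>: "\<kappa> > 0" using \<epsilon> B by (simp add: \<kappa>_def)
 have "\<forall>\<^sub>F x in at_right 0. M - \<kappa> < \<Phi> x"
  by (rule order_tendstoD(1)[OF \<Phi>0]) (use \<kappa> in simp)
 moreover have "\<forall>\<^sub>F x in at_right 0. 0 < x \<and> x < t0"
  using t0 by (auto simp: eventually_at_right_field intro!: exI[of _ t0])
 ultimately have "\<forall>\<^sub>F x in at_right 0. M - \<kappa> < \<Phi> x \<and> 0 < x \<and> x < t0" by (rule eventually_conj)
 \<comment> \<open>A positive cutoff below which at most a share \<kappa> of the budget
   \<open>M\<close> is left; the finite lists of singular values exist only above such a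
   cutoff.\<close>
 from eventually_happens'[OF _ this] obtain c where c: "M - \<kappa> < \<Phi> c" "0 < c" "c < t0"
  by (auto simp: trivial_limit_at_right_real)
 define d where "d = max D (t + 1)"
 have d: "d \<ge> D" "t < d" "d > 0" using t by (auto simp: d_def)
 obtain m :: nat where m: "real m > 2 * d^2 * F c / \<kappa>" "m \<ge> 1"
  using reals_Archimedean2[of "max 1 (2 * d^2 * F c / \<kappa>)"] by (metis less_eq_real_def max_less_iff_conj of_nat_1 of_nat_le_iff)
 have m\<kappa>: "2 * d^2 / real m * F c \<le> \<kappa>"
 proof -
  have "2 * d^2 * F c < real m * \<kappa>" using m(1) \<kappa> by (simp add: pos_divide_less_eq)
  then show ?thesis using m(2) by (simp add: field_simps)
 qed
 define \<tau> where "\<tau> p = c + (t0 - c) * real p / real m" for p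
 define \<sigma> where "\<sigma> p = t + (d - t) * real p / real m" for p
 have ends: "\<tau> 0 = c" "\<tau> m = t0" "\<sigma> 0 = t" "\<sigma> m = d" using m by (auto simp: \<tau>_def \<sigma>_def)
 have \<tau>pos: "\<tau> p \<ge> c" "\<sigma> p \<ge> t" for p using c d by (auto simp: \<tau>_def \<sigma>_def)
 have \<tau>mono: "\<tau> p \<le> \<tau> (Suc p)" "\<sigma> p \<le> \<sigma> (Suc p)" for p
  unfolding \<tau>_def \<sigma>_def using c d by (auto intro!: divide_right_mono mult_left_mono)
 \<comment> \<open>The layers used have total height at most \<open>d^2\<close> in squares, so an
   error \<epsilon>' in each lower bound costs at most \<kappa> altogether.\<close>
 define \<epsilon>' where "\<epsilon>' = \<kappa> / d^2"
 have \<epsilon>': "\<epsilon>' > 0" using \<kappa> d by (simp add: \<epsilon>'_def)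
 have r1: "\<Phi> c - \<Phi> t0 - \<kappa> \<le> (\<Sum>p<m. ((\<tau> (Suc p))^2 - (\<tau> p)^2) * F (\<tau> (Suc p)))"
  using riemann_lower[where F=F and \<Phi>=\<Phi>, OF F(1,2) \<Phi> c(2), of t0 d m] c t0 d m m\<kappa> by (simp add: \<tau>_def)
 have r2: "\<Phi> t - \<kappa> \<le> (\<Sum>p<m. ((\<sigma> (Suc p))^2 - (\<sigma> p)^2) * F (\<sigma> (Suc p)))"
 proof -
  have "2 * d^2 / real m * F t \<le> 2 * d^2 / real m * F c"
   using F(1)[of c t] c t0 by (intro mult_left_mono) auto
  then show ?thesis
   using riemann_lower[where F=F and \<Phi>=\<Phi>, OF F(1,2) \<Phi> t, of d d m] d m m\<kappa> \<Phi>D[OF d(1)] by (simp add: \<sigma>_def)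
 qed
 have \<tau>gt0: "\<tau> p > 0" "\<sigma> p > 0" for p using \<tau>pos[of p] c t by linarith+
 have ev1: "\<forall>\<^sub>F N in sequentially. \<forall>p<m. (F (\<tau> (Suc p)) - \<epsilon>') * L N \<le> real (n N (\<tau> (Suc p)))"
 proof -
  have "\<forall>\<^sub>F N in sequentially. \<forall>p\<in>{..<m}. (F (\<tau> (Suc p)) - \<epsilon>') * L N \<le> real (n N (\<tau> (Suc p)))"
   by (intro eventually_ball_finite ballI lower \<epsilon>' \<tau>gt0) simp
  then show ?thesis by (simp add: lessThan_def)
 qed
 have ev2: "\<forall>\<^sub>F N in sequentially. \<forall>p<m. (F (\<sigma> (Suc p)) - \<epsilon>') * L N \<le> real (n N (\<sigma> (Suc p)))"
 proof -
  have "\<forall>\<^sub>F N in sequentially. \<forall>p\<in>{..<m}. (F (\<sigma> (Suc p)) - \<epsilon>') * L N \<le> real (n N (\<sigma> (Suc p)))"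
   by (intro eventually_ball_finite ballI lower \<epsilon>' \<tau>gt0) simp
  then show ?thesis by (simp add: lessThan_def)
 qed
 have ev3: "\<forall>\<^sub>F N in sequentially. L N \<ge> max 0 (K / \<kappa>)" using L unfolding filterlim_at_top by (rule spec)
 show ?thesis
  using ev1 ev2 ev3 eventually_ge_at_top[of 2]
 proof eventually_elim
  case (elim N)
  obtain X s where X: "finite (X :: 'x set)" "(\<Sum>x\<in>X. (s x)^2) \<le> L N * M + K" "\<And>x. x \<in> X \<Longrightarrow> s x \<ge> 0"
   "\<And>t. t \<ge> c \<Longrightarrow> n N t = card {x \<in> X. s x > t}"
   using layers[OF elim(4) c(2)] by blast
  have LN: "L N \<ge> 0" "K \<le> \<kappa> * L N" using elim(3) \<kappa> by (auto simp: pos_divide_le_eq mult.commute)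
  have cnt: "real (n N u) = (\<Sum>x\<in>X. if s x > u then 1 else 0)" if "u \<ge> c" for u
   using X(1) by (simp add: X(4)[OF that] sum.inter_filter[symmetric])
  have layer: "(\<Sum>p<m. ((\<rho> (Suc p))^2 - (\<rho> p)^2) * real (n N (\<rho> (Suc p)))) \<le> (\<Sum>x\<in>X. (min (s x) (\<rho> m))^2 - (min (s x) (\<rho> 0))^2)"
   if "\<And>p. \<rho> p \<ge> c" "\<And>p. \<rho> p \<le> \<rho> (Suc p)" for \<rho> :: "nat \<Rightarrow> real"
  proof -
   have "(\<Sum>p<m. ((\<rho> (Suc p))^2 - (\<rho> p)^2) * real (n N (\<rho> (Suc p)))) = (\<Sum>x\<in>X. \<Sum>p<m. ((\<rho> (Suc p))^2 - (\<rho> p)^2) * (if s x > \<rho> (Suc p) then 1 else 0))"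
    by (subst sum.swap) (simp only: cnt[OF that(1)] sum_distrib_left)
   also have "\<dots> \<le> (\<Sum>x\<in>X. (min (s x) (\<rho> m))^2 - (min (s x) (\<rho> 0))^2)"
    by (intro sum_mono layer_sum_le X(3)) (use that c(2) in \<open>auto intro: order_trans less_imp_le\<close>)
   finally show ?thesis .
  qed
  have mid: "B * real (n N t) \<le> (\<Sum>x\<in>X. (min (s x) t)^2 - (min (s x) t0)^2)"
  proof -
   have "B * real (n N t) = (\<Sum>x\<in>X. B * (if s x > t then 1 else 0))"
    using c t0 by (subst cnt) (auto simp: sum_distrib_left)
   also have "\<dots> \<le> (\<Sum>x\<in>X. (min (s x) t)^2 - (min (s x) t0)^2)"
   proof (rule sum_mono)
    fix x assume x: "x \<in> X"
    have "(min (s x) t0)^2 \<le> (min (s x) t)^2" using X(3)[OF x] t0 by (intro power_mono) auto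
    then show "B * (if s x > t then 1 else 0) \<le> (min (s x) t)^2 - (min (s x) t0)^2"
     using t0 by (auto simp: B_def min_def)
   qed
   finally show ?thesis .
  qed
  have l1: "(\<Sum>p<m. ((\<tau> (Suc p))^2 - (\<tau> p)^2) * real (n N (\<tau> (Suc p)))) \<le> (\<Sum>x\<in>X. (min (s x) t0)^2 - (min (s x) c)^2)"
   using layer[of \<tau>, OF \<tau>pos(1) \<tau>mono(1)] by (simp add: ends)
  have l2: "(\<Sum>p<m. ((\<sigma> (Suc p))^2 - (\<sigma> p)^2) * real (n N (\<sigma> (Suc p)))) \<le> (\<Sum>x\<in>X. (min (s x) d)^2 - (min (s x) t)^2)"
   using layer[of \<sigma>] \<tau>pos(2) \<tau>mono(2) c t0 by (simp add: ends order_trans[OF _ \<tau>pos(2)])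
  have tot: "(\<Sum>x\<in>X. (min (s x) t0)^2 - (min (s x) c)^2) + (\<Sum>x\<in>X. (min (s x) t)^2 - (min (s x) t0)^2) + (\<Sum>x\<in>X. (min (s x) d)^2 - (min (s x) t)^2) \<le> L N * M + K"
  proof -
   have "(\<Sum>x\<in>X. (min (s x) t0)^2 - (min (s x) c)^2) + (\<Sum>x\<in>X. (min (s x) t)^2 - (min (s x) t0)^2) + (\<Sum>x\<in>X. (min (s x) d)^2 - (min (s x) t)^2)
     = (\<Sum>x\<in>X. (min (s x) d)^2 - (min (s x) c)^2)" by (simp add: sum_subtractf)
   also have "\<dots> \<le> (\<Sum>x\<in>X. (s x)^2)"
   proof (rule sum_mono)
    fix x assume x: "x \<in> X"
    have "(min (s x) d)^2 \<le> (s x)^2" using X(3)[OF x] d by (intro power_mono) auto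
    then show "(min (s x) d)^2 - (min (s x) c)^2 \<le> (s x)^2" using zero_le_power2[of "min (s x) c"] by linarith
   qed
   finally show ?thesis using X(2) by linarith
  qed
  have low: "((\<Sum>p<m. ((\<rho> (Suc p))^2 - (\<rho> p)^2) * F (\<rho> (Suc p))) - \<epsilon>' * ((\<rho> m)^2 - (\<rho> 0)^2)) * L N \<le> (\<Sum>p<m. ((\<rho> (Suc p))^2 - (\<rho> p)^2) * real (n N (\<rho> (Suc p))))"
   if "\<And>p. \<rho> p \<ge> 0" "\<And>p. \<rho> p \<le> \<rho> (Suc p)" "\<forall>p<m. (F (\<rho> (Suc p)) - \<epsilon>') * L N \<le> real (n N (\<rho> (Suc p)))" for \<rho> :: "nat \<Rightarrow> real"
  proof -
   have "(\<Sum>p<m. (\<rho> (Suc p))^2 - (\<rho> p)^2) = (\<rho> m)^2 - (\<rho> 0)^2" by (rule sum_lessThan_telescope)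
   from this[symmetric] have "((\<Sum>p<m. ((\<rho> (Suc p))^2 - (\<rho> p)^2) * F (\<rho> (Suc p))) - \<epsilon>' * ((\<rho> m)^2 - (\<rho> 0)^2)) * L N
     = (\<Sum>p<m. ((\<rho> (Suc p))^2 - (\<rho> p)^2) * ((F (\<rho> (Suc p)) - \<epsilon>') * L N))"
    by (simp only: sum_distrib_left sum_subtractf[symmetric] sum_distrib_right)
     (intro sum.cong refl, simp add: algebra_simps)
   also have "\<dots> \<le> (\<Sum>p<m. ((\<rho> (Suc p))^2 - (\<rho> p)^2) * real (n N (\<rho> (Suc p))))"
   proof (rule sum_mono)
    fix p assume p: "p \<in> {..<m}"
    have "(\<rho> p)^2 \<le> (\<rho> (Suc p))^2" using that by (intro power_mono) auto
    then show "((\<rho> (Suc p))^2 - (\<rho> p)^2) * ((F (\<rho> (Suc p)) - \<epsilon>') * L N) \<le> ((\<rho> (Suc p))^2 - (\<rho> p)^2) * real (n N (\<rho> (Suc p)))"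
     using p that(3) by (intro mult_left_mono) auto
   qed
   finally show ?thesis .
  qed
  have nn: "\<tau> p \<ge> 0" "\<sigma> p \<ge> 0" for p using \<tau>pos[of p] c t by auto
  have "(\<Phi> c - \<Phi> t0 - \<kappa> - \<epsilon>' * (t0^2 - c^2)) * L N \<le> (\<Sum>p<m. ((\<tau> (Suc p))^2 - (\<tau> p)^2) * real (n N (\<tau> (Suc p))))"
   using order_trans[OF mult_right_mono[OF diff_right_mono[OF r1] LN(1)] low[of \<tau>, OF nn(1) \<tau>mono(1) elim(1), unfolded ends]] .
  moreover have "(\<Phi> t - \<kappa> - \<epsilon>' * (d^2 - t^2)) * L N \<le> (\<Sum>p<m. ((\<sigma> (Suc p))^2 - (\<sigma> p)^2) * real (n N (\<sigma> (Suc p))))"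
   using order_trans[OF mult_right_mono[OF diff_right_mono[OF r2] LN(1)] low[of \<sigma>, OF nn(2) \<tau>mono(2) elim(2), unfolded ends]] .
  \<comment> \<open>The layers from \<open>c\<close> to \<open>t0\<close> and from \<open>t\<close>
    to \<open>d\<close> consume at least their asymptotic share of the budget; what remains bounds
    the layer between \<open>t0\<close> and \<open>t\<close>.\<close>
  ultimately have "B * real (n N t) \<le> L N * M + K - (\<Phi> c - \<Phi> t0 - \<kappa> - \<epsilon>' * (t0^2 - c^2)) * L N - (\<Phi> t - \<kappa> - \<epsilon>' * (d^2 - t^2)) * L N"
   using l1 l2 mid tot by linarith
  also have "\<dots> = (M - \<Phi> c + (\<Phi> t0 - \<Phi> t) + 2 * \<kappa> + \<epsilon>' * (t0^2 - c^2 + (d^2 - t^2))) * L N + K"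
   by (simp add: algebra_simps)
  also have "\<dots> \<le> (\<kappa> + F t0 * B + 2 * \<kappa> + \<kappa>) * L N + \<kappa> * L N"
  proof (intro add_mono mult_right_mono LN)
   show "M - \<Phi> c \<le> \<kappa>" using c by simp
   show "\<Phi> t0 - \<Phi> t \<le> F t0 * B" unfolding B_def by (rule \<Phi>) (use t0 in auto)
   have "t0^2 \<le> t^2" using t0 by (intro power_mono) auto
   then have "t0^2 - c^2 + (d^2 - t^2) \<le> d^2" using zero_le_power2[of c] by linarith
   then have "\<epsilon>' * (t0^2 - c^2 + (d^2 - t^2)) \<le> \<epsilon>' * d^2" using \<epsilon>' by (intro mult_left_mono) auto
   also have "\<dots> = \<kappa>" using d by (simp add: \<epsilon>'_def)
   finally show "\<epsilon>' * (t0^2 - c^2 + (d^2 - t^2)) \<le> \<kappa>" .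
  qed (use \<kappa> in auto)
  also have "\<dots> = B * ((F t0 + 5 / 8 * \<epsilon>) * L N)" by (simp add: \<kappa>_def algebra_simps)
  also have "\<dots> \<le> B * ((F t + \<epsilon>) * L N)" using t0(1) LN(1) B \<epsilon> by (intro mult_left_mono mult_right_mono) auto
  finally show "real (n N t) \<le> (F t + \<epsilon>) * L N" using B by simp
 qed
qed

section \<open>Asymptotics for finitely many jumps\<close>

lemma filterlim_ln_real: "filterlim (\<lambda>N. ln (real N)) at_top sequentially"
 by (rule filterlim_compose[OF ln_at_top filterlim_real_sequentially])

lemma isCont_cfun_sum:
 fixes lam :: "'p \<Rightarrow> real"
 assumes "t > 0" "\<And>p. p \<in> P \<Longrightarrow> lam p \<ge> 0"
 shows "isCont (\<lambda>t. \<Sum>p\<in>P. cfun (t / lam p)) t"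
proof (intro continuous_intros)
 fix p assume p: "p \<in> P"
 show "isCont (\<lambda>t. cfun (t / lam p)) t"
 proof (cases "lam p = 0")
  case False
  then have "lam p > 0" using assms(2)[OF p] by simp
  then show ?thesis
   by (intro isCont_o2[where g=cfun, OF _ isCont_cfun] continuous_intros) (use assms(1) in auto)
 qed simp
qed

context jump_data
begin

text \<open>Continuity in the level absorbs the gap between \<open>t\<close> and \<open>t'\<close>,
  and the constant loss \<open>K\<close> is absorbed by a multiple of \<open>ln N\<close>. The
  disjunction on \<open>n\<close> treats singular values and positive eigenvalues at once.\<close>

lemma n_lower_of_types:
 fixes \<alpha> \<beta> :: "'p \<Rightarrow> complex \<Rightarrow> complex" and lam :: "'p \<Rightarrow> real" and n :: "real \<Rightarrow> nat \<Rightarrow> nat"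
 assumes P: "finite P"
  and on\<alpha>: "\<And>p q. p \<in> P \<Longrightarrow> q \<in> P \<Longrightarrow> (\<Sum>z\<in>Z. \<alpha> p z * cnj (\<alpha> q z)) = (if p = q then 1 else 0)"
  and on\<beta>: "\<And>p q. p \<in> P \<Longrightarrow> q \<in> P \<Longrightarrow> (\<Sum>z\<in>Z. \<beta> p z * cnj (\<beta> q z)) = (if p = q then 1 else 0)"
  and a1: "\<And>p z. p \<in> P \<Longrightarrow> z \<in> Z \<Longrightarrow> norm (\<alpha> p z) \<le> 1"
  and rel: "\<And>p z. p \<in> P \<Longrightarrow> z \<in> Z \<Longrightarrow> \<alpha> p z * a z = complex_of_real (lam p) * \<beta> p (cnj z)"
  and lam: "\<And>p. p \<in> P \<Longrightarrow> 0 < lam p" and t: "t > 0" and \<epsilon>: "\<epsilon> > 0"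
  and n: "n = (\<lambda>t N. n_sing t (jump_operator a Z N)) \<or>
   (n = (\<lambda>t N. n_plus t (jump_operator a Z N)) \<and> \<alpha> = \<beta> \<and>
    (\<forall>N. self_adjoint (jump_operator a Z N)))"
 shows "\<forall>\<^sub>F N in sequentially. ((\<Sum>p\<in>P. cfun (t / lam p)) - \<epsilon>) * ln (real N) \<le> real (n t N)"
proof -
 define F where "F t = (\<Sum>p\<in>P. cfun (t / lam p))" for t
 have "isCont F t" unfolding F_def by (rule isCont_cfun_sum) (use t lam in \<open>auto intro: less_imp_le\<close>)
 then have "\<forall>\<^sub>F x in at_right t. F t - \<epsilon> / 2 < F x"
  using order_tendstoD(1)[of F "F t" "at_right t" "F t - \<epsilon> / 2"] \<epsilon> by (simp add: isCont_def filterlim_at_split)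
 moreover have "\<forall>\<^sub>F x in at_right t. t < x" by (rule eventually_at_right_less)
 ultimately have "\<forall>\<^sub>F x in at_right t. F t - \<epsilon> / 2 < F x \<and> t < x" by (rule eventually_conj)
 from eventually_happens'[OF _ this] obtain t' where t': "F t - \<epsilon> / 2 < F t'" "t < t'"
  by (auto simp: trivial_limit_at_right_real)
 \<comment> \<open>The types below the level \<open>t'\<close> supply no modes and contribute
   nothing to the sum either, as \<open>cfun\<close> vanishes from 1 on.\<close>
 define P' where "P' = {p\<in>P. t' \<le> lam p}"
 have F': "(\<Sum>p\<in>P'. cfun (t' / lam p)) = F t'"
  unfolding F_def by (rule sum.mono_neutral_left) (use P lam in \<open>auto simp: P'_def not_le intro!: cfun_eq_0\<close>)
 obtain K where K:
  "\<And>N. N \<ge> 2 \<Longrightarrow> ln (real N) * (\<Sum>p\<in>P'. cfun (t' / lam p)) - K \<le> real (n_sing t (jump_operator a Z N))"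
  "\<And>N. N \<ge> 2 \<Longrightarrow> \<alpha> = \<beta> \<Longrightarrow> self_adjoint (jump_operator a Z N) \<Longrightarrow>
   ln (real N) * (\<Sum>p\<in>P'. cfun (t' / lam p)) - K \<le> real (n_plus t (jump_operator a Z N))"
  by (rule count_lower[where P=P' and \<alpha>=\<alpha> and \<beta>=\<beta> and lam=lam and a=a and t=t and t'=t'])
   (use P on\<alpha> on\<beta> a1 rel t t' in \<open>auto simp: P'_def\<close>)
 have "\<forall>\<^sub>F N in sequentially. ln (real N) \<ge> max 0 (2 * K / \<epsilon>)"
  using filterlim_ln_real unfolding filterlim_at_top by (rule spec)
 then show ?thesis
  using eventually_ge_at_top[of 2]
 proof eventually_elim
  case (elim N)
  define L where "L = ln (real N)"
  have L: "L \<ge> 0" "K \<le> \<epsilon> / 2 * L" using elim(1) \<epsilon> by (auto simp: L_def field_simps)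
  have "(F t - \<epsilon>) * L \<le> (F t' - \<epsilon> / 2) * L" using t'(1) L(1) by (intro mult_right_mono) auto
  also have "\<dots> \<le> L * F t' - K" using L(2) by (simp add: algebra_simps)
  also have "\<dots> \<le> real (n t N)"
   using n K(1)[OF elim(2)] K(2)[OF elim(2)] unfolding F' L_def by auto
  finally show ?case by (simp add: F_def L_def)
 qed
qed

text \<open>The matrix of jumps is a weighted permutation of the points. Its singular vectors are
  the point masses at \<open>p\<close>, and their images are the point masses at
  \<open>cnj p\<close> times the phase of \<open>a p\<close>.\<close>

lemma n_sing_lower:
 assumes t: "t > 0" and \<epsilon>: "\<epsilon> > 0"
 shows "\<forall>\<^sub>F N in sequentially. ((\<Sum>z\<in>Z. cfun (t / norm (a z))) - \<epsilon>) * ln (real N) \<le> real (n_sing t (jump_operator a Z N))"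
proof -
 define P where "P = {z\<in>Z. a z \<noteq> 0}"
 have "(\<Sum>p\<in>P. cfun (t / norm (a p))) = (\<Sum>z\<in>Z. cfun (t / norm (a z)))"
  by (rule sum.mono_neutral_left) (use fin in \<open>auto simp: P_def cfun_def\<close>)
 moreover have "\<forall>\<^sub>F N in sequentially. ((\<Sum>p\<in>P. cfun (t / norm (a p))) - \<epsilon>) * ln (real N) \<le> real (n_sing t (jump_operator a Z N))"
 proof (rule n_lower_of_types[where P=P and lam="\<lambda>p. norm (a p)" and \<alpha>="\<lambda>p z. if z = p then 1 else 0"
    and \<beta>="\<lambda>p z. if z = cnj p then a p / of_real (norm (a p)) else 0"
    and n="\<lambda>t N. n_sing t (jump_operator a Z N)"])
  show "finite P" using fin by (simp add: P_def)
  fix p q assume p: "p \<in> P" and q: "q \<in> P"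
  have pZ: "p \<in> Z" "cnj p \<in> Z" using p cnj_closed by (auto simp: P_def)
  show "(\<Sum>z\<in>Z. (if z = p then 1 else 0) * cnj (if z = q then 1 else 0)) = (if p = q then 1 else 0)"
  proof -
   have "(\<Sum>z\<in>Z. (if z = p then 1 else 0) * cnj (if z = q then 1 else 0)) = (\<Sum>z\<in>Z. if z = p then (if p = q then 1 else 0) else (0 :: complex))"
    by (intro sum.cong) auto
   then show ?thesis using fin pZ by simp
  qed
  show "(\<Sum>z\<in>Z. (if z = cnj p then a p / of_real (norm (a p)) else 0) * cnj (if z = cnj q then a q / of_real (norm (a q)) else 0)) = (if p = q then 1 else 0)"
  proof -
   have one: "a p / of_real (norm (a p)) * cnj (a p / of_real (norm (a p))) = 1"
    using p by (simp add: complex_norm_square[symmetric] P_def power2_eq_square[symmetric])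
   have "(\<Sum>z\<in>Z. (if z = cnj p then a p / of_real (norm (a p)) else 0) * cnj (if z = cnj q then a q / of_real (norm (a q)) else 0))
     = (\<Sum>z\<in>Z. if z = cnj p then (if p = q then 1 else 0) else 0)"
    using one by (intro sum.cong) auto
   then show ?thesis using fin pZ by simp
  qed
 qed (use t \<epsilon> in \<open>auto simp: P_def\<close>)
 ultimately show ?thesis by simp
qed

text \<open>On a nonreal pair \<open>p\<close>, \<open>cnj p\<close> the matrix of jumps exchanges
  the points with conjugate weights and has eigenvalues plus and minus \<open>norm (a p)\<close>, so
  each pair gives one positive type. At a real point the eigenvalue is the real number
  \<open>a p\<close> itself.\<close>

lemma n_plus_lower:
 assumes t: "t > 0" and \<epsilon>: "\<epsilon> > 0" and sym: "\<And>z. z \<in> Z \<Longrightarrow> a (cnj z) = cnj (a z)"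
  and sa: "\<And>N. self_adjoint (jump_operator a Z N)"
 shows "\<forall>\<^sub>F N in sequentially. ((\<Sum>z\<in>{z\<in>Z. Im z > 0 \<or> (Im z = 0 \<and> Re (a z) > 0)}. cfun (t / norm (a z))) - \<epsilon>) * ln (real N)
  \<le> real (n_plus t (jump_operator a Z N))"
proof -
 define P where "P = {z\<in>Z. a z \<noteq> 0 \<and> (Im z > 0 \<or> (Im z = 0 \<and> Re (a z) > 0))}"
 \<comment> \<open>Coefficients at \<open>p\<close> and \<open>cnj p\<close> of the normalized
   eigenvector for the positive eigenvalue. At a real point the two coincide, and only the first is
   used.\<close>
 define u where "u p = complex_of_real (if Im p = 0 then 1 else 1 / sqrt 2)" for p
 define w where "w p = (if Im p = 0 then 0 else a p / of_real (norm (a p)) * of_real (1 / sqrt 2))" for p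
 define \<alpha> where "\<alpha> p z = u p * (if z = p then 1 else 0) + w p * (if z = cnj p then 1 else 0)" for p z
 have half: "complex_of_real (1 / sqrt 2) * of_real (1 / sqrt 2) = 1 / 2"
  by (simp add: of_real_mult[symmetric] del: of_real_mult)
 have ph: "a p / of_real (norm (a p)) * cnj (a p / of_real (norm (a p))) = 1" if "p \<in> P" for p
  using that by (simp add: complex_norm_square[symmetric] P_def power2_eq_square[symmetric])
 have uw: "u p * cnj (u p) + w p * cnj (w p) = 1" if "p \<in> P" for p
 proof (cases "Im p = 0")
  case False
  have "w p * cnj (w p) = (a p / of_real (norm (a p)) * cnj (a p / of_real (norm (a p)))) * (complex_of_real (1 / sqrt 2) * of_real (1 / sqrt 2))"
   using False by (simp add: w_def)
  then have "w p * cnj (w p) = 1 / 2" unfolding ph[OF that] half by simp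
  moreover have "u p * cnj (u p) = 1 / 2" using False half by (simp add: u_def)
  ultimately have "u p * cnj (u p) + w p * cnj (w p) = 1 / 2 + 1 / 2" by (simp only:)
  then show ?thesis by simp
 qed (simp add: u_def w_def)
 have real_cnj: "cnj p = p" if "Im p = 0" for p using that by (simp add: complex_eq_iff)
 have sum_eq: "(\<Sum>z\<in>Z. \<alpha> p z * cnj (\<alpha> q z)) = (if p = q then 1 else 0)" if p: "p \<in> P" and q: "q \<in> P" for p q
 proof -
  have Zp: "p \<in> Z" "cnj p \<in> Z" using p cnj_closed by (auto simp: P_def)
  have "(\<Sum>z\<in>Z. \<alpha> p z * cnj (\<alpha> q z)) = (\<Sum>z\<in>Z. if z = p then u p * cnj (\<alpha> q p) else 0) + (\<Sum>z\<in>Z. if z = cnj p then w p * cnj (\<alpha> q (cnj p)) else 0)"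
   unfolding sum.distrib[symmetric] by (intro sum.cong refl) (auto simp: \<alpha>_def[of p] distrib_right)
  also have "\<dots> = u p * cnj (\<alpha> q p) + w p * cnj (\<alpha> q (cnj p))" using fin Zp by simp
  also have "\<dots> = (if p = q then 1 else 0)"
  proof (cases "Im p = 0")
   case True
   have "p = cnj q \<longleftrightarrow> p = q" using True by (auto simp: complex_eq_iff)
   then show ?thesis using True by (auto simp: \<alpha>_def w_def u_def)
  next
   case False
   then have "Im p > 0" using p by (auto simp: P_def)
   then have "p \<noteq> cnj q" "cnj p \<noteq> q" using q by (auto simp: P_def complex_eq_iff)
   then show ?thesis using uw[OF p] by (auto simp: \<alpha>_def)
  qed
  finally show ?thesis .
 qed
 have a1: "norm (\<alpha> p z) \<le> 1" if p: "p \<in> P" for p z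
 proof (cases "Im p = 0")
  case True
  then show ?thesis by (simp add: \<alpha>_def u_def w_def)
 next
  case False
  then have "p \<noteq> cnj p" by (auto simp: complex_eq_iff)
  then show ?thesis using False p by (auto simp: \<alpha>_def u_def w_def norm_mult norm_divide P_def)
 qed
 have rel: "\<alpha> p z * a z = complex_of_real (norm (a p)) * \<alpha> p (cnj z)" if p: "p \<in> P" and z: "z \<in> Z" for p z
 proof (cases "Im p = 0")
  case True
  have "Im (a p) = 0" using sym[of p] p real_cnj[OF True] by (auto simp: P_def complex_eq_iff)
  then have "a p = complex_of_real (norm (a p))" using p True by (auto simp: P_def complex_eq_iff cmod_def)
  moreover have "cnj z = p \<longleftrightarrow> z = p" using real_cnj[OF True] by (metis complex_cnj_cnj)
  ultimately show ?thesis using True by (simp add: \<alpha>_def u_def w_def)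
 next
  case False
  then have ne: "p \<noteq> cnj p" by (auto simp: complex_eq_iff)
  have p0: "norm (a p) \<noteq> 0" using p by (simp add: P_def)
  have cz: "cnj z = p \<longleftrightarrow> z = cnj p" "cnj z = cnj p \<longleftrightarrow> z = p" by (metis complex_cnj_cnj)+
  have wn: "complex_of_real (norm (a p)) * w p = u p * a p" using False p0 by (simp add: w_def u_def)
  have "w p * cnj (a p) = (a p * cnj (a p)) / of_real (norm (a p)) * of_real (1 / sqrt 2)"
   using False by (simp add: w_def)
  also have "a p * cnj (a p) = complex_of_real (norm (a p)) * of_real (norm (a p))"
   by (simp add: complex_norm_square[symmetric] power2_eq_square)
  also have "\<dots> / of_real (norm (a p)) * of_real (1 / sqrt 2) = complex_of_real (norm (a p)) * u p"
   using False p0 by (simp add: u_def)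
  finally have wa: "w p * cnj (a p) = complex_of_real (norm (a p)) * u p" .
  have "a (cnj p) = cnj (a p)" using sym p by (simp add: P_def)
  then show ?thesis using ne wn wa by (auto simp: \<alpha>_def cz)
 qed
 have "\<forall>\<^sub>F N in sequentially. ((\<Sum>p\<in>P. cfun (t / norm (a p))) - \<epsilon>) * ln (real N) \<le> real (n_plus t (jump_operator a Z N))"
  by (rule n_lower_of_types[where P=P and lam="\<lambda>p. norm (a p)" and \<alpha>=\<alpha> and \<beta>=\<alpha>
    and n="\<lambda>t N. n_plus t (jump_operator a Z N)"])
   (use sum_eq a1 rel t \<epsilon> sa fin in \<open>auto simp: P_def\<close>)
 moreover have "(\<Sum>p\<in>P. cfun (t / norm (a p))) = (\<Sum>z\<in>{z\<in>Z. Im z > 0 \<or> (Im z = 0 \<and> Re (a z) > 0)}. cfun (t / norm (a z)))"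
  by (rule sum.mono_neutral_left) (use fin in \<open>auto simp: P_def cfun_def\<close>)
 ultimately show ?thesis by simp
qed

text \<open>The value of \<open>\<Phi>\<close> at 0 equals the coefficient of \<open>ln N\<close> in
  the squared Hilbert--Schmidt norm. This coincidence leaves no budget for singular values beyond
  those found from below.\<close>

lemma n_sing_upper:
 assumes t: "t > 0" and \<epsilon>: "\<epsilon> > 0"
 shows "\<forall>\<^sub>F N in sequentially. real (n_sing t (jump_operator a Z N)) \<le> ((\<Sum>z\<in>Z. cfun (t / norm (a z))) + \<epsilon>) * ln (real N)"
proof -
 obtain K where K: "\<And>N. N \<ge> 2 \<Longrightarrow> hs_bound (jump_section a Z N) (ln (real N) * (\<Sum>z\<in>Z. (norm (a z))^2) / pi^2 + K)"
  using jump_section_hs_asymp by blast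
 \<comment> \<open>By scaling, each summand is the integral from \<open>s\<close> to infinity of
   twice the variable times \<open>cfun\<close> of the variable divided by
   \<open>norm (a z)\<close>.\<close>
 define \<Phi> where "\<Phi> s = (\<Sum>z\<in>Z. (norm (a z))^2 * cfun_primitive (s / norm (a z)))" for s
 show ?thesis
 proof (rule counting_upper[where F="\<lambda>t. \<Sum>z\<in>Z. cfun (t / norm (a z))" and \<Phi>=\<Phi> and M="(\<Sum>z\<in>Z. (norm (a z))^2) / pi^2"
    and n="\<lambda>N t. n_sing t (jump_operator a Z N)" and L="\<lambda>N. ln (real N)" and K=K
    and D="\<Sum>z\<in>Z. norm (a z)" and 'x=ell2])
  fix x y :: real assume xy: "0 < x" "x \<le> y"
  show "(\<Sum>z\<in>Z. cfun (y / norm (a z))) \<le> (\<Sum>z\<in>Z. cfun (x / norm (a z)))"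
  proof (rule sum_mono)
   fix z
   show "cfun (y / norm (a z)) \<le> cfun (x / norm (a z))"
    by (cases "a z = 0") (use xy in \<open>auto intro!: cfun_antimono divide_right_mono\<close>)
  qed
  have "\<Phi> x - \<Phi> y = (\<Sum>z\<in>Z. (norm (a z))^2 * (cfun_primitive (x / norm (a z)) - cfun_primitive (y / norm (a z))))"
   by (simp add: \<Phi>_def sum_subtractf right_diff_distrib)
  also have "\<dots> \<le> (\<Sum>z\<in>Z. cfun (x / norm (a z)) * (y^2 - x^2))"
  proof (rule sum_mono)
   fix z
   show "(norm (a z))^2 * (cfun_primitive (x / norm (a z)) - cfun_primitive (y / norm (a z))) \<le> cfun (x / norm (a z)) * (y^2 - x^2)"
   proof (cases "a z = 0")
    case True
    then show ?thesis by (simp add: cfun_def)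
   next
    case False
    have "cfun_primitive (x / norm (a z)) - cfun_primitive (y / norm (a z)) \<le> cfun (x / norm (a z)) * ((y / norm (a z))^2 - (x / norm (a z))^2)"
     by (rule cfun_primitive_diff) (use xy False in \<open>auto intro: divide_right_mono\<close>)
    also have "\<dots> = cfun (x / norm (a z)) * (y^2 - x^2) / (norm (a z))^2"
     by (simp add: power_divide diff_divide_distrib[symmetric])
    finally show ?thesis using False by (simp add: pos_le_divide_eq mult.commute)
   qed
  qed
  also have "\<dots> = (\<Sum>z\<in>Z. cfun (x / norm (a z))) * (y^2 - x^2)" by (simp add: sum_distrib_right)
  finally show "\<Phi> x - \<Phi> y \<le> (\<Sum>z\<in>Z. cfun (x / norm (a z))) * (y^2 - x^2)" .
 next
  show "(\<Sum>z\<in>Z. cfun (x / norm (a z))) \<ge> 0" for x by (intro sum_nonneg cfun_nonneg)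
  show "isCont (\<lambda>t. \<Sum>z\<in>Z. cfun (t / norm (a z))) x" if "x > 0" for x
   by (rule isCont_cfun_sum) (use that in auto)
  have lim: "((\<lambda>s. (norm (a z))^2 * cfun_primitive (s / norm (a z))) \<longlongrightarrow> (norm (a z))^2 * (1 / pi^2)) (at_right 0)" for z
  proof (cases "a z = 0")
   case False
   have "filterlim (\<lambda>s. s / norm (a z)) (at_right 0) (at_right 0)"
    unfolding filterlim_at
   proof
    show "\<forall>\<^sub>F s in at_right 0. s / norm (a z) \<in> {0<..} \<and> s / norm (a z) \<noteq> 0"
     using eventually_at_right_less[of "0::real"] by eventually_elim (use False in simp)
    have "((\<lambda>s. s / norm (a z)) \<longlongrightarrow> 0 / norm (a z)) (at_right 0)" by (intro tendsto_intros) (use False in auto)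
    then show "((\<lambda>s. s / norm (a z)) \<longlongrightarrow> 0) (at_right 0)" by simp
   qed
   from filterlim_compose[OF cfun_primitive_at_0 this] show ?thesis by (intro tendsto_intros)
  qed simp
  have "(\<Phi> \<longlongrightarrow> (\<Sum>z\<in>Z. (norm (a z))^2 * (1 / pi^2))) (at_right 0)"
   unfolding \<Phi>_def by (intro tendsto_sum lim)
  then show "(\<Phi> \<longlongrightarrow> (\<Sum>z\<in>Z. (norm (a z))^2) / pi^2) (at_right 0)" by (simp add: sum_divide_distrib)
  show "\<Phi> d = 0" if d: "d \<ge> (\<Sum>z\<in>Z. norm (a z))" for d
   unfolding \<Phi>_def
  proof (rule sum.neutral, rule ballI)
   fix z assume z: "z \<in> Z"
   have "norm (a z) \<le> d" using member_le_sum[OF z, of "\<lambda>z. norm (a z)"] fin d by simp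
   then show "(norm (a z))^2 * cfun_primitive (d / norm (a z)) = 0"
    by (cases "a z = 0") (auto simp: cfun_primitive_def)
  qed
  fix N :: nat and c :: real assume "N \<ge> 2" "c > 0"
  have "hs_bound (jump_section a Z N) (ln (real N) * ((\<Sum>z\<in>Z. (norm (a z))^2) / pi^2) + K)"
   using K[OF \<open>N \<ge> 2\<close>] by simp
  note hs = this
  show "\<exists>X s. finite (X :: ell2 set) \<and> (\<Sum>x\<in>X. (s x)^2) \<le> ln (real N) * ((\<Sum>z\<in>Z. (norm (a z))^2) / pi^2) + K \<and>
   (\<forall>x\<in>X. s x \<ge> 0) \<and> (\<forall>t\<ge>c. n_sing t (jump_operator a Z N) = card {x \<in> X. s x > t})"
   by (rule singular_values_hs[OF hs \<open>c > 0\<close>], intro exI conjI ballI allI impI) assumption+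
 qed (use n_sing_lower filterlim_ln_real t \<epsilon> in auto)
qed

lemma jump_section_self_adjoint:
 assumes sym: "\<And>z. z \<in> Z \<Longrightarrow> a (cnj z) = cnj (a z)"
 shows "self_adjoint (jump_operator a Z N)"
proof (rule self_adjoint_matrix_operator[OF jump_section_bounded])
 have bij: "bij_betw cnj Z Z"
  by (rule bij_betwI[where g=cnj]) (auto simp: cnj_closed)
 have "(\<Sum>z\<in>Z. a z * cnj z ^ m) = cnj (\<Sum>z\<in>Z. a z * cnj z ^ m)" for m
 proof -
  have "(\<Sum>z\<in>Z. a z * cnj z ^ m) = (\<Sum>z\<in>Z. a (cnj z) * cnj (cnj z) ^ m)"
   by (rule sum.reindex_bij_betw[OF bij, symmetric])
  also have "\<dots> = cnj (\<Sum>z\<in>Z. a z * cnj z ^ m)" using sym by simp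
  finally show ?thesis .
 qed
 then show "jump_section a Z N j k = cnj (jump_section a Z N k j)" for j k
  unfolding jump_section_def by (auto simp: add.commute[of k j] simp del: cnj_sum)
qed

end

section \<open>Fourier coefficients and Hankel matrices of bounded symbols\<close>

text \<open>A Borel representative, bounded everywhere, on the closed parameter interval. Unlike
  essential boundedness this is a pointwise notion, which suits sums, reflections and integrals over
  subintervals.\<close>

definition bounded_symbol :: "(complex \<Rightarrow> complex) \<Rightarrow> bool" where
 "bounded_symbol \<phi> \<longleftrightarrow> (\<exists>g M. g \<in> borel_measurable borel \<and> (\<forall>x\<in>{0..2 * pi}. \<phi> (cis x) = g x) \<and> (\<forall>x. norm (g x) \<le> M))"

lemma integrable_bounded_borel:
 fixes g :: "real \<Rightarrow> 'a::{banach, second_countable_topology}"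
 assumes g: "g \<in> borel_measurable borel" and M: "\<And>x. x \<in> {a..b} \<Longrightarrow> norm (g x) \<le> M"
 shows "integrable (lebesgue_on {a..b}) g"
proof (rule finite_measure.integrable_const_bound[where B=M])
 show "finite_measure (lebesgue_on {a..b})" by (rule finite_measure_lebesgue_on) simp
 have "g \<in> borel_measurable lborel" using g by simp
 then show "g \<in> borel_measurable (lebesgue_on {a..b})"
  by (intro measurable_restrict_space1 measurable_completion)
 show "AE x in lebesgue_on {a..b}. norm (g x) \<le> M"
  by (rule AE_I2) (use M in \<open>simp add: space_restrict_space\<close>)
qed

lemma bounded_symbol_integrable:
 assumes \<phi>: "bounded_symbol \<phi>" and h: "h \<in> borel_measurable borel" and B: "\<And>x. norm (h x :: complex) \<le> B"
 shows "integrable (lebesgue_on {0..2 * pi}) (\<lambda>x. \<phi> (cis x) * h x)"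
proof -
 obtain g M where g: "g \<in> borel_measurable borel" "\<And>x. x \<in> {0..2 * pi} \<Longrightarrow> \<phi> (cis x) = g x" "\<And>x. norm (g x) \<le> M"
  using \<phi> unfolding bounded_symbol_def by blast
 have "integrable (lebesgue_on {0..2 * pi}) (\<lambda>x. g x * h x)"
 proof (rule integrable_bounded_borel[where M="M * B"])
  show "(\<lambda>x. g x * h x) \<in> borel_measurable borel" using g(1) h by measurable
  show "norm (g x * h x) \<le> M * B" for x
   unfolding norm_mult using g(3)[of x] B[of x] by (intro mult_mono) (auto intro: order_trans[OF norm_ge_zero])
 qed
 then show ?thesis
  by (rule Bochner_Integration.integrable_cong[THEN iffD1, rotated -1]) (auto simp: space_restrict_space g(2))
qed

lemma cis_borel [measurable]: "(\<lambda>x. cis (c * x)) \<in> borel_measurable borel"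
 by (intro borel_measurable_continuous_onI continuous_intros)

lemma fourier_integrable:
 assumes "bounded_symbol \<phi>"
 shows "integrable (lebesgue_on {0..2 * pi}) (\<lambda>x. \<phi> (cis x) * cis (- (of_int j * x)))"
 using bounded_symbol_integrable[OF assms cis_borel[of "- of_int j"], of 1] by simp

lemma bounded_symbol_ess_bounded:
 assumes \<phi>: "bounded_symbol \<phi>"
 shows "ess_bounded \<phi>"
 unfolding ess_bounded_def
proof
 show "(\<lambda>x. \<phi> (cis x)) \<in> borel_measurable (lebesgue_on {0..2 * pi})"
  using bounded_symbol_integrable[OF \<phi>, of "\<lambda>_. 1" 1] by (auto dest: borel_measurable_integrable)
 obtain g M where g: "\<And>x. x \<in> {0..2 * pi} \<Longrightarrow> \<phi> (cis x) = g x" "\<And>x. norm (g x) \<le> M"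
  using \<phi> unfolding bounded_symbol_def by blast
 have "AE x in lebesgue_on {0..2 * pi}. norm (\<phi> (cis x)) \<le> M"
  by (rule AE_I2) (use g in \<open>simp add: space_restrict_space\<close>)
 then show "\<exists>M. AE x in lebesgue_on {0..2 * pi}. norm (\<phi> (cis x)) \<le> M" by blast
qed

lemma bounded_symbol_add:
 assumes "bounded_symbol \<phi>" "bounded_symbol \<psi>"
 shows "bounded_symbol (\<lambda>z. \<phi> z + \<psi> z)"
proof -
 obtain g M where g: "g \<in> borel_measurable borel" "\<And>x. x \<in> {0..2 * pi} \<Longrightarrow> \<phi> (cis x) = g x" "\<And>x. norm (g x) \<le> M"
  using assms(1) unfolding bounded_symbol_def by blast
 obtain h B where h: "h \<in> borel_measurable borel" "\<And>x. x \<in> {0..2 * pi} \<Longrightarrow> \<psi> (cis x) = h x" "\<And>x. norm (h x) \<le> B"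
  using assms(2) unfolding bounded_symbol_def by blast
 show ?thesis unfolding bounded_symbol_def
 proof (intro exI[of _ "\<lambda>x. g x + h x"] exI[of _ "M + B"] conjI allI ballI)
  show "(\<lambda>x. g x + h x) \<in> borel_measurable borel" using g(1) h(1) by measurable
  show "norm (g x + h x) \<le> M + B" for x by (rule norm_triangle_mono[OF g(3) h(3)])
 qed (simp add: g(2) h(2))
qed

lemma bounded_symbol_mult_const:
 assumes "bounded_symbol \<phi>"
 shows "bounded_symbol (\<lambda>z. c * \<phi> z)"
proof -
 obtain g M where g: "g \<in> borel_measurable borel" "\<And>x. x \<in> {0..2 * pi} \<Longrightarrow> \<phi> (cis x) = g x" "\<And>x. norm (g x) \<le> M"
  using assms(1) unfolding bounded_symbol_def by blast
 show ?thesis unfolding bounded_symbol_def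
 proof (intro exI[of _ "\<lambda>x. c * g x"] exI[of _ "norm c * M"] conjI allI ballI)
  show "(\<lambda>x. c * g x) \<in> borel_measurable borel" using g(1) by measurable
  show "norm (c * g x) \<le> norm c * M" for x unfolding norm_mult by (rule mult_left_mono[OF g(3)]) simp
 qed (simp add: g(2))
qed

lemma cis_2pi_minus: "cis (2 * pi - x) = cnj (cis x)"
 by (simp add: cis_cnj complex_eq_iff cos_diff sin_diff)

lemma bounded_symbol_reflect:
 assumes "bounded_symbol \<phi>"
 shows "bounded_symbol (\<lambda>z. cnj (\<phi> (cnj z)))"
proof -
 obtain g M where g: "g \<in> borel_measurable borel" "\<And>x. x \<in> {0..2 * pi} \<Longrightarrow> \<phi> (cis x) = g x" "\<And>x. norm (g x) \<le> M"
  using assms(1) unfolding bounded_symbol_def by blast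
 show ?thesis unfolding bounded_symbol_def
 proof (intro exI[of _ "\<lambda>x. cnj (g (2 * pi - x))"] exI[of _ M] conjI allI ballI)
  have c: "cnj \<in> borel_measurable borel"
   by (intro borel_measurable_continuous_onI continuous_intros)
  have "(\<lambda>x. g (2 * pi - x)) \<in> borel_measurable borel"
   using g(1) by measurable
  from measurable_compose[OF this c] show "(\<lambda>x. cnj (g (2 * pi - x))) \<in> borel_measurable borel" .
  fix x :: real assume x: "x \<in> {0..2 * pi}"
  then have "2 * pi - x \<in> {0..2 * pi}" by auto
  from g(2)[OF this] show "cnj (\<phi> (cnj (cis x))) = cnj (g (2 * pi - x))" by (simp add: cis_2pi_minus)
 qed (simp add: g(3))
qed

lemma fourier_coeff_add:
 assumes "bounded_symbol \<phi>" "bounded_symbol \<psi>"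
 shows "fourier_coeff (\<lambda>z. \<phi> z + \<psi> z) j = fourier_coeff \<phi> j + fourier_coeff \<psi> j"
 unfolding fourier_coeff_def distrib_right
 by (subst Bochner_Integration.integral_add[OF fourier_integrable fourier_integrable]) (use assms in \<open>auto simp: add_divide_distrib\<close>)

lemma fourier_coeff_mult_const: "fourier_coeff (\<lambda>z. c * \<phi> z) j = c * fourier_coeff \<phi> j"
 unfolding fourier_coeff_def mult.assoc by simp

abbreviation circle_int :: "(real \<Rightarrow> 'a::{banach, second_countable_topology}) \<Rightarrow> 'a" where
 "circle_int \<equiv> integral\<^sup>L (lebesgue_on {0..2 * pi})"

text \<open>The reflection \<open>x\<close> to \<open>2 * pi - x\<close> of the parameter interval
  is conjugation on the circle, and it maps the exponential weight to its own conjugate.\<close>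

lemma fourier_coeff_reflect:
 assumes \<phi>: "bounded_symbol \<phi>"
 shows "fourier_coeff (\<lambda>z. cnj (\<phi> (cnj z))) j = cnj (fourier_coeff \<phi> j)"
proof -
 define f where "f x = \<phi> (cis x) * cis (- (of_int j * x))" for x
 have int: "integrable (lebesgue_on {0..2 * pi}) f" unfolding f_def by (rule fourier_integrable[OF \<phi>])
 have f_int: "(f has_integral circle_int f) {0..2 * pi}"
  by (rule has_integral_integral_lebesgue_on[OF int]) simp
 have "((\<lambda>x. f (2 * pi - x)) has_integral circle_int f) {0..2 * pi}"
 proof -
  have "((\<lambda>x. f ((- 1) *\<^sub>R x + 2 * pi)) has_integral (1 / (\<bar>- 1\<bar> ^ DIM(real))) *\<^sub>R circle_int f)
    ((\<lambda>x. (1 / (- 1)) *\<^sub>R x + - ((1 / (- 1)) *\<^sub>R (2 * pi))) ` cbox 0 (2 * pi))"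
   by (rule has_integral_affinity) (use f_int in \<open>auto simp: cbox_interval\<close>)
  moreover have "(\<lambda>x. (1 / (- 1)) *\<^sub>R x + - ((1 / (- 1)) *\<^sub>R (2 * pi))) ` cbox 0 (2 * pi) = {0..2 * pi}"
  proof -
   have "(\<lambda>x. 2 * pi - x) ` {0..2 * pi} = {0..2 * pi}"
   proof (rule equalityI; rule subsetI)
    fix x assume "x \<in> {0..2 * pi}"
    then show "x \<in> (\<lambda>x. 2 * pi - x) ` {0..2 * pi}" by (intro image_eqI[of _ _ "2 * pi - x"]) auto
   qed auto
   then show ?thesis by (simp add: cbox_interval)
  qed
  ultimately show ?thesis by simp
 qed
 from has_integral_cnj[THEN iffD2, OF this]
 have 1: "((\<lambda>x. cnj (f (2 * pi - x))) has_integral cnj (circle_int f)) {0..2 * pi}"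
  by (simp add: o_def)
 have e: "cnj (f (2 * pi - x)) = cnj (\<phi> (cnj (cis x))) * cis (- (of_int j * x))" for x
 proof -
  have "cis (of_int j * (2 * pi - x)) = cis (2 * pi * of_int j) * cis (- (of_int j * x))"
   unfolding cis_mult by (simp add: algebra_simps)
  also have "cis (2 * pi * of_int j) = 1" by (rule cis_multiple_2pi) simp
  finally show ?thesis by (simp add: f_def cis_2pi_minus cis_cnj)
 qed
 have int': "integrable (lebesgue_on {0..2 * pi}) (\<lambda>x. cnj (\<phi> (cnj (cis x))) * cis (- (of_int j * x)))"
  by (rule fourier_integrable[OF bounded_symbol_reflect[OF \<phi>]])
 have "((\<lambda>x. cnj (\<phi> (cnj (cis x))) * cis (- (of_int j * x))) has_integral
   circle_int (\<lambda>x. cnj (\<phi> (cnj (cis x))) * cis (- (of_int j * x)))) {0..2 * pi}"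
  by (rule has_integral_integral_lebesgue_on[OF int']) simp
 from has_integral_unique[OF this 1[unfolded e]]
 show ?thesis unfolding fourier_coeff_def f_def by simp
qed

lemma cis_has_integral:
 assumes "a \<le> b" "c \<noteq> 0"
 shows "((\<lambda>x. cis (c * x)) has_integral (cis (c * b) - cis (c * a)) / (\<i> * of_real c)) {a..b}"
proof -
 have "((\<lambda>x. cis (c * x)) has_integral cis (c * b) / (\<i> * of_real c) - cis (c * a) / (\<i> * of_real c)) {a..b}"
 proof (rule fundamental_theorem_of_calculus[OF assms(1)])
  fix x
  have "((\<lambda>x. c * x) has_derivative (\<lambda>t. c * t)) (at x within {a..b})" by (auto intro!: derivative_eq_intros)
  from has_derivative_cis[OF this]
  have "((\<lambda>x. cis (c * x)) has_vector_derivative \<i> * of_real c * cis (c * x)) (at x within {a..b})"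
   by (simp add: has_vector_derivative_def scaleR_conv_of_real mult_ac)
  from has_vector_derivative_divide[OF this, of "\<i> * of_real c"]
  show "((\<lambda>x. cis (c * x) / (\<i> * of_real c)) has_vector_derivative cis (c * x)) (at x within {a..b})"
   using assms(2) by simp
 qed
 then show ?thesis by (simp add: diff_divide_distrib)
qed

lemma cis_orthogonal:
 "circle_int (\<lambda>x. cis (of_int j * x)) = (if j = 0 then 2 * pi else 0)"
proof -
 have int: "integrable (lebesgue_on {0..2 * pi}) (\<lambda>x. cis (of_int j * x))"
  by (rule integrable_bounded_borel[OF cis_borel, where M=1]) simp
 have 1: "((\<lambda>x. cis (of_int j * x)) has_integral circle_int (\<lambda>x. cis (of_int j * x))) {0..2 * pi}"
  by (rule has_integral_integral_lebesgue_on[OF int]) simp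
 show ?thesis
 proof (cases "j = 0")
  case True
  have "((\<lambda>x::real. 1 :: complex) has_integral (2 * pi - 0) *\<^sub>R 1) {0..2 * pi}"
   by (rule has_integral_const_real[of "1::complex" 0 "2 * pi", simplified content_real, THEN has_integral_eq_rhs]) simp_all
  with 1 True show ?thesis by (auto dest: has_integral_unique simp: scaleR_conv_of_real)
 next
  case False
  have "cis (of_int j * (2 * pi)) = 1" using cis_multiple_2pi[of "of_int j"] by (simp add: mult.commute)
  then have "((\<lambda>x. cis (of_int j * x)) has_integral 0) {0..2 * pi}"
   using cis_has_integral[of 0 "2 * pi" "of_int j"] False by simp
  from has_integral_unique[OF 1 this] False show ?thesis by simp
 qed
qed

lemma trig_parseval:
 fixes x :: "nat \<Rightarrow> complex" and n :: nat
 defines "f \<equiv> \<lambda>\<theta>. \<Sum>j<n. x j * cis (- real j * \<theta>)"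
 shows "circle_int (\<lambda>\<theta>. (norm (f \<theta>))^2) = 2 * pi * (\<Sum>j<n. (norm (x j))^2)"
proof -
 have e: "complex_of_real ((norm (f \<theta>))^2) = (\<Sum>j<n. \<Sum>k<n. x j * cnj (x k) * cis (of_int (int k - int j) * \<theta>))" for \<theta>
 proof -
  have "complex_of_real ((norm (f \<theta>))^2) = f \<theta> * cnj (f \<theta>)" by (rule complex_norm_square)
  also have "\<dots> = (\<Sum>j<n. \<Sum>k<n. x j * cnj (x k) * (cis (- real j * \<theta>) * cis (real k * \<theta>)))"
   unfolding f_def cnj_sum sum_product by (intro sum.cong refl) (simp add: cis_cnj mult_ac)
  also have "\<dots> = (\<Sum>j<n. \<Sum>k<n. x j * cnj (x k) * cis (of_int (int k - int j) * \<theta>))"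
   by (intro sum.cong refl) (simp add: cis_mult algebra_simps)
  finally show ?thesis .
 qed
 have int: "integrable (lebesgue_on {0..2 * pi}) (\<lambda>\<theta>. cis (of_int (int k - int j) * \<theta>))" for j k :: nat
  by (rule integrable_bounded_borel[OF cis_borel, where M=1]) simp
 have "complex_of_real (circle_int (\<lambda>\<theta>. (norm (f \<theta>))^2))
   = circle_int (\<lambda>\<theta>. complex_of_real ((norm (f \<theta>))^2))"
  by (rule integral_complex_of_real[symmetric])
 also have "\<dots> = (\<Sum>j<n. \<Sum>k<n. x j * cnj (x k) * circle_int (\<lambda>\<theta>. cis (of_int (int k - int j) * \<theta>)))"
  unfolding e using int by (simp del: of_int_diff)
 also have "\<dots> = (\<Sum>j<n. \<Sum>k<n. if k = j then x j * cnj (x j) * (2 * pi) else 0)"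
  unfolding cis_orthogonal by (intro sum.cong refl) auto
 also have "\<dots> = (\<Sum>j<n. complex_of_real (2 * pi * (norm (x j))^2))"
  by (intro sum.cong refl) (simp add: complex_norm_square del: of_real_power)
 finally show ?thesis unfolding of_real_sum[symmetric] of_real_eq_iff by (simp add: sum_distrib_left)
qed

text \<open>The easy half of Nehari's theorem.\<close>

lemma hankel_section_bound:
 assumes \<phi>: "bounded_symbol \<phi>" and M: "\<And>z. norm z = 1 \<Longrightarrow> norm (\<phi> z) \<le> M"
 shows "section_bound (\<lambda>j k. fourier_coeff \<phi> (int j + int k)) M"
proof -
 have M0: "M \<ge> 0" using order_trans[OF norm_ge_zero M[of 1]] by simp
 define a where "a j k = fourier_coeff \<phi> (int j + int k)" for j k
 \<comment> \<open>The bilinear form is the mean of \<open>\<phi>\<close> times two trigonometric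
   polynomials. The arithmetic-geometric mean inequality under the integral reduces it to Parseval's
   identity.\<close>
 have form: "norm (\<Sum>k<n. \<Sum>j<n. a j k * x j * y k) \<le> M / 2 * ((\<Sum>j<n. (norm (x j))^2) + (\<Sum>k<n. (norm (y k))^2))"
  for n and x y :: "nat \<Rightarrow> complex"
 proof -
  define f where "f \<theta> = (\<Sum>j<n. x j * cis (- real j * \<theta>))" for \<theta>
  define g where "g \<theta> = (\<Sum>j<n. y j * cis (- real j * \<theta>))" for \<theta>
  have fgm: "f \<in> borel_measurable borel" "g \<in> borel_measurable borel"
   unfolding f_def g_def by measurable
  have nf: "norm (f \<theta>) \<le> (\<Sum>j<n. norm (x j))" and ng: "norm (g \<theta>) \<le> (\<Sum>j<n. norm (y j))" for \<theta>
   unfolding f_def g_def by (rule sum_norm_le, simp add: norm_mult)+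
  have int1: "integrable (lebesgue_on {0..2 * pi}) (\<lambda>\<theta>. \<phi> (cis \<theta>) * (f \<theta> * g \<theta>))"
  proof (rule bounded_symbol_integrable[OF \<phi>, where B="(\<Sum>j<n. norm (x j)) * (\<Sum>j<n. norm (y j))"])
   show "(\<lambda>\<theta>. f \<theta> * g \<theta>) \<in> borel_measurable borel" using fgm by measurable
   show "norm (f \<theta> * g \<theta>) \<le> (\<Sum>j<n. norm (x j)) * (\<Sum>j<n. norm (y j))" for \<theta>
    unfolding norm_mult by (intro mult_mono nf ng) (auto intro: sum_nonneg)
  qed
  have sq_int: "integrable (lebesgue_on {0..2 * pi}) (\<lambda>\<theta>. (norm (h \<theta>))^2)"
   if "h \<in> borel_measurable borel" "\<And>\<theta>. norm (h \<theta>) \<le> B" for h :: "real \<Rightarrow> complex" and B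
  proof (rule integrable_bounded_borel[where M="B^2"])
   show "(\<lambda>\<theta>. (norm (h \<theta>))^2) \<in> borel_measurable borel" using that(1) by measurable
   show "norm ((norm (h x))^2) \<le> B^2" for x
    using power_mono[OF that(2)[of x], of 2] by simp
  qed
  note sf = sq_int[OF fgm(1) nf] and sg = sq_int[OF fgm(2) ng]
  have aint: "a j k * (2 * pi) = circle_int (\<lambda>\<theta>. \<phi> (cis \<theta>) * cis (- (of_int (int j + int k) * \<theta>)))" for j k
   by (simp add: a_def fourier_coeff_def)
  have "(\<Sum>k<n. \<Sum>j<n. a j k * x j * y k) * (2 * pi) = (\<Sum>k<n. \<Sum>j<n. x j * y k * (a j k * (2 * pi)))"
   unfolding sum_distrib_right by (intro sum.cong refl) (simp add: mult_ac)
  also have "\<dots> = (\<Sum>k<n. \<Sum>j<n. circle_int (\<lambda>\<theta>. x j * y k * (\<phi> (cis \<theta>) * cis (- (of_int (int j + int k) * \<theta>)))))"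
   unfolding aint by simp
  also have "\<dots> = circle_int (\<lambda>\<theta>. \<Sum>k<n. \<Sum>j<n. x j * y k * (\<phi> (cis \<theta>) * cis (- (of_int (int j + int k) * \<theta>))))"
   by (simp only: Bochner_Integration.integral_sum Bochner_Integration.integrable_sum integrable_mult_right fourier_integrable[OF \<phi>])
  also have "\<dots> = circle_int (\<lambda>\<theta>. \<phi> (cis \<theta>) * (f \<theta> * g \<theta>))"
  proof (rule arg_cong[where f="circle_int"], rule ext)
   fix \<theta>
   have "\<phi> (cis \<theta>) * (f \<theta> * g \<theta>) = (\<Sum>j<n. \<Sum>k<n. \<phi> (cis \<theta>) * (x j * cis (- real j * \<theta>) * (y k * cis (- real k * \<theta>))))"
    unfolding f_def g_def sum_product unfolding sum_distrib_left ..
   also have "\<dots> = (\<Sum>j<n. \<Sum>k<n. x j * y k * (\<phi> (cis \<theta>) * cis (- (of_int (int j + int k) * \<theta>))))"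
   proof (intro sum.cong refl)
    fix j k
    have "cis (- real j * \<theta>) * cis (- real k * \<theta>) = cis (- (of_int (int j + int k) * \<theta>))"
     unfolding cis_mult by (simp add: algebra_simps)
    then show "\<phi> (cis \<theta>) * (x j * cis (- real j * \<theta>) * (y k * cis (- real k * \<theta>))) = x j * y k * (\<phi> (cis \<theta>) * cis (- (of_int (int j + int k) * \<theta>)))"
     by (metis (no_types, lifting) mult.assoc mult.commute)
   qed
   also have "\<dots> = (\<Sum>k<n. \<Sum>j<n. x j * y k * (\<phi> (cis \<theta>) * cis (- (of_int (int j + int k) * \<theta>))))"
    by (rule sum.swap)
   finally show "(\<Sum>k<n. \<Sum>j<n. x j * y k * (\<phi> (cis \<theta>) * cis (- (of_int (int j + int k) * \<theta>)))) = \<phi> (cis \<theta>) * (f \<theta> * g \<theta>)" by simp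
  qed
  finally have eq: "(\<Sum>k<n. \<Sum>j<n. a j k * x j * y k) * (2 * pi) = circle_int (\<lambda>\<theta>. \<phi> (cis \<theta>) * (f \<theta> * g \<theta>))" .
  have "norm (circle_int (\<lambda>\<theta>. \<phi> (cis \<theta>) * (f \<theta> * g \<theta>)))
    \<le> circle_int (\<lambda>\<theta>. M / 2 * ((norm (f \<theta>))^2 + (norm (g \<theta>))^2))"
  proof (rule Bochner_Integration.integral_norm_bound_integral[OF int1])
   show "integrable (lebesgue_on {0..2 * pi}) (\<lambda>\<theta>. M / 2 * ((norm (f \<theta>))^2 + (norm (g \<theta>))^2))"
    using sf sg by simp
   fix \<theta>
   have "norm (f \<theta>) * norm (g \<theta>) \<le> ((norm (f \<theta>))^2 + (norm (g \<theta>))^2) / 2"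
    using sum_squares_bound[of "norm (f \<theta>)" "norm (g \<theta>)"] by simp
   then have "norm (\<phi> (cis \<theta>)) * (norm (f \<theta>) * norm (g \<theta>)) \<le> M * (((norm (f \<theta>))^2 + (norm (g \<theta>))^2) / 2)"
    using M[of "cis \<theta>"] M0 by (intro mult_mono) auto
   then show "norm (\<phi> (cis \<theta>) * (f \<theta> * g \<theta>)) \<le> M / 2 * ((norm (f \<theta>))^2 + (norm (g \<theta>))^2)"
    by (simp add: norm_mult)
  qed
  also have "\<dots> = M / 2 * ((\<Sum>j<n. (norm (x j))^2) + (\<Sum>k<n. (norm (y k))^2)) * (2 * pi)"
   using sf sg trig_parseval[of x n] trig_parseval[of y n] by (simp add: f_def g_def algebra_simps)
  finally have "norm (\<Sum>k<n. \<Sum>j<n. a j k * x j * y k) * (2 * pi) \<le> M / 2 * ((\<Sum>j<n. (norm (x j))^2) + (\<Sum>k<n. (norm (y k))^2)) * (2 * pi)"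
   unfolding eq[symmetric] norm_mult by simp
  then show ?thesis by (rule mult_right_le_imp_le) simp
 qed
 have "(\<Sum>k<n. (norm (\<Sum>j<n. a j k * x j))^2) \<le> M^2 * (\<Sum>j<n. (norm (x j))^2)" for n and x :: "nat \<Rightarrow> complex"
 proof -
  define v where "v k = (\<Sum>j<n. a j k * x j)" for k
  define V where "V = (\<Sum>k<n. (norm (v k))^2)"
  define X where "X = (\<Sum>j<n. (norm (x j))^2)"
  have V0: "V \<ge> 0" by (simp add: V_def sum_nonneg)
  \<comment> \<open>The additive bound is not homogeneous, so the test vector is scaled by a free
    factor \<open>s\<close>; the choice \<open>s = 1 / M\<close> recovers the multiplicative
    bound.\<close>
  have key: "s * V \<le> M / 2 * (X + s^2 * V)" if s: "s > 0" for s
  proof -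
   have "(\<Sum>k<n. \<Sum>j<n. a j k * x j * (complex_of_real s * cnj (v k))) = (\<Sum>k<n. complex_of_real s * (v k * cnj (v k)))"
    unfolding sum_distrib_right[symmetric] v_def[symmetric] by (simp add: mult_ac)
   also have "\<dots> = complex_of_real (s * V)"
    by (simp only: complex_norm_square[symmetric] V_def sum_distrib_left of_real_sum of_real_mult)
   finally have "norm (complex_of_real (s * V)) \<le> M / 2 * (X + (\<Sum>k<n. (norm (complex_of_real s * cnj (v k)))^2))"
    using form[where x=x and y="\<lambda>k. complex_of_real s * cnj (v k)" and n=n] by (simp add: X_def)
   also have "(\<Sum>k<n. (norm (complex_of_real s * cnj (v k)))^2) = s^2 * V"
    by (simp add: norm_mult power_mult_distrib V_def sum_distrib_left)
   finally show ?thesis using s V0 by (simp only: norm_of_real abs_of_nonneg[OF mult_nonneg_nonneg[OF less_imp_le]])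
  qed
  have "V \<le> M^2 * X"
  proof (cases "M = 0")
   case True
   then show ?thesis using key[of 1] by simp
  next
   case False
   then have Mp: "M > 0" using M0 by simp
   have "1 / M * V \<le> M / 2 * (X + (1 / M)^2 * V)" by (rule key) (use Mp in simp)
   then have "M * (1 / M * V) \<le> M * (M / 2 * (X + (1 / M)^2 * V))" using Mp by (intro mult_left_mono) auto
   then show ?thesis using Mp by (simp add: power2_eq_square algebra_simps)
  qed
  then show ?thesis by (simp add: V_def X_def v_def)
 qed
 then show ?thesis using M0 by (simp add: section_bound_def a_def)
qed

section \<open>Piecewise continuous symbols\<close>

lemma PC_limits:
 assumes "\<omega> \<in> PC" "norm z = 1"
 shows "((\<lambda>\<epsilon>. \<omega> (z * cis \<epsilon>)) \<longlongrightarrow> lim_plus \<omega> z) (at_right 0)"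
  "((\<lambda>\<epsilon>. \<omega> (z * cis (- \<epsilon>))) \<longlongrightarrow> lim_minus \<omega> z) (at_right 0)"
proof -
 have z: "z \<in> sphere 0 1" using assms(2) by simp
 obtain l where l: "((\<lambda>\<epsilon>. \<omega> (z * cis \<epsilon>)) \<longlongrightarrow> l) (at_right 0)" using assms(1) z unfolding PC_def by blast
 obtain m where m: "((\<lambda>\<epsilon>. \<omega> (z * cis (- \<epsilon>))) \<longlongrightarrow> m) (at_right 0)" using assms(1) z unfolding PC_def by blast
 have nb: "at_right (0::real) \<noteq> bot" by (simp add: trivial_limit_at_right_real)
 show "((\<lambda>\<epsilon>. \<omega> (z * cis \<epsilon>)) \<longlongrightarrow> lim_plus \<omega> z) (at_right 0)"
  using l tendsto_Lim[OF nb l] by (simp add: lim_plus_def)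
 show "((\<lambda>\<epsilon>. \<omega> (z * cis (- \<epsilon>))) \<longlongrightarrow> lim_minus \<omega> z) (at_right 0)"
  using m tendsto_Lim[OF nb m] by (simp add: lim_minus_def)
qed

text \<open>A Bolzano argument. The property is local, because the one-sided limits at
  \<open>x\<close> make the three points \<open>a\<close>, \<open>x\<close>, \<open>b\<close>
  sufficient. It also survives concatenation, since the common endpoint belongs to both sets and no
  admissible interval crosses it.\<close>

lemma PC_partition:
 assumes \<omega>: "\<omega> \<in> PC" and \<delta>: "\<delta> > 0"
 obtains D where "finite D" "0 \<in> D" "2 * pi \<in> D" "D \<subseteq> {0..2 * pi}"
  "\<And>x y. 0 \<le> x \<Longrightarrow> x \<le> y \<Longrightarrow> y \<le> 2 * pi \<Longrightarrow> {x..y} \<inter> D = {} \<Longrightarrow> norm (\<omega> (cis x) - \<omega> (cis y)) \<le> \<delta>"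
proof -
 define P where "P a b \<longleftrightarrow> (\<exists>D. finite D \<and> a \<in> D \<and> b \<in> D \<and> D \<subseteq> {a..b} \<and>
  (\<forall>x y. a \<le> x \<longrightarrow> x \<le> y \<longrightarrow> y \<le> b \<longrightarrow> {x..y} \<inter> D = {} \<longrightarrow> norm (\<omega> (cis x) - \<omega> (cis y)) \<le> \<delta>))" for a b
 have "P 0 (2 * pi)"
 proof (rule Bolzano)
  fix a b c assume ab: "P a b" and bc: "P b c" and le: "a \<le> b" "b \<le> c"
  obtain D where D: "finite D" "a \<in> D" "b \<in> D" "D \<subseteq> {a..b}"
   "\<And>x y. a \<le> x \<Longrightarrow> x \<le> y \<Longrightarrow> y \<le> b \<Longrightarrow> {x..y} \<inter> D = {} \<Longrightarrow> norm (\<omega> (cis x) - \<omega> (cis y)) \<le> \<delta>"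
   using ab unfolding P_def by blast
  obtain E where E: "finite E" "b \<in> E" "c \<in> E" "E \<subseteq> {b..c}"
   "\<And>x y. b \<le> x \<Longrightarrow> x \<le> y \<Longrightarrow> y \<le> c \<Longrightarrow> {x..y} \<inter> E = {} \<Longrightarrow> norm (\<omega> (cis x) - \<omega> (cis y)) \<le> \<delta>"
   using bc unfolding P_def by blast
  show "P a c" unfolding P_def
  proof (intro exI[of _ "D \<union> E"] conjI allI impI)
   show "D \<union> E \<subseteq> {a..c}" using D(4) E(4) le by fastforce
   fix x y assume xy: "a \<le> x" "x \<le> y" "y \<le> c" "{x..y} \<inter> (D \<union> E) = {}"
   have "b \<notin> {x..y}" using xy(4) D(3) by blast
   then have "y < b \<or> b < x" by auto
   moreover have "{x..y} \<inter> D = {}" "{x..y} \<inter> E = {}" using xy(4) by blast+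
   ultimately show "norm (\<omega> (cis x) - \<omega> (cis y)) \<le> \<delta>"
    using D(5)[of x y] E(5)[of x y] xy by auto
  qed (use D E in auto)
 next
  fix x :: real
  have n1: "norm (cis x) = 1" by simp
  have "\<forall>\<^sub>F \<epsilon> in at_right 0. dist (\<omega> (cis x * cis \<epsilon>)) (lim_plus \<omega> (cis x)) < \<delta> / 2"
   using tendstoD[OF PC_limits(1)[OF \<omega> n1], of "\<delta> / 2"] \<delta> by simp
  then obtain d1 where d1: "d1 > 0" "\<And>\<epsilon>. 0 < \<epsilon> \<Longrightarrow> \<epsilon> < d1 \<Longrightarrow> dist (\<omega> (cis x * cis \<epsilon>)) (lim_plus \<omega> (cis x)) < \<delta> / 2"
   by (auto simp: eventually_at_right_field)
  have "\<forall>\<^sub>F \<epsilon> in at_right 0. dist (\<omega> (cis x * cis (- \<epsilon>))) (lim_minus \<omega> (cis x)) < \<delta> / 2"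
   using tendstoD[OF PC_limits(2)[OF \<omega> n1], of "\<delta> / 2"] \<delta> by simp
  then obtain d2 where d2: "d2 > 0" "\<And>\<epsilon>. 0 < \<epsilon> \<Longrightarrow> \<epsilon> < d2 \<Longrightarrow> dist (\<omega> (cis x * cis (- \<epsilon>))) (lim_minus \<omega> (cis x)) < \<delta> / 2"
   by (auto simp: eventually_at_right_field)
  show "\<exists>d>0. \<forall>a b. a \<le> x \<and> x \<le> b \<and> b - a < d \<longrightarrow> P a b"
  proof (intro exI[of _ "min d1 d2"] conjI allI impI)
   show "0 < min d1 d2" using d1(1) d2(1) by simp
   fix a b assume ab: "a \<le> x \<and> x \<le> b \<and> b - a < min d1 d2"
   show "P a b" unfolding P_def
   proof (intro exI[of _ "{a, x, b}"] conjI allI impI)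
    show "{a, x, b} \<subseteq> {a..b}" using ab by auto
    fix u v assume uv: "a \<le> u" "u \<le> v" "v \<le> b" "{u..v} \<inter> {a, x, b} = {}"
    have "x \<notin> {u..v}" using uv(4) by blast
    then consider "v < x" | "x < u" by fastforce
    then show "norm (\<omega> (cis u) - \<omega> (cis v)) \<le> \<delta>"
    proof cases
     case 1
     have "dist (\<omega> (cis w)) (lim_minus \<omega> (cis x)) < \<delta> / 2" if "a \<le> w" "w < x" for w
      using d2(2)[of "x - w"] that ab by (simp add: cis_mult)
     from dist_triangle_half_l[OF this this] show ?thesis using 1 uv by (auto simp: dist_norm intro: less_imp_le)
    next
     case 2
     have "dist (\<omega> (cis w)) (lim_plus \<omega> (cis x)) < \<delta> / 2" if "w \<le> b" "x < w" for w
      using d1(2)[of "w - x"] that ab by (simp add: cis_mult)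
     from dist_triangle_half_l[OF this this] show ?thesis using 2 uv by (auto simp: dist_norm intro: less_imp_le)
    qed
   qed auto
  qed
 qed simp
 then obtain D where "finite D" "0 \<in> D" "2 * pi \<in> D" "D \<subseteq> {0..2 * pi}"
  "\<And>x y. 0 \<le> x \<Longrightarrow> x \<le> y \<Longrightarrow> y \<le> 2 * pi \<Longrightarrow> {x..y} \<inter> D = {} \<Longrightarrow> norm (\<omega> (cis x) - \<omega> (cis y)) \<le> \<delta>"
  unfolding P_def by blast
 then show ?thesis by (rule that)
qed

lemma Arg2pi_cis': "0 \<le> x \<Longrightarrow> x < 2 * pi \<Longrightarrow> Arg2pi (cis x) = x"
 by (rule Arg2pi_unique[of 1]) (auto simp: cis_conv_exp)

lemma unit_eq_cis: "norm z = 1 \<Longrightarrow> z = cis (Arg2pi z)"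
 using Arg2pi_eq[of z] by (simp add: cis_conv_exp)

locale step_approximation =
 fixes \<omega> :: "complex \<Rightarrow> complex" and \<delta> :: real and \<theta> :: "nat \<Rightarrow> real" and m :: nat
 assumes \<omega>: "\<omega> \<in> PC" and \<delta>: "\<delta> > 0" and m: "m \<ge> 1"
  and mono: "\<And>i k. i < k \<Longrightarrow> k \<le> m \<Longrightarrow> \<theta> i < \<theta> k" and ends: "\<theta> 0 = 0" "\<theta> m = 2 * pi"
  and osc: "\<And>i x y. i < m \<Longrightarrow> x \<in> {\<theta> i<..<\<theta> (Suc i)} \<Longrightarrow> y \<in> {\<theta> i<..<\<theta> (Suc i)} \<Longrightarrow> norm (\<omega> (cis x) - \<omega> (cis y)) \<le> \<delta>"
begin

definition c :: "nat \<Rightarrow> complex" where "c i = \<omega> (cis ((\<theta> i + \<theta> (Suc i)) / 2))"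

text \<open>The value on the interval preceding node \<open>i\<close>, where the last interval
  precedes node 0 on the circle.\<close>

definition pc :: "nat \<Rightarrow> complex" where "pc i = c (if i = 0 then m - 1 else i - 1)"

text \<open>At the nodes the values of \<omega> are kept, so that the approximation is uniform at
  every point; the integrals do not see them.\<close>

definition g :: "real \<Rightarrow> complex" where
 "g x = (\<Sum>i<m. indicator {\<theta> i<..<\<theta> (Suc i)} x * c i) + (\<Sum>d\<in>\<theta> ` {..m}. indicator {d} x * \<omega> (cis d))"

definition s :: "complex \<Rightarrow> complex" where "s z = g (Arg2pi z)"

lemma mono_le: "i \<le> k \<Longrightarrow> k \<le> m \<Longrightarrow> \<theta> i \<le> \<theta> k"
 using mono[of i k] by (cases "i = k") auto

lemma range: "i \<le> m \<Longrightarrow> \<theta> i \<in> {0..2 * pi}"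
 using mono_le[of 0 i] mono_le[of i m] ends by auto

lemma mid: "i < m \<Longrightarrow> (\<theta> i + \<theta> (Suc i)) / 2 \<in> {\<theta> i<..<\<theta> (Suc i)}"
 using mono[of i "Suc i"] by auto

lemma near_c: "i < m \<Longrightarrow> x \<in> {\<theta> i<..<\<theta> (Suc i)} \<Longrightarrow> norm (\<omega> (cis x) - c i) \<le> \<delta>"
 unfolding c_def by (rule osc[OF _ _ mid])

lemma interval_unique:
 assumes "i < m" "k < m" "x \<in> {\<theta> i<..<\<theta> (Suc i)}" "x \<in> {\<theta> k<..<\<theta> (Suc k)}"
 shows "i = k"
proof (rule ccontr)
 assume "i \<noteq> k"
 then consider "Suc i \<le> k" | "Suc k \<le> i" by linarith
 then show False
  using mono_le[of "Suc i" k] mono_le[of "Suc k" i] assms by cases auto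
qed

lemma interval_no_node:
 assumes "i < m" "k \<le> m" "x \<in> {\<theta> i<..<\<theta> (Suc i)}"
 shows "x \<noteq> \<theta> k"
proof
 assume "x = \<theta> k"
 then show False using mono_le[of k i] mono_le[of "Suc i" k] assms by (cases "k \<le> i") auto
qed

lemma interval_cases:
 assumes "x \<in> {0..2 * pi}"
 obtains k where "k \<le> m" "x = \<theta> k" | i where "i < m" "x \<in> {\<theta> i<..<\<theta> (Suc i)}"
proof (cases "x \<in> \<theta> ` {..m}")
 case True
 then show ?thesis using that(1) by auto
next
 case False
 then have ne: "x \<noteq> \<theta> k" if "k \<le> m" for k using that by auto
 have x: "0 < x" "x < 2 * pi" using assms ne[of 0] ne[of m] ends by auto
 define i where "i = (GREATEST i. i \<le> m \<and> \<theta> i < x)"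
 have i: "i \<le> m \<and> \<theta> i < x"
  unfolding i_def by (rule GreatestI_nat[where k=0 and b=m]) (use ends x in auto)
 then have "i < m" using ends x by (cases "i = m") auto
 moreover have "\<not> \<theta> (Suc i) < x"
 proof
  assume "\<theta> (Suc i) < x"
  then have "Suc i \<le> i" unfolding i_def
   by (intro Greatest_le_nat[where b=m]) (use \<open>i < m\<close> in \<open>auto simp: i_def\<close>)
  then show False by simp
 qed
 ultimately show ?thesis using that(2)[of i] i ne[of "Suc i"] by auto
qed

lemma g_interval:
 assumes i: "i < m" and x: "x \<in> {\<theta> i<..<\<theta> (Suc i)}"
 shows "g x = c i"
proof -
 have "(\<Sum>k<m. indicator {\<theta> k<..<\<theta> (Suc k)} x * c k) = (\<Sum>k<m. if k = i then c i else 0)"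
  using x by (intro sum.cong refl) (auto simp: indicator_def dest: interval_unique[OF _ i _ x])
 moreover have "(\<Sum>d\<in>\<theta> ` {..m}. indicator {d} x * \<omega> (cis d)) = 0"
  by (intro sum.neutral) (auto simp: indicator_def dest: interval_no_node[OF i _ x])
 ultimately show ?thesis using i by (simp add: g_def)
qed

lemma g_node:
 assumes k: "k \<le> m"
 shows "g (\<theta> k) = \<omega> (cis (\<theta> k))"
proof -
 have "(\<Sum>i<m. indicator {\<theta> i<..<\<theta> (Suc i)} (\<theta> k) * c i) = 0"
  by (intro sum.neutral) (auto simp: indicator_def dest: interval_no_node[OF _ k])
 moreover have "(\<Sum>d\<in>\<theta> ` {..m}. indicator {d} (\<theta> k) * \<omega> (cis d)) = (\<Sum>d\<in>\<theta> ` {..m}. if d = \<theta> k then \<omega> (cis (\<theta> k)) else 0)"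
  by (intro sum.cong) (auto simp: indicator_def)
 ultimately show ?thesis using k by (simp add: g_def)
qed

lemma s_cis: "x \<in> {0..2 * pi} \<Longrightarrow> s (cis x) = g x"
proof (cases "x = 2 * pi")
 case True
 have "s (cis x) = g 0" using Arg2pi_cis'[of 0] True by (simp add: s_def)
 also have "\<dots> = \<omega> 1" using g_node[of 0] ends by simp
 also have "\<dots> = g x" using g_node[of m] ends True by simp
 finally show ?thesis .
qed (auto simp: s_def Arg2pi_cis')

lemma g_near: "x \<in> {0..2 * pi} \<Longrightarrow> norm (\<omega> (cis x) - g x) \<le> \<delta>"
 using \<delta> by (elim interval_cases) (auto simp: g_node g_interval near_c)

lemma g_borel: "g \<in> borel_measurable borel"
 unfolding g_def by measurable

lemma g_bounded: "norm (g x) \<le> (\<Sum>i<m. norm (c i)) + (\<Sum>d\<in>\<theta> ` {..m}. norm (\<omega> (cis d)))"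
 unfolding g_def
 by (intro norm_triangle_mono sum_norm_le) (auto simp: norm_mult indicator_def)

lemma bounded_symbol_s: "bounded_symbol s"
 unfolding bounded_symbol_def using g_borel s_cis g_bounded by blast

lemma g_has_integral:
 assumes c: "e \<noteq> 0" and k: "k \<le> m"
 shows "((\<lambda>x. g x * cis (e * x)) has_integral (\<Sum>i<k. c i * ((cis (e * \<theta> (Suc i)) - cis (e * \<theta> i)) / (\<i> * of_real e)))) {0..\<theta> k}"
 using k
proof (induction k)
 case 0
 then show ?case using ends has_integral_refl(2)[where a="0::real"] by simp
next
 case (Suc k)
 have k: "k < m" using Suc.prems by simp
 have "((\<lambda>x. c k * cis (e * x)) has_integral c k * ((cis (e * \<theta> (Suc k)) - cis (e * \<theta> k)) / (\<i> * of_real e))) {\<theta> k..\<theta> (Suc k)}"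
  by (intro has_integral_mult_right cis_has_integral) (use c mono[of k "Suc k"] k in auto)
 then have 1: "((\<lambda>x. g x * cis (e * x)) has_integral c k * ((cis (e * \<theta> (Suc k)) - cis (e * \<theta> k)) / (\<i> * of_real e))) {\<theta> k..\<theta> (Suc k)}"
  by (rule has_integral_spike_finite[of "{\<theta> k, \<theta> (Suc k)}", rotated -1]) (use g_interval[OF k] in auto)
 have "((\<lambda>x. g x * cis (e * x)) has_integral
   (\<Sum>i<k. c i * ((cis (e * \<theta> (Suc i)) - cis (e * \<theta> i)) / (\<i> * of_real e)))
    + c k * ((cis (e * \<theta> (Suc k)) - cis (e * \<theta> k)) / (\<i> * of_real e))) {0..\<theta> (Suc k)}"
  by (rule has_integral_combine[OF _ _ Suc.IH 1]) (use range[of k] mono[of k "Suc k"] k in auto)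
 then show ?case by simp
qed

text \<open>The half-jump of the step function times \<open>- \<i>\<close>. By
  \<open>node_inj\<close> at most one term is nonzero for given \<open>z\<close>.\<close>

definition a :: "complex \<Rightarrow> complex" where
 "a z = (\<Sum>i<m. if z = cis (\<theta> i) then (c i - pc i) / (2 * \<i>) else 0)"

definition Z :: "complex set" where "Z = (\<lambda>i. cis (\<theta> i)) ` {..<m}"

lemma a_off: "z \<notin> Z \<Longrightarrow> a z = 0"
 unfolding a_def Z_def by (rule sum.neutral) auto

lemma node_inj:
 assumes "i < m" "k < m" "cis (\<theta> i) = cis (\<theta> k)"
 shows "i = k"
proof -
 have "\<theta> i < 2 * pi" "\<theta> k < 2 * pi" using mono[of i m] mono[of k m] assms ends by auto
 moreover have "\<theta> i \<ge> 0" "\<theta> k \<ge> 0" using range[of i] range[of k] assms by auto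
 ultimately have "Arg2pi (cis (\<theta> i)) = \<theta> i" "Arg2pi (cis (\<theta> k)) = \<theta> k" by (simp_all only: Arg2pi_cis')
 then have "\<theta> i = \<theta> k" using assms(3) by metis
 then show ?thesis using mono[of i k] mono[of k i] assms by (cases i k rule: linorder_cases) auto
qed

lemma a_node: "i < m \<Longrightarrow> a (cis (\<theta> i)) = (c i - pc i) / (2 * \<i>)"
proof -
 assume i: "i < m"
 have "a (cis (\<theta> i)) = (\<Sum>k<m. if k = i then (c i - pc i) / (2 * \<i>) else 0)"
  unfolding a_def by (intro sum.cong refl) (auto dest: node_inj[OF i])
 then show ?thesis using i by simp
qed

text \<open>Integration over each interval leaves boundary values at its two ends; regrouped by
  nodes they become the jumps of the step function.\<close>

lemma fourier_s:
 assumes j: "j \<ge> 1"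
 shows "fourier_coeff s (int j) = (\<Sum>z\<in>Z. a z * cnj z ^ j) / of_real (pi * real j)"
proof -
 define e where "e = - real j"
 have e0: "e \<noteq> 0" using j by (simp add: e_def)
 define E where "E i = cis (e * \<theta> i)" for i
 have int: "integrable (lebesgue_on {0..2 * pi}) (\<lambda>x. s (cis x) * cis (- (of_int (int j) * x)))"
  by (rule fourier_integrable[OF bounded_symbol_s])
 have "((\<lambda>x. s (cis x) * cis (- (of_int (int j) * x))) has_integral circle_int (\<lambda>x. s (cis x) * cis (- (of_int (int j) * x)))) {0..2 * pi}"
  by (rule has_integral_integral_lebesgue_on[OF int]) simp
 moreover have "((\<lambda>x. s (cis x) * cis (- (of_int (int j) * x))) has_integral (\<Sum>i<m. c i * ((E (Suc i) - E i) / (\<i> * of_real e)))) {0..2 * pi}"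
  using g_has_integral[OF e0 order_refl] unfolding ends E_def
  by (rule has_integral_eq[rotated]) (simp add: s_cis e_def)
 ultimately have I: "circle_int (\<lambda>x. s (cis x) * cis (- (of_int (int j) * x))) = (\<Sum>i<m. c i * ((E (Suc i) - E i) / (\<i> * of_real e)))"
  by (rule has_integral_unique)
 \<comment> \<open>The nodes 0 and \<open>m\<close> are the same point of the circle, which closes
   the cyclic regrouping.\<close>
 have Em: "E m = E 0"
 proof -
  have "E m = cis (2 * pi * of_int (- int j))" by (simp add: E_def e_def ends mult_ac)
  also have "\<dots> = 1" by (rule cis_multiple_2pi) simp
  finally show ?thesis by (simp add: E_def ends)
 qed
 obtain m' where m': "m = Suc m'" using m by (cases m) auto
 have m1: "m - 1 = m'" using m' by simp
 have pc0: "pc 0 = c m'" and pcS: "pc (Suc i) = c i" for i unfolding pc_def m1 by simp_all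
 have "(\<Sum>i<m. c i * E (Suc i)) = (\<Sum>i<m'. c i * E (Suc i)) + c m' * E m" by (simp add: m')
 also have "\<dots> = pc 0 * E 0 + (\<Sum>i<m'. pc (Suc i) * E (Suc i))" by (simp only: pc0 pcS Em) simp
 also have "\<dots> = (\<Sum>i<m. pc i * E i)" unfolding m' by (rule sum.lessThan_Suc_shift[symmetric])
 finally have shift: "(\<Sum>i<m. c i * E (Suc i)) = (\<Sum>i<m. pc i * E i)" .
 have "(\<Sum>i<m. c i * ((E (Suc i) - E i) / (\<i> * of_real e))) = ((\<Sum>i<m. c i * E (Suc i)) - (\<Sum>i<m. c i * E i)) / (\<i> * of_real e)"
  by (simp add: sum_divide_distrib sum_subtractf right_diff_distrib diff_divide_distrib)
 also have "\<dots> = (\<Sum>i<m. (c i - pc i) * E i) / (\<i> * of_real (real j))"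
  unfolding shift by (simp add: e_def left_diff_distrib sum_subtractf minus_divide_left[symmetric] divide_minus_right diff_divide_distrib)
 finally have "fourier_coeff s (int j) = (\<Sum>i<m. (c i - pc i) * E i) / (\<i> * of_real (real j)) / of_real (2 * pi)"
  unfolding fourier_coeff_def I by simp
 also have "\<dots> = (\<Sum>i<m. (c i - pc i) / (2 * \<i>) * E i) / of_real (pi * real j)"
  by (simp add: sum_divide_distrib mult_ac)
 also have "(\<Sum>i<m. (c i - pc i) / (2 * \<i>) * E i) = (\<Sum>i<m. a (cis (\<theta> i)) * cnj (cis (\<theta> i)) ^ j)"
 proof (intro sum.cong refl)
  fix i assume i: "i \<in> {..<m}"
  have "cnj (cis (\<theta> i)) ^ j = E i" unfolding cis_cnj Complex.DeMoivre E_def e_def by simp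
  then show "(c i - pc i) / (2 * \<i>) * E i = a (cis (\<theta> i)) * cnj (cis (\<theta> i)) ^ j" using a_node[of i] i by simp
 qed
 also have "\<dots> = (\<Sum>z\<in>Z. a z * cnj z ^ j)"
  unfolding Z_def by (subst sum.reindex) (auto simp: inj_on_def node_inj)
 finally show ?thesis .
qed

lemma lim_near:
 assumes z: "norm z = 1" and i: "i < m"
 shows "(\<forall>\<^sub>F \<epsilon> in at_right 0. \<exists>x\<in>{\<theta> i<..<\<theta> (Suc i)}. z * cis \<epsilon> = cis x) \<Longrightarrow> norm (lim_plus \<omega> z - c i) \<le> \<delta>"
  "(\<forall>\<^sub>F \<epsilon> in at_right 0. \<exists>x\<in>{\<theta> i<..<\<theta> (Suc i)}. z * cis (- \<epsilon>) = cis x) \<Longrightarrow> norm (lim_minus \<omega> z - c i) \<le> \<delta>"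
proof -
 have nb: "at_right (0::real) \<noteq> bot" by (simp add: trivial_limit_at_right_real)
 assume "\<forall>\<^sub>F \<epsilon> in at_right 0. \<exists>x\<in>{\<theta> i<..<\<theta> (Suc i)}. z * cis \<epsilon> = cis x"
 then have "\<forall>\<^sub>F \<epsilon> in at_right 0. norm (\<omega> (z * cis \<epsilon>) - c i) \<le> \<delta>"
  by eventually_elim (use near_c[OF i] in auto)
 then show "norm (lim_plus \<omega> z - c i) \<le> \<delta>"
  by (rule tendsto_upperbound[rotated]) (use nb in \<open>auto intro!: tendsto_intros PC_limits(1)[OF \<omega> z]\<close>)
next
 have nb: "at_right (0::real) \<noteq> bot" by (simp add: trivial_limit_at_right_real)
 assume "\<forall>\<^sub>F \<epsilon> in at_right 0. \<exists>x\<in>{\<theta> i<..<\<theta> (Suc i)}. z * cis (- \<epsilon>) = cis x"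
 then have "\<forall>\<^sub>F \<epsilon> in at_right 0. norm (\<omega> (z * cis (- \<epsilon>)) - c i) \<le> \<delta>"
  by eventually_elim (use near_c[OF i] in auto)
 then show "norm (lim_minus \<omega> z - c i) \<le> \<delta>"
  by (rule tendsto_upperbound[rotated]) (use nb in \<open>auto intro!: tendsto_intros PC_limits(2)[OF \<omega> z]\<close>)
qed

lemma eventually_right_interval:
 fixes u v w :: real
 assumes "u \<le> w" "w < v"
 shows "\<forall>\<^sub>F \<epsilon> in at_right 0. \<exists>x\<in>{u<..<v}. cis w * cis \<epsilon> = cis x"
 unfolding eventually_at_right_field
proof (intro exI[of _ "v - w"] conjI allI impI)
 show "v - w > 0" using assms by simp
 fix \<epsilon> :: real assume "0 < \<epsilon>" "\<epsilon> < v - w"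
 then show "\<exists>x\<in>{u<..<v}. cis w * cis \<epsilon> = cis x"
  using assms by (intro bexI[of _ "w + \<epsilon>"]) (auto simp: cis_mult)
qed

lemma eventually_left_interval:
 fixes u v w :: real
 assumes "u < w" "w \<le> v"
 shows "\<forall>\<^sub>F \<epsilon> in at_right 0. \<exists>x\<in>{u<..<v}. cis w * cis (- \<epsilon>) = cis x"
 unfolding eventually_at_right_field
proof (intro exI[of _ "w - u"] conjI allI impI)
 show "w - u > 0" using assms by simp
 fix \<epsilon> :: real assume "0 < \<epsilon>" "\<epsilon> < w - u"
 then show "\<exists>x\<in>{u<..<v}. cis w * cis (- \<epsilon>) = cis x"
  using assms by (intro bexI[of _ "w - \<epsilon>"]) (auto simp: cis_mult)
qed

text \<open>Each one-sided limit of \<omega> is within \<delta> of the constant on the adjacent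
  interval. At a non-node both limits are compared with the same constant, so a jump missed by the
  partition is at most \<delta> in modulus.\<close>

lemma a_near_jump:
 assumes z: "norm z = 1"
 shows "norm (a z - (- \<i> * jump \<omega> z)) \<le> \<delta>"
proof -
 have main: "norm (a z - (- \<i> * jump \<omega> z)) \<le> \<delta>"
  if p: "norm (lim_plus \<omega> z - x) \<le> \<delta>" and q: "norm (lim_minus \<omega> z - y) \<le> \<delta>" and a: "a z = (x - y) / (2 * \<i>)" for x y
 proof -
  have "a z - (- \<i> * jump \<omega> z) = \<i> / 2 * ((lim_plus \<omega> z - x) - (lim_minus \<omega> z - y))"
   unfolding a jump_def by (simp add: field_simps)
  then have "norm (a z - (- \<i> * jump \<omega> z)) = 1 / 2 * norm ((lim_plus \<omega> z - x) - (lim_minus \<omega> z - y))"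
   by (simp only: norm_mult norm_divide) simp
  also have "\<dots> \<le> 1 / 2 * (\<delta> + \<delta>)"
   using norm_triangle_le_diff[of "lim_plus \<omega> z - x" "lim_minus \<omega> z - y"] p q by (intro mult_left_mono) (auto intro: order_trans[OF norm_triangle_ineq4])
  finally show ?thesis by simp
 qed
 define w where "w = Arg2pi z"
 have w: "z = cis w" "0 \<le> w" "w < 2 * pi"
  using unit_eq_cis[OF z] Arg2pi_ge_0[of z] Arg2pi_lt_2pi[of z] by (auto simp: w_def)
 have "w \<in> {0..2 * pi}" using w by simp
 then show ?thesis
 proof (cases rule: interval_cases)
  case (1 k)
  then have k: "k < m" using w ends by (cases "k = m") auto
  have p: "norm (lim_plus \<omega> z - c k) \<le> \<delta>"
   using lim_near(1)[OF z k] eventually_right_interval[of "\<theta> k" "\<theta> k" "\<theta> (Suc k)"] mono[of k "Suc k"] k by (simp add: w 1)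
  have q: "norm (lim_minus \<omega> z - pc k) \<le> \<delta>"
  proof (cases k)
   case 0
   \<comment> \<open>The left neighbourhood of node 0 lies in the last interval, reached through the
     parameter \<open>2 * pi\<close>.\<close>
   have m1: "m - 1 < m" "Suc (m - 1) = m" using m by auto
   have "cis (2 * pi) = cis w" using 1 0 ends by simp
   then show ?thesis
    using lim_near(2)[OF z m1(1)] eventually_left_interval[of "\<theta> (m - 1)" "2 * pi" "\<theta> m"] mono[of "m - 1" m] m1
    by (simp add: w ends pc_def 0)
  next
   case (Suc i)
   then show ?thesis
    using lim_near(2)[OF z, of i] eventually_left_interval[of "\<theta> i" "\<theta> k" "\<theta> k"] mono[of i k] k
    by (simp add: w 1 pc_def)
  qed
  show ?thesis by (rule main[OF p q]) (simp add: w 1 a_node k)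
 next
  case (2 i)
  have p: "norm (lim_plus \<omega> z - c i) \<le> \<delta>" "norm (lim_minus \<omega> z - c i) \<le> \<delta>"
   using lim_near[OF z 2(1)] eventually_right_interval[of "\<theta> i" w "\<theta> (Suc i)"] eventually_left_interval[of "\<theta> i" w "\<theta> (Suc i)"] 2(2)
   by (auto simp: w)
  have "z \<notin> Z"
  proof
   assume "z \<in> Z"
   then obtain k where k: "k < m" "cis w = cis (\<theta> k)" by (auto simp: Z_def w)
   then have "\<theta> k < 2 * pi" using mono[of k m] ends by auto
   moreover have "\<theta> k \<ge> 0" using range[of k] k by auto
   ultimately have "Arg2pi (cis w) = w" "Arg2pi (cis (\<theta> k)) = \<theta> k" using w by (simp_all only: Arg2pi_cis')
   then have "w = \<theta> k" using k(2) by metis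
   moreover have "w \<noteq> \<theta> k" by (rule interval_no_node[OF 2(1) less_imp_le[OF k(1)] 2(2)])
   ultimately show False by contradiction
  qed
  then have "a z = (c i - c i) / (2 * \<i>)" by (simp add: a_off)
  from main[OF p this] show ?thesis .
 qed
qed

end

lemma PC_step_approximation:
 assumes \<omega>: "\<omega> \<in> PC" and \<delta>: "\<delta> > 0"
 shows "\<exists>\<theta> m. step_approximation \<omega> \<delta> \<theta> m"
proof -
 obtain D where D: "finite D" "0 \<in> D" "2 * pi \<in> D" "D \<subseteq> {0..2 * pi}"
  "\<And>x y. 0 \<le> x \<Longrightarrow> x \<le> y \<Longrightarrow> y \<le> 2 * pi \<Longrightarrow> {x..y} \<inter> D = {} \<Longrightarrow> norm (\<omega> (cis x) - \<omega> (cis y)) \<le> \<delta>"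
  using PC_partition[OF \<omega> \<delta>] by blast
 define xs where "xs = sorted_list_of_set D"
 have xs: "set xs = D" "sorted xs" "distinct xs" unfolding xs_def using D(1) by auto
 have len: "length xs \<ge> 2"
 proof -
  have "card {0, 2 * pi} \<le> card D" using D by (intro card_mono) auto
  then show ?thesis using xs distinct_card[of xs] by simp
 qed
 define m where "m = length xs - 1"
 define \<theta> where "\<theta> i = xs ! i" for i
 have st: "\<theta> i < \<theta> k" if "i < k" "k \<le> m" for i k
  using sorted_wrt_nth_less[of "(<)" xs i k] xs that len by (simp add: \<theta>_def m_def strict_sorted_iff)
 have mem: "\<theta> i \<in> D" if "i \<le> m" for i
  using that len xs(1) by (auto simp: \<theta>_def m_def intro!: nth_mem)
 have ex: "\<exists>i\<le>m. d = \<theta> i" if "d \<in> D" for d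
 proof -
  have "d \<in> set xs" using that xs(1) by simp
  then obtain i where "i < length xs" "xs ! i = d" unfolding in_set_conv_nth by blast
  then show ?thesis by (intro exI[of _ i]) (auto simp: \<theta>_def m_def)
 qed
 have le: "\<theta> i \<le> \<theta> k" if "i \<le> k" "k \<le> m" for i k using st[of i k] that by (cases "i = k") auto
 have e0: "\<theta> 0 = 0"
 proof -
  obtain i where i: "i \<le> m" "0 = \<theta> i" using ex[OF D(2)] by auto
  have "\<theta> 0 \<le> \<theta> i" by (rule le) (use i in auto)
  moreover have "\<theta> 0 \<ge> 0" using mem[of 0] D(4) by auto
  ultimately show ?thesis using i by simp
 qed
 have em: "\<theta> m = 2 * pi"
 proof -
  obtain i where i: "i \<le> m" "2 * pi = \<theta> i" using ex[OF D(3)] by auto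
  have "\<theta> i \<le> \<theta> m" by (rule le) (use i in auto)
  moreover have "\<theta> m \<le> 2 * pi" using mem[of m] D(4) by auto
  ultimately show ?thesis using i by simp
 qed
 have osc_le: "norm (\<omega> (cis x) - \<omega> (cis y)) \<le> \<delta>"
  if i: "i < m" and xy: "x \<in> {\<theta> i<..<\<theta> (Suc i)}" "y \<in> {\<theta> i<..<\<theta> (Suc i)}" "x \<le> y" for i x y
 proof (rule D(5))
  show "0 \<le> x" "y \<le> 2 * pi" using le[of 0 i] le[of "Suc i" m] i xy e0 em by auto
  show "{x..y} \<inter> D = {}"
  proof (rule ccontr)
   assume "{x..y} \<inter> D \<noteq> {}"
   then obtain d where d: "d \<in> D" "x \<le> d" "d \<le> y" by auto
   then obtain k where k: "k \<le> m" "d = \<theta> k" using ex by blast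
   show False using le[of k i] le[of "Suc i" k] i k d xy by (cases "k \<le> i") auto
  qed
 qed (use xy in simp)
 have "step_approximation \<omega> \<delta> \<theta> m"
 proof
  show "norm (\<omega> (cis x) - \<omega> (cis y)) \<le> \<delta>"
   if i: "i < m" "x \<in> {\<theta> i<..<\<theta> (Suc i)}" "y \<in> {\<theta> i<..<\<theta> (Suc i)}" for i x y
   using osc_le[OF i] osc_le[OF i(1,3,2)] by (cases "x \<le> y") (auto simp: norm_minus_commute)
 qed (use \<omega> \<delta> len st e0 em in \<open>auto simp: m_def\<close>)
 then show ?thesis by blast
qed

text \<open>Measurability comes from the step functions, which converge uniformly as \<delta> runs
  through \<open>1 / (n + 1)\<close>; the first of them already gives boundedness.\<close>

lemma PC_bounded_symbol:
 assumes \<omega>: "\<omega> \<in> PC"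
 shows "bounded_symbol \<omega>"
proof -
 define f where "f x = (if x \<in> {0..2 * pi} then \<omega> (cis x) else 0)" for x
 have "\<exists>g. g \<in> borel_measurable borel \<and> (\<exists>M. \<forall>x. norm (g x) \<le> M) \<and> (\<forall>x\<in>{0..2 * pi}. norm (\<omega> (cis x) - g x) \<le> 1 / real (Suc n))" for n
 proof -
  have "1 / real (Suc n) > 0" by simp
  from PC_step_approximation[OF \<omega> this] obtain \<theta> m where sa: "step_approximation \<omega> (1 / real (Suc n)) \<theta> m" by blast
  show ?thesis
   using step_approximation.g_borel[OF sa] step_approximation.g_bounded[OF sa] step_approximation.g_near[OF sa] by blast
 qed
 then obtain g where g: "\<And>n. g n \<in> borel_measurable borel" "\<And>n. \<exists>M. \<forall>x. norm (g n x) \<le> M"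
  "\<And>n x. x \<in> {0..2 * pi} \<Longrightarrow> norm (\<omega> (cis x) - g n x) \<le> 1 / real (Suc n)" by metis
 have "f \<in> borel_measurable borel"
 proof (rule borel_measurable_LIMSEQ_metric)
  show "(\<lambda>x. indicator {0..2 * pi} x * g n x) \<in> borel_measurable borel" for n using g(1)[of n] by measurable
  fix x :: real
  show "(\<lambda>n. indicator {0..2 * pi} x * g n x) \<longlonglongrightarrow> f x"
  proof (cases "x \<in> {0..2 * pi}")
   case True
   have "(\<lambda>n. \<omega> (cis x) - g n x) \<longlonglongrightarrow> 0"
   proof (rule Lim_null_comparison)
    show "\<forall>\<^sub>F n in sequentially. norm (\<omega> (cis x) - g n x) \<le> 1 / real (Suc n)"
     by (rule always_eventually) (use g(3)[OF True] in blast)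
    show "(\<lambda>n. 1 / real (Suc n)) \<longlonglongrightarrow> 0" using LIMSEQ_inverse_real_of_nat by (simp add: inverse_eq_divide)
   qed
   from tendsto_diff[OF tendsto_const[of "\<omega> (cis x)"] this] True show ?thesis by (simp add: f_def)
  next
   case False
   then have "indicator {0..2 * pi} x = (0 :: complex)" "f x = 0" by (auto simp: f_def)
   then show ?thesis by simp
  qed
 qed
 moreover obtain M where "\<And>x. norm (g 0 x) \<le> M" using g(2)[of 0] by blast
 moreover have "norm (f x) \<le> M + 1" for x
 proof (cases "x \<in> {0..2 * pi}")
  case True
  then show ?thesis using g(3)[OF True, of 0] calculation(2)[of x] norm_triangle_sub[of "\<omega> (cis x)" "g 0 x"] by (simp add: f_def)
 next
  case False
  then show ?thesis using order_trans[OF norm_ge_zero calculation(2)[of 0]] by (auto simp: f_def)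
 qed
 ultimately show ?thesis unfolding bounded_symbol_def
  by (intro exI[of _ f] exI[of _ "M + 1"]) (simp add: f_def)
qed

lemma PC_decomposition:
 assumes \<omega>: "\<omega> \<in> PC" and \<delta>: "\<delta> > 0"
 obtains Z a \<phi> where "finite Z" "\<And>z. z \<in> Z \<Longrightarrow> norm z = 1" "\<And>z. z \<notin> Z \<Longrightarrow> a z = 0"
  "\<And>z. norm z = 1 \<Longrightarrow> norm (a z - (- \<i> * jump \<omega> z)) \<le> \<delta>"
  "bounded_symbol \<phi>" "\<And>z. norm z = 1 \<Longrightarrow> norm (\<phi> z) \<le> \<delta>"
  "\<And>j::nat. j \<ge> 1 \<Longrightarrow> fourier_coeff \<omega> (int j) = (\<Sum>z\<in>Z. a z * cnj z ^ j) / of_real (pi * real j) + fourier_coeff \<phi> (int j)"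
proof -
 obtain \<theta> m where sa: "step_approximation \<omega> \<delta> \<theta> m" using PC_step_approximation[OF \<omega> \<delta>] by blast
 interpret step_approximation \<omega> \<delta> \<theta> m by fact
 define \<phi> where "\<phi> z = \<omega> z + (-1) * s z" for z
 note bs = PC_bounded_symbol[OF \<omega>] bounded_symbol_mult_const[OF bounded_symbol_s, of "-1"]
 show ?thesis
 proof (rule that[of Z a \<phi>])
  show "finite Z" by (simp add: Z_def)
  show "norm z = 1" if "z \<in> Z" for z using that by (auto simp: Z_def)
  show "bounded_symbol \<phi>" unfolding \<phi>_def by (rule bounded_symbol_add[OF bs])
  show "norm (\<phi> z) \<le> \<delta>" if z: "norm z = 1" for z
  proof -
   define w where "w = Arg2pi z"
   have w: "z = cis w" "w \<in> {0..2 * pi}"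
    using unit_eq_cis[OF z] Arg2pi_ge_0[of z] Arg2pi_lt_2pi[of z] by (auto simp: w_def)
   show ?thesis using g_near[OF w(2)] s_cis[OF w(2)] by (simp add: \<phi>_def w(1))
  qed
  show "fourier_coeff \<omega> (int j) = (\<Sum>z\<in>Z. a z * cnj z ^ j) / of_real (pi * real j) + fourier_coeff \<phi> (int j)" if "j \<ge> 1" for j :: nat
   unfolding \<phi>_def fourier_coeff_add[OF bs] fourier_coeff_mult_const fourier_s[OF that] by simp
 qed (use a_off a_near_jump in auto)
qed

section \<open>The multiplier acting on the jump part\<close>

text \<open>Comparison with the logarithm: \<open>ln ((m + 1) / m)\<close> is at least
  \<open>1 / (m + 1)\<close>, hence at least half of \<open>1 / m\<close>. A window whose ends have
  bounded ratio contributes a bounded amount.\<close>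

lemma harmonic_window:
 fixes u v :: real
 assumes u: "0 < u" and uv: "u \<le> v + 1"
 shows "(\<Sum>m\<in>{1..<L}. if u < real m \<and> real m \<le> v then 1 / real m else 0) \<le> 2 * (ln (v + 1) - ln u)"
proof (cases "1 \<le> L")
 case True
 \<comment> \<open>Clipping to the window makes the increments outside it nonnegative and harmless,
   so the sum telescopes over the whole range.\<close>
 define p where "p x = ln (max u (min (real x) (v + 1)))" for x :: nat
 have p_mono: "p m \<le> p (Suc m)" for m using u uv by (simp add: p_def)
 have "(\<Sum>m\<in>{1..<L}. if u < real m \<and> real m \<le> v then 1 / real m else 0) \<le> (\<Sum>m\<in>{1..<L}. 2 * (p (Suc m) - p m))"
 proof (intro sum_mono)
  fix m assume "m \<in> {1..<L}"
  then have m: "real m \<ge> 1" by auto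
  show "(if u < real m \<and> real m \<le> v then 1 / real m else 0) \<le> 2 * (p (Suc m) - p m)"
  proof (cases "u < real m \<and> real m \<le> v")
   case True
   then have "p (Suc m) - p m = ln ((real m + 1) / real m)" using m by (simp add: p_def ln_div add.commute)
   also have "\<dots> = - ln (real m / (real m + 1))" using m by (simp add: ln_div)
   also have "\<dots> \<ge> 1 - real m / (real m + 1)" using ln_le_minus_one[of "real m / (real m + 1)"] m by simp
   finally have "2 * (p (Suc m) - p m) \<ge> 2 / (real m + 1)" using m by (simp add: field_simps)
   moreover have "2 / (real m + 1) \<ge> 1 / real m" using m by (simp add: field_simps)
   ultimately show ?thesis using True by simp
  next
   case False
   show ?thesis unfolding if_not_P[OF False] using p_mono[of m] by simp
  qed
 qed
 also have "\<dots> = 2 * (p L - p 1)"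
  unfolding sum_distrib_left[symmetric] using sum_Suc_diff'[OF True, of p] by simp
 also have "\<dots> \<le> 2 * (ln (v + 1) - ln u)"
 proof -
  have "p L \<le> ln (v + 1)" "ln u \<le> p 1" unfolding p_def using u uv by (simp_all)
  then show ?thesis by simp
 qed
 finally show ?thesis .
next
 case False
 then have "{1..<L} = {}" by auto
 then show ?thesis using u uv by simp
qed

text \<open>Comparison with the integral of a negative power of the logarithm, convergent for
  \<open>s > 1\<close>. Starting beyond \<open>2 * N\<close> keeps the logarithm above
  \<open>ln 2\<close>, so the bound depends neither on \<open>N\<close> nor on
  \<open>L\<close>.\<close>

lemma log_power_tail:
 fixes s :: real
 assumes s: "s > 1" and N: "N \<ge> 1"
 shows "(\<Sum>m\<in>{1..<L}. if 2 * N < m then ln (real m / real N) powr (- s) / real m else 0) \<le> ln 2 powr (1 - s) / (s - 1)"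
proof (cases "1 \<le> L")
 case True
 define G where "G x = - (ln (x / real N) powr (1 - s) / (s - 1))" for x :: real
 have G': "(G has_real_derivative ln (x / real N) powr (- s) / x) (at x)" if x: "x > real N" for x
 proof -
  have "x / real N > 1" "ln (x / real N) > 0" using x N by auto
  moreover have "((\<lambda>x. ln (x / real N)) has_real_derivative 1 / x) (at x)"
   using x N by (auto intro!: derivative_eq_intros)
  ultimately have "(G has_real_derivative - ((1 - s) * ln (x / real N) powr (1 - s - 1) * (1 / x) / (s - 1))) (at x)"
   unfolding G_def by (intro DERIV_minus DERIV_cdivide DERIV_chain2[OF has_real_derivative_powr])
  moreover have "- ((1 - s) * ln (x / real N) powr (1 - s - 1) * (1 / x) / (s - 1)) = ln (x / real N) powr (- s) / x"
  proof -
   have "1 - s - 1 = - s" by simp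
   moreover have "- ((1 - s) * P * (1 / x) / (s - 1)) = P / x" for P using s by (simp add: divide_simps) (simp add: algebra_simps)?
   ultimately show ?thesis by metis
  qed
  ultimately show ?thesis by simp
 qed
 \<comment> \<open>Freezing the primitive up to \<open>2 * N\<close> lets the sum telescope from the
   first term on.\<close>
 define q where "q m = G (max (real m) (2 * real N))" for m :: nat
 have step: "(if 2 * N < m then ln (real m / real N) powr (- s) / real m else 0) \<le> q m - q (m - 1)" if m: "m \<ge> 1" for m
 proof (cases "2 * N < m")
  case True
  have lt: "real (m - 1) < real m" using m by simp
  have ge: "real (m - 1) \<ge> 2 * real N" "real m > 2 * real N" using True by auto
  obtain \<xi> where \<xi>: "real (m - 1) < \<xi>" "\<xi> < real m" "G (real m) - G (real (m - 1)) = (real m - real (m - 1)) * (ln (\<xi> / real N) powr (- s) / \<xi>)"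
   using MVT2[OF lt, of G "\<lambda>x. ln (x / real N) powr (- s) / x"] G' ge N by auto
  have \<xi>N: "\<xi> > real N" "\<xi> > 0" using \<xi>(1) ge N by auto
  have "ln (\<xi> / real N) > 0" using \<xi>N N by simp
  moreover have "ln (\<xi> / real N) \<le> ln (real m / real N)" using \<xi> \<xi>N N by (simp add: divide_right_mono)
  ultimately have "ln (real m / real N) powr (- s) \<le> ln (\<xi> / real N) powr (- s)" using s by (intro powr_mono2') auto
  then have "ln (real m / real N) powr (- s) / real m \<le> ln (\<xi> / real N) powr (- s) / \<xi>"
   using \<xi> \<xi>N by (intro frac_le) auto
  also have "\<dots> = G (real m) - G (real (m - 1))" using \<xi>(3) m by (simp add: of_nat_diff)
  also have "\<dots> = q m - q (m - 1)" using ge by (simp add: q_def)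
  finally show ?thesis using True by simp
 next
  case False
  then have "real m \<le> 2 * real N" "real (m - 1) \<le> 2 * real N" by auto
  then have "q m = q (m - 1)" by (simp add: q_def)
  then show ?thesis using False by simp
 qed
 have "(\<Sum>m\<in>{1..<L}. if 2 * N < m then ln (real m / real N) powr (- s) / real m else 0) \<le> (\<Sum>m\<in>{1..<L}. q m - q (m - 1))"
  by (intro sum_mono step) auto
 also have "\<dots> = q (L - 1) - q 0"
  using sum_Suc_diff'[OF True, of "\<lambda>m. q (m - 1)"] by simp
 also have "\<dots> \<le> - q 0" using s by (simp add: q_def G_def)
 also have "\<dots> = ln 2 powr (1 - s) / (s - 1)" using N by (simp add: q_def G_def)
 finally show ?thesis .
next
 case False
 then have "{1..<L} = {}" by auto
 then show ?thesis using s by simp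
qed

text \<open>The index sums \<open>m = j + k\<close> fall into three ranges. Up to
  \<open>N * exp (- \<kappa>)\<close> condition (B) makes the multiplier close to 1, and the
  harmonic sum carries a small coefficient. From there to \<open>2 * N\<close> the window has
  bounded logarithmic length, so a crude bound costs a constant. Beyond \<open>2 * N\<close>
  condition (C) enters squared, with exponent \<open>2 * \<alpha> > 1\<close>, and the tail
  converges.\<close>

lemma multiplier_remainder_hs:
 fixes \<tau> :: "real \<Rightarrow> real \<Rightarrow> complex" and b :: "nat \<Rightarrow> complex"
 assumes M: "\<And>x y. 0 \<le> x \<Longrightarrow> 0 \<le> y \<Longrightarrow> norm (\<tau> x y) \<le> M" and B: "cond_B \<tau>" and C: "cond_C \<tau>"
  and b: "\<And>m. m \<ge> 1 \<Longrightarrow> norm (b m) \<le> A / real m" and \<eta>: "\<eta> > 0"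
 shows "\<exists>K. \<forall>N\<ge>1. hs_bound (\<lambda>j k. dilate \<tau> N j k * b (j + k) - (if j \<in> {1..N} \<and> k \<in> {1..N} then b (j + k) else 0))
  (\<eta> * ln (real N) + K)"
proof -
 have M0: "M \<ge> 0" using order_trans[OF norm_ge_zero M[of 0 0]] by simp
 have A0: "A \<ge> 0" using order_trans[OF norm_ge_zero b[of 1]] by simp
 obtain \<epsilon> \<beta> C\<beta> where \<beta>: "\<epsilon> > 0" "\<beta> > 1/2" "C\<beta> > 0"
  "\<And>x y. 0 \<le> x \<Longrightarrow> x \<le> \<epsilon> \<Longrightarrow> 0 \<le> y \<Longrightarrow> y \<le> \<epsilon> \<Longrightarrow> norm (\<tau> x y - 1) \<le> C\<beta> * \<bar>ln (x + y)\<bar> powr (- \<beta>)"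
  using B unfolding cond_B_def by (metis atLeastAtMost_iff)
 obtain \<alpha> C\<alpha> where \<alpha>: "\<alpha> > 1/2" "\<And>x y. 0 \<le> x \<Longrightarrow> 0 \<le> y \<Longrightarrow> norm (\<tau> x y) \<le> C\<alpha> * ln (x + y + 2) powr (- \<alpha>)"
  using C unfolding cond_C_def by blast
 \<comment> \<open>One factor 2 comes from \<open>(m + 1) / m \<le> 2\<close> on antidiagonals,
   another from \<open>harmonic_window\<close>; the added 1 excludes division by 0.\<close>
 define \<eta>' where "\<eta>' = \<eta> / (4 * A^2 + 1)"
 have \<eta>': "\<eta>' > 0" unfolding \<eta>'_def using \<eta> by (intro divide_pos_pos add_nonneg_pos) auto
 have \<eta>'_le: "4 * A^2 * \<eta>' \<le> \<eta>"
 proof -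
  have "4 * A^2 * \<eta>' \<le> (4 * A^2 + 1) * \<eta>'" using \<eta>' by (simp add: algebra_simps)
  also have "\<dots> = \<eta>" unfolding \<eta>'_def using zero_le_power2[of A] by (simp add: add_nonneg_eq_0_iff)
  finally show ?thesis .
 qed
 have "((\<lambda>\<kappa>. C\<beta> * \<kappa> powr (- \<beta>)) \<longlongrightarrow> C\<beta> * 0) at_top"
  by (intro tendsto_mult tendsto_const tendsto_neg_powr filterlim_ident) (use \<beta> in auto)
 then have ev1: "\<forall>\<^sub>F \<kappa> in at_top. C\<beta> * \<kappa> powr (- \<beta>) < sqrt \<eta>'"
  by (rule order_tendstoD(2)) (use \<eta>' in simp)
 have ev2: "\<forall>\<^sub>F \<kappa> in at_top. \<kappa> \<ge> max 1 (- ln \<epsilon>)" by (rule eventually_ge_at_top)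
 \<comment> \<open>A depth at which the arguments are below the \<epsilon> of (B) and the multiplier
   is within \<open>sqrt \<eta>'\<close> of 1.\<close>
 obtain \<kappa> where \<kappa>: "C\<beta> * \<kappa> powr (- \<beta>) < sqrt \<eta>'" "\<kappa> \<ge> max 1 (- ln \<epsilon>)"
  using eventually_happens[OF eventually_conj[OF ev1 ev2]] by auto
 have \<kappa>1: "\<kappa> \<ge> 1" using \<kappa>(2) by simp
 have "exp (- \<kappa>) \<le> exp (ln \<epsilon>)" using \<kappa>(2) by simp
 then have \<kappa>\<epsilon>: "exp (- \<kappa>) \<le> \<epsilon>" using \<beta>(1) by simp
 have e1: "exp (- \<kappa>) \<le> 1" using \<kappa>1 by simp
 define W where "W = (M + 1)^2 + C\<alpha>^2"
 define g where "g N m = (if real m \<le> real N * exp (- \<kappa>) then \<eta>' else if m \<le> 2 * N then W else W * ln (real m / real N) powr (- (2 * \<alpha>)))" for N m :: nat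
 have W0: "W \<ge> 0" by (simp add: W_def)
 have g0: "g N m \<ge> 0" for N m using W0 \<eta>' by (simp add: g_def)
 have sum_b: "summable (\<lambda>m. (norm (b m))^2)"
 proof (rule summable_comparison_test'[where N=1])
  show "summable (\<lambda>m. A^2 * inverse (real m ^ 2))" by (intro summable_mult inverse_power_summable) simp
  show "norm ((norm (b m))^2) \<le> A^2 * inverse (real m ^ 2)" if "m \<ge> 1" for m
   using power_mono[OF b[OF that], of 2] by (simp add: power_divide inverse_eq_divide)
 qed
 define Q where "Q = (\<Sum>m. (norm (b m))^2)"
 have Q: "(\<Sum>m<n. (norm (b m))^2) \<le> Q" for n unfolding Q_def by (rule sum_le_suminf[OF sum_b]) auto
 define e where "e N j k = dilate \<tau> N j k * b (j + k) - (if j \<in> {1..N} \<and> k \<in> {1..N} then b (j + k) else 0)" for N j k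
 define f where "f N m = A^2 / (real m)^2 * g N m" for N m
 \<comment> \<open>Row and column 0, absent from the truncated matrix, are bounded separately: the
   squares of \<open>b\<close> are summable, uniformly in \<open>N\<close>.\<close>
 define h where "h j k = (if j = 0 then M^2 * (norm (b k))^2 else 0) + (if k = 0 then M^2 * (norm (b j))^2 else 0)" for j k :: nat
 have h0: "h j k \<ge> 0" for j k by (simp add: h_def)
 have pt: "(norm (e N j k))^2 \<le> f N (j + k) + h j k" if N: "N \<ge> 1" for N j k
 proof (cases "j = 0 \<or> k = 0")
  case True
  have "norm (e N j k) \<le> M * norm (b (j + k))"
   using True M[of "real j / real N" "real k / real N"] by (auto simp: e_def dilate_def norm_mult intro: mult_right_mono)
  then have "(norm (e N j k))^2 \<le> (M * norm (b (j + k)))^2" by (rule power_mono) simp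
  also have "\<dots> \<le> h j k" using True by (auto simp: h_def power_mult_distrib)
  moreover have "f N (j + k) \<ge> 0" using g0[of N "j + k"] by (simp add: f_def)
  ultimately show ?thesis by simp
 next
  case False
  define m where "m = j + k"
  have m: "m \<ge> 2" "j \<le> m" "k \<le> m" using False by (auto simp: m_def)
  define T where "T = dilate \<tau> N j k"
  have xy: "real j / real N + real k / real N = real m / real N" by (simp add: m_def add_divide_distrib)
  have TM: "norm T \<le> M" unfolding T_def dilate_def by (rule M) auto
  have bm: "norm (b m) \<le> A / real m" using b[of m] m by simp
  have red: "(norm (e N j k))^2 \<le> A^2 / (real m)^2 * G" if r: "norm (e N j k) \<le> r * norm (b m)" "r^2 \<le> G" for r G
  proof -
   have "(norm (e N j k))^2 \<le> (r * norm (b m))^2" by (rule power_mono[OF r(1)]) simp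
   also have "\<dots> = (norm (b m))^2 * r^2" by (simp add: power_mult_distrib)
   also have "\<dots> \<le> (A / real m)^2 * G" using r(2) bm by (intro mult_mono power_mono) auto
   finally show ?thesis by (simp add: power_divide)
  qed
  consider "real m \<le> real N * exp (- \<kappa>)" | "\<not> real m \<le> real N * exp (- \<kappa>)" "m \<le> 2 * N" | "\<not> real m \<le> real N * exp (- \<kappa>)" "\<not> m \<le> 2 * N" by blast
  then have "(norm (e N j k))^2 \<le> f N m"
  proof cases
   case 1
   have mN: "real m / real N \<le> exp (- \<kappa>)" "real m / real N > 0" using 1 N m by (auto simp: field_simps)
   have "real m \<le> real N" using 1 mult_left_mono[OF e1, of "real N"] by simp
   then have jk: "j \<in> {1..N}" "k \<in> {1..N}" using False m by auto
   have eq: "e N j k = (T - 1) * b m" using jk by (simp add: e_def T_def m_def algebra_simps)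
   have le: "real j / real N \<le> \<epsilon>" "real k / real N \<le> \<epsilon>"
    using mN(1) \<kappa>\<epsilon> m(2,3) divide_right_mono[of "real j" "real m" "real N"] divide_right_mono[of "real k" "real m" "real N"] by auto
   have "ln (real m / real N) \<le> ln (exp (- \<kappa>))" using mN by (subst ln_le_cancel_iff) auto
   then have "ln (real m / real N) \<le> - \<kappa>" by simp
   then have ab: "\<kappa> \<le> \<bar>ln (real m / real N)\<bar>" by linarith
   have "norm (T - 1) \<le> C\<beta> * \<bar>ln (real m / real N)\<bar> powr (- \<beta>)"
    using \<beta>(4)[OF _ le(1) _ le(2)] unfolding xy T_def dilate_def by simp
   also have "\<dots> \<le> C\<beta> * \<kappa> powr (- \<beta>)" using ab \<beta> \<kappa>1 by (intro mult_left_mono powr_mono2') auto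
   also have "\<dots> \<le> sqrt \<eta>'" using \<kappa>(1) by simp
   finally have "norm (T - 1) \<le> sqrt \<eta>'" .
   then have "norm (e N j k) \<le> sqrt \<eta>' * norm (b m)" unfolding eq norm_mult by (intro mult_right_mono) auto
   from red[OF this, of \<eta>'] show ?thesis using 1 \<eta>' by (simp add: f_def g_def)
  next
   case 2
   have "norm (e N j k) \<le> (M + 1) * norm (b m)"
   proof -
    have "norm (e N j k) \<le> norm (T * b m) + norm (b m)"
     unfolding e_def T_def[symmetric] m_def[symmetric] by (rule order_trans[OF norm_triangle_ineq4]) auto
    also have "\<dots> \<le> M * norm (b m) + norm (b m)" unfolding norm_mult using TM by (intro add_right_mono mult_right_mono) auto
    finally show ?thesis by (simp add: algebra_simps)
   qed
   from red[OF this, of W] show ?thesis using 2 by (simp add: f_def g_def W_def)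
  next
   case 3
   \<comment> \<open>Here nothing is subtracted, because both indices in \<open>1\<close> to
     \<open>N\<close> would force their sum to be at most \<open>2 * N\<close>.\<close>
   have eq: "e N j k = T * b m" using 3 by (auto simp: e_def T_def m_def)
   have gt: "real m / real N > 2"
   proof -
    have "real m > 2 * real N" using 3(2) by simp
    then show ?thesis using N by (simp add: field_simps)
   qed
   have l: "ln (real m / real N) > 0" "ln (real m / real N) \<le> ln (real m / real N + 2)" using gt by auto
   have "norm T \<le> C\<alpha> * ln (real m / real N + 2) powr (- \<alpha>)"
    using \<alpha>(2)[of "real j / real N" "real k / real N"] unfolding xy T_def dilate_def by simp
   also have "\<dots> \<le> \<bar>C\<alpha>\<bar> * ln (real m / real N) powr (- \<alpha>)"
    using l \<alpha>(1) by (intro mult_mono powr_mono2') auto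
   finally have "norm (e N j k) \<le> \<bar>C\<alpha>\<bar> * ln (real m / real N) powr (- \<alpha>) * norm (b m)"
    unfolding eq norm_mult by (intro mult_right_mono) auto
   moreover have "(\<bar>C\<alpha>\<bar> * ln (real m / real N) powr (- \<alpha>))^2 \<le> W * ln (real m / real N) powr (- (2 * \<alpha>))"
   proof -
    have "(ln (real m / real N) powr (- \<alpha>))^2 = ln (real m / real N) powr (- (2 * \<alpha>))"
     unfolding power2_eq_square powr_add[symmetric] by simp
    then show ?thesis unfolding power_mult_distrib by (simp add: W_def mult_right_mono)
   qed
   ultimately have "(norm (e N j k))^2 \<le> A^2 / (real m)^2 * (W * ln (real m / real N) powr (- (2 * \<alpha>)))" by (rule red)
   then show ?thesis using 3 by (simp add: f_def g_def)
  qed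
  then show ?thesis using h0[of j k] by (simp add: m_def)
 qed
 define c where "c = ln 2 powr (1 - 2 * \<alpha>) / (2 * \<alpha> - 1)"
 have gsum: "(\<Sum>m\<in>{1..<L}. g N m / real m) \<le> 2 * \<eta>' * ln (real N) + (4 * \<eta>' * ln 2 + 2 * W * (ln 3 + \<kappa>) + W * c)" if N: "N \<ge> 1" for N L
 proof -
  define u where "u = real N * exp (- \<kappa>)"
  have u: "0 < u" "u \<le> real N" using N mult_left_mono[OF e1, of "real N"] by (auto simp: u_def)
  define s1 where "s1 m = (if 1 / 2 < real m \<and> real m \<le> real N then 1 / real m else 0)" for m
  define s2 where "s2 m = (if u < real m \<and> real m \<le> 2 * real N then 1 / real m else 0)" for m
  define s3 where "s3 m = (if 2 * N < m then ln (real m / real N) powr (- (2 * \<alpha>)) / real m else 0)" for m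
  have "(\<Sum>m\<in>{1..<L}. g N m / real m) \<le> (\<Sum>m\<in>{1..<L}. \<eta>' * s1 m + W * s2 m + W * s3 m)"
  proof (intro sum_mono)
   fix m assume "m \<in> {1..<L}"
   then have m: "m \<ge> 1" by simp
   have nn: "\<eta>' * s1 m \<ge> 0" "W * s2 m \<ge> 0" "W * s3 m \<ge> 0" using \<eta>' W0 by (auto simp: s1_def s2_def s3_def)
   consider "real m \<le> u" | "\<not> real m \<le> u" "m \<le> 2 * N" | "\<not> real m \<le> u" "\<not> m \<le> 2 * N" by blast
   then show "g N m / real m \<le> \<eta>' * s1 m + W * s2 m + W * s3 m"
   proof cases
    case 1
    then have "g N m / real m = \<eta>' * s1 m" using u m by (simp add: g_def s1_def u_def)
    then show ?thesis using nn by linarith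
   next
    case 2
    then have "real m \<le> 2 * real N" by linarith
    then have "g N m / real m = W * s2 m" using 2 by (simp add: g_def s2_def u_def)
    then show ?thesis using nn by linarith
   next
    case 3
    then have "g N m / real m = W * s3 m" by (simp add: g_def s3_def u_def)
    then show ?thesis using nn by linarith
   qed
  qed
  also have "\<dots> = \<eta>' * (\<Sum>m\<in>{1..<L}. s1 m) + W * (\<Sum>m\<in>{1..<L}. s2 m) + W * (\<Sum>m\<in>{1..<L}. s3 m)"
   by (simp add: sum.distrib sum_distrib_left)
  also have "\<dots> \<le> \<eta>' * (2 * (ln (real N + 1) - ln (1 / 2))) + W * (2 * (ln (2 * real N + 1) - ln u)) + W * c"
  proof (intro add_mono mult_left_mono)
   show "(\<Sum>m\<in>{1..<L}. s1 m) \<le> 2 * (ln (real N + 1) - ln (1 / 2))" unfolding s1_def by (rule harmonic_window) auto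
   show "(\<Sum>m\<in>{1..<L}. s2 m) \<le> 2 * (ln (2 * real N + 1) - ln u)" unfolding s2_def by (rule harmonic_window) (use u in auto)
   show "(\<Sum>m\<in>{1..<L}. s3 m) \<le> c" unfolding s3_def c_def by (rule log_power_tail) (use \<alpha> N in auto)
  qed (use \<eta>' W0 in auto)
  also have "\<dots> \<le> \<eta>' * (2 * (ln (real N) + 2 * ln 2)) + W * (2 * (ln 3 + \<kappa>)) + W * c"
  proof (intro add_mono mult_left_mono order_refl)
   have "ln (real N + 1) \<le> ln (2 * real N)" using N by simp
   then show "ln (real N + 1) - ln (1 / 2) \<le> ln (real N) + 2 * ln 2" using N by (simp add: ln_mult ln_div)
   have "ln (2 * real N + 1) \<le> ln (3 * real N)" using N by simp
   then show "ln (2 * real N + 1) - ln u \<le> ln 3 + \<kappa>" using N by (simp add: ln_mult u_def)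
  qed (use \<eta>' W0 in auto)
  finally show ?thesis by (simp add: algebra_simps)
 qed
 show ?thesis
 proof (intro exI allI impI)
  fix N :: nat assume N: "N \<ge> 1"
  show "hs_bound (\<lambda>j k. dilate \<tau> N j k * b (j + k) - (if j \<in> {1..N} \<and> k \<in> {1..N} then b (j + k) else 0))
   (\<eta> * ln (real N) + (2 * A^2 * (4 * \<eta>' * ln 2 + 2 * W * (ln 3 + \<kappa>) + W * c) + 2 * M^2 * Q))"
   unfolding hs_bound_def
  proof
   fix n
   have "(\<Sum>k<n. \<Sum>j<n. (norm (e N j k))^2) \<le> (\<Sum>k<n. \<Sum>j<n. f N (k + j) + h j k)"
    by (intro sum_mono) (subst add.commute[of _ "_ :: nat"], rule pt[OF N])
   also have "\<dots> = (\<Sum>k<n. \<Sum>j<n. f N (k + j)) + (\<Sum>k<n. \<Sum>j<n. h j k)" by (simp add: sum.distrib)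
   also have "(\<Sum>k<n. \<Sum>j<n. f N (k + j)) \<le> (\<Sum>m<2 * n. real (m + 1) * f N m)"
    by (rule diagonal_sum_le) (use g0 in \<open>simp add: f_def\<close>)
   also have "(\<Sum>m<2 * n. real (m + 1) * f N m) \<le> (\<Sum>m<2 * n. if m = 0 then 0 else 2 * A^2 * (g N m / real m))"
   proof (intro sum_mono)
    fix m
    show "real (m + 1) * f N m \<le> (if m = 0 then 0 else 2 * A^2 * (g N m / real m))"
    proof (cases "m = 0")
     case False
     have "real (m + 1) * f N m = A^2 * (g N m / real m) * ((real m + 1) / real m)"
      by (simp add: f_def power2_eq_square field_simps)
     also have "\<dots> \<le> A^2 * (g N m / real m) * 2"
      using g0[of N m] False by (intro mult_left_mono) (auto simp: field_simps)
     finally show ?thesis using False by (simp add: mult_ac)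
    qed (simp add: f_def)
   qed
   also have "\<dots> = (\<Sum>m\<in>{1..<2 * n}. 2 * A^2 * (g N m / real m))"
    by (rule sum.mono_neutral_cong_right) auto
   also have "\<dots> = 2 * A^2 * (\<Sum>m\<in>{1..<2 * n}. g N m / real m)" by (simp only: sum_distrib_left)
   also have "\<dots> \<le> 2 * A^2 * (2 * \<eta>' * ln (real N) + (4 * \<eta>' * ln 2 + 2 * W * (ln 3 + \<kappa>) + W * c))"
    by (intro mult_left_mono gsum[OF N]) simp
   also have "\<dots> \<le> \<eta> * ln (real N) + 2 * A^2 * (4 * \<eta>' * ln 2 + 2 * W * (ln 3 + \<kappa>) + W * c)"
    using mult_right_mono[OF \<eta>'_le, of "ln (real N)"] N by (simp add: algebra_simps)
   also have "(\<Sum>k<n. \<Sum>j<n. h j k) \<le> 2 * M^2 * Q"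
   proof -
    have 1: "(\<Sum>k<n. \<Sum>j<n. if j = 0 then M^2 * (norm (b k))^2 else 0) \<le> M^2 * Q"
    proof -
     have "(\<Sum>k<n. \<Sum>j<n. if j = 0 then M^2 * (norm (b k))^2 else 0) \<le> (\<Sum>k<n. M^2 * (norm (b k))^2)"
      by (intro sum_mono) (simp add: sum.delta)
     also have "\<dots> \<le> M^2 * Q" unfolding sum_distrib_left[symmetric] by (intro mult_left_mono Q) simp
     finally show ?thesis .
    qed
    have "(\<Sum>k<n. \<Sum>j<n. if k = 0 then M^2 * (norm (b j))^2 else 0) = (\<Sum>k<n. \<Sum>j<n. if j = 0 then M^2 * (norm (b k))^2 else 0)"
     by (rule sum.swap)
    then show ?thesis using 1 by (simp add: h_def sum.distrib)
   qed
   finally show "(\<Sum>k<n. \<Sum>j<n. (norm (dilate \<tau> N j k * b (j + k) - (if j \<in> {1..N} \<and> k \<in> {1..N} then b (j + k) else 0)))^2)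
    \<le> \<eta> * ln (real N) + (2 * A^2 * (4 * \<eta>' * ln 2 + 2 * W * (ln 3 + \<kappa>) + W * c) + 2 * M^2 * Q)"
    by (simp add: e_def)
  qed
 qed
qed

section \<open>Families of operators close to jump sections\<close>

lemma tendsto_ratio_ln:
 fixes n :: "nat \<Rightarrow> nat"
 assumes lo: "\<And>e. e > 0 \<Longrightarrow> \<forall>\<^sub>F N in sequentially. (F - e) * ln (real N) \<le> real (n N)"
  and up: "\<And>e. e > 0 \<Longrightarrow> \<forall>\<^sub>F N in sequentially. real (n N) \<le> (F + e) * ln (real N)"
 shows "(\<lambda>N. real (n N) / ln (real N)) \<longlonglongrightarrow> F"
proof (rule tendstoI)
 fix e :: real assume e: "e > 0"
 have "\<forall>\<^sub>F N in sequentially. ln (real N) \<ge> 1" using filterlim_ln_real by (simp add: filterlim_at_top)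
 then show "\<forall>\<^sub>F N in sequentially. dist (real (n N) / ln (real N)) F < e"
  using lo[OF half_gt_zero[OF e]] up[OF half_gt_zero[OF e]]
 proof eventually_elim
  case (elim N)
  then have "F - e / 2 \<le> real (n N) / ln (real N)" "real (n N) / ln (real N) \<le> F + e / 2"
   by (simp_all add: pos_le_divide_eq pos_divide_le_eq)
  then show ?case using e by (auto simp: dist_real_def abs_if)
 qed
qed

lemma eventually_ln_weaken:
 assumes "x \<le> y" and "\<forall>\<^sub>F N in sequentially. (y - e) * ln (real N) \<le> f N"
 shows "\<forall>\<^sub>F N in sequentially. (x - e) * ln (real N) \<le> f N"
 using assms(2) eventually_ge_at_top[of 1]
proof eventually_elim
 case (elim N)
 have "(x - e) * ln (real N) \<le> (y - e) * ln (real N)"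
  using assms(1) elim(2) by (intro mult_right_mono) auto
 then show ?case using elim(1) by linarith
qed

text \<open>The order of quantifiers matters: the norm error \<open>r\<close> is fixed, whereas the
  Hilbert--Schmidt part has an arbitrarily small coefficient of \<open>ln N\<close> with a constant
  \<open>K\<close> independent of \<open>N\<close>.\<close>

abbreviation jump_close :: "real \<Rightarrow> (nat \<Rightarrow> ell2 \<Rightarrow> ell2) \<Rightarrow> complex set \<Rightarrow> (complex \<Rightarrow> complex) \<Rightarrow> bool" where
 "jump_close r A Z a \<equiv> \<forall>\<eta>>0. \<exists>K. \<forall>N\<ge>1. \<exists>E. hs_bound E (\<eta> * ln (real N) + K) \<and>
  (\<forall>x. norm (A N x - jump_operator a Z N x - matrix_operator E x) \<le> r * norm x)"

text \<open>An interface that separates the counting from the origin of the operators. Here \<kappa>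
  gives the limiting weights of the possibly infinitely many jumps, and \<open>C\<close> relates
  symbol norm to operator norm. The flag \<open>symm\<close> lets the symmetric conclusions share
  the hypotheses of the general one.\<close>

locale jump_approximation =
 fixes \<kappa> :: "complex \<Rightarrow> complex" and A :: "nat \<Rightarrow> ell2 \<Rightarrow> ell2" and C :: real and symm :: bool
 assumes C: "C \<ge> 0" and bcA: "\<And>N. N \<ge> 1 \<Longrightarrow> bounded_clinear (A N)"
  and approx: "\<And>\<delta>. \<delta> > 0 \<Longrightarrow> \<exists>Z a. jump_data Z \<and> (\<forall>z. z \<notin> Z \<longrightarrow> a z = 0) \<and>
   (\<forall>z. norm z = 1 \<longrightarrow> norm (a z - \<kappa> z) \<le> \<delta>) \<and> (symm \<longrightarrow> (\<forall>z. a (cnj z) = cnj (a z))) \<and>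
   (jump_close (C * \<delta>) A Z a)"
  and symA: "\<And>N. symm \<Longrightarrow> N \<ge> 1 \<Longrightarrow> self_adjoint (A N)"
  and sym\<kappa>: "\<And>z. symm \<Longrightarrow> norm z = 1 \<Longrightarrow> \<kappa> (cnj z) = cnj (\<kappa> z)"
begin

abbreviation close_via where
 "close_via E \<delta> a Z N x \<equiv> norm (A N x - jump_operator a Z N x) \<le> norm (matrix_operator E x) + C * \<delta> * norm x"

lemma compact:
 assumes N: "N \<ge> 1"
 shows "compact_operator (A N)"
proof (rule compact_operator_approx[OF bcA[OF N]])
 fix e :: real assume e: "e > 0"
 define \<delta> where "\<delta> = e / (C + 1)"
 have \<delta>: "\<delta> > 0" "C * \<delta> \<le> e" using e C by (auto simp: \<delta>_def field_simps)
 obtain Z a where "jump_close (C * \<delta>) A Z a"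
  using approx[OF \<delta>(1)] by blast
 then obtain K E where E: "hs_bound E (1 * ln (real N) + K)"
  "\<And>x. norm (A N x - jump_operator a Z N x - matrix_operator E x) \<le> C * \<delta> * norm x"
  using N zero_less_one by blast
 have "compact_operator (\<lambda>x. jump_operator a Z N x + matrix_operator E x)"
  by (intro compact_operator_add jump_section_compact hs_compact[OF E(1)])
 moreover have "norm (A N x - (jump_operator a Z N x + matrix_operator E x)) \<le> e * norm x" for x
  using order_trans[OF E(2) mult_right_mono[OF \<delta>(2) norm_ge_zero[of x]]] by (simp add: diff_diff_eq)
 ultimately show "\<exists>B. compact_operator B \<and> (\<forall>x. norm (A N x - B x) \<le> e * norm x)" by blast
qed

definition approximant :: "real \<Rightarrow> complex set \<Rightarrow> (complex \<Rightarrow> complex) \<Rightarrow> bool" where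
 "approximant \<delta> Z a \<longleftrightarrow> jump_data Z \<and> (\<forall>z. z \<notin> Z \<longrightarrow> a z = 0) \<and> (\<forall>z. norm z = 1 \<longrightarrow> norm (a z - \<kappa> z) \<le> \<delta>) \<and>
  (symm \<longrightarrow> (\<forall>z. a (cnj z) = cnj (a z))) \<and>
  (\<forall>\<eta>>0. \<exists>K. \<forall>N\<ge>1. \<exists>E. hs_bound E (\<eta> * ln (real N) + K) \<and>
   (\<forall>x. close_via E \<delta> a Z N x))"

lemma approximantD:
 assumes "approximant \<delta> Z a"
 shows "jump_data Z" "\<And>z. z \<notin> Z \<Longrightarrow> a z = 0" "\<And>z. norm z = 1 \<Longrightarrow> norm (a z - \<kappa> z) \<le> \<delta>"
  "\<And>z. symm \<Longrightarrow> a (cnj z) = cnj (a z)"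
  "\<And>\<eta>. \<eta> > 0 \<Longrightarrow> \<exists>K. \<forall>N\<ge>1. \<exists>E. hs_bound E (\<eta> * ln (real N) + K) \<and>
    (\<forall>x. close_via E \<delta> a Z N x)"
 using assms unfolding approximant_def by simp_all

lemma approximant_exists:
 assumes \<delta>: "\<delta> > 0"
 shows "\<exists>Z a. approximant \<delta> Z a"
proof -
 obtain Z a where Z: "jump_data Z" "\<forall>z. z \<notin> Z \<longrightarrow> a z = 0" "\<forall>z. norm z = 1 \<longrightarrow> norm (a z - \<kappa> z) \<le> \<delta>"
  "symm \<longrightarrow> (\<forall>z. a (cnj z) = cnj (a z))" and ap: "jump_close (C * \<delta>) A Z a"
  using approx[OF \<delta>] by blast
 have "\<exists>K. \<forall>N\<ge>1. \<exists>E. hs_bound E (\<eta> * ln (real N) + K) \<and>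
    (\<forall>x. close_via E \<delta> a Z N x)" if "\<eta> > 0" for \<eta>
 proof -
  obtain K where K: "\<forall>N\<ge>1. \<exists>E. hs_bound E (\<eta> * ln (real N) + K) \<and>
    (\<forall>x. norm (A N x - jump_operator a Z N x - matrix_operator E x) \<le> C * \<delta> * norm x)"
   using ap \<open>\<eta> > 0\<close> by blast
  have tri: "norm (u - v) \<le> norm w + r" if "norm (u - v - w) \<le> r" for u v w :: ell2 and r
   using norm_triangle_sub[of "u - v" w] that by simp
  show ?thesis using K tri by meson
 qed
 with Z show ?thesis unfolding approximant_def by blast
qed

text \<open>The threshold \<open>t / 2\<close> instead of \<open>t\<close> leaves a margin: with
  weights perturbed by at most \<open>t / 4\<close> and levels not below \<open>3 * t / 4\<close>,
  points outside still contribute nothing.\<close>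

definition J :: "real \<Rightarrow> complex set" where "J t = {z. norm z = 1 \<and> t / 2 \<le> norm (\<kappa> z)}"

abbreviation Jplus :: "real \<Rightarrow> complex set" where "Jplus t \<equiv> {z\<in>J t. Im z > 0 \<or> (Im z = 0 \<and> Re (\<kappa> z) > 0)}"

abbreviation Jminus :: "real \<Rightarrow> complex set" where "Jminus t \<equiv> {z\<in>J t. Im z > 0 \<or> (Im z = 0 \<and> Re (\<kappa> z) < 0)}"

abbreviation level :: "real \<Rightarrow> complex \<Rightarrow> real" where "level t z \<equiv> cfun (t / norm (\<kappa> z))"

lemma cfun_off_J: "t > 0 \<Longrightarrow> norm z = 1 \<Longrightarrow> z \<notin> J t \<Longrightarrow> level t z = 0"
proof (cases "\<kappa> z = 0")
 case True
 then show ?thesis by (simp add: cfun_def)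
next
 case False
 assume "t > 0" "norm z = 1" "z \<notin> J t"
 then show ?thesis using False by (intro cfun_eq_0) (simp add: J_def)
qed

lemma J_lower:
 assumes t: "t > 0" and \<delta>: "\<delta> \<le> t / 4" and near: "\<And>z. norm z = 1 \<Longrightarrow> norm (a z - \<kappa> z) \<le> \<delta>" and z: "z \<in> J t"
 shows "norm (\<kappa> z) - \<delta> > 0" "norm (\<kappa> z) - \<delta> \<le> norm (a z)"
proof -
 have z1: "norm z = 1" "t / 2 \<le> norm (\<kappa> z)" using z by (auto simp: J_def)
 show "norm (\<kappa> z) - \<delta> > 0" using z1 \<delta> t by linarith
 show "norm (\<kappa> z) - \<delta> \<le> norm (a z)"
  using near[OF z1(1)] norm_triangle_ineq3[of "a z" "\<kappa> z"] by linarith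
qed

text \<open>An approximant with error \<open>t / 4\<close> cannot vanish at a point of
  \<open>J t\<close>, and it is supported on a finite set.\<close>

lemma finite_J:
 assumes t: "t > 0"
 shows "finite (J t)"
proof -
 have "t / 4 > 0" using t by simp
 then obtain Z a where ap: "approximant (t / 4) Z a" using approximant_exists by blast
 note Z = approximantD[OF ap]
 have "J t \<subseteq> Z"
 proof
  fix z assume z: "z \<in> J t"
  have "norm (a z) > 0" using J_lower[OF t order_refl Z(3) z] by linarith
  then show "z \<in> Z" using Z(2)[of z] by auto
 qed
 then show ?thesis using jump_data.fin[OF Z(1)] finite_subset by blast
qed

lemma eventually_small_constant:
 assumes e: "e > (0::real)"
 shows "\<forall>\<^sub>F N in sequentially. N \<ge> 1 \<and> K \<le> e * ln (real N)"
proof -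
 have "\<forall>\<^sub>F N in sequentially. K / e \<le> ln (real N)" using filterlim_ln_real by (simp add: filterlim_at_top)
 then show ?thesis using eventually_ge_at_top[of 1]
  by eventually_elim (use e in \<open>simp add: field_simps\<close>)
qed

text \<open>The constants \<open>c\<close> and \<open>d\<close> cover both directions: level up and
  weights down for lower bounds, the reverse for upper bounds.\<close>

lemma perturbed_sum_tendsto:
 assumes t: "t > 0" and P: "P \<subseteq> J t"
 shows "((\<lambda>\<delta>. \<Sum>z\<in>P. cfun ((t + c * \<delta>) / (norm (\<kappa> z) + d * \<delta>))) \<longlongrightarrow> (\<Sum>z\<in>P. level t z)) (at_right 0)"
proof (rule tendsto_sum)
 fix z assume "z \<in> P"
 then have \<kappa>: "norm (\<kappa> z) > 0" using P t by (auto simp: J_def)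
 have id: "((\<lambda>\<delta>::real. \<delta>) \<longlongrightarrow> 0) (at_right 0)" by (rule tendsto_ident_at)
 have "((\<lambda>\<delta>. (t + c * \<delta>) / (norm (\<kappa> z) + d * \<delta>)) \<longlongrightarrow> (t + c * 0) / (norm (\<kappa> z) + d * 0)) (at_right 0)"
  by (intro tendsto_divide tendsto_add tendsto_mult tendsto_const id) (use \<kappa> in simp)
 then have "((\<lambda>\<delta>. (t + c * \<delta>) / (norm (\<kappa> z) + d * \<delta>)) \<longlongrightarrow> t / norm (\<kappa> z)) (at_right 0)" by simp
 then show "((\<lambda>\<delta>. cfun ((t + c * \<delta>) / (norm (\<kappa> z) + d * \<delta>))) \<longlongrightarrow> level t z) (at_right 0)"
  by (rule isCont_tendsto_compose[rotated]) (intro isCont_cfun divide_pos_pos t \<kappa>)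
qed

text \<open>The counting function and the index set are kept abstract, so one argument serves
  singular values and positive eigenvalues. It combines their perturbation inequality with the lower
  bound for finitely many jumps.\<close>

lemma lower_transfer:
 fixes n :: "real \<Rightarrow> (ell2 \<Rightarrow> ell2) \<Rightarrow> nat"
 assumes t: "t > 0" and e: "e > 0" and P: "P \<subseteq> J t"
  and pert: "\<And>Z a N E S \<delta>. jump_data Z \<Longrightarrow> (\<And>z. symm \<Longrightarrow> a (cnj z) = cnj (a z)) \<Longrightarrow> hs_bound E S \<Longrightarrow> \<delta> > 0 \<Longrightarrow> N \<ge> 1 \<Longrightarrow>
   (\<And>x. close_via E \<delta> a Z N x) \<Longrightarrow>
   real (n (t + \<delta> + C * \<delta>) (jump_operator a Z N)) \<le> real (n t (A N)) + S / \<delta>^2"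
  and low: "\<And>Z a e s \<delta>. jump_data Z \<Longrightarrow> (\<And>z. symm \<Longrightarrow> a (cnj z) = cnj (a z)) \<Longrightarrow> (\<And>z. z \<notin> Z \<Longrightarrow> a z = 0) \<Longrightarrow>
   (\<And>z. norm z = 1 \<Longrightarrow> norm (a z - \<kappa> z) \<le> \<delta>) \<Longrightarrow> \<delta> \<le> t / 4 \<Longrightarrow> e > 0 \<Longrightarrow> s > 0 \<Longrightarrow>
   \<forall>\<^sub>F N in sequentially. ((\<Sum>z\<in>P. cfun (s / norm (a z))) - e) * ln (real N) \<le> real (n s (jump_operator a Z N))"
 shows "\<forall>\<^sub>F N in sequentially. ((\<Sum>z\<in>P. level t z) - e) * ln (real N) \<le> real (n t (A N))"
proof -
 define F where "F = (\<Sum>z\<in>P. level t z)"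
 have "\<forall>\<^sub>F \<delta> in at_right 0. (\<Sum>z\<in>P. cfun ((t + (1 + C) * \<delta>) / (norm (\<kappa> z) + (- 1) * \<delta>))) > F - e / 4"
  by (rule order_tendstoD(1)[OF perturbed_sum_tendsto[OF t P]]) (use e in \<open>simp add: F_def\<close>)
 moreover have "\<forall>\<^sub>F \<delta> in at_right 0. \<delta> < t / 4"
  by (rule order_tendstoD(2)[OF tendsto_ident_at]) (use t in simp)
 moreover have "\<forall>\<^sub>F \<delta> in at_right (0::real). \<delta> > 0" by (rule eventually_at_right_less)
 ultimately have "\<forall>\<^sub>F \<delta> in at_right 0. (\<Sum>z\<in>P. cfun ((t + (1 + C) * \<delta>) / (norm (\<kappa> z) + (- 1) * \<delta>))) > F - e / 4 \<and> \<delta> < t / 4 \<and> \<delta> > 0"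
  by eventually_elim simp
 from eventually_happens'[OF trivial_limit_at_right_real this] obtain \<delta> where \<delta>: "(\<Sum>z\<in>P. cfun ((t + (1 + C) * \<delta>) / (norm (\<kappa> z) + (- 1) * \<delta>))) > F - e / 4" "\<delta> < t / 4" "\<delta> > 0"
  by blast
 obtain Z a where ap: "approximant \<delta> Z a" using approximant_exists[OF \<delta>(3)] by blast
 note Z = approximantD[OF ap]
 \<comment> \<open>The level is shifted by \<delta> for the Hilbert--Schmidt part of the
   perturbation and by \<open>C * \<delta>\<close> for its norm part.\<close>
 define s where "s = t + \<delta> + C * \<delta>"
 have s: "s > 0" using t \<delta> C by (auto simp: s_def intro!: add_pos_nonneg)
 have e4: "e / 4 > 0" using e by simp
 \<comment> \<open>The perturbation bound divides the Hilbert--Schmidt budget by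
   \<open>\<delta>^2\<close>, so this coefficient costs \<open>e / 4\<close> per unit of
   \<open>ln N\<close>.\<close>
 have ed: "e / 4 * \<delta>^2 > 0" using e \<delta> by simp
 obtain K where K: "\<forall>N\<ge>1. \<exists>E. hs_bound E (e / 4 * \<delta>^2 * ln (real N) + K) \<and>
    (\<forall>x. close_via E \<delta> a Z N x)"
  using Z(5)[OF ed] by blast
 have sum: "F - e / 4 \<le> (\<Sum>z\<in>P. cfun (s / norm (a z)))"
 proof -
  have "(\<Sum>z\<in>P. cfun ((t + (1 + C) * \<delta>) / (norm (\<kappa> z) + (- 1) * \<delta>))) \<le> (\<Sum>z\<in>P. cfun (s / norm (a z)))"
  proof (rule sum_mono)
   fix z assume "z \<in> P"
   then have zJ: "z \<in> J t" using P by blast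
   note b = J_lower[OF t less_imp_le[OF \<delta>(2)] Z(3) zJ]
   have "s / norm (a z) \<le> s / (norm (\<kappa> z) - \<delta>)" using s b by (intro divide_left_mono mult_pos_pos) auto
   moreover have "s / norm (a z) > 0" using s b by (intro divide_pos_pos) linarith+
   ultimately have "cfun (s / (norm (\<kappa> z) - \<delta>)) \<le> cfun (s / norm (a z))" by (intro cfun_antimono)
   then show "cfun ((t + (1 + C) * \<delta>) / (norm (\<kappa> z) + (- 1) * \<delta>)) \<le> cfun (s / norm (a z))"
    by (simp add: s_def algebra_simps)
  qed
  then show ?thesis using \<delta>(1) by linarith
 qed
 have lowH: "\<forall>\<^sub>F N in sequentially. ((\<Sum>z\<in>P. cfun (s / norm (a z))) - e / 4) * ln (real N) \<le> real (n s (jump_operator a Z N))"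
  by (rule low[OF Z(1,4,2,3) less_imp_le[OF \<delta>(2)] e4 s])
 show ?thesis using lowH eventually_small_constant[OF e4, of "K / \<delta>^2"]
 proof eventually_elim
  case (elim N)
  then obtain E where E: "hs_bound E (e / 4 * \<delta>^2 * ln (real N) + K)"
   "\<And>x. close_via E \<delta> a Z N x"
   using K by blast
  have N: "N \<ge> 1" "K / \<delta>^2 \<le> e / 4 * ln (real N)" using elim(2) by auto
  have l0: "ln (real N) \<ge> 0" using N by simp
  have "(F - e / 4 - e / 4) * ln (real N) \<le> ((\<Sum>z\<in>P. cfun (s / norm (a z))) - e / 4) * ln (real N)"
   using sum l0 by (intro mult_right_mono) auto
  also have "\<dots> \<le> real (n s (jump_operator a Z N))" by (rule elim(1))
  also have "\<dots> \<le> real (n t (A N)) + (e / 4 * \<delta>^2 * ln (real N) + K) / \<delta>^2"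
   unfolding s_def by (rule pert[OF Z(1) Z(4) E(1) \<delta>(3) N(1) E(2)])
  also have "(e / 4 * \<delta>^2 * ln (real N) + K) / \<delta>^2 = e / 4 * ln (real N) + K / \<delta>^2" using \<delta>(3) by (simp add: add_divide_distrib)
  also have "\<dots> \<le> e / 4 * ln (real N) + e / 4 * ln (real N)" using N(2) by linarith
  finally show ?case by (simp add: F_def algebra_simps)
 qed
qed

lemma n_sing_lower:
 assumes t: "t > 0" and e: "e > 0"
 shows "\<forall>\<^sub>F N in sequentially. ((\<Sum>z\<in>J t. level t z) - e) * ln (real N) \<le> real (n_sing t (A N))"
proof (rule lower_transfer[OF t e order_refl])
 fix Z :: "complex set" and a N E S \<delta>
 assume a: "hs_bound E S" "\<delta> > 0" "N \<ge> 1"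
  "\<And>x. close_via E \<delta> a Z N x"
 show "real (n_sing (t + \<delta> + C * \<delta>) (jump_operator a Z N)) \<le> real (n_sing t (A N)) + S / \<delta>^2"
  by (rule n_sing_perturb[OF compact[OF a(3)] jump_section_compact _ a(1,2) t])
   (use a C in \<open>auto simp: norm_minus_commute[of "jump_operator a Z N _"]\<close>)
next
 fix Z :: "complex set" and a and e s \<delta> :: real
 assume Z: "jump_data Z" "\<And>z. z \<notin> Z \<Longrightarrow> a z = 0" "\<And>z. norm z = 1 \<Longrightarrow> norm (a z - \<kappa> z) \<le> \<delta>" "\<delta> \<le> t / 4" "e > 0" "s > 0"
 have sub: "J t \<subseteq> Z"
 proof
  fix z assume "z \<in> J t"
  then have "norm (a z) > 0" using J_lower[OF t Z(4) Z(3)] by (meson less_le_trans)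
  then show "z \<in> Z" using Z(2)[of z] by auto
 qed
 have "(\<Sum>z\<in>J t. cfun (s / norm (a z))) \<le> (\<Sum>z\<in>Z. cfun (s / norm (a z)))"
  by (rule sum_mono2[OF jump_data.fin[OF Z(1)] sub]) (rule cfun_nonneg)
 then show "\<forall>\<^sub>F N in sequentially. ((\<Sum>z\<in>J t. cfun (s / norm (a z))) - e) * ln (real N) \<le> real (n_sing s (jump_operator a Z N))"
  by (rule eventually_ln_weaken[OF _ jump_data.n_sing_lower[OF Z(1) Z(6) Z(5)]])
qed

lemma n_plus_lower:
 assumes t: "t > 0" and e: "e > 0" and symm
 shows "\<forall>\<^sub>F N in sequentially. ((\<Sum>z\<in>Jplus t. level t z) - e) * ln (real N) \<le> real (n_plus t (A N))"
proof (rule lower_transfer[OF t e])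
 let ?P = "Jplus t"
 {
  fix Z :: "complex set" and a N E S \<delta>
  assume a: "hs_bound E S" "\<delta> > 0" "N \<ge> 1"
   "\<And>x. close_via E \<delta> a Z N x"
   and Z: "jump_data Z" and asym: "\<And>z. symm \<Longrightarrow> a (cnj z) = cnj (a z)"
  have "compact_self_adjoint (A N)" by unfold_locales (intro compact a(3) symA \<open>symm\<close>)+
  moreover have "compact_self_adjoint (jump_operator a Z N)"
   by unfold_locales (rule jump_section_compact, rule jump_data.jump_section_self_adjoint[OF Z], rule asym[OF \<open>symm\<close>])
  ultimately show "real (n_plus (t + \<delta> + C * \<delta>) (jump_operator a Z N)) \<le> real (n_plus t (A N)) + S / \<delta>^2"
   by (rule n_plus_perturb[OF _ _ _ a(1,2) t])
    (use a C in \<open>auto simp: norm_minus_commute[of "jump_operator a Z N _"]\<close>)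
 next
  fix Z :: "complex set" and a and e s \<delta> :: real
  assume Z: "jump_data Z" "\<And>z. z \<notin> Z \<Longrightarrow> a z = 0" "\<And>z. norm z = 1 \<Longrightarrow> norm (a z - \<kappa> z) \<le> \<delta>" "\<delta> \<le> t / 4" "e > 0" "s > 0"
   and asym: "\<And>z. symm \<Longrightarrow> a (cnj z) = cnj (a z)"
  define Q where "Q = {z\<in>Z. Im z > 0 \<or> (Im z = 0 \<and> Re (a z) > 0)}"
  have sub: "?P \<subseteq> Q"
  proof
   fix z assume z: "z \<in> ?P"
   then have zJ: "z \<in> J t" by simp
   note b = J_lower[OF t Z(4) Z(3) zJ]
   have zZ: "z \<in> Z" using Z(2)[of z] b by (cases "z \<in> Z") auto
   \<comment> \<open>At a real point \<kappa> is real by symmetry, with modulus larger than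
     \<delta>, so the approximating weight keeps its sign.\<close>
   have "Re (a z) > 0" if im: "Im z = 0"
   proof -
    have "cnj z = z" using im by (simp add: complex_eq_iff)
    then have "cnj (\<kappa> z) = \<kappa> z" using sym\<kappa>[OF \<open>symm\<close>, of z] zJ by (simp add: J_def)
    then have "Im (\<kappa> z) = 0" by (simp add: complex_eq_iff)
    then have "Re (\<kappa> z) = norm (\<kappa> z)" using z im by (simp add: cmod_eq_Re)
    moreover have "\<bar>Re (a z) - Re (\<kappa> z)\<bar> \<le> \<delta>"
     using order_trans[OF abs_Re_le_cmod[of "a z - \<kappa> z"] Z(3)[of z]] zJ by (simp add: J_def)
    ultimately show ?thesis using b(1) by linarith
   qed
   then show "z \<in> Q" using z zZ by (auto simp: Q_def)
  qed
  have fQ: "finite Q" using jump_data.fin[OF Z(1)] by (simp add: Q_def)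
  have "(\<Sum>z\<in>?P. cfun (s / norm (a z))) \<le> (\<Sum>z\<in>Q. cfun (s / norm (a z)))"
   by (rule sum_mono2[OF fQ sub]) (rule cfun_nonneg)
  moreover have "\<forall>\<^sub>F N in sequentially. ((\<Sum>z\<in>Q. cfun (s / norm (a z))) - e) * ln (real N) \<le> real (n_plus s (jump_operator a Z N))"
   unfolding Q_def
   by (rule jump_data.n_plus_lower[OF Z(1) Z(6) Z(5)])
    (rule asym[OF \<open>symm\<close>], rule jump_data.jump_section_self_adjoint[OF Z(1)], rule asym[OF \<open>symm\<close>])
  ultimately show "\<forall>\<^sub>F N in sequentially. ((\<Sum>z\<in>?P. cfun (s / norm (a z))) - e) * ln (real N) \<le> real (n_plus s (jump_operator a Z N))"
   by (rule eventually_ln_weaken)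
 }
qed auto

lemma n_sing_upper:
 assumes t: "t > 0" and e: "e > 0"
 shows "\<forall>\<^sub>F N in sequentially. real (n_sing t (A N)) \<le> ((\<Sum>z\<in>J t. level t z) + e) * ln (real N)"
proof -
 define F where "F = (\<Sum>z\<in>J t. level t z)"
 \<comment> \<open>For \<delta> below this value the lowered level
   \<open>t - (1 + C) * \<delta>\<close> stays above \<open>3 * t / 4\<close>, inside the margin of
   \<open>J t\<close>.\<close>
 define r where "r = t / 4 / (1 + C)"
 have r: "r > 0" using t C by (simp add: r_def)
 have "\<forall>\<^sub>F \<delta> in at_right 0. (\<Sum>z\<in>J t. cfun ((t + (- (1 + C)) * \<delta>) / (norm (\<kappa> z) + 1 * \<delta>))) < F + e / 4"
  by (rule order_tendstoD(2)[OF perturbed_sum_tendsto[OF t order_refl]]) (use e in \<open>simp add: F_def\<close>)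
 moreover have "\<forall>\<^sub>F \<delta> in at_right 0. \<delta> < min (t / 4) r"
  by (rule order_tendstoD(2)[OF tendsto_ident_at]) (use t r in simp)
 moreover have "\<forall>\<^sub>F \<delta> in at_right (0::real). \<delta> > 0" by (rule eventually_at_right_less)
 ultimately have "\<forall>\<^sub>F \<delta> in at_right 0. (\<Sum>z\<in>J t. cfun ((t + (- (1 + C)) * \<delta>) / (norm (\<kappa> z) + 1 * \<delta>))) < F + e / 4 \<and> \<delta> < min (t / 4) r \<and> \<delta> > 0"
  by eventually_elim simp
 from eventually_happens'[OF trivial_limit_at_right_real this] obtain \<delta> where \<delta>: "(\<Sum>z\<in>J t. cfun ((t + (- (1 + C)) * \<delta>) / (norm (\<kappa> z) + 1 * \<delta>))) < F + e / 4" "\<delta> < min (t / 4) r" "\<delta> > 0"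
  by blast
 have \<delta>t: "\<delta> \<le> t / 4" using \<delta>(2) by simp
 have \<delta>r: "(1 + C) * \<delta> \<le> t / 4"
 proof -
  have "(1 + C) * \<delta> \<le> (1 + C) * r" using \<delta>(2) C by (intro mult_left_mono) auto
  also have "(1 + C) * r = t / 4"
  proof -
   have "1 + C \<noteq> 0" using C by linarith
   then have "(1 + C) * (x / (1 + C)) = x" for x by simp
   then show ?thesis unfolding r_def .
  qed
  finally show ?thesis .
 qed
 obtain Z a where ap: "approximant \<delta> Z a" using approximant_exists[OF \<delta>(3)] by blast
 note Z = approximantD[OF ap]
 define s where "s = t - (1 + C) * \<delta>"
 have s: "s \<ge> 3 * t / 4" "s > 0" using t \<delta>r by (auto simp: s_def)
 have st: "s + \<delta> + C * \<delta> = t" by (simp add: s_def algebra_simps)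
 have e4: "e / 4 > 0" using e by simp
 have ed: "e / 4 * \<delta>^2 > 0" using e \<delta> by simp
 obtain K where K: "\<forall>N\<ge>1. \<exists>E. hs_bound E (e / 4 * \<delta>^2 * ln (real N) + K) \<and>
    (\<forall>x. close_via E \<delta> a Z N x)"
  using Z(5)[OF ed] by blast
 have sum: "(\<Sum>z\<in>Z. cfun (s / norm (a z))) \<le> F + e / 4"
 proof -
  have tri: "norm (a z) \<le> norm (\<kappa> z) + \<delta>" if "norm z = 1" for z
   using Z(3)[OF that] norm_triangle_sub[of "a z" "\<kappa> z"] by linarith
  have "(\<Sum>z\<in>Z. cfun (s / norm (a z))) = (\<Sum>z\<in>Z \<inter> J t. cfun (s / norm (a z)))"
  proof (rule sum.mono_neutral_right[OF jump_data.fin[OF Z(1)]], simp, intro ballI)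
   fix z assume z: "z \<in> Z - Z \<inter> J t"
   then have z1: "norm z = 1" using jump_data.unit[OF Z(1)] by auto
   then have "norm (\<kappa> z) < t / 2" using z by (auto simp: J_def)
   then have le: "norm (a z) \<le> s" using tri[OF z1] \<delta>t s by linarith
   show "cfun (s / norm (a z)) = 0"
   proof (cases "a z = 0")
    case True
    then show ?thesis by (simp add: cfun_def)
   next
    case False
    then show ?thesis using le by (intro cfun_eq_0) simp
   qed
  qed
  also have "\<dots> \<le> (\<Sum>z\<in>Z \<inter> J t. cfun ((t + (- (1 + C)) * \<delta>) / (norm (\<kappa> z) + 1 * \<delta>)))"
  proof (rule sum_mono)
   fix z assume z: "z \<in> Z \<inter> J t"
   then have zJ: "z \<in> J t" by simp
   note b = J_lower[OF t \<delta>t Z(3) zJ]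
   have z1: "norm z = 1" using zJ by (simp add: J_def)
   have "s / (norm (\<kappa> z) + \<delta>) \<le> s / norm (a z)" using s b tri[OF z1] \<delta>(3) by (intro divide_left_mono mult_pos_pos) auto
   moreover have "s / (norm (\<kappa> z) + \<delta>) > 0" using s \<delta>(3) by (intro divide_pos_pos add_nonneg_pos) auto
   ultimately have "cfun (s / norm (a z)) \<le> cfun (s / (norm (\<kappa> z) + \<delta>))" by (intro cfun_antimono)
   then show "cfun (s / norm (a z)) \<le> cfun ((t + (- (1 + C)) * \<delta>) / (norm (\<kappa> z) + 1 * \<delta>))"
    by (simp add: s_def algebra_simps)
  qed
  also have "\<dots> \<le> (\<Sum>z\<in>J t. cfun ((t + (- (1 + C)) * \<delta>) / (norm (\<kappa> z) + 1 * \<delta>)))"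
   by (rule sum_mono2[OF finite_J[OF t]]) (auto intro: cfun_nonneg)
  finally show ?thesis using \<delta>(1) by linarith
 qed
 show ?thesis using jump_data.n_sing_upper[OF Z(1) s(2) e4, of a] eventually_small_constant[OF e4, of "K / \<delta>^2"]
 proof eventually_elim
  case (elim N)
  then obtain E where E: "hs_bound E (e / 4 * \<delta>^2 * ln (real N) + K)"
   "\<And>x. close_via E \<delta> a Z N x"
   using K by blast
  have N: "N \<ge> 1" "K / \<delta>^2 \<le> e / 4 * ln (real N)" using elim(2) by auto
  have l0: "ln (real N) \<ge> 0" using N by simp
  have "real (n_sing (s + \<delta> + C * \<delta>) (A N)) \<le> real (n_sing s (jump_operator a Z N)) + (e / 4 * \<delta>^2 * ln (real N) + K) / \<delta>^2"
   by (rule n_sing_perturb[OF jump_section_compact compact[OF N(1)] E(2,1) \<delta>(3) s(2)]) (use C \<delta> in auto)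
  also have "(e / 4 * \<delta>^2 * ln (real N) + K) / \<delta>^2 = e / 4 * ln (real N) + K / \<delta>^2" using \<delta>(3) by (simp add: add_divide_distrib)
  also have "\<dots> \<le> e / 4 * ln (real N) + e / 4 * ln (real N)" using N(2) by linarith
  also have "real (n_sing s (jump_operator a Z N)) \<le> ((\<Sum>z\<in>Z. cfun (s / norm (a z))) + e / 4) * ln (real N)" by (rule elim(1))
  also have "\<dots> \<le> (F + e / 4 + e / 4) * ln (real N)" using sum l0 by (intro mult_right_mono) auto
  finally show ?case unfolding st by (simp add: F_def algebra_simps)
 qed
qed

lemma n_sing_limit:
 assumes t: "t > 0"
 shows "(\<lambda>N. real (n_sing t (A N)) / ln (real N)) \<longlonglongrightarrow> (\<Sum>z\<in>J t. level t z)"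
 by (rule tendsto_ratio_ln) (intro n_sing_lower n_sing_upper t, assumption)+

text \<open>All hypotheses are invariant under a change of sign, so the lower bound for
  \<open>n_minus\<close> is the one for \<open>n_plus\<close> of the negated family.\<close>

lemma negated: "jump_approximation (\<lambda>z. - \<kappa> z) (\<lambda>N x. - A N x) C symm"
proof
 show "C \<ge> 0" by (rule C)
 show "bounded_clinear (\<lambda>x. - A N x)" if "N \<ge> 1" for N by (rule bounded_clinear_minus[OF bcA[OF that]])
 show "self_adjoint (\<lambda>x. - A N x)" if "symm" "N \<ge> 1" for N using symA[OF that] by (simp add: self_adjoint_def)
 show "- \<kappa> (cnj z) = cnj (- \<kappa> z)" if "symm" "norm z = 1" for z using sym\<kappa>[OF that] by simp
 fix \<delta> :: real assume \<delta>: "\<delta> > 0"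
 obtain Z a where Z: "jump_data Z" "\<forall>z. z \<notin> Z \<longrightarrow> a z = 0" "\<forall>z. norm z = 1 \<longrightarrow> norm (a z - \<kappa> z) \<le> \<delta>"
  "symm \<longrightarrow> (\<forall>z. a (cnj z) = cnj (a z))" and ap: "jump_close (C * \<delta>) A Z a"
  using approx[OF \<delta>] by blast
 have neg: "matrix_operator (\<lambda>j k. - E j k) x = - matrix_operator E x" if "bounded_matrix E" for E x
 proof -
  have "- 1 *\<^sub>C y = - y" for y by (rule ell2_eqI) (simp add: scaleC.rep_eq uminus_ell2.rep_eq)
  then show ?thesis using matrix_operator_scale(2)[OF that, of "- 1"] by (simp add: fun_eq_iff)
 qed
 have js: "jump_section (\<lambda>z. - a z) Z N = (\<lambda>j k. - jump_section a Z N j k)" for N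
  by (auto simp: jump_section_def fun_eq_iff sum_negf)
 have tr: "\<exists>E'. hs_bound E' S \<and> (\<forall>x. norm (- A N x - jump_operator (\<lambda>z. - a z) Z N x - matrix_operator E' x) \<le> C * \<delta> * norm x)"
  if E: "hs_bound E S" "\<forall>x. norm (A N x - jump_operator a Z N x - matrix_operator E x) \<le> C * \<delta> * norm x" for N E S
 proof (intro exI conjI allI)
  show "hs_bound (\<lambda>j k. - E j k) S" using E(1) by (simp add: hs_bound_def)
  fix x
  have "- u - (- v) - (- w) = - (u - v - w)" for u v w :: ell2 by simp
  then show "norm (- A N x - jump_operator (\<lambda>z. - a z) Z N x - matrix_operator (\<lambda>j k. - E j k) x) \<le> C * \<delta> * norm x"
   unfolding js neg[OF jump_section_bounded] neg[OF hs_bounded_matrix[OF E(1)]] using E(2) by (simp only: norm_minus_cancel)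
 qed
 show "\<exists>Z a. jump_data Z \<and> (\<forall>z. z \<notin> Z \<longrightarrow> a z = 0) \<and>
   (\<forall>z. norm z = 1 \<longrightarrow> norm (a z - - \<kappa> z) \<le> \<delta>) \<and> (symm \<longrightarrow> (\<forall>z. a (cnj z) = cnj (a z))) \<and>
   (jump_close (C * \<delta>) (\<lambda>N x. - A N x) Z a)"
 proof (intro exI[of _ Z] exI[of _ "\<lambda>z. - a z"] conjI)
  show "\<forall>z. norm z = 1 \<longrightarrow> norm (- a z - - \<kappa> z) \<le> \<delta>" using Z(3) by (simp add: norm_minus_commute)
  show "jump_close (C * \<delta>) (\<lambda>N x. - A N x) Z (\<lambda>z. - a z)"
   using ap tr by meson
 qed (use Z in auto)
qed

lemma n_minus_lower:
 assumes t: "t > 0" and e: "e > 0" and symm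
 shows "\<forall>\<^sub>F N in sequentially. ((\<Sum>z\<in>Jminus t. level t z) - e) * ln (real N) \<le> real (n_minus t (A N))"
 using jump_approximation.n_plus_lower[OF negated t e \<open>symm\<close>]
 by (simp add: n_minus_def J_def jump_approximation.J_def[OF negated])

text \<open>Conjugation carries the points of the lower half plane to the upper one without changing
  the modulus of \<kappa>, so each nonreal pair serves both signs once. At a real point of
  \<open>J t\<close> the value of \<kappa> is real and nonzero and serves one sign.\<close>

lemma J_sum_split:
 assumes t: "t > 0" and symm
 shows "(\<Sum>z\<in>J t. level t z) =
  (\<Sum>z\<in>Jplus t. level t z) +
  (\<Sum>z\<in>Jminus t. level t z)"
proof -
 let ?f = "\<lambda>z. level t z"
 let ?M = "{z\<in>J t. Im z < 0 \<or> (Im z = 0 \<and> Re (\<kappa> z) < 0)}"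
 have cJ: "cnj z \<in> J t \<longleftrightarrow> z \<in> J t" for z using sym\<kappa>[OF \<open>symm\<close>, of z] by (auto simp: J_def)
 have reJ: "Re (\<kappa> z) \<noteq> 0" if z: "z \<in> J t" "Im z = 0" for z
 proof -
  have "cnj z = z" using z by (simp add: complex_eq_iff)
  then have "cnj (\<kappa> z) = \<kappa> z" using sym\<kappa>[OF \<open>symm\<close>, of z] z by (simp add: J_def)
  then have "Im (\<kappa> z) = 0" by (simp add: complex_eq_iff)
  moreover have "\<kappa> z \<noteq> 0" using z t by (auto simp: J_def)
  ultimately show ?thesis by (auto simp: complex_eq_iff)
 qed
 have eq: "J t = Jplus t \<union> ?M"
  using reJ by fastforce
 have "(\<Sum>z\<in>J t. ?f z) = (\<Sum>z\<in>Jplus t. ?f z) + (\<Sum>z\<in>?M. ?f z)"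
  by (subst eq, rule sum.union_disjoint) (use finite_J[OF t] in auto)
 also have "(\<Sum>z\<in>?M. ?f z) = (\<Sum>z\<in>Jminus t. ?f z)"
 proof (rule sum.reindex_bij_witness[where i=cnj and j=cnj])
  show "?f (cnj z) = ?f z" if "z \<in> ?M" for z using that sym\<kappa>[OF \<open>symm\<close>, of z] by (simp add: J_def)
 qed (use cJ sym\<kappa>[OF \<open>symm\<close>] in \<open>auto simp: J_def\<close>)
 finally show ?thesis .
qed

lemma n_plus_minus_limit:
 assumes t: "t > 0" and symm
 shows "(\<lambda>N. real (n_plus t (A N)) / ln (real N)) \<longlonglongrightarrow>
   (\<Sum>z\<in>Jplus t. level t z)"
  "(\<lambda>N. real (n_minus t (A N)) / ln (real N)) \<longlonglongrightarrow>
   (\<Sum>z\<in>Jminus t. level t z)"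
proof -
 define P where "P = (\<Sum>z\<in>Jplus t. level t z)"
 define M where "M = (\<Sum>z\<in>Jminus t. level t z)"
 note split = J_sum_split[OF t \<open>symm\<close>, folded P_def M_def]
 note plus = n_plus_lower[OF t _ \<open>symm\<close>, folded P_def] and minus = n_minus_lower[OF t _ \<open>symm\<close>, folded M_def]
 have sing: "\<forall>\<^sub>F N in sequentially. real (n_plus t (A N)) + real (n_minus t (A N)) \<le> (P + M + e) * ln (real N)" if e: "e > 0" for e
  using n_sing_upper[OF t e, unfolded split] eventually_ge_at_top[of 1]
 proof eventually_elim
  case (elim N)
  have "n_plus t (A N) + n_minus t (A N) \<le> n_sing t (A N)"
   by (rule n_plus_add_n_minus_le_n_sing[OF compact symA t]) (use elim \<open>symm\<close> in auto)
  then have "real (n_plus t (A N)) + real (n_minus t (A N)) \<le> real (n_sing t (A N))" by simp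
  then show ?case using elim by linarith
 qed
 have half: "\<forall>\<^sub>F N in sequentially. real (n_plus t (A N)) \<le> (P + e) * ln (real N)"
  "\<forall>\<^sub>F N in sequentially. real (n_minus t (A N)) \<le> (M + e) * ln (real N)" if e: "e > 0" for e
 proof -
  have e2: "e / 2 > 0" using e by simp
  show "\<forall>\<^sub>F N in sequentially. real (n_plus t (A N)) \<le> (P + e) * ln (real N)"
   using sing[OF e2] minus[OF e2] by eventually_elim (simp add: algebra_simps)
  show "\<forall>\<^sub>F N in sequentially. real (n_minus t (A N)) \<le> (M + e) * ln (real N)"
   using sing[OF e2] plus[OF e2] by eventually_elim (simp add: algebra_simps)
 qed
 show "(\<lambda>N. real (n_plus t (A N)) / ln (real N)) \<longlonglongrightarrow> (\<Sum>z\<in>Jplus t. level t z)"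
  unfolding P_def[symmetric] by (rule tendsto_ratio_ln) (erule plus, erule half)
 show "(\<lambda>N. real (n_minus t (A N)) / ln (real N)) \<longlonglongrightarrow> (\<Sum>z\<in>Jminus t. level t z)"
  unfolding M_def[symmetric] by (rule tendsto_ratio_ln) (erule minus, erule half)
qed

text \<open>All but finitely many terms vanish, since outside \<open>J t\<close> the argument of
  \<open>cfun\<close> exceeds 1 or is 0 by division by zero.\<close>

lemma infsum_eq_J:
 assumes t: "t > 0" and S: "S \<subseteq> {z. norm z = 1}" and J: "J t \<inter> Q \<subseteq> S" and SQ: "S \<subseteq> Q"
 shows "(\<Sum>\<^sub>\<infinity>z\<in>S. cfun (t * inverse (norm (\<kappa> z)))) = (\<Sum>z\<in>J t \<inter> Q. level t z)"
proof -
 have "(\<Sum>\<^sub>\<infinity>z\<in>S. cfun (t * inverse (norm (\<kappa> z)))) = (\<Sum>\<^sub>\<infinity>z\<in>J t \<inter> Q. level t z)"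
 proof (rule infsum_cong_neutral)
  show "cfun (t * inverse (norm (\<kappa> z))) = 0" if "z \<in> S - J t \<inter> Q" for z
   using cfun_off_J[OF t, of z] that S SQ by (auto simp: divide_inverse)
 qed (use J in \<open>auto simp: divide_inverse\<close>)
 then show ?thesis using finite_J[OF t] by simp
qed

text \<open>The only real points of the circle are 1 and -1; \<open>B\<close> stands for the
  half-line of the sign under consideration.\<close>

lemma signed_sum_eq:
 assumes t: "t > 0" and S: "S = {z. norm z = 1 \<and> \<kappa> z \<noteq> 0 \<and> Im z > 0}"
 shows "(\<Sum>z\<in>{z\<in>J t. Im z > 0 \<or> (Im z = 0 \<and> Re (\<kappa> z) \<in> B)}. level t z) =
  (\<Sum>\<^sub>\<infinity>z\<in>S. cfun (t * inverse (norm (\<kappa> z))))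
   + cfun (t * inverse (norm (\<kappa> 1))) * indicator B (Re (\<kappa> 1))
   + cfun (t * inverse (norm (\<kappa> (- 1)))) * indicator B (Re (\<kappa> (- 1)))"
proof -
 let ?f = "\<lambda>z. level t z"
 let ?T = "\<lambda>w. {z \<in> J t. z = w \<and> Re (\<kappa> z) \<in> B}"
 have pm: "z = 1 \<or> z = - 1" if "norm z = 1" "Im z = 0" for z :: complex
 proof -
  have "\<bar>Re z\<bar> = 1" using that by (simp add: cmod_eq_Re)
  then show ?thesis using that by (auto simp: complex_eq_iff)
 qed
 have eq: "{z\<in>J t. Im z > 0 \<or> (Im z = 0 \<and> Re (\<kappa> z) \<in> B)} = (J t \<inter> {z. Im z > 0}) \<union> (?T 1 \<union> ?T (- 1))"
 proof (intro set_eqI iffI)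
  fix z assume z: "z \<in> {z\<in>J t. Im z > 0 \<or> (Im z = 0 \<and> Re (\<kappa> z) \<in> B)}"
  then have "norm z = 1" by (simp add: J_def)
  then show "z \<in> (J t \<inter> {z. Im z > 0}) \<union> (?T 1 \<union> ?T (- 1))" using z pm[of z] by blast
 next
  fix z assume "z \<in> (J t \<inter> {z. Im z > 0}) \<union> (?T 1 \<union> ?T (- 1))"
  then show "z \<in> {z\<in>J t. Im z > 0 \<or> (Im z = 0 \<and> Re (\<kappa> z) \<in> B)}" by auto
 qed
 have fin: "finite (J t \<inter> X)" "finite {z \<in> J t. R z}" for X R using finite_J[OF t] by auto
 have single: "(\<Sum>z\<in>?T w. ?f z) = cfun (t * inverse (norm (\<kappa> w))) * indicator B (Re (\<kappa> w))" if w: "norm w = 1" for w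
 proof (cases "w \<in> J t \<and> Re (\<kappa> w) \<in> B")
  case True
  then have "?T w = {w}" by auto
  then show ?thesis using True by (simp add: divide_inverse)
 next
  case False
  then have "?T w = {}" by auto
  moreover have "cfun (t * inverse (norm (\<kappa> w))) * indicator B (Re (\<kappa> w)) = 0"
   using False cfun_off_J[OF t w] by (auto simp: divide_inverse)
  ultimately show ?thesis by (simp only: sum.empty)
 qed
 have "(\<Sum>z\<in>{z\<in>J t. Im z > 0 \<or> (Im z = 0 \<and> Re (\<kappa> z) \<in> B)}. ?f z) = (\<Sum>z\<in>J t \<inter> {z. Im z > 0}. ?f z) + (\<Sum>z\<in>?T 1 \<union> ?T (- 1). ?f z)"
  unfolding eq by (rule sum.union_disjoint) (use fin in auto)
 also have "(\<Sum>z\<in>?T 1 \<union> ?T (- 1). ?f z) = (\<Sum>z\<in>?T 1. ?f z) + (\<Sum>z\<in>?T (- 1). ?f z)"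
  by (rule sum.union_disjoint) (use fin in auto)
 also have "(\<Sum>z\<in>J t \<inter> {z. Im z > 0}. ?f z) = (\<Sum>\<^sub>\<infinity>z\<in>S. cfun (t * inverse (norm (\<kappa> z))))"
  by (rule infsum_eq_J[OF t, symmetric]) (use t in \<open>auto simp: S J_def\<close>)
 finally show ?thesis using single[of 1] single[of "- 1"] by simp
qed

end

section \<open>Multiplied Hankel matrices\<close>

text \<open>Condition (A) speaks of Hankel matrices of norm exactly 1. Dividing the symbol by the
  actual operator norm, which is at most \<open>M\<close>, extends it by homogeneity; finiteness of
  \<open>matrix_norm\<close> also shows that the product is bounded at all.\<close>

lemma multiplier_hankel_bound:
 assumes AH: "cond_AH \<tau>"
 shows "\<exists>C\<ge>0. \<forall>N\<ge>1. \<forall>\<phi> M. bounded_symbol \<phi> \<longrightarrow> section_bound (\<lambda>j k. fourier_coeff \<phi> (int j + int k)) M \<longrightarrow>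
  bounded_matrix (\<lambda>j k. dilate \<tau> N j k * fourier_coeff \<phi> (int j + int k)) \<and>
  (\<forall>x. norm (matrix_operator (\<lambda>j k. dilate \<tau> N j k * fourier_coeff \<phi> (int j + int k)) x) \<le> C * M * norm x)"
proof -
 define S where "S = (SUP N\<in>{1::nat..}. SUP \<phi>\<in>{\<phi>. ess_bounded \<phi> \<and> onorm (hankel (fourier_coeff \<phi>)) = 1}.
    matrix_norm (schur_matrix (dilate \<tau> N) (hankel (fourier_coeff \<phi>))))"
 have "S < \<infinity>" using AH unfolding cond_AH_def S_def .
 then obtain C where C: "C \<ge> 0" "S = ennreal C" by (cases S) auto
 show ?thesis
 proof (intro exI[of _ C] conjI C allI impI)
  fix N :: nat and \<phi> :: "complex \<Rightarrow> complex" and M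
  assume N: "1 \<le> N" and \<phi>: "bounded_symbol \<phi>" and sb: "section_bound (\<lambda>j k. fourier_coeff \<phi> (int j + int k)) M"
  define a where "a j k = fourier_coeff \<phi> (int j + int k)" for j k
  define H where "H = matrix_operator a"
  have sba: "section_bound a M" unfolding a_def by (rule sb)
  have sbH: "norm (H x) \<le> M * norm x" for x unfolding H_def by (rule section_boundD(2)[OF sba])
  have bma: "bounded_matrix a" by (rule section_boundD(1)[OF sba])
  have H: "bounded_clinear H" "entry H = a" using bounded_matrixD[OF bma] by (simp_all add: H_def)
  have blH: "bounded_linear H" using H(1) by (simp add: bounded_clinear_def)
  define c where "c = onorm H"
  have cM: "c \<le> M" unfolding c_def by (rule onorm_bound) (use sbH sb in \<open>auto simp: section_bound_def\<close>)
  have c0: "c \<ge> 0" unfolding c_def by (rule onorm_pos_le[OF blH])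
  have "bounded_matrix (\<lambda>j k. dilate \<tau> N j k * a j k) \<and>
   (\<forall>x. norm (matrix_operator (\<lambda>j k. dilate \<tau> N j k * a j k) x) \<le> C * M * norm x)"
  \<comment> \<open>The zero operator cannot be normalized, but then all its entries vanish.\<close>
  proof (cases "c = 0")
   case True
   have "H x = 0" for x using onorm_eq_0[OF blH] True by (simp add: c_def)
   then have "entry H j k = 0" for j k by (simp add: entry_def)
   then have a0: "a j k = 0" for j k using H(2) by simp
   have "section_bound (\<lambda>j k. dilate \<tau> N j k * a j k) 0" by (simp add: a0 section_bound_def)
   from section_boundD[OF this] show ?thesis using C(1) cM c0 by (auto intro: order_trans)
  next
   case False
   then have cp: "c > 0" using c0 by simp
   define r where "r = complex_of_real (1 / c)"
   define \<psi> where "\<psi> = (\<lambda>z. r * \<phi> z)"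
   have fc: "fourier_coeff \<psi> = (\<lambda>j. r * fourier_coeff \<phi> j)" by (simp add: \<psi>_def fun_eq_iff fourier_coeff_mult_const)
   have hk: "hankel (fourier_coeff \<psi>) = (\<lambda>x. (1 / c) *\<^sub>R H x)"
   proof -
    have "hankel (fourier_coeff \<psi>) = matrix_operator (\<lambda>j k. r * a j k)" by (simp add: hankel_def fc a_def)
    also have "\<dots> = (\<lambda>x. r *\<^sub>C H x)" unfolding H_def by (rule matrix_operator_scale(2)[OF bma])
    finally show ?thesis unfolding r_def scaleC_of_real .
   qed
   have ent: "entry (hankel (fourier_coeff \<psi>)) = (\<lambda>j k. r * a j k)"
   proof -
    have "entry (hankel (fourier_coeff \<psi>)) j k = r * entry H j k" for j k
     unfolding hk entry_def by (simp add: r_def)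
    then show ?thesis using H(2) by (simp add: fun_eq_iff)
   qed
   have on1: "onorm (hankel (fourier_coeff \<psi>)) = 1"
    unfolding hk using onorm_scaleR[OF blH, of "1 / c"] cp by (simp add: c_def)
   have eb: "ess_bounded \<psi>" unfolding \<psi>_def by (rule bounded_symbol_ess_bounded[OF bounded_symbol_mult_const[OF \<phi>]])
   define s where "s = schur_matrix (dilate \<tau> N) (hankel (fourier_coeff \<psi>))"
   have "matrix_norm s \<le> S" unfolding S_def s_def
    by (rule SUP_upper2[where i=N], use N in simp, rule SUP_upper) (use eb on1 in simp)
   then have mn: "matrix_norm s \<le> ennreal C" using C(2) by simp
   then have bs: "bounded_matrix s" by (cases "bounded_matrix s") (auto simp: matrix_norm_def top_unique)
   have ons: "onorm (matrix_operator s) \<le> C" using mn bs C(1) by (simp add: matrix_norm_def ennreal_le_iff)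
   have bls: "bounded_linear (matrix_operator s)" using bounded_matrixD(1)[OF bs] by (simp add: bounded_clinear_def)
   have eq: "(\<lambda>j k. complex_of_real c * s j k) = (\<lambda>j k. dilate \<tau> N j k * a j k)"
    using cp by (simp add: s_def schur_matrix_def ent r_def fun_eq_iff)
   show ?thesis unfolding eq[symmetric] matrix_operator_scale(2)[OF bs]
   proof (intro conjI allI matrix_operator_scale(1)[OF bs])
    fix x
    have "norm (matrix_operator s x) \<le> C * norm x"
     by (rule order_trans[OF onorm[OF bls]]) (intro mult_right_mono ons norm_ge_zero)
    then have "c * norm (matrix_operator s x) \<le> M * (C * norm x)" using cM c0 by (intro mult_mono) auto
    then show "norm (complex_of_real c *\<^sub>C matrix_operator s x) \<le> C * M * norm x" using c0 by (simp add: mult_ac)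
   qed
  qed
  then show "bounded_matrix (\<lambda>j k. dilate \<tau> N j k * fourier_coeff \<phi> (int j + int k))"
   "norm (matrix_operator (\<lambda>j k. dilate \<tau> N j k * fourier_coeff \<phi> (int j + int k)) x) \<le> C * M * norm x" for x
   by (auto simp: a_def)
 qed
qed

lemma PC_bounded:
 assumes "\<omega> \<in> PC"
 shows "\<exists>M. \<forall>z. norm z = 1 \<longrightarrow> norm (\<omega> z) \<le> M"
proof -
 obtain g M where g: "\<forall>x\<in>{0..2 * pi}. \<omega> (cis x) = g x" "\<forall>x. norm (g x) \<le> M"
  using PC_bounded_symbol[OF assms] unfolding bounded_symbol_def by blast
 have "norm (\<omega> z) \<le> M" if "norm z = 1" for z
 proof -
  have "Arg2pi z \<in> {0..2 * pi}" using Arg2pi_ge_0[of z] Arg2pi_lt_2pi[of z] by auto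
  then have "norm (\<omega> (cis (Arg2pi z))) \<le> M" using g by simp
  then show ?thesis using unit_eq_cis[OF that] by simp
 qed
 then show ?thesis by blast
qed

lemma fourier_coeff_cong:
 assumes "\<And>z. norm z = 1 \<Longrightarrow> \<phi> z = \<psi> z"
 shows "fourier_coeff \<phi> j = fourier_coeff \<psi> j"
 unfolding fourier_coeff_def using assms by simp

abbreviation real_symbol :: "(complex \<Rightarrow> complex) \<Rightarrow> bool" where
 "real_symbol \<omega> \<equiv> \<forall>v\<in>sphere 0 1. \<omega> v = cnj (\<omega> (cnj v))"

lemma symmetric_fourier_coeff_real:
 assumes "bounded_symbol \<omega>" and sym: "real_symbol \<omega>"
 shows "cnj (fourier_coeff \<omega> j) = fourier_coeff \<omega> j"
 unfolding fourier_coeff_reflect[OF assms(1), symmetric]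
proof (rule fourier_coeff_cong)
 fix z :: complex assume "norm z = 1"
 then show "cnj (\<omega> (cnj z)) = \<omega> z" using bspec[OF sym, of z] by simp
qed

text \<open>Conjugation reverses the orientation of the circle and exchanges the one-sided limits.
  Consequently \<open>- \<i> * jump \<omega>\<close> commutes with conjugation and is real at 1 and
  -1.\<close>

lemma jump_reflect:
 assumes \<omega>: "\<omega> \<in> PC" and sym: "real_symbol \<omega>" and z: "norm z = 1"
 shows "jump \<omega> (cnj z) = - cnj (jump \<omega> z)"
proof -
 have nb: "at_right (0::real) \<noteq> bot" by (simp add: trivial_limit_at_right_real)
 have z': "norm (cnj z) = 1" using z by simp
 have \<omega>c: "\<omega> (cnj v) = cnj (\<omega> v)" if "norm v = 1" for v
  using bspec[OF sym, of "cnj v"] that by simp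
 have pm: "\<omega> (cnj z * cis \<epsilon>) = cnj (\<omega> (z * cis (- \<epsilon>)))" for \<epsilon>
  using \<omega>c[of "z * cis (- \<epsilon>)"] z by (simp add: norm_mult cis_cnj)
 have "((\<lambda>\<epsilon>. \<omega> (cnj z * cis \<epsilon>)) \<longlongrightarrow> cnj (lim_minus \<omega> z)) (at_right 0)"
  unfolding pm by (intro tendsto_cnj PC_limits(2)[OF \<omega> z])
 then have 1: "lim_plus \<omega> (cnj z) = cnj (lim_minus \<omega> z)"
  by (rule tendsto_unique[OF nb PC_limits(1)[OF \<omega> z']])
 have mp: "\<omega> (cnj z * cis (- \<epsilon>)) = cnj (\<omega> (z * cis \<epsilon>))" for \<epsilon>
  using pm[of "- \<epsilon>"] by simp
 have "((\<lambda>\<epsilon>. \<omega> (cnj z * cis (- \<epsilon>))) \<longlongrightarrow> cnj (lim_plus \<omega> z)) (at_right 0)"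
  unfolding mp by (intro tendsto_cnj PC_limits(1)[OF \<omega> z])
 then have 2: "lim_minus \<omega> (cnj z) = cnj (lim_plus \<omega> z)"
  by (rule tendsto_unique[OF nb PC_limits(2)[OF \<omega> z']])
 show ?thesis unfolding jump_def 1 2 by (simp add: diff_divide_distrib)
qed

text \<open>In the symmetric case the approximation is averaged with its reflection, which preserves all
 the error bounds.\<close>

lemma PC_decomposition_closed:
 assumes \<omega>: "\<omega> \<in> PC" and \<delta>: "\<delta> > 0"
 shows "\<exists>Z a \<phi>. jump_data Z \<and> (\<forall>z. z \<notin> Z \<longrightarrow> a z = 0) \<and> (\<forall>z. norm z = 1 \<longrightarrow> norm (a z - (- \<i> * jump \<omega> z)) \<le> \<delta>) \<and>
  (real_symbol \<omega> \<longrightarrow> (\<forall>z. a (cnj z) = cnj (a z))) \<and>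
  bounded_symbol \<phi> \<and> (\<forall>z. norm z = 1 \<longrightarrow> norm (\<phi> z) \<le> \<delta>) \<and>
  (\<forall>j\<ge>1. fourier_coeff \<omega> (int j) = (\<Sum>z\<in>Z. a z * cnj z ^ j) / of_real (pi * real j) + fourier_coeff \<phi> (int j))"
proof (rule PC_decomposition[OF \<omega> \<delta>])
 fix Z0 :: "complex set" and a0 \<phi>0 :: "complex \<Rightarrow> complex"
 assume fin: "finite Z0" and unit: "\<And>z. z \<in> Z0 \<Longrightarrow> norm z = 1" and off: "\<And>z. z \<notin> Z0 \<Longrightarrow> a0 z = 0"
  and near: "\<And>z. norm z = 1 \<Longrightarrow> norm (a0 z - (- \<i> * jump \<omega> z)) \<le> \<delta>"
  and bs: "bounded_symbol \<phi>0" and small: "\<And>z. norm z = 1 \<Longrightarrow> norm (\<phi>0 z) \<le> \<delta>"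
  and coeff: "\<And>j::nat. j \<ge> 1 \<Longrightarrow> fourier_coeff \<omega> (int j) = (\<Sum>z\<in>Z0. a0 z * cnj z ^ j) / of_real (pi * real j) + fourier_coeff \<phi>0 (int j)"
 \<comment> \<open>The points added by closing under conjugation carry weight 0, so no coefficient
   changes.\<close>
 define Z where "Z = Z0 \<union> cnj ` Z0"
 have Z: "jump_data Z"
  by unfold_locales (use fin unit in \<open>auto simp: Z_def\<close>)
 have finZ: "finite Z" using fin by (simp add: Z_def)
 have sumZ: "(\<Sum>z\<in>Z. a0 z * cnj z ^ j) = (\<Sum>z\<in>Z0. a0 z * cnj z ^ j)" for j
  by (rule sum.mono_neutral_right[OF finZ]) (use off in \<open>auto simp: Z_def\<close>)
 have offZ: "z \<notin> Z \<Longrightarrow> a0 z = 0" for z using off by (simp add: Z_def)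
 show ?thesis
 proof (cases "real_symbol \<omega>")
  case False
  show ?thesis
  proof (rule exI[of _ Z], rule exI[of _ a0], rule exI[of _ \<phi>0], intro conjI)
   show "real_symbol \<omega> \<longrightarrow> (\<forall>z. a0 (cnj z) = cnj (a0 z))" using False by blast
  qed (use Z offZ near bs small coeff sumZ in simp_all)
 next
  case True
  define a where "a z = (a0 z + cnj (a0 (cnj z))) / 2" for z
  define \<phi> where "\<phi> z = 1 / 2 * \<phi>0 z + 1 / 2 * cnj (\<phi>0 (cnj z))" for z
  have avg: "norm ((u + v) / 2) \<le> \<delta>" if "norm u \<le> \<delta>" "norm v \<le> \<delta>" for u v :: complex
   using norm_triangle_mono[OF that] by (simp add: norm_divide)
  show ?thesis
  proof (rule exI[of _ Z], rule exI[of _ a], rule exI[of _ \<phi>], intro conjI impI allI Z)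
   fix z assume "z \<notin> Z"
   then have "z \<notin> Z" "cnj z \<notin> Z" using jump_data.cnj_closed[OF Z, of "cnj z"] by auto
   then show "a z = 0" using offZ by (simp add: a_def)
  next
   fix z :: complex assume z: "norm z = 1"
   define \<kappa> where "\<kappa> = - \<i> * jump \<omega> z"
   have "- \<i> * jump \<omega> (cnj z) = cnj \<kappa>" by (simp add: jump_reflect[OF \<omega> True z] \<kappa>_def)
   then have n2: "norm (a0 (cnj z) - cnj \<kappa>) \<le> \<delta>" using near[of "cnj z"] z by simp
   have "norm (cnj (a0 (cnj z)) - \<kappa>) = norm (cnj (a0 (cnj z) - cnj \<kappa>))" by simp
   also have "\<dots> \<le> \<delta>" using n2 by (simp only: complex_mod_cnj)
   finally have "norm (((a0 z - \<kappa>) + (cnj (a0 (cnj z)) - \<kappa>)) / 2) \<le> \<delta>"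
    using near[OF z] by (intro avg) (auto simp: \<kappa>_def)
   moreover have "((a0 z - \<kappa>) + (cnj (a0 (cnj z)) - \<kappa>)) / 2 = a z - \<kappa>" by (simp add: a_def field_simps)
   ultimately show "norm (a z - (- \<i> * jump \<omega> z)) \<le> \<delta>" by (simp only: \<kappa>_def)
   have eq: "\<phi> z = (\<phi>0 z + cnj (\<phi>0 (cnj z))) / 2" by (simp add: \<phi>_def field_simps)
   show "norm (\<phi> z) \<le> \<delta>" unfolding eq by (rule avg) (use small z in simp_all)
  next
   show "a (cnj z) = cnj (a z)" for z by (simp add: a_def add.commute)
   note b1 = bounded_symbol_mult_const[OF bs, of "1 / 2"]
   note b2 = bounded_symbol_mult_const[OF bounded_symbol_reflect[OF bs], of "1 / 2"]
   show "bounded_symbol \<phi>" unfolding \<phi>_def by (rule bounded_symbol_add[OF b1 b2])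
   fix j :: nat assume j: "1 \<le> j"
   have fc\<phi>: "fourier_coeff \<phi> (int j) = 1 / 2 * fourier_coeff \<phi>0 (int j) + 1 / 2 * cnj (fourier_coeff \<phi>0 (int j))"
    unfolding \<phi>_def fourier_coeff_add[OF b1 b2] fourier_coeff_mult_const fourier_coeff_reflect[OF bs] ..
   have real: "cnj (fourier_coeff \<omega> (int j)) = fourier_coeff \<omega> (int j)"
    by (rule symmetric_fourier_coeff_real[OF PC_bounded_symbol[OF \<omega>] True])
   define s where "s = (\<Sum>z\<in>Z. a0 z * cnj z ^ j)"
   define p where "p = complex_of_real (pi * real j)"
   have sc: "(\<Sum>z\<in>Z. cnj (a0 (cnj z)) * cnj z ^ j) = cnj s"
   proof -
    have "(\<Sum>z\<in>Z. cnj (a0 (cnj z)) * cnj z ^ j) = (\<Sum>z\<in>Z. cnj (a0 z) * z ^ j)"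
     by (rule sum.reindex_bij_witness[where i=cnj and j=cnj]) (use jump_data.cnj_closed[OF Z] in auto)
    then show ?thesis by (simp add: s_def)
   qed
   have "(\<Sum>z\<in>Z. a z * cnj z ^ j) = (\<Sum>z\<in>Z. a0 z * cnj z ^ j / 2 + cnj (a0 (cnj z)) * cnj z ^ j / 2)"
    by (simp add: a_def add_divide_distrib distrib_right)
   also have "\<dots> = s / 2 + cnj s / 2"
    unfolding sum.distrib sum_divide_distrib[symmetric] sc s_def[symmetric] ..
   finally have sa: "(\<Sum>z\<in>Z. a z * cnj z ^ j) = s / 2 + cnj s / 2" .
   have w: "fourier_coeff \<omega> (int j) = s / p + fourier_coeff \<phi>0 (int j)"
    using coeff[OF j] sumZ by (simp add: s_def p_def)
   have cp: "cnj p = p" by (simp add: p_def)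
   have "fourier_coeff \<omega> (int j) = (fourier_coeff \<omega> (int j) + cnj (fourier_coeff \<omega> (int j))) / 2" unfolding real by simp
   also have "\<dots> = (s / 2 + cnj s / 2) / p + fourier_coeff \<phi> (int j)"
    unfolding w fc\<phi> complex_cnj_add complex_cnj_divide cp by (simp add: add_divide_distrib mult.commute)
   finally show "fourier_coeff \<omega> (int j) = (\<Sum>z\<in>Z. a z * cnj z ^ j) / of_real (pi * real j) + fourier_coeff \<phi> (int j)"
    unfolding sa p_def .
  qed
 qed
qed

lemma schur_hankel:
 assumes "section_bound (\<lambda>j k. a (int j + int k)) M"
 shows "dilate \<tau> N \<star> hankel a = matrix_operator (\<lambda>j k. dilate \<tau> N j k * a (int j + int k))"
 using bounded_matrixD(2)[OF section_boundD(1)[OF assms]] by (simp add: schur_def schur_matrix_def hankel_def)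

text \<open>The multiplied matrix splits exactly into the jump section, the multiplier remainder
  controlled by (B) and (C), and the multiplied Hankel matrix of the uniformly small symbol
  controlled by (A).\<close>

lemma jump_approximation_hankel:
 assumes \<omega>: "\<omega> \<in> PC" and \<tau>: "\<And>x y. 0 \<le> x \<Longrightarrow> 0 \<le> y \<Longrightarrow> norm (\<tau> x y) \<le> M"
  and AH: "cond_AH \<tau>" and B: "cond_B \<tau>" and Cc: "cond_C \<tau>"
 defines "A \<equiv> \<lambda>N. dilate \<tau> N \<star> hankel (fourier_coeff \<omega>)"
 shows "\<exists>C. jump_approximation (\<lambda>z. - \<i> * jump \<omega> z) A C
  (real_symbol \<omega> \<and> (\<forall>x\<ge>0. \<forall>y\<ge>0. \<tau> x y = cnj (\<tau> y x)))"
proof -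
 define symm where "symm \<longleftrightarrow> real_symbol \<omega> \<and> (\<forall>x\<ge>0. \<forall>y\<ge>0. \<tau> x y = cnj (\<tau> y x))"
 obtain C where C: "C \<ge> 0" and bd: "\<And>N \<phi> M. N \<ge> 1 \<Longrightarrow> bounded_symbol \<phi> \<Longrightarrow> section_bound (\<lambda>j k. fourier_coeff \<phi> (int j + int k)) M \<Longrightarrow>
  bounded_matrix (\<lambda>j k. dilate \<tau> N j k * fourier_coeff \<phi> (int j + int k)) \<and>
  (\<forall>x. norm (matrix_operator (\<lambda>j k. dilate \<tau> N j k * fourier_coeff \<phi> (int j + int k)) x) \<le> C * M * norm x)"
  using multiplier_hankel_bound[OF AH] by blast
 note bs\<omega> = PC_bounded_symbol[OF \<omega>]
 obtain M\<omega> where M\<omega>: "\<And>z. norm z = 1 \<Longrightarrow> norm (\<omega> z) \<le> M\<omega>" using PC_bounded[OF \<omega>] by blast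
 have sb\<omega>: "section_bound (\<lambda>j k. fourier_coeff \<omega> (int j + int k)) M\<omega>" by (rule hankel_section_bound[OF bs\<omega> M\<omega>])
 have A: "A N = matrix_operator (\<lambda>j k. dilate \<tau> N j k * fourier_coeff \<omega> (int j + int k))" for N
  unfolding A_def by (rule schur_hankel[OF sb\<omega>])
 have bmA: "bounded_matrix (\<lambda>j k. dilate \<tau> N j k * fourier_coeff \<omega> (int j + int k))" if "N \<ge> 1" for N
  using bd[OF that bs\<omega> sb\<omega>] by blast
 have "jump_approximation (\<lambda>z. - \<i> * jump \<omega> z) A C symm"
 proof
  show "C \<ge> 0" by (rule C)
  show "bounded_clinear (A N)" if "N \<ge> 1" for N unfolding A by (rule bounded_matrixD(1)[OF bmA[OF that]])
  show "self_adjoint (A N)" if s: "symm" "N \<ge> 1" for N unfolding A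
  proof (rule self_adjoint_matrix_operator[OF bmA[OF s(2)]])
   fix j k
   have \<omega>s: "real_symbol \<omega>" and \<tau>s: "\<And>x y. 0 \<le> x \<Longrightarrow> 0 \<le> y \<Longrightarrow> \<tau> x y = cnj (\<tau> y x)"
    using s(1) unfolding symm_def by blast+
   have "cnj (fourier_coeff \<omega> i) = fourier_coeff \<omega> i" for i
    by (rule symmetric_fourier_coeff_real[OF bs\<omega> \<omega>s])
   moreover have "dilate \<tau> N j k = cnj (dilate \<tau> N k j)" unfolding dilate_def by (rule \<tau>s) auto
   ultimately show "dilate \<tau> N j k * fourier_coeff \<omega> (int j + int k) = cnj (dilate \<tau> N k j * fourier_coeff \<omega> (int k + int j))"
    by (simp only: complex_cnj_mult add.commute[of "int k"])
  qed
  show "- \<i> * jump \<omega> (cnj z) = cnj (- \<i> * jump \<omega> z)" if "symm" "norm z = 1" for z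
   using jump_reflect[OF \<omega> conjunct1[OF that(1)[unfolded symm_def]] that(2)] by simp
  fix \<delta> :: real assume \<delta>: "\<delta> > 0"
  obtain Z a \<phi> where Z: "jump_data Z" and off: "\<forall>z. z \<notin> Z \<longrightarrow> a z = 0" and near: "\<forall>z. norm z = 1 \<longrightarrow> norm (a z - (- \<i> * jump \<omega> z)) \<le> \<delta>"
   and asym: "real_symbol \<omega> \<longrightarrow> (\<forall>z. a (cnj z) = cnj (a z))"
   and bs: "bounded_symbol \<phi>" and small: "\<forall>z. norm z = 1 \<longrightarrow> norm (\<phi> z) \<le> \<delta>"
   and coeff: "\<forall>j\<ge>1. fourier_coeff \<omega> (int j) = (\<Sum>z\<in>Z. a z * cnj z ^ j) / of_real (pi * real j) + fourier_coeff \<phi> (int j)"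
   using PC_decomposition_closed[OF \<omega> \<delta>] by blast
  \<comment> \<open>The formula for the coefficients fails at 0. Taking the difference there keeps
    the splitting exact at the corner entry, which belongs to the remainder.\<close>
  define b where "b m = (if m = 0 then fourier_coeff \<omega> 0 - fourier_coeff \<phi> 0 else (\<Sum>z\<in>Z. a z * cnj z ^ m) / of_real (pi * real m))" for m :: nat
  have dec: "fourier_coeff \<omega> (int j + int k) = b (j + k) + fourier_coeff \<phi> (int j + int k)" for j k
   using coeff[rule_format, of "j + k"] by (cases "j + k = 0") (auto simp: b_def)
  define D where "D = (\<Sum>z\<in>Z. norm (a z))"
  have bb: "norm (b m) \<le> D / real m" if m: "m \<ge> 1" for m
  proof -
   have "norm (\<Sum>z\<in>Z. a z * cnj z ^ m) \<le> D" unfolding D_def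
    by (rule sum_norm_le) (use jump_data.unit[OF Z] in \<open>simp add: norm_mult norm_power\<close>)
   then have "norm (b m) \<le> D / (pi * real m)" using m by (simp add: b_def norm_divide norm_mult divide_right_mono)
   also have "\<dots> \<le> D / real m"
   proof (rule divide_left_mono)
    show "real m \<le> pi * real m" using m pi_ge_two by simp
   qed (use m in \<open>auto simp: D_def intro: sum_nonneg\<close>)
   finally show ?thesis .
  qed
  define E where "E N j k = dilate \<tau> N j k * b (j + k) - (if j \<in> {1..N} \<and> k \<in> {1..N} then b (j + k) else 0)" for N j k
  have js: "jump_section a Z N j k = (if j \<in> {1..N} \<and> k \<in> {1..N} then b (j + k) else 0)" for N j k
   by (auto simp: jump_section_def b_def)
  have sb\<phi>: "section_bound (\<lambda>j k. fourier_coeff \<phi> (int j + int k)) \<delta>" by (rule hankel_section_bound[OF bs]) (use small in blast)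
  have key: "norm (A N x - jump_operator a Z N x - matrix_operator (E N) x) \<le> C * \<delta> * norm x"
   if N: "N \<ge> 1" and hs: "hs_bound (E N) S" for N S x
  proof -
   define R where "R j k = dilate \<tau> N j k * fourier_coeff \<phi> (int j + int k)" for j k
   have R: "bounded_matrix R" "norm (matrix_operator R x) \<le> C * \<delta> * norm x"
    unfolding R_def using bd[OF N bs sb\<phi>] by blast+
   note JE = matrix_operator_add[OF jump_section_bounded hs_bounded_matrix[OF hs], of a Z N]
   note JER = matrix_operator_add[OF JE(1) R(1)]
   have "(\<lambda>j k. dilate \<tau> N j k * fourier_coeff \<omega> (int j + int k)) = (\<lambda>j k. jump_section a Z N j k + E N j k + R j k)"
    unfolding dec E_def R_def js by (simp add: fun_eq_iff algebra_simps)
   then have "A N x = jump_operator a Z N x + matrix_operator (E N) x + matrix_operator R x"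
    unfolding A JE(2)[symmetric] using JER(2) JE(2) by (simp add: fun_eq_iff)
   then show ?thesis using R(2) by simp
  qed
  have hsE: "\<exists>K. \<forall>N\<ge>1. hs_bound (E N) (\<eta> * ln (real N) + K)" if "\<eta> > 0" for \<eta>
   unfolding E_def by (rule multiplier_remainder_hs[OF \<tau> B Cc bb that])
  show "\<exists>Z a. jump_data Z \<and> (\<forall>z. z \<notin> Z \<longrightarrow> a z = 0) \<and>
   (\<forall>z. norm z = 1 \<longrightarrow> norm (a z - - \<i> * jump \<omega> z) \<le> \<delta>) \<and> (symm \<longrightarrow> (\<forall>z. a (cnj z) = cnj (a z))) \<and>
   (jump_close (C * \<delta>) A Z a)"
  proof (intro exI[of _ Z] exI[of _ a] conjI Z off near)
   show "symm \<longrightarrow> (\<forall>z. a (cnj z) = cnj (a z))" using asym unfolding symm_def by blast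
   show "jump_close (C * \<delta>) A Z a"
    using hsE key by meson
  qed
 qed
 then show ?thesis unfolding symm_def by blast
qed

theorem proposition1p4:
 fixes \<omega> :: "complex \<Rightarrow> complex" and \<tau> :: "real \<Rightarrow> real \<Rightarrow> complex"
 assumes "\<omega> \<in> PC"
  and "\<exists>M. \<forall>x\<ge>0. \<forall>y\<ge>0. norm (\<tau> x y) \<le> M"
  and "cond_AH \<tau>" and "cond_B \<tau>" and "cond_C \<tau>"
 shows
  "(\<forall>N\<ge>1. compact_operator (dilate \<tau> N \<star> hankel (fourier_coeff \<omega>))) \<and>
  (\<forall>t>0. (\<lambda>N. real (n_sing t (dilate \<tau> N \<star> hankel (fourier_coeff \<omega>))) / ln (real N))
    \<longlonglongrightarrow> (\<Sum>\<^sub>\<infinity>z\<in>jumps \<omega>. cfun (t * inverse (norm (jump \<omega> z))))) \<and>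
  ((\<forall>v\<in>sphere 0 1. \<omega> v = cnj (\<omega> (cnj v))) \<and> (\<forall>x\<ge>0. \<forall>y\<ge>0. \<tau> x y = cnj (\<tau> y x)) \<longrightarrow>
   (\<forall>N\<ge>1. self_adjoint (dilate \<tau> N \<star> hankel (fourier_coeff \<omega>))) \<and>
   (\<forall>t>0.
    (\<lambda>N. real (n_plus t (dilate \<tau> N \<star> hankel (fourier_coeff \<omega>))) / ln (real N))
     \<longlonglongrightarrow> (\<Sum>\<^sub>\<infinity>z\<in>{z \<in> jumps \<omega>. Im z > 0}. cfun (t * inverse (norm (jump \<omega> z))))
      + cfun (t * inverse (norm (jump \<omega> 1))) * indicator {0<..} (Re (- \<i> * jump \<omega> 1))
      + cfun (t * inverse (norm (jump \<omega> (-1)))) * indicator {0<..} (Re (- \<i> * jump \<omega> (-1)))) \<and>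
   (\<forall>t>0.
    (\<lambda>N. real (n_minus t (dilate \<tau> N \<star> hankel (fourier_coeff \<omega>))) / ln (real N))
     \<longlonglongrightarrow> (\<Sum>\<^sub>\<infinity>z\<in>{z \<in> jumps \<omega>. Im z > 0}. cfun (t * inverse (norm (jump \<omega> z))))
      + cfun (t * inverse (norm (jump \<omega> 1))) * indicator {..<0} (Re (- \<i> * jump \<omega> 1))
      + cfun (t * inverse (norm (jump \<omega> (-1)))) * indicator {..<0} (Re (- \<i> * jump \<omega> (-1)))))"
  (is "_ \<and> _ \<and> (?symm \<longrightarrow> _ \<and> (\<forall>t>0. ?plus t) \<and> (\<forall>t>0. ?minus t))")
proof -
 obtain M where M: "\<And>x y. 0 \<le> x \<Longrightarrow> 0 \<le> y \<Longrightarrow> norm (\<tau> x y) \<le> M" using assms(2) by blast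
 \<comment> \<open>The factor \<open>- \<i>\<close> turns half-jumps into the weights of the jump
   sections and, in the symmetric case, makes the values at 1 and -1 real, so that their signs
   select the counting function.\<close>
 define \<kappa> where "\<kappa> = (\<lambda>z. - \<i> * jump \<omega> z)"
 obtain C where ja: "jump_approximation \<kappa> (\<lambda>N. dilate \<tau> N \<star> hankel (fourier_coeff \<omega>)) C ?symm"
  using jump_approximation_hankel[OF assms(1) M assms(3-5)] unfolding \<kappa>_def by blast
 interpret jump_approximation \<kappa> "\<lambda>N. dilate \<tau> N \<star> hankel (fourier_coeff \<omega>)" C ?symm
  by (rule ja)
 have nk: "norm (\<kappa> z) = norm (jump \<omega> z)" and k0: "\<kappa> z \<noteq> 0 \<longleftrightarrow> jump \<omega> z \<noteq> 0" for z
  by (simp_all add: \<kappa>_def norm_mult)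
 have k: "- \<i> * jump \<omega> z = \<kappa> z" for z by (simp add: \<kappa>_def)
 show ?thesis
 proof (intro conjI allI impI)
  show "compact_operator (dilate \<tau> N \<star> hankel (fourier_coeff \<omega>))" if "N \<ge> 1" for N by (rule compact[OF that])
  show "(\<lambda>N. real (n_sing t (dilate \<tau> N \<star> hankel (fourier_coeff \<omega>))) / ln (real N))
    \<longlonglongrightarrow> (\<Sum>\<^sub>\<infinity>z\<in>jumps \<omega>. cfun (t * inverse (norm (jump \<omega> z))))" if t: "t > 0" for t
  proof -
   have "(\<Sum>\<^sub>\<infinity>z\<in>jumps \<omega>. cfun (t * inverse (norm (\<kappa> z)))) = (\<Sum>z\<in>J t \<inter> UNIV. cfun (t / norm (\<kappa> z)))"
    by (rule infsum_eq_J[OF t]) (use t in \<open>auto simp: jumps_def J_def nk\<close>)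
   then show ?thesis using n_sing_limit[OF t] unfolding nk by simp
  qed
 next
  fix N :: nat assume "?symm" "N \<ge> 1"
  then show "self_adjoint (dilate \<tau> N \<star> hankel (fourier_coeff \<omega>))" by (rule symA)
 next
  fix t :: real assume s: "?symm" and t: "t > 0"
  have S: "{z \<in> jumps \<omega>. Im z > 0} = {z. norm z = 1 \<and> \<kappa> z \<noteq> 0 \<and> Im z > 0}" by (auto simp: jumps_def k0)
  show "?plus t"
   using n_plus_minus_limit(1)[OF t s] signed_sum_eq[OF t S, of "{0<..}"] unfolding nk k by (simp only: greaterThan_iff)
  show "?minus t"
   using n_plus_minus_limit(2)[OF t s] signed_sum_eq[OF t S, of "{..<0}"] unfolding nk k by (simp only: lessThan_iff)
 qed
qed

end
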